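(* Suppose that, in all mixed inequalities considered, no coefficient on the right-hand side is equal to $+\infty$ (and that the moduli of all coefficients different from $-\infty$ are integers). Then the following decision problems are Karp polynomial-time equivalent: (i) deciding whether a given mixed tropical affine inequality is implied by a given finite system of such inequalities, i.e. whether every $\mathbf{x}\in\mathbb{R}_{\max}^n$ satisfying the system satisfies the inequality; (ii) deciding whether a tropical polyhedron with mixed constraints, given by a finite system of mixed tropical affine inequalities, is empty; (iii) determining whether a given initial node in a mean payoff game is winning.
   Context: $\mathbb{R}_{\max}=\mathbb{R}\cup\{-\infty\}$ is the max-plus semiring ($x\oplus y=\max(x,y)$, $x\otimes y=xy=x+y$), and $\overline{\mathbb{R}}_{\max}=\mathbb{R}_{\max}\cup\{+\infty\}$. Let $\mathbb{R}^-=\{\alpha^-:\alpha\in\mathbb{R}\}$ be a disjoint copy of $\mathbb{R}$ and $\mathbb{G}=\overline{\mathbb{R}}_{\max}\cup\mathbb{R}^-$. The modulus is $|x|=x$ for $x\in\overline{\mathbb{R}}_{\max}$ and $|\alpha^-|=\alpha$. The total order $\leq_{\mathbb{G}}$ is: $x\leq_{\mathbb{G}}y$ iff $|x|<|y|$ when $x\in\overline{\mathbb{R}}_{\max}$ and $y\in\mathbb{R}^-$, and $|x|\le|y|$ in all other cases. $\mathbb{G}$ is a semiring where $x\oplus y$ is the greater of $x,y$ for $\leq_{\mathbb{G}}$, and $xy$ is: $x+y$ if $x,y\in\mathbb{R}$; $(|x|+|y|)^-$ if $x\in\mathbb{R}^-$ or $y\in\mathbb{R}^-$ and both are different from $\pm\infty$;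 $-\infty$ if $x=-\infty$ or $y=-\infty$; $+\infty$ if neither is $-\infty$ and at least one is $+\infty$. A mixed tropical affine inequality is a constraint $a_0\oplus a_1\mathbf{x}_1\oplus\cdots\oplus a_n\mathbf{x}_n\leq_{\mathbb{G}}b_0\oplus b_1\mathbf{x}_1\oplus\cdots\oplus b_n\mathbf{x}_n$ with $a_i\in\mathbb{R}_{\max}$ and $b_i\in\mathbb{G}$. A tropical polyhedron with mixed constraints is the set of $\mathbf{x}\in\mathbb{R}_{\max}^n$ satisfying finitely many mixed tropical affine inequalities. A mean payoff game is played by two players, Max and Min, on a finite bipartite digraph with (integer) arc weights, whose nodes are row nodes (where Max chooses an outgoing arc) and column nodes (where Min chooses an outgoing arc); every node has at least one outgoing arc. A pawn is moved forever along the arcs chosen by the players; at each move Min pays to Max the weight of the chosen arc. The payoff of an infinite run is the long-run mean of the payments of Min to Max, which Max wants to maximize and Min to minimize; the game has a value from each initial node. An initial node is winning (for Player Max) if its value is $\geq0$. Numbers are encoded in binary. *)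

theory Defs
  imports "HOL-Library.Extended_Real" "HOL-Computational_Algebra.Polynomial"
begin

section \<open>The semiring of mixed coefficients\<close>

text \<open>\<open>Plain e\<close> is an element of the completed max-plus semiring; \<open>Minus r\<close> is the element
  \<open>r\<close> of the disjoint copy of the reals.\<close>

datatype mixed = Plain ereal | Minus real

fun modulus :: "mixed \<Rightarrow> ereal" where
  "modulus (Plain e) = e"
| "modulus (Minus r) = ereal r"

instantiation mixed :: linorder
begin

fun less_eq_mixed :: "mixed \<Rightarrow> mixed \<Rightarrow> bool" where
  "less_eq_mixed (Plain e) (Minus r) \<longleftrightarrow> modulus (Plain e) < modulus (Minus r)"
| "less_eq_mixed x y \<longleftrightarrow> modulus x \<le> modulus y"

definition less_mixed :: "mixed \<Rightarrow> mixed \<Rightarrow> bool" where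
  "less_mixed x y \<longleftrightarrow> x \<le> y \<and> \<not> y \<le> x"

instance
proof
  fix x y z :: mixed
  show "x < y \<longleftrightarrow> x \<le> y \<and> \<not> y \<le> x" by (rule less_mixed_def)
  show "x \<le> x" by (cases x) auto
  show "x \<le> y \<Longrightarrow> y \<le> z \<Longrightarrow> x \<le> z"
    by (cases x; cases y; cases z) (auto intro: order_trans less_le_trans le_less_trans
          simp flip: ereal_less_eq(3) ereal_less(2))
  show "x \<le> y \<Longrightarrow> y \<le> x \<Longrightarrow> x = y" by (cases x; cases y) auto
  show "x \<le> y \<or> y \<le> x" by (cases x; cases y) auto
qed

end

text \<open>Addition is the maximum, so the neutral elements are \<open>0 = -\<infinity>\<close> and \<open>1\<close>, the real number
  zero; sums over finite sets are maxima.\<close>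

instantiation mixed :: comm_semiring_1
begin

definition zero_mixed :: mixed where "zero_mixed = Plain (-\<infinity>)"

definition one_mixed :: mixed where "one_mixed = Plain (ereal 0)"

definition plus_mixed :: "mixed \<Rightarrow> mixed \<Rightarrow> mixed" where
  "plus_mixed x y = max x y"

definition times_mixed :: "mixed \<Rightarrow> mixed \<Rightarrow> mixed" where
  "times_mixed x y =
    (if x = Plain (-\<infinity>) \<or> y = Plain (-\<infinity>) then Plain (-\<infinity>)
     else if x = Plain \<infinity> \<or> y = Plain \<infinity> then Plain \<infinity>
     else if x \<in> range Minus \<or> y \<in> range Minus
       then Minus (real_of_ereal (modulus x + modulus y))
     else Plain (modulus x + modulus y))"

instance
proof -
  have cases4: thesis
    if "x = Plain (-\<infinity>) \<Longrightarrow> thesis" "x = Plain \<infinity> \<Longrightarrow> thesis"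
      "\<And>r. x = Plain (ereal r) \<Longrightarrow> thesis" "\<And>r. x = Minus r \<Longrightarrow> thesis" for x thesis
  proof (cases x)
    case (Plain e)
    then show ?thesis using that by (cases e) auto
  qed (use that in auto)
  have bot: "max (Plain (-\<infinity>)) x = x" for x :: mixed
    by (cases x) (auto simp: max_def)
  show "OFCLASS(mixed, comm_semiring_1_class)"
  proof
    fix a b c :: mixed
    show "a + b + c = a + (b + c)" by (simp add: plus_mixed_def max.assoc)
    show "a + b = b + a" by (simp add: plus_mixed_def max.commute)
    show "0 + a = a" by (simp add: plus_mixed_def zero_mixed_def bot)
    show "a * b * c = a * (b * c)"
      by (rule cases4[of a]; rule cases4[of b]; rule cases4[of c])
        (auto simp: times_mixed_def add.assoc)
    show "a * b = b * a" by (auto simp: times_mixed_def add.commute)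
    show "1 * a = a"
      by (rule cases4[of a]) (auto simp: times_mixed_def one_mixed_def)
    show "(a + b) * c = a * c + b * c"
      by (rule cases4[of a]; rule cases4[of b]; rule cases4[of c])
        (auto simp: times_mixed_def plus_mixed_def max_def)
    show "0 * a = 0" by (simp add: times_mixed_def zero_mixed_def)
    show "a * 0 = 0" by (simp add: times_mixed_def zero_mixed_def)
    show "(0::mixed) \<noteq> 1" by (simp add: zero_mixed_def one_mixed_def)
  qed
qed

end

definition Rmax :: "mixed set" where
  "Rmax = Plain ` {e. e \<noteq> \<infinity>}"


section \<open>Mixed inequalities and tropical polyhedra with mixed constraints\<close>

text \<open>Points of the \<open>n\<close>-dimensional space are lists of length \<open>n\<close>; an affine form is the list of
  its \<open>n + 1\<close> coefficients, constant term first.\<close>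

definition points :: "nat \<Rightarrow> mixed list set" where
  "points n = {x. length x = n \<and> set x \<subseteq> Rmax}"

definition affine_form :: "mixed list \<Rightarrow> mixed list \<Rightarrow> mixed" where
  "affine_form c x = c ! 0 + (\<Sum>j<length x. c ! Suc j * x ! j)"

type_synonym inequality = "mixed list \<times> mixed list"

definition mixed_inequality :: "nat \<Rightarrow> inequality \<Rightarrow> bool" where
  "mixed_inequality n q \<longleftrightarrow>
     length (fst q) = n + 1 \<and> set (fst q) \<subseteq> Rmax \<and> length (snd q) = n + 1"

definition satisfies :: "mixed list \<Rightarrow> inequality \<Rightarrow> bool" where
  "satisfies x q \<longleftrightarrow> affine_form (fst q) x \<le> affine_form (snd q) x"

definition polyhedron :: "nat \<Rightarrow> inequality list \<Rightarrow> mixed list set" where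
  "polyhedron n S = {x \<in> points n. \<forall>q\<in>set S. satisfies x q}"

definition implied_by :: "nat \<Rightarrow> inequality list \<Rightarrow> inequality \<Rightarrow> bool" where
  "implied_by n S q \<longleftrightarrow>
     (\<forall>x\<in>points n. (\<forall>p\<in>set S. satisfies x p) \<longrightarrow> satisfies x q)"

definition no_top_rhs :: "inequality \<Rightarrow> bool" where
  "no_top_rhs q \<longleftrightarrow> Plain \<infinity> \<notin> set (snd q)"

definition integer_moduli :: "inequality \<Rightarrow> bool" where
  "integer_moduli q \<longleftrightarrow>
     (\<forall>c \<in> set (fst q) \<union> set (snd q). c \<noteq> Plain (-\<infinity>) \<longrightarrow> modulus c \<in> ereal ` \<int>)"

definition admissible :: "nat \<Rightarrow> inequality \<Rightarrow> bool" where
  "admissible n q \<longleftrightarrow> mixed_inequality n q \<and> no_top_rhs q \<and> integer_moduli q"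


section \<open>Mean payoff games\<close>

text \<open>The bipartite digraph is given by its two weighted adjacency matrices: \<open>row_arcs g ! i ! j\<close>
  is the weight of the arc from row node \<open>i\<close> to column node \<open>j\<close>, \<open>col_arcs g ! j ! i\<close> that of the
  arc from column node \<open>j\<close> to row node \<open>i\<close>, and \<^term>\<open>None\<close> means that there is no arc.\<close>

datatype node = Row nat | Col nat

record game =
  row_arcs :: "int option list list"
  col_arcs :: "int option list list"

definition num_rows :: "game \<Rightarrow> nat" where
  "num_rows g = length (row_arcs g)"

definition num_cols :: "game \<Rightarrow> nat" where
  "num_cols g = length (col_arcs g)"

definition nodes :: "game \<Rightarrow> node set" where
  "nodes g = Row ` {..<num_rows g} \<union> Col ` {..<num_cols g}"

fun arc_weight :: "game \<Rightarrow> node \<Rightarrow> node \<Rightarrow> int option" where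
  "arc_weight g (Row i) (Col j) =
     (if i < num_rows g \<and> j < num_cols g then row_arcs g ! i ! j else None)"
| "arc_weight g (Col j) (Row i) =
     (if i < num_rows g \<and> j < num_cols g then col_arcs g ! j ! i else None)"
| "arc_weight g _ _ = None"

definition mean_payoff_game :: "game \<Rightarrow> bool" where
  "mean_payoff_game g \<longleftrightarrow>
     (\<forall>r\<in>set (row_arcs g). length r = num_cols g) \<and>
     (\<forall>c\<in>set (col_arcs g). length c = num_rows g) \<and>
     (\<forall>u\<in>nodes g. \<exists>v\<in>nodes g. arc_weight g u v \<noteq> None)"

text \<open>Strategies may depend on the whole history, the list of nodes visited so far.\<close>

type_synonym strategy = "node list \<Rightarrow> node"

definition max_strategies :: "game \<Rightarrow> strategy set" where
  "max_strategies g =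
     {\<sigma>. \<forall>h i. i < num_rows g \<longrightarrow> arc_weight g (Row i) (\<sigma> (h @ [Row i])) \<noteq> None}"

definition min_strategies :: "game \<Rightarrow> strategy set" where
  "min_strategies g =
     {\<tau>. \<forall>h j. j < num_cols g \<longrightarrow> arc_weight g (Col j) (\<tau> (h @ [Col j])) \<noteq> None}"

fun history :: "strategy \<Rightarrow> strategy \<Rightarrow> node \<Rightarrow> nat \<Rightarrow> node list" where
  "history \<sigma> \<tau> s 0 = [s]"
| "history \<sigma> \<tau> s (Suc k) =
     (let h = history \<sigma> \<tau> s k
      in h @ [case last h of Row _ \<Rightarrow> \<sigma> h | Col _ \<Rightarrow> \<tau> h])"

definition payment :: "game \<Rightarrow> strategy \<Rightarrow> strategy \<Rightarrow> node \<Rightarrow> nat \<Rightarrow> int" where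
  "payment g \<sigma> \<tau> s k =
     the (arc_weight g (last (history \<sigma> \<tau> s k)) (last (history \<sigma> \<tau> s (Suc k))))"

definition mean_payment :: "game \<Rightarrow> strategy \<Rightarrow> strategy \<Rightarrow> node \<Rightarrow> nat \<Rightarrow> real" where
  "mean_payment g \<sigma> \<tau> s N = real_of_int (\<Sum>k<N. payment g \<sigma> \<tau> s k) / real N"

text \<open>The means along a run need not converge. What Max can secure is measured with the limit
  inferior and what Min can secure with the limit superior, so that the value does not depend on
  which of the two is taken as the long-run mean.\<close>

definition lower_value :: "game \<Rightarrow> node \<Rightarrow> ereal" where
  "lower_value g s =
     (SUP \<sigma>\<in>max_strategies g. INF \<tau>\<in>min_strategies g.
        liminf (\<lambda>N. ereal (mean_payment g \<sigma> \<tau> s N)))"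

definition upper_value :: "game \<Rightarrow> node \<Rightarrow> ereal" where
  "upper_value g s =
     (INF \<tau>\<in>min_strategies g. SUP \<sigma>\<in>max_strategies g.
        limsup (\<lambda>N. ereal (mean_payment g \<sigma> \<tau> s N)))"

definition has_value :: "game \<Rightarrow> node \<Rightarrow> real \<Rightarrow> bool" where
  "has_value g s v \<longleftrightarrow> lower_value g s = ereal v \<and> upper_value g s = ereal v"

definition winning :: "game \<Rightarrow> node \<Rightarrow> bool" where
  "winning g s \<longleftrightarrow> (\<exists>v. has_value g s v \<and> v \<ge> 0)"


section \<open>Polynomial-time computable functions and Karp reductions\<close>

text \<open>Deterministic multi-tape Turing machines with two-way infinite tapes. The tape alphabet is
  the input alphabet together with the blank symbol \<^term>\<open>None\<close>; since the number of tapes and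
  of states is arbitrary, this restriction does not affect polynomial-time computability over an
  alphabet with at least two letters.\<close>

datatype move = MoveLeft | Stay | MoveRight

type_synonym 'a tape = "(int \<Rightarrow> 'a option) \<times> int"

text \<open>The states are the numbers up to \<open>num_states\<close>; the machine starts in state \<open>0\<close>, and
  \<open>num_states\<close> itself is the halting state.\<close>

record 'a machine =
  num_tapes :: nat
  num_states :: nat
  transition :: "nat \<Rightarrow> 'a option list \<Rightarrow> nat \<times> ('a option \<times> move) list"

definition turing_machine :: "'a machine \<Rightarrow> bool" where
  "turing_machine M \<longleftrightarrow>
     num_tapes M \<ge> 2 \<and>
     (\<forall>q rs. q < num_states M \<and> length rs = num_tapes M \<longrightarrow>
        fst (transition M q rs) \<le> num_states M \<and>
        length (snd (transition M q rs)) = num_tapes M)"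

fun read_tape :: "'a tape \<Rightarrow> 'a option" where
  "read_tape (t, p) = t p"

fun move_head :: "move \<Rightarrow> int \<Rightarrow> int" where
  "move_head MoveLeft p = p - 1"
| "move_head Stay p = p"
| "move_head MoveRight p = p + 1"

fun act :: "'a option \<times> move \<Rightarrow> 'a tape \<Rightarrow> 'a tape" where
  "act (a, d) (t, p) = (t(p := a), move_head d p)"

type_synonym 'a config = "nat \<times> 'a tape list"

fun step :: "'a machine \<Rightarrow> 'a config \<Rightarrow> 'a config" where
  "step M (q, ts) =
     (if q = num_states M then (q, ts)
      else let (q', as) = transition M q (map read_tape ts) in (q', map2 act as ts))"

definition blank_tape :: "'a tape" where
  "blank_tape = (\<lambda>_. None, 0)"

definition input_tape :: "'a list \<Rightarrow> 'a tape" where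
  "input_tape w =
     (\<lambda>p. if 0 \<le> p \<and> nat p < length w then Some (w ! nat p) else None, 0)"

definition initial :: "'a machine \<Rightarrow> 'a list \<Rightarrow> 'a config" where
  "initial M w = (0, input_tape w # replicate (num_tapes M - 1) blank_tape)"

text \<open>The input is on the first tape; the output is read on the second tape, from cell \<open>0\<close> up to
  the first blank.\<close>

definition holds_output :: "'a tape \<Rightarrow> 'a list \<Rightarrow> bool" where
  "holds_output t y \<longleftrightarrow>
     (\<forall>i<length y. fst t (int i) = Some (y ! i)) \<and> fst t (int (length y)) = None"

definition poly_time_computable :: "('a::finite list \<Rightarrow> 'a list) \<Rightarrow> bool" where
  "poly_time_computable f \<longleftrightarrow>
     (\<exists>(M :: 'a machine) (p :: nat poly). turing_machine M \<and>
        (\<forall>w. \<exists>T \<le> poly p (length w). \<exists>ts.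
           (step M ^^ T) (initial M w) = (num_states M, ts) \<and> holds_output (ts ! 1) (f w)))"

definition karp_reducible :: "'a::finite list set \<Rightarrow> 'a list set \<Rightarrow> bool" where
  "karp_reducible L L' \<longleftrightarrow>
     (\<exists>f. poly_time_computable f \<and> (\<forall>w. w \<in> L \<longleftrightarrow> f w \<in> L'))"

definition karp_equivalent :: "'a::finite list set \<Rightarrow> 'a list set \<Rightarrow> bool" where
  "karp_equivalent L L' \<longleftrightarrow> karp_reducible L L' \<and> karp_reducible L' L"


section \<open>Encoding of instances\<close>

datatype symbol =
    Dig0 | Dig1   \<comment> \<open>binary digits\<close>
  | NegSign       \<comment> \<open>sign of a negative integer\<close>
  | MinusMark     \<comment> \<open>marks an element of the copy of the reals\<close>
  | Bot           \<comment> \<open>the coefficient \<open>-\<infinity>\<close>, or a missing arc\<close>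
  | EndNum | OpenList | CloseList

instance symbol :: finite
proof
  have "(UNIV :: symbol set) =
      {Dig0, Dig1, NegSign, MinusMark, Bot, EndNum, OpenList, CloseList}"
    using symbol.exhaust by blast
  then show "finite (UNIV :: symbol set)" by (metis finite.emptyI finite.insertI)
qed

text \<open>Binary digits, least significant first, without superfluous zeros.\<close>

fun binary :: "nat \<Rightarrow> symbol list" where
  "binary n = (if n = 0 then [] else (if odd n then Dig1 else Dig0) # binary (n div 2))"

declare binary.simps [simp del]

definition encode_int :: "int \<Rightarrow> symbol list" where
  "encode_int z = (if z < 0 then [NegSign] else []) @ binary (nat \<bar>z\<bar>) @ [EndNum]"

text \<open>Only used for integer moduli, and not for \<open>+\<infinity>\<close>.\<close>

fun encode_coeff :: "mixed \<Rightarrow> symbol list" where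
  "encode_coeff (Plain e) =
     (if e = -\<infinity> then [Bot] else encode_int \<lfloor>real_of_ereal e\<rfloor>)"
| "encode_coeff (Minus r) = MinusMark # encode_int \<lfloor>r\<rfloor>"

fun encode_arc :: "int option \<Rightarrow> symbol list" where
  "encode_arc None = [Bot]"
| "encode_arc (Some w) = encode_int w"

definition encode_list :: "('b \<Rightarrow> symbol list) \<Rightarrow> 'b list \<Rightarrow> symbol list" where
  "encode_list e xs = OpenList # concat (map e xs) @ [CloseList]"

definition encode_inequality :: "inequality \<Rightarrow> symbol list" where
  "encode_inequality q = encode_list encode_coeff (fst q) @ encode_list encode_coeff (snd q)"

text \<open>Coefficients and weights are written in binary. The dimension and the index of a node are
  sizes rather than numerical data (a point has \<open>n\<close> coordinates, a node index is smaller than the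
  number of nodes), and are written in unary.\<close>

definition encode_size :: "nat \<Rightarrow> symbol list" where
  "encode_size n = replicate n Dig1 @ [EndNum]"

fun encode_node :: "node \<Rightarrow> symbol list" where
  "encode_node (Row i) = Dig0 # encode_size i"
| "encode_node (Col j) = Dig1 # encode_size j"

definition encode_game :: "game \<Rightarrow> symbol list" where
  "encode_game g =
     encode_list (encode_list encode_arc) (row_arcs g) @
     encode_list (encode_list encode_arc) (col_arcs g)"

definition encode_system :: "nat \<Rightarrow> inequality list \<Rightarrow> symbol list" where
  "encode_system n S = encode_size n @ encode_list encode_inequality S"


section \<open>The decision problems, as languages of encoded yes-instances\<close>

definition IMPLICATION :: "symbol list set" where
  "IMPLICATION =
     {encode_system n S @ encode_inequality q | n S q.
        (\<forall>p\<in>set S. admissible n p) \<and> admissible n q \<and> implied_by n S q}"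

definition EMPTINESS :: "symbol list set" where
  "EMPTINESS =
     {encode_system n S | n S. (\<forall>p\<in>set S. admissible n p) \<and> polyhedron n S = {}}"

definition MEAN_PAYOFF :: "symbol list set" where
  "MEAN_PAYOFF =
     {encode_game g @ encode_node s | g s.
        mean_payoff_game g \<and> s \<in> nodes g \<and> winning g s}"

end

theory Submission
  imports Defs
begin

text \<open>Emptiness reduces to implication by asking whether the system implies an inequality without
  solutions. An implication instance reduces to a mean payoff game by homogenizing the system together
  with the negated conclusion, which is again a mixed system, and by scaling all integers by a power of
  two so that strict inequalities become weak ones with a unit slack; the game is winning exactly when
  the resulting weak system has no solution. Conversely, Min wins from a node exactly when a strict
  potential exists on a set of nodes containing it that is closed for Max, which is the solvability of a
  mixed system. Games are analysed with a duality theorem for potentials that yields positional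
  strategies. The reductions are programs of a small stack language that is compiled to Turing machines,
  and the iteration bound of a program determines its polynomial running time.\<close>

section \<open>Stack programs and their compilation to Turing machines\<close>

text \<open>The three reductions form a cycle that transitivity closes. The obstacle is that mixed
  systems contain both strict and weak inequalities, whereas a game has a single threshold: Min
  brings the value below 0 exactly when all inequalities of a potential hold with a uniform slack.
  With \<open>M = 2 ^ e\<close> larger than the number of variables, a first factor \<open>M\<close>
  turns a real solution into an integral one in which strict inequalities hold with margin 1. A
  second factor \<open>M\<close> makes room for a relaxation: weak inequalities are relaxed by 1,
  hence hold strictly, and strict ones are tightened by \<open>M - 1\<close>. As fewer than
  \<open>M\<close> integers miss some residue class modulo \<open>M\<close>, the relaxation can be
  rounded away again. This is the origin of the weights \<open>M * M * a\<close> and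
  \<open>- (M * M * b) - 1 + M\<close>. Powers of two keep the computation on words trivial: with
  the least significant digit first, multiplying by \<open>M\<close> prepends zeros, a subsequent
  addition of \<open>M - 1\<close> turns them into ones, and the only arithmetic left is a
  predecessor.\<close>

type_synonym 'a stacks = "nat \<Rightarrow> 'a list"

datatype 'a com =
    Push nat "(nat \<Rightarrow> 'a option) \<Rightarrow> 'a"
  | Pop nat
  | Emit "(nat \<Rightarrow> 'a option) \<Rightarrow> 'a"
  | Skip
  | Abort
  | Seq "'a com" "'a com" (infixr \<open>;;\<close> 60)
  | Cond "(nat \<Rightarrow> 'a option) \<Rightarrow> bool" "'a com" "'a com"
  | Loop "(nat \<Rightarrow> 'a option) \<Rightarrow> bool" "'a com"

text \<open>Register 1 is the output tape, which is written from left to right and never read. All other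
  registers are stacks that grow to the left, so that the input is a stack with its first symbol
  on top.\<close>

definition tops :: "'a stacks \<Rightarrow> nat \<Rightarrow> 'a option" where
  "tops s i = (if i = 1 then None else case s i of [] \<Rightarrow> None | x # _ \<Rightarrow> Some x)"

text \<open>\<open>Stuck\<close> stands for exceeding the loop bound and for aborting after output
  has been written. Nothing is claimed about the machine in that case, so a bound that is too small
  cannot be mistaken for a result.\<close>

datatype 'a outcome = Stuck | Aborted | Done "'a stacks"

fun and_then :: "'a outcome \<Rightarrow> ('a stacks \<Rightarrow> 'a outcome) \<Rightarrow> 'a outcome" where
  "and_then (Done s) f = f s"
| "and_then Stuck f = Stuck"
| "and_then Aborted f = Aborted"

fun iterate :: "nat \<Rightarrow> ('a stacks \<Rightarrow> bool) \<Rightarrow> ('a stacks \<Rightarrow> 'a outcome) \<Rightarrow> 'a stacks \<Rightarrow> 'a outcome" where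
  "iterate 0 b f s = (if b s then Stuck else Done s)"
| "iterate (Suc n) b f s = (if b s then and_then (f s) (iterate n b f) else Done s)"

text \<open>No run is allowed more than \<open>B\<close> rounds of any single loop execution; this makes the
  running time a polynomial in \<open>B\<close> that can be read off the program. Aborting leaves an empty
  output, which is not an instance of any of the problems.\<close>

primrec sem :: "nat \<Rightarrow> 'a com \<Rightarrow> 'a stacks \<Rightarrow> 'a outcome" where
  "sem B (Push j g) s = Done (s(j := g ((tops s)(j := None)) # s j))"
| "sem B (Pop j) s = Done (s(j := tl (s j)))"
| "sem B (Emit g) s = Done (s(1 := s 1 @ [g (tops s)]))"
| "sem B Skip s = Done s"
| "sem B Abort s = (if s 1 = [] then Aborted else Stuck)"
| "sem B (c ;; d) s = and_then (sem B c s) (sem B d)"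
| "sem B (Cond b c d) s = (if b (tops s) then sem B c s else sem B d s)"
| "sem B (Loop b c) s = iterate B (\<lambda>s. b (tops s)) (sem B c) s"

primrec registers_below :: "nat \<Rightarrow> 'a com \<Rightarrow> bool" where
  "registers_below k (Push j g) \<longleftrightarrow> j < k \<and> j \<noteq> 1"
| "registers_below k (Pop j) \<longleftrightarrow> j < k \<and> j \<noteq> 1"
| "registers_below k (Emit g) \<longleftrightarrow> 1 < k"
| "registers_below k Skip \<longleftrightarrow> True"
| "registers_below k Abort \<longleftrightarrow> True"
| "registers_below k (c ;; d) \<longleftrightarrow> registers_below k c \<and> registers_below k d"
| "registers_below k (Cond b c d) \<longleftrightarrow> registers_below k c \<and> registers_below k d"
| "registers_below k (Loop b c) \<longleftrightarrow> registers_below k c"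

text \<open>A push takes two machine steps, a move to the left and a write. The variable of the
  polynomial is the loop bound: every round pays for one test and one body, and a last test leaves
  the loop.\<close>

primrec cost :: "'a com \<Rightarrow> nat poly" where
  "cost (Push j g) = 2"
| "cost (Pop j) = 1"
| "cost (Emit g) = 1"
| "cost Skip = 1"
| "cost Abort = 1"
| "cost (c ;; d) = cost c + cost d"
| "cost (Cond b c d) = 1 + cost c + cost d"
| "cost (Loop b c) = 1 + [:0, 1:] * (cost c + 1)"

primrec states :: "'a com \<Rightarrow> nat" where
  "states (Push j g) = 2"
| "states (Pop j) = 1"
| "states (Emit g) = 1"
| "states Skip = 1"
| "states Abort = 1"
| "states (c ;; d) = states c + states d"
| "states (Cond b c d) = 1 + states c + states d"
| "states (Loop b c) = 1 + states c"

text \<open>The code of a program occupies the states from \<open>a\<close> on; it continues in state \<open>e\<close>, or in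
  state \<open>h\<close> after aborting.\<close>

primrec code :: "'a com \<Rightarrow> nat \<Rightarrow> nat \<Rightarrow> nat \<Rightarrow> nat \<Rightarrow> (nat \<Rightarrow> 'a option) \<Rightarrow>
    nat \<times> (nat \<Rightarrow> 'a option \<times> move)" where
  "code (Push j g) a e h q v =
     (if q = a then (a + 1, (\<lambda>i. (v i, Stay))(j := (v j, MoveLeft)))
      else (e, (\<lambda>i. (v i, Stay))(j := (Some (g v), Stay))))"
| "code (Pop j) a e h q v = (e, (\<lambda>i. (v i, Stay))(j := (None, MoveRight)))"
| "code (Emit g) a e h q v = (e, (\<lambda>i. (v i, Stay))(1 := (Some (g v), MoveRight)))"
| "code Skip a e h q v = (e, \<lambda>i. (v i, Stay))"
| "code Abort a e h q v = (h, \<lambda>i. (v i, Stay))"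
| "code (c ;; d) a e h q v =
     (if q < a + states c then code c a (a + states c) h q v else code d (a + states c) e h q v)"
| "code (Cond b c d) a e h q v =
     (if q = a then (if b v then a + 1 else a + 1 + states c, \<lambda>i. (v i, Stay))
      else if q < a + 1 + states c then code c (a + 1) e h q v
      else code d (a + 1 + states c) e h q v)"
| "code (Loop b c) a e h q v =
     (if q = a then (if b v then a + 1 else e, \<lambda>i. (v i, Stay)) else code c (a + 1) a h q v)"

lemma states_pos: "0 < states c"
  by (induction c) auto

lemma poly_mono_nat: "(x::nat) \<le> y \<Longrightarrow> poly p x \<le> poly p y"
  by (induction p) (auto intro!: mult_mono)

text \<open>Positions beyond the last tape read as blank, so \<open>code\<close> can be defined
  without knowing the number of tapes.\<close>

definition view :: "'a option list \<Rightarrow> nat \<Rightarrow> 'a option" where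
  "view rs i = (if i < length rs then rs ! i else None)"

text \<open>Correctness is stated for a segment of states inside a fixed machine; subprograms then
  occupy subsegments of the same machine, which makes an induction on the program possible.\<close>

definition embedded :: "'a machine \<Rightarrow> 'a com \<Rightarrow> nat \<Rightarrow> nat \<Rightarrow> nat \<Rightarrow> bool" where
  "embedded M c a e h \<longleftrightarrow> a + states c \<le> num_states M \<and>
     (\<forall>q rs. a \<le> q \<and> q < a + states c \<and> length rs = num_tapes M \<longrightarrow>
        transition M q rs = (fst (code c a e h q (view rs)),
          map (snd (code c a e h q (view rs))) [0..<num_tapes M]))"

text \<open>A bound on the number of steps, rather than the exact number, lets branches of different
  cost be treated alike.\<close>

definition reach :: "'a machine \<Rightarrow> nat \<Rightarrow> 'a config \<Rightarrow> 'a config \<Rightarrow> bool" where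
  "reach M t x y \<longleftrightarrow> (\<exists>t'\<le>t. (step M ^^ t') x = y)"

section \<open>Bounded reachability and the representation of stacks by tapes\<close>

lemma reach_trans:
  assumes "reach M t x y" "reach M t' y z" "t + t' \<le> u"
  shows "reach M u x z"
proof -
  obtain n m where "n \<le> t" "(step M ^^ n) x = y" "m \<le> t'" "(step M ^^ m) y = z"
    using assms by (auto simp: reach_def)
  then have "(step M ^^ (m + n)) x = z" "m + n \<le> u" using assms(3) by (simp_all add: funpow_add)
  then show ?thesis unfolding reach_def by blast
qed

lemma reach_step: "step M x = y \<Longrightarrow> 1 \<le> t \<Longrightarrow> reach M t x y"
  unfolding reach_def by (rule exI[of _ 1]) auto

lemma reach_refl: "reach M t x x"
  unfolding reach_def by (rule exI[of _ 0]) auto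

text \<open>The output has to start in cell 0 because of \<open>holds_output\<close>, and its head
  stands behind the last symbol. A stack may sit anywhere, with its top under the head; as all other
  cells are blank, a move to the left finds room for a push.\<close>

definition tape_rep :: "nat \<Rightarrow> 'a tape \<Rightarrow> 'a list \<Rightarrow> bool" where
  "tape_rep i T l \<longleftrightarrow>
     (if i = 1 then snd T = int (length l) \<and>
        (\<forall>x. fst T x = (if 0 \<le> x \<and> x < int (length l) then Some (l ! nat x) else None))
      else \<forall>x. fst T x =
        (if snd T \<le> x \<and> x < snd T + int (length l) then Some (l ! nat (x - snd T)) else None))"

definition represents :: "nat \<Rightarrow> 'a stacks \<Rightarrow> 'a tape list \<Rightarrow> bool" where
  "represents k s ts \<longleftrightarrow> length ts = k \<and> (\<forall>i<k. tape_rep i (ts ! i) (s i)) \<and> (\<forall>i\<ge>k. s i = [])"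

lemma read_tape_fst: "read_tape T = fst T (snd T)"
  by (cases T) auto

lemma tape_rep_read:
  "tape_rep i T l \<Longrightarrow> read_tape T = (if i = 1 then None else case l of [] \<Rightarrow> None | x # _ \<Rightarrow> Some x)"
  by (auto simp: tape_rep_def read_tape_fst split: list.splits if_splits)

lemma act_stay: "act (read_tape T, Stay) T = T"
  by (cases T) auto

lemma tape_rep_push:
  assumes "tape_rep i T l" "i \<noteq> 1"
  shows "read_tape (act (read_tape T, MoveLeft) T) = None"
    and "tape_rep i (act (Some x, Stay) (act (read_tape T, MoveLeft) T)) (x # l)"
proof -
  obtain t p where T: "T = (t, p)" by (cases T)
  have t: "t y = (if p \<le> y \<and> y < p + int (length l) then Some (l ! nat (y - p)) else None)" for y
    using assms T by (simp add: tape_rep_def)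
  show "read_tape (act (read_tape T, MoveLeft) T) = None" using t T by simp
  have "nat (y - (p - 1)) = Suc (nat (y - p))" if "p \<le> y" for y using that by simp
  then show "tape_rep i (act (Some x, Stay) (act (read_tape T, MoveLeft) T)) (x # l)"
    using t T assms(2) by (auto simp: tape_rep_def)
qed

lemma tape_rep_pop:
  assumes "tape_rep i T l" "i \<noteq> 1"
  shows "tape_rep i (act (None, MoveRight) T) (tl l)"
proof -
  obtain t p where T: "T = (t, p)" by (cases T)
  have t: "t y = (if p \<le> y \<and> y < p + int (length l) then Some (l ! nat (y - p)) else None)" for y
    using assms T by (simp add: tape_rep_def)
  have "nat (y - p) = Suc (nat (y - (p + 1)))" if "p < y" for y using that by simp
  then show ?thesis using t T assms(2) by (cases l) (auto simp: tape_rep_def)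
qed

lemma tape_rep_emit:
  assumes "tape_rep (Suc 0) T l"
  shows "tape_rep (Suc 0) (act (Some x, MoveRight) T) (l @ [x])"
proof -
  obtain t p where T: "T = (t, p)" by (cases T)
  have t: "t y = (if 0 \<le> y \<and> y < int (length l) then Some (l ! nat y) else None)"
    "p = int (length l)" for y
    using assms T by (simp_all add: tape_rep_def)
  show ?thesis using t T by (auto simp: tape_rep_def nth_append)
qed

lemma represents_read:
  "represents k s ts \<Longrightarrow> i < k \<Longrightarrow> read_tape (ts ! i) = tops s i"
  using tape_rep_read[of i "ts ! i" "s i"] by (simp add: represents_def tops_def)

lemma represents_act_stay:
  "represents k s ts \<Longrightarrow> i < k \<Longrightarrow> act (tops s i, Stay) (ts ! i) = ts ! i"
  using act_stay[of "ts ! i"] by (simp add: represents_read)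

lemma view_tops:
  "represents k s ts \<Longrightarrow> view (map read_tape ts) = tops s"
proof
  fix i assume r: "represents k s ts"
  then show "view (map read_tape ts) i = tops s i"
    using represents_read[OF r, of i]
    by (cases "i < k") (auto simp: view_def represents_def tops_def)
qed

lemma step_embedded:
  assumes "embedded M c a e h" "a \<le> q" "q < a + states c" "length ts = num_tapes M"
    and "v = view (map read_tape ts)"
  shows "step M (q, ts) = (fst (code c a e h q v),
    map (\<lambda>i. act (snd (code c a e h q v) i) (ts ! i)) [0..<num_tapes M])"
proof -
  have *: "map2 act (map f [0..<length ts]) ts = map (\<lambda>i. act (f i) (ts ! i)) [0..<length ts]" for f
    by (rule nth_equalityI) auto
  show ?thesis
    using assms * by (auto simp: embedded_def Let_def)
qed

lemma embedded_Seq: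
  "embedded M (c ;; d) a e h \<Longrightarrow>
     embedded M c a (a + states c) h \<and> embedded M d (a + states c) e h"
  by (auto simp: embedded_def)

lemma embedded_Cond:
  "embedded M (Cond b c d) a e h \<Longrightarrow>
     embedded M c (a + 1) e h \<and> embedded M d (a + 1 + states c) e h"
  by (auto simp: embedded_def)

lemma embedded_Loop: "embedded M (Loop b c) a e h \<Longrightarrow> embedded M c (a + 1) a h"
  by (auto simp: embedded_def)

lemma represents_stay:
  "represents k s ts \<Longrightarrow> map (\<lambda>i. act (tops s i, Stay) (ts ! i)) [0..<k] = ts"
  by (rule nth_equalityI) (auto simp: represents_act_stay, auto simp: represents_def)

lemma represents_upd:
  assumes "represents k s ts" "j < k" "tape_rep j T l"
    "\<And>i. i < k \<Longrightarrow> i \<noteq> j \<Longrightarrow> f i = (tops s i, Stay)" "act (f j) (ts ! j) = T"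
  shows "represents k (s(j := l)) (map (\<lambda>i. act (f i) (ts ! i)) [0..<k])"
proof -
  have "act (f i) (ts ! i) = ts ! i" if "i < k" "i \<noteq> j" for i
    using that assms by (simp add: represents_act_stay)
  then show ?thesis using assms by (auto simp: represents_def)
qed

definition simulates :: "'a machine \<Rightarrow> nat \<Rightarrow> nat \<Rightarrow> nat \<Rightarrow> nat \<Rightarrow> 'a tape list \<Rightarrow> 'a outcome \<Rightarrow> bool" where
  "simulates M t a e h ts r = (case r of Stuck \<Rightarrow> True
     | Aborted \<Rightarrow> (\<exists>ts'. reach M t (a, ts) (h, ts') \<and> holds_output (ts' ! 1) [])
     | Done s' \<Rightarrow> (\<exists>ts'. reach M t (a, ts) (e, ts') \<and> represents (num_tapes M) s' ts'))"

lemma simulates_and_then: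
  assumes "simulates M t a m h ts r"
    and "\<And>s' ts'. represents (num_tapes M) s' ts' \<Longrightarrow> r = Done s' \<Longrightarrow> simulates M t' m e h ts' (f s')"
    and "t + t' \<le> u"
  shows "simulates M u a e h ts (and_then r f)"
proof (cases r)
  case Aborted
  then show ?thesis using assms(1,3)
    by (auto simp: simulates_def intro: reach_trans[OF _ reach_refl[of _ t']])
next
  case (Done s')
  then obtain ts' where *: "reach M t (a, ts) (m, ts')" "represents (num_tapes M) s' ts'"
    using assms(1) by (auto simp: simulates_def)
  then show ?thesis using assms(2)[OF *(2) Done] assms(3) Done
    by (auto simp: simulates_def split: outcome.splits intro: reach_trans[OF *(1)])
qed (auto simp: simulates_def)

lemma simulates_step:
  assumes "step M (a, ts) = (m, ts)" "simulates M t m e h ts r" "1 + t \<le> u"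
  shows "simulates M u a e h ts r"
proof -
  have "reach M u (a, ts) y" if "reach M t (m, ts) y" for y
    using reach_trans[OF reach_step[OF assms(1), of 1] that assms(3)] by simp
  then show ?thesis using assms(2) by (auto simp: simulates_def split: outcome.splits)
qed

lemma simulation:
  assumes "embedded M c a e h" "registers_below (num_tapes M) c" "1 < num_tapes M"
    and "represents (num_tapes M) s ts"
  shows "simulates M (poly (cost c) B) a e h ts (sem B c s)"
  using assms
proof (induction c arbitrary: a e s ts)
  case (Push j g)
  let ?v = "view (map read_tape ts)"
  have len: "length ts = num_tapes M" using Push by (simp add: represents_def)
  have v: "?v = tops s" using Push by (simp add: view_tops)
  let ?ts1 = "map (\<lambda>i. act (((\<lambda>i. (tops s i, Stay))(j := (tops s j, MoveLeft))) i) (ts ! i))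
    [0..<num_tapes M]"
  have 1: "step M (a, ts) = (a + 1, ?ts1)"
    using step_embedded[OF Push(1) _ _ len refl, of a] v by simp
  have rd: "read_tape (ts ! i) = tops s i" if "i < num_tapes M" for i
    using that Push(4) by (simp add: represents_read)
  have tj: "tape_rep j (ts ! j) (s j)" "j \<noteq> 1" "j < num_tapes M"
    using Push by (auto simp: represents_def)
  have old: "?ts1 ! i = ts ! i" if "i < num_tapes M" "i \<noteq> j" for i
    using that act_stay[of "ts ! i"] rd[of i] by simp
  have new: "?ts1 ! j = act (read_tape (ts ! j), MoveLeft) (ts ! j)"
    using tj rd[of j] by (simp del: act.simps)
  \<comment> \<open>After the first of the two steps the head of tape \<open>j\<close> stands on a
    blank, so the symbol to be written is computed without the old top of \<open>j\<close>;
    \<open>sem\<close> hides this top for the same reason.\<close>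
  have v1: "view (map read_tape ?ts1) = (tops s)(j := None)"
  proof
    fix i
    consider "i = j" | "i < num_tapes M" "i \<noteq> j" | "\<not> i < num_tapes M" by blast
    then show "view (map read_tape ?ts1) i = ((tops s)(j := None)) i"
    proof cases
      case 1
      have "view (map read_tape ?ts1) j = read_tape (?ts1 ! j)" using tj(3) by (simp add: view_def)
      then show ?thesis using 1 new tape_rep_push(1)[OF tj(1,2)] by simp
    next
      case 2
      have "view (map read_tape ?ts1) i = read_tape (?ts1 ! i)" using 2 by (simp add: view_def)
      then show ?thesis using old[OF 2] rd[OF 2(1)] 2 by simp
    next
      case 3
      then show ?thesis using tj(3) Push(4) by (auto simp: view_def represents_def tops_def)
    qed
  qed
  let ?x = "g ((tops s)(j := None))"
  have 2: "step M (a + 1, ?ts1) = (e, map (\<lambda>i. act (((\<lambda>i. (((tops s)(j := None)) i, Stay))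
      (j := (Some ?x, Stay))) i) (?ts1 ! i)) [0..<num_tapes M])" (is "_ = (e, ?ts2)")
    using step_embedded[OF Push(1), of "a + 1" ?ts1 "(tops s)(j := None)"] v1 by simp
  have "?ts2 ! i = ts ! i" if "i < num_tapes M" "i \<noteq> j" for i
    using that old[of i] act_stay[of "ts ! i"] rd[of i] by simp
  moreover have "?ts2 ! j = act (Some ?x, Stay) (act (read_tape (ts ! j), MoveLeft) (ts ! j))"
    using tj new by simp
  ultimately have "represents (num_tapes M) (s(j := ?x # s j)) ?ts2"
    using Push(4) tj tape_rep_push(2)[OF tj(1,2)] by (auto simp: represents_def)
  moreover have "reach M 2 (a, ts) (e, ?ts2)"
    using reach_trans[OF reach_step[OF 1] reach_step[OF 2], of 1 1 2] by simp
  ultimately show ?case by (auto simp: simulates_def)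
next
  case (Pop j)
  let ?v = "view (map read_tape ts)"
  have len: "length ts = num_tapes M" using Pop by (simp add: represents_def)
  have v: "?v = tops s" using Pop by (simp add: view_tops)
  have tj: "tape_rep j (ts ! j) (s j)" "j \<noteq> 1" "j < num_tapes M"
    using Pop by (auto simp: represents_def)
  show ?case
    using reach_step[OF step_embedded[OF Pop(1) _ _ len refl, of a], of 1]
      represents_upd[OF Pop(4) tj(3) tape_rep_pop[OF tj(1,2)],
        of "(\<lambda>i. (tops s i, Stay))(j := (None, MoveRight))"] v
    by (auto simp: simulates_def)
next
  case (Emit g)
  let ?v = "view (map read_tape ts)"
  have len: "length ts = num_tapes M" using Emit by (simp add: represents_def)
  have v: "?v = tops s" using Emit by (simp add: view_tops)
  have tj: "tape_rep (Suc 0) (ts ! 1) (s 1)" "1 < num_tapes M"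
    using Emit by (auto simp: represents_def)
  show ?case
    using reach_step[OF step_embedded[OF Emit(1) _ _ len refl, of a], of 1]
      represents_upd[OF Emit(4) tj(2) tape_rep_emit[OF tj(1), folded One_nat_def, of "g (tops s)"],
        of "(\<lambda>i. (tops s i, Stay))(1 := (Some (g (tops s)), MoveRight))"] v
    by (auto simp: simulates_def)
next
  case Skip
  have len: "length ts = num_tapes M" using Skip by (simp add: represents_def)
  show ?case
    using reach_step[OF step_embedded[OF Skip(1) _ _ len refl, of a], of 1] Skip(4)
    by (auto simp: simulates_def view_tops represents_stay)
next
  case Abort
  have len: "length ts = num_tapes M" using Abort by (simp add: represents_def)
  have "holds_output (ts ! 1) []" if "s 1 = []"
    using that Abort(3,4) by (auto simp: represents_def tape_rep_def holds_output_def)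
  then show ?case
    using reach_step[OF step_embedded[OF Abort(1) _ _ len refl, of a], of 1] Abort(4)
    by (auto simp: simulates_def view_tops represents_stay)
next
  case (Seq c d)
  note em = embedded_Seq[OF Seq.prems(1)]
  show ?case unfolding sem.simps
    by (rule simulates_and_then[OF Seq.IH(1)[OF em[THEN conjunct1]] Seq.IH(2)[OF em[THEN conjunct2]]])
      (use Seq.prems in auto)
next
  case (Cond b c d)
  note em = embedded_Cond[OF Cond.prems(1)]
  have len: "length ts = num_tapes M" using Cond.prems by (simp add: represents_def)
  have st: "step M (a, ts) = (if b (tops s) then a + 1 else a + 1 + states c, ts)"
    using step_embedded[OF Cond.prems(1) _ _ len refl, of a] Cond.prems(4)
    by (simp add: view_tops represents_stay)
  show ?case
  proof (cases "b (tops s)")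
    case True
    then show ?thesis
      using simulates_step[OF _ Cond.IH(1)[OF em[THEN conjunct1] _ _ Cond.prems(4)]] st Cond.prems
      by auto
  next
    case False
    then show ?thesis
      using simulates_step[OF _ Cond.IH(2)[OF em[THEN conjunct2] _ _ Cond.prems(4)]] st Cond.prems
      by auto
  qed
next
  case (Loop b c)
  note em = embedded_Loop[OF Loop.prems(1)]
  \<comment> \<open>Inner induction on the rounds still allowed: one test plus one body per round,
    and one test to leave.\<close>
  have *: "simulates M (1 + n * (poly (cost c) B + 1)) a e h ts
      (iterate n (\<lambda>s. b (tops s)) (sem B c) s)"
    if "represents (num_tapes M) s ts" for n s ts
    using that
  proof (induction n arbitrary: s ts)
    case (0 s ts)
    have len: "length ts = num_tapes M" using 0 by (simp add: represents_def)
    have st: "step M (a, ts) = (if b (tops s) then a + 1 else e, ts)"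
      using step_embedded[OF Loop.prems(1) _ _ len refl, of a] 0
      by (simp add: view_tops represents_stay)
    then show ?case using 0 by (auto simp: simulates_def intro!: reach_step)
  next
    case (Suc n s ts)
    have len: "length ts = num_tapes M" using Suc by (simp add: represents_def)
    have st: "step M (a, ts) = (if b (tops s) then a + 1 else e, ts)"
      using step_embedded[OF Loop.prems(1) _ _ len refl, of a] Suc.prems
      by (simp add: view_tops represents_stay)
    show ?case
    proof (cases "b (tops s)")
      case False
      then show ?thesis using Suc.prems st by (auto simp: simulates_def intro!: reach_step)
    next
      case True
      have "simulates M (poly (cost c) B + (1 + n * (poly (cost c) B + 1))) (a + 1) e h ts
          (and_then (sem B c s) (iterate n (\<lambda>s. b (tops s)) (sem B c)))"
        by (rule simulates_and_then[OF Loop.IH[OF em] Suc.IH]) (use Loop.prems Suc.prems in auto)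
      then show ?thesis using True st by (auto intro!: simulates_step[of M a ts "a + 1"])
    qed
  qed
  show ?case using *[OF Loop.prems(4), of B] by (simp add: algebra_simps)
qed

text \<open>The regular end and an abort share the halting state; only the contents of the output
  tape tell them apart.\<close>

definition compile :: "nat \<Rightarrow> 'a com \<Rightarrow> 'a machine" where
  "compile k c = \<lparr>num_tapes = k, num_states = states c,
     transition = (\<lambda>q rs. (fst (code c 0 (states c) (states c) q (view rs)),
       map (snd (code c 0 (states c) (states c) q (view rs))) [0..<k]))\<rparr>"

text \<open>Supplies the bound on successor states that \<open>turing_machine\<close>
  demands.\<close>

lemma code_target:
  "a \<le> q \<Longrightarrow> q < a + states c \<Longrightarrow> a + states c \<le> n \<Longrightarrow> e \<le> n \<Longrightarrow> h \<le> n \<Longrightarrow>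
     fst (code c a e h q v) \<le> n"
proof (induction c arbitrary: a e)
  case (Cond b c d) then show ?case using states_pos[of c] states_pos[of d] by auto
next
  case (Loop b c) then show ?case using states_pos[of c] by auto
qed auto

lemma represents_initial:
  assumes "1 < k"
  shows "represents k ((\<lambda>_. [])(0 := w)) (input_tape w # replicate (k - 1) blank_tape)"
  using assms by (auto simp: represents_def tape_rep_def input_tape_def blank_tape_def nth_Cons
      nat_less_iff split: nat.splits)

lemma compiled_run:
  assumes "registers_below k c" "1 < k"
  shows "turing_machine (compile k c)"
    and "sem B c ((\<lambda>_. [])(0 := w)) = Done s \<Longrightarrow> \<exists>T\<le>poly (cost c) B. \<exists>ts.
      (step (compile k c) ^^ T) (initial (compile k c) w) = (num_states (compile k c), ts) \<and>
      holds_output (ts ! 1) (s 1)"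
    and "sem B c ((\<lambda>_. [])(0 := w)) = Aborted \<Longrightarrow> \<exists>T\<le>poly (cost c) B. \<exists>ts.
      (step (compile k c) ^^ T) (initial (compile k c) w) = (num_states (compile k c), ts) \<and>
      holds_output (ts ! 1) []"
proof -
  show "turing_machine (compile k c)"
    using assms by (auto simp: turing_machine_def compile_def intro!: code_target)
  have "embedded (compile k c) c 0 (states c) (states c)"
    by (auto simp: embedded_def compile_def)
  from simulation[OF this, of "(\<lambda>_. [])(0 := w)" "input_tape w # replicate (k - 1) blank_tape" B]
  have *: "simulates (compile k c) (poly (cost c) B) 0 (states c) (states c)
      (input_tape w # replicate (k - 1) blank_tape) (sem B c ((\<lambda>_. [])(0 := w)))"
    using assms represents_initial[of k w] by (auto simp: compile_def)
  have [simp]: "num_states (compile k c) = states c" "num_tapes (compile k c) = k"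
    by (auto simp: compile_def)
  { assume "sem B c ((\<lambda>_. [])(0 := w)) = Done s"
    then show "\<exists>T\<le>poly (cost c) B. \<exists>ts.
      (step (compile k c) ^^ T) (initial (compile k c) w) = (num_states (compile k c), ts) \<and>
      holds_output (ts ! 1) (s 1)"
    proof -
      obtain ts where ts: "reach (compile k c) (poly (cost c) B) (initial (compile k c) w)
          (states c, ts)" "represents k s ts"
        using * \<open>sem B c _ = Done s\<close> by (auto simp: simulates_def initial_def)
      have "holds_output (ts ! 1) (s 1)"
        using ts(2) assms(2) by (auto simp: represents_def tape_rep_def holds_output_def)
      then show ?thesis using ts(1) by (auto simp: reach_def)
    qed }
  { assume "sem B c ((\<lambda>_. [])(0 := w)) = Aborted"
    then show "\<exists>T\<le>poly (cost c) B. \<exists>ts.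
      (step (compile k c) ^^ T) (initial (compile k c) w) = (num_states (compile k c), ts) \<and>
      holds_output (ts ! 1) []"
      using * by (auto simp: simulates_def reach_def initial_def) }
qed

section \<open>Dependence of runs on the loop bound, and growth of the registers\<close>

lemma iterate_mono:
  assumes "iterate n b f s \<noteq> Stuck" "n \<le> m" "\<And>s. f s \<noteq> Stuck \<Longrightarrow> g s = f s"
  shows "iterate m b g s = iterate n b f s"
  using assms(1,2)
proof (induction n arbitrary: m s)
  case 0
  then show ?case by (cases m) (auto split: if_splits)
next
  case (Suc n)
  then obtain m' where m: "m = Suc m'" "n \<le> m'" by (cases m) auto
  show ?case
  proof (cases "b s")
    case True
    then have "f s \<noteq> Stuck" using Suc by auto
    then show ?thesis using Suc True m assms(3) by (cases "f s") auto
  qed (simp add: m)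
qed

text \<open>Raising the bound changes only runs that were stuck, so programs analysed with different
  bounds can be run under a common one.\<close>

lemma sem_mono: "sem B c s \<noteq> Stuck \<Longrightarrow> B \<le> B' \<Longrightarrow> sem B' c s = sem B c s"
proof (induction c arbitrary: s)
  case (Seq c d)
  then show ?case by (cases "sem B c s") auto
next
  case (Loop b c)
  then show ?case using iterate_mono[OF Loop.prems(1)[simplified] Loop.prems(2)] by simp
qed (auto split: if_splits)

lemma iterate_growth:
  assumes "\<And>s s'. f s = Done s' \<Longrightarrow> length (s' i) \<le> length (s i) + m"
  shows "iterate n b f s = Done s' \<Longrightarrow> length (s' i) \<le> length (s i) + n * m"
proof (induction n arbitrary: s)
  case (Suc n)
  show ?case
  proof (cases "b s")
    case True
    then obtain s1 where s1: "f s = Done s1" "iterate n b f s1 = Done s'"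
      using Suc by (cases "f s") auto
    show ?thesis using Suc.IH[OF s1(2)] assms[OF s1(1)] by simp
  qed (use Suc in auto)
qed (auto split: if_splits)

text \<open>Every command adds at most as many symbols to a register as it costs. This bounds the
  word handed to the next program of a chain, and hence the loop bound that this program
  needs.\<close>

lemma sem_growth: "sem B c s = Done s' \<Longrightarrow> length (s' i) \<le> length (s i) + poly (cost c) B"
proof (induction c arbitrary: s s')
  case (Seq c d)
  then obtain s1 where s1: "sem B c s = Done s1" "sem B d s1 = Done s'" by (cases "sem B c s") auto
  show ?case using Seq.IH(1)[OF s1(1)] Seq.IH(2)[OF s1(2)] by simp
next
  case (Cond b c d)
  show ?case using Cond.IH(1)[of s s'] Cond.IH(2)[of s s'] Cond.prems by (auto split: if_splits)
next
  case (Loop b c)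
  have "length (s' i) \<le> length (s i) + B * poly (cost c) B"
    by (rule iterate_growth[where f = "sem B c" and b = "\<lambda>s. b (tops s)"])
      (use Loop in auto)
  then show ?case by (simp add: algebra_simps)
qed (auto split: if_splits)

subsection \<open>Reductions by stack programs\<close>

definition input :: "'a list \<Rightarrow> 'a stacks" where
  "input w = (\<lambda>_. [])(0 := w)"

text \<open>The result is left in register 0 with all other registers empty, in the form in which
  the next reduction expects its input. Aborting is a permitted answer for words outside
  \<open>L\<close>, which include the malformed ones.\<close>

definition stack_reducible :: "'a list set \<Rightarrow> 'a list set \<Rightarrow> bool" where
  "stack_reducible L L' \<longleftrightarrow>
     (\<exists>c k p. registers_below k c \<and> 1 < k \<and>
        (\<forall>w. (\<exists>w'. sem (poly p (length w)) c (input w) = Done (input w') \<and> (w \<in> L \<longleftrightarrow> w' \<in> L')) \<or>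
             sem (poly p (length w)) c (input w) = Aborted \<and> w \<notin> L))"

lemma registers_below_mono: "registers_below k c \<Longrightarrow> k \<le> k' \<Longrightarrow> registers_below k' c"
  by (induction c) auto

lemma stack_reducible_trans:
  assumes "stack_reducible L L'" "stack_reducible L' L''"
  shows "stack_reducible L L''"
proof -
  obtain c k p where 1: "registers_below k c" "1 < k"
    "\<And>w. (\<exists>w'. sem (poly p (length w)) c (input w) = Done (input w') \<and> (w \<in> L \<longleftrightarrow> w' \<in> L')) \<or>
         sem (poly p (length w)) c (input w) = Aborted \<and> w \<notin> L"
    using assms(1) unfolding stack_reducible_def by blast
  obtain d l q where 2: "registers_below l d" "1 < l"
    "\<And>w. (\<exists>w'. sem (poly q (length w)) d (input w) = Done (input w') \<and> (w \<in> L' \<longleftrightarrow> w' \<in> L'')) \<or>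
         sem (poly q (length w)) d (input w) = Aborted \<and> w \<notin> L'"
    using assms(2) unfolding stack_reducible_def by blast
  \<comment> \<open>The intermediate word is at most as long as the input plus the cost of the first
    program, so \<open>q\<close> is composed with that sum.\<close>
  define r where "r = p + pcompose q ([:0, 1:] + pcompose (cost c) p)"
  have "(\<exists>w'. sem (poly r (length w)) (c ;; d) (input w) = Done (input w') \<and> (w \<in> L \<longleftrightarrow> w' \<in> L'')) \<or>
         sem (poly r (length w)) (c ;; d) (input w) = Aborted \<and> w \<notin> L" for w
  proof -
    have p: "poly p (length w) \<le> poly r (length w)" by (simp add: r_def)
    from 1(3)[of w] show ?thesis
    proof
      assume "\<exists>w'. sem (poly p (length w)) c (input w) = Done (input w') \<and> (w \<in> L \<longleftrightarrow> w' \<in> L')"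
      then obtain w' where w': "sem (poly p (length w)) c (input w) = Done (input w')"
        "w \<in> L \<longleftrightarrow> w' \<in> L'" by blast
      have c: "sem (poly r (length w)) c (input w) = Done (input w')"
        using sem_mono[of "poly p (length w)" c "input w"] w'(1) p by simp
      have "length w' \<le> length w + poly (cost c) (poly p (length w))"
        using sem_growth[OF w'(1), of 0] by (simp add: input_def)
      then have "poly q (length w') \<le> poly r (length w)"
        using poly_mono_nat[of "length w'" _ q] by (simp add: r_def poly_pcompose trans_le_add2)
      from sem_mono[OF _ this, of d "input w'"] show ?thesis
        using 2(3)[of w'] c w'(2) by auto
    next
      assume "sem (poly p (length w)) c (input w) = Aborted \<and> w \<notin> L"
      then show ?thesis using sem_mono[of "poly p (length w)" c "input w"] p by simp
    qed
  qed
  moreover have "registers_below (max k l) (c ;; d)"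
    using 1(1) 2(1) by (auto intro: registers_below_mono)
  ultimately show ?thesis unfolding stack_reducible_def using 1(2)
    by (intro exI[of _ "c ;; d"] exI[of _ "max k l"] exI[of _ r]) auto
qed

section \<open>Loops over encoded items, and macros for moving and copying stacks\<close>

lemma tops_upd [simp]:
  "tops (s(j := l)) i =
     (if i = j then (if j = 1 then None else case l of [] \<Rightarrow> None | x # _ \<Rightarrow> Some x) else tops s i)"
  by (simp add: tops_def)

text \<open>Loops that consume a register item by item are reduced to a \<open>fold\<close>, with
  \<open>P\<close> as the invariant, so that they need no induction of their own.\<close>

lemma iterate_items:
  assumes "\<And>x r s. P s \<Longrightarrow> x \<in> set xs \<Longrightarrow> g (s(i := e x @ r)) = Done ((f x s)(i := r))"
    and "\<And>x s. P s \<Longrightarrow> x \<in> set xs \<Longrightarrow> P (f x s)"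
    and "\<And>x r s. P s \<Longrightarrow> x \<in> set xs \<Longrightarrow> b (s(i := e x @ r))" "\<And>s. P s \<Longrightarrow> \<not> b (s(i := rest))"
    and "length xs \<le> B" "P s" "s i = concat (map e xs) @ rest"
  shows "iterate B b g s = Done ((fold f xs s)(i := rest))"
proof -
  have "iterate B b g (s(i := concat (map e xs) @ rest)) = Done ((fold f xs s)(i := rest))"
    using assms(1-6)
  proof (induction xs arbitrary: s B)
    case Nil
    then show ?case by (cases B) auto
  next
    case (Cons x xs)
    then obtain B' where B: "B = Suc B'" "length xs \<le> B'" by (cases B) auto
    show ?case using Cons.prems Cons.IH[of B' "f x s"] B by simp
  qed
  moreover have "s(i := concat (map e xs) @ rest) = s" using assms(7) by (simp add: fun_eq_iff)
  ultimately show ?thesis by simp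
qed

lemma sem_each:
  assumes "\<And>x r s. P s \<Longrightarrow> x \<in> set xs \<Longrightarrow> sem B c (s(i := x # r)) = Done ((f x s)(i := r))"
    and "\<And>x s. P s \<Longrightarrow> x \<in> set xs \<Longrightarrow> P (f x s)"
    and "length xs \<le> B" "P s" "s i = xs" "i \<noteq> 1"
  shows "sem B (Loop (\<lambda>t. t i \<noteq> None) c) s = Done ((fold f xs s)(i := []))"
proof -
  have "concat (map (\<lambda>x. [x]) xs) = xs" by (induction xs) auto
  then show ?thesis unfolding sem.simps
    by (intro iterate_items[where P = P and e = "\<lambda>x. [x]"]) (use assms in auto)
qed

abbreviation top_of :: "nat \<Rightarrow> (nat \<Rightarrow> 'a option) \<Rightarrow> 'a" where
  "top_of i \<equiv> \<lambda>t. the (t i)"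

text \<open>Moving by pops reverses a word; \<open>copy\<close> and \<open>fill\<close> therefore go
  through a scratch stack and back, which restores the source.\<close>

definition transfer :: "nat \<Rightarrow> nat \<Rightarrow> 'a com" where
  "transfer i j = Loop (\<lambda>t. t i \<noteq> None) (Push j (top_of i) ;; Pop i)"

lemma fold_push: "fold (\<lambda>x s. s(j := x # s j)) xs s = s(j := rev xs @ s j)"
  by (induction xs arbitrary: s) auto

lemma sem_transfer:
  assumes "i \<noteq> j" "i \<noteq> 1" "length (s i) \<le> B"
  shows "sem B (transfer i j) s = Done (s(j := rev (s i) @ s j, i := []))"
  unfolding transfer_def
  by (subst sem_each[where P = "\<lambda>_. True" and f = "\<lambda>x s. s(j := x # s j)" and xs = "s i"])
    (use assms in \<open>auto simp: fold_push fun_upd_twist\<close>)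

definition clear :: "nat \<Rightarrow> 'a com" where
  "clear i = Loop (\<lambda>t. t i \<noteq> None) (Pop i)"

lemma sem_clear:
  assumes "i \<noteq> 1" "length (s i) \<le> B"
  shows "sem B (clear i) s = Done (s(i := []))"
proof -
  have "fold (\<lambda>x s. s) xs s = s" for xs :: "'a list" and s :: "'a stacks" by (induction xs) auto
  then show ?thesis
  unfolding clear_def
  by (subst sem_each[where P = "\<lambda>_. True" and f = "\<lambda>x s. s" and xs = "s i"])
    (use assms in \<open>auto\<close>)
qed

text \<open>Register \<open>k\<close> is scratch space.\<close>

definition copy :: "nat \<Rightarrow> nat \<Rightarrow> nat \<Rightarrow> 'a com" where
  "copy i k j = transfer i k ;;
     Loop (\<lambda>t. t k \<noteq> None) (Push i (top_of k) ;; Push j (top_of k) ;; Pop k)"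

lemma fold_push2:
  "j \<noteq> i \<Longrightarrow> fold (\<lambda>x s. s(i := x # s i, j := x # s j)) xs s = s(i := rev xs @ s i, j := rev xs @ s j)"
  by (induction xs arbitrary: s) (auto simp: fun_eq_iff)

lemma sem_copy:
  assumes "i \<noteq> j" "i \<noteq> 1" "length (s i) \<le> B" "k \<noteq> 1" "s k = []" "k \<noteq> i" "k \<noteq> j" "j \<noteq> 1"
  shows "sem B (copy i k j) s = Done (s(j := s i @ s j))"
proof -
  let ?s = "s(k := rev (s i), i := [])"
  have "sem B (Loop (\<lambda>t. t k \<noteq> None) (Push i (top_of k) ;; Push j (top_of k) ;; Pop k)) ?s =
      Done ((fold (\<lambda>x s. s(i := x # s i, j := x # s j)) (rev (s i)) ?s)(k := []))"
    by (rule sem_each[where P = "\<lambda>_. True"]) (use assms in \<open>auto simp: fun_eq_iff\<close>)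
  also have "(fold (\<lambda>x s. s(i := x # s i, j := x # s j)) (rev (s i)) ?s)(k := []) = s(j := s i @ s j)"
    using assms by (auto simp: fold_push2 fun_eq_iff)
  finally have loop: "sem B (Loop (\<lambda>t. t k \<noteq> None) (Push i (top_of k) ;; Push j (top_of k) ;; Pop k)) ?s =
      Done (s(j := s i @ s j))" .
  have "sem B (transfer i k) s = Done ?s" using assms by (simp add: sem_transfer)
  then show ?thesis unfolding copy_def sem.simps(6) using loop by (simp only: and_then.simps)
qed

text \<open>Register \<open>i\<close> acts as a unary counter; this is how the programs write as
  many copies of a symbol as there are variables or nodes.\<close>

definition fill :: "nat \<Rightarrow> nat \<Rightarrow> nat \<Rightarrow> 'a \<Rightarrow> 'a com" where
  "fill i k j c = transfer i k ;;
     Loop (\<lambda>t. t k \<noteq> None) (Push i (top_of k) ;; Push j (\<lambda>_. c) ;; Pop k)"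

lemma replicate_app_Cons: "replicate n c @ c # xs = c # replicate n c @ xs"
  by (induction n) auto

lemma fold_push_fill:
  "j \<noteq> i \<Longrightarrow> fold (\<lambda>x s. s(i := x # s i, j := c # s j)) xs s =
     s(i := rev xs @ s i, j := replicate (length xs) c @ s j)"
  by (induction xs arbitrary: s) (auto simp: fun_eq_iff replicate_app_Cons)

lemma sem_fill:
  assumes "i \<noteq> j" "i \<noteq> 1" "length (s i) \<le> B" "k \<noteq> 1" "s k = []" "k \<noteq> i" "k \<noteq> j" "j \<noteq> 1"
  shows "sem B (fill i k j c) s = Done (s(j := replicate (length (s i)) c @ s j))"
proof -
  let ?s = "s(k := rev (s i), i := [])"
  have "sem B (Loop (\<lambda>t. t k \<noteq> None) (Push i (top_of k) ;; Push j (\<lambda>_. c) ;; Pop k)) ?s =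
      Done ((fold (\<lambda>x s. s(i := x # s i, j := c # s j)) (rev (s i)) ?s)(k := []))"
    by (rule sem_each[where P = "\<lambda>_. True"]) (use assms in \<open>auto simp: fun_eq_iff\<close>)
  also have "(fold (\<lambda>x s. s(i := x # s i, j := c # s j)) (rev (s i)) ?s)(k := []) =
      s(j := replicate (length (s i)) c @ s j)"
    using assms by (auto simp: fold_push_fill fun_eq_iff)
  finally have loop: "sem B (Loop (\<lambda>t. t k \<noteq> None) (Push i (top_of k) ;; Push j (\<lambda>_. c) ;; Pop k)) ?s =
      Done (s(j := replicate (length (s i)) c @ s j))" .
  have "sem B (transfer i k) s = Done ?s" using assms by (simp add: sem_transfer)
  then show ?thesis unfolding fill_def sem.simps(6) using loop by (simp only: and_then.simps)
qed

lemma registers_below_macros [simp]: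
  "registers_below k (transfer i j) \<longleftrightarrow> j < k \<and> j \<noteq> 1 \<and> i < k \<and> i \<noteq> 1"
  "registers_below k (clear i) \<longleftrightarrow> i < k \<and> i \<noteq> 1"
  "registers_below k (copy i l j) \<longleftrightarrow> i < k \<and> i \<noteq> 1 \<and> l < k \<and> l \<noteq> 1 \<and> j < k \<and> j \<noteq> 1"
  "registers_below k (fill i l j c) \<longleftrightarrow> i < k \<and> i \<noteq> 1 \<and> l < k \<and> l \<noteq> 1 \<and> j < k \<and> j \<noteq> 1"
  by (auto simp: transfer_def clear_def copy_def fill_def)

definition output_stack :: "'a com" where
  "output_stack = Loop (\<lambda>t. t 0 \<noteq> None) (Emit (top_of 0) ;; Pop 0)"

lemma sem_output_stack: "sem (length w) output_stack (input w) = Done ((\<lambda>_. [])(1 := w))"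
proof -
  have "fold (\<lambda>x s. s(1 := s 1 @ [x])) xs s = s(1 := s 1 @ xs)" for xs and s :: "'a stacks"
    by (induction xs arbitrary: s) auto
  then show ?thesis unfolding output_stack_def
    by (subst sem_each[where P = "\<lambda>_. True" and f = "\<lambda>x s. s(1 := s 1 @ [x])" and xs = w])
      (auto simp: input_def fun_eq_iff)
qed

text \<open>An aborted run leaves the empty output. This must be a no-instance of the target, whence
  the hypothesis on the empty word.\<close>

lemma stack_reducible_imp_karp:
  fixes L L' :: "'a::finite list set"
  assumes "stack_reducible L L'" "[] \<notin> L'"
  shows "karp_reducible L L'"
proof -
  obtain c k p where c: "registers_below k c" "1 < k"
    "\<And>w. (\<exists>w'. sem (poly p (length w)) c (input w) = Done (input w') \<and> (w \<in> L \<longleftrightarrow> w' \<in> L')) \<or>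
         sem (poly p (length w)) c (input w) = Aborted \<and> w \<notin> L"
    using assms(1) unfolding stack_reducible_def by blast
  define d where "d = c ;; output_stack"
  define r where "r = p + [:0, 1:] + pcompose (cost c) p"
  have rd: "registers_below k d" using c(1,2) by (simp add: d_def output_stack_def)
  \<comment> \<open>Output, correctness and running time are bundled for each word, so that the
    reduction function comes from choice and fits the machine automatically.\<close>
  define good where "good w y \<longleftrightarrow> (w \<in> L \<longleftrightarrow> y \<in> L') \<and>
      (\<exists>T\<le>poly (pcompose (cost d) r) (length w). \<exists>ts.
        (step (compile k d) ^^ T) (initial (compile k d) w) = (num_states (compile k d), ts) \<and>
        holds_output (ts ! 1) y)" for w y
  have "\<exists>y. good w y" for w
  proof -
    have r: "poly p (length w) \<le> poly r (length w)" by (simp add: r_def)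
    from c(3)[of w] show ?thesis
    proof
      assume "\<exists>w'. sem (poly p (length w)) c (input w) = Done (input w') \<and> (w \<in> L \<longleftrightarrow> w' \<in> L')"
      then obtain w' where w': "sem (poly p (length w)) c (input w) = Done (input w')"
        "w \<in> L \<longleftrightarrow> w' \<in> L'" by blast
      have "length w' \<le> length w + poly (cost c) (poly p (length w))"
        using sem_growth[OF w'(1), of 0] by (simp add: input_def)
      then have "length w' \<le> poly r (length w)" by (simp add: r_def poly_pcompose)
      then have "sem (poly r (length w)) d (input w) = Done ((\<lambda>_. [])(1 := w'))"
        using sem_mono[of "poly p (length w)" c "input w"] w'(1) r sem_output_stack[of w']
          sem_mono[of "length w'" output_stack "input w'"] by (simp add: d_def)
      from compiled_run(2)[OF rd c(2) this[unfolded input_def]] show ?thesis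
        using w'(2) by (auto simp: good_def poly_pcompose)
    next
      assume "sem (poly p (length w)) c (input w) = Aborted \<and> w \<notin> L"
      then have "sem (poly r (length w)) d (input w) = Aborted" "w \<notin> L"
        using sem_mono[of "poly p (length w)" c "input w"] r by (simp_all add: d_def)
      with compiled_run(3)[OF rd c(2) this(1)[unfolded input_def]] show ?thesis
        using assms(2) by (auto simp: good_def poly_pcompose)
    qed
  qed
  then obtain f where f: "\<And>w. good w (f w)" by metis
  then have "poly_time_computable f"
    unfolding poly_time_computable_def good_def using compiled_run(1)[OF rd c(2)] by blast
  then show ?thesis using f unfolding karp_reducible_def good_def by blast
qed

section \<open>Potentials and the value of a mean payoff game\<close>

definition succs :: "game \<Rightarrow> node \<Rightarrow> node set" where
  "succs g u = {v. arc_weight g u v \<noteq> None}"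

definition weight :: "game \<Rightarrow> node \<Rightarrow> node \<Rightarrow> real" where
  "weight g u v = real_of_int (the (arc_weight g u v))"

fun is_row :: "node \<Rightarrow> bool" where
  "is_row (Row i) = True"
| "is_row (Col j) = False"

text \<open>A certificate that Max secures the mean \<open>l\<close> from \<open>Y\<close>: Max can
  stay in \<open>Y\<close>, Min cannot leave it, and the weights diminished by \<open>l\<close>
  telescope against the bounded function \<open>y\<close>.\<close>

definition max_potential :: "game \<Rightarrow> real \<Rightarrow> node set \<Rightarrow> (node \<Rightarrow> real) \<Rightarrow> bool" where
  "max_potential g l Y y \<longleftrightarrow> Y \<subseteq> nodes g \<and> (\<forall>u\<in>Y.
     if is_row u then \<exists>v\<in>succs g u. v \<in> Y \<and> y u \<le> weight g u v - l + y v
     else \<forall>v\<in>succs g u. v \<in> Y \<and> y u \<le> weight g u v - l + y v)"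

text \<open>The dual certificate. Its uniform gain \<open>d\<close> per move brings the mean down to
  \<open>l - d\<close>, so at one node and one level it excludes a
  \<open>max_potential\<close>.\<close>

definition min_potential :: "game \<Rightarrow> real \<Rightarrow> real \<Rightarrow> node set \<Rightarrow> (node \<Rightarrow> real) \<Rightarrow> bool" where
  "min_potential g l d U p \<longleftrightarrow> U \<subseteq> nodes g \<and> 0 < d \<and> (\<forall>u\<in>U.
     if is_row u then \<forall>v\<in>succs g u. v \<in> U \<and> p u \<le> p v - (weight g u v - l) - d
     else \<exists>v\<in>succs g u. v \<in> U \<and> p u \<le> p v - (weight g u v - l) - d)"

lemma arc_nodes: "arc_weight g u v \<noteq> None \<Longrightarrow> u \<in> nodes g \<and> v \<in> nodes g"
  by (cases u; cases v) (auto simp: nodes_def split: if_splits)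

lemma finite_nodes [simp]: "finite (nodes g)"
  by (simp add: nodes_def)

lemma succs_nodes: "succs g u \<subseteq> nodes g"
  using arc_nodes by (auto simp: succs_def)

lemma finite_succs [simp]: "finite (succs g u)"
  using succs_nodes finite_nodes by (rule finite_subset)

lemma succs_ne: "mean_payoff_game g \<Longrightarrow> u \<in> nodes g \<Longrightarrow> succs g u \<noteq> {}"
  unfolding mean_payoff_game_def succs_def by blast

text \<open>The credit that Max needs in order not to run into debt during the first \<open>m\<close> moves, for
  the weights diminished by \<open>l\<close>.\<close>

fun credit :: "game \<Rightarrow> real \<Rightarrow> nat \<Rightarrow> node \<Rightarrow> real" where
  "credit g l 0 u = 0"
| "credit g l (Suc m) u =
     (if is_row u then Min else Max) ((\<lambda>v. max 0 (credit g l m v - (weight g u v - l))) ` succs g u)"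

lemma credit_row:
  assumes "mean_payoff_game g" "u \<in> nodes g" "is_row u"
  shows "v \<in> succs g u \<Longrightarrow> credit g l (Suc m) u \<le> max 0 (credit g l m v - (weight g u v - l))"
    and "\<exists>v\<in>succs g u. credit g l (Suc m) u = max 0 (credit g l m v - (weight g u v - l))"
proof -
  let ?A = "(\<lambda>v. max 0 (credit g l m v - (weight g u v - l))) ` succs g u"
  have A: "finite ?A" "?A \<noteq> {}" using succs_ne[OF assms(1,2)] by auto
  show "credit g l (Suc m) u \<le> max 0 (credit g l m v - (weight g u v - l))" if "v \<in> succs g u"
    using Min_le[OF A(1), of "max 0 (credit g l m v - (weight g u v - l))"] that assms(3) by simp
  show "\<exists>v\<in>succs g u. credit g l (Suc m) u = max 0 (credit g l m v - (weight g u v - l))"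
    using Min_in[OF A] assms(3) by auto
qed

lemma credit_col:
  assumes "mean_payoff_game g" "u \<in> nodes g" "\<not> is_row u"
  shows "v \<in> succs g u \<Longrightarrow> max 0 (credit g l m v - (weight g u v - l)) \<le> credit g l (Suc m) u"
    and "\<exists>v\<in>succs g u. credit g l (Suc m) u = max 0 (credit g l m v - (weight g u v - l))"
proof -
  let ?A = "(\<lambda>v. max 0 (credit g l m v - (weight g u v - l))) ` succs g u"
  have A: "finite ?A" "?A \<noteq> {}" using succs_ne[OF assms(1,2)] by auto
  show "max 0 (credit g l m v - (weight g u v - l)) \<le> credit g l (Suc m) u" if "v \<in> succs g u"
    using Max_ge[OF A(1), of "max 0 (credit g l m v - (weight g u v - l))"] that assms(3) by simp
  show "\<exists>v\<in>succs g u. credit g l (Suc m) u = max 0 (credit g l m v - (weight g u v - l))"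
    using Max_in[OF A] assms(3) by auto
qed

lemma credit_nonneg:
  assumes "mean_payoff_game g" "u \<in> nodes g"
  shows "0 \<le> credit g l m u"
proof (cases m)
  case (Suc k)
  have "\<exists>v\<in>succs g u. credit g l (Suc k) u = max 0 (credit g l k v - (weight g u v - l))"
    using credit_row(2) credit_col(2) assms by (cases "is_row u") blast+
  then show ?thesis using Suc by auto
qed simp

text \<open>Because of the truncation at zero a credit also has to cover all shorter plays, so a
  longer horizon never lowers it.\<close>

lemma credit_Suc:
  assumes "mean_payoff_game g" "u \<in> nodes g"
  shows "credit g l m u \<le> credit g l (Suc m) u"
  using assms(2)
proof (induction m arbitrary: u)
  case 0
  then show ?case using credit_nonneg[OF assms(1) 0, of l "Suc 0"] by (simp only: credit.simps(1))
next
  case (Suc m u)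
  have IH: "v \<in> succs g u \<Longrightarrow> credit g l m v \<le> credit g l (Suc m) v" for v
    using Suc.IH succs_nodes by blast
  show ?case
  proof (cases "is_row u")
    case True
    obtain v where v: "v \<in> succs g u"
      "credit g l (Suc (Suc m)) u = max 0 (credit g l (Suc m) v - (weight g u v - l))"
      using credit_row(2)[OF assms(1) Suc.prems True] by blast
    show ?thesis using v IH[OF v(1)] credit_row(1)[OF assms(1) Suc.prems True v(1), of l m] by linarith
  next
    case False
    obtain v where v: "v \<in> succs g u"
      "credit g l (Suc m) u = max 0 (credit g l m v - (weight g u v - l))"
      using credit_col(2)[OF assms(1) Suc.prems False] by blast
    show ?thesis
      using v IH[OF v(1)] credit_col(1)[OF assms(1) Suc.prems False v(1), of l "Suc m"] by linarith
  qed
qed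

lemma credit_mono:
  assumes "mean_payoff_game g" "u \<in> nodes g" "m \<le> n"
  shows "credit g l m u \<le> credit g l n u"
  using credit_Suc[OF assms(1,2)] assms(3) by (rule lift_Suc_mono_le)

text \<open>Where the needed credits stay bounded, their suprema are a potential for Max. On the other
  nodes they eventually exceed every bound, so that Min never leaves these nodes and truncation
  at zero plays no role any more; an average of the credits over one increase by 1 is then a
  strict potential for Min.\<close>

lemma max_potential_bounded:
  assumes G: "mean_payoff_game g"
  shows "max_potential g l {u \<in> nodes g. bdd_above (range (\<lambda>m. credit g l m u))}
    (\<lambda>u. - (SUP m. credit g l m u))" (is "max_potential g l ?Y ?y")
  unfolding max_potential_def
proof (intro conjI ballI)
  show "?Y \<subseteq> nodes g" by auto
  fix u assume u: "u \<in> ?Y"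
  let ?F = "\<lambda>u. SUP m. credit g l m u"
  have le: "credit g l m u \<le> ?F u" for m using u by (auto intro: cSUP_upper)
  have *: "v \<in> ?Y \<and> ?y u \<le> weight g u v - l + ?y v"
    if "v \<in> succs g u" "\<And>m. credit g l m v - (weight g u v - l) \<le> ?F u" for v
  proof
    have b: "credit g l m v \<le> ?F u + (weight g u v - l)" for m using that(2)[of m] by simp
    then show "v \<in> ?Y" using that(1) succs_nodes[of g u] by (auto intro!: bdd_aboveI2[of _ _ "?F u + (weight g u v - l)"])
    have "?F v \<le> ?F u + (weight g u v - l)" using b by (intro cSUP_least) auto
    then show "?y u \<le> weight g u v - l + ?y v" by simp
  qed
  show "if is_row u then \<exists>v\<in>succs g u. v \<in> ?Y \<and> ?y u \<le> weight g u v - l + ?y v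
     else \<forall>v\<in>succs g u. v \<in> ?Y \<and> ?y u \<le> weight g u v - l + ?y v"
  proof (cases "is_row u")
    case True
    have "\<forall>m. \<exists>v\<in>succs g u. credit g l m v - (weight g u v - l) \<le> ?F u"
    proof
      fix m
      obtain v where "v \<in> succs g u"
        "credit g l (Suc m) u = max 0 (credit g l m v - (weight g u v - l))"
        using credit_row(2)[OF G _ True] u by blast
      then show "\<exists>v\<in>succs g u. credit g l m v - (weight g u v - l) \<le> ?F u"
        using le[of "Suc m"] by (intro bexI[of _ v]) linarith+
    qed
    then obtain c where c: "\<And>m. c m \<in> succs g u"
      "\<And>m. credit g l m (c m) - (weight g u (c m) - l) \<le> ?F u" by metis
    \<comment> \<open>One successor is optimal for infinitely many horizons; as credits grow with
      the horizon, its bound extends to all of them.\<close>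
    have "finite (range c)" by (rule finite_subset[OF _ finite_succs[of g u]]) (use c(1) in auto)
    then obtain m0 where inf: "infinite {m. c m = c m0}"
      using pigeonhole_infinite[of UNIV c] by auto
    have "credit g l m (c m0) - (weight g u (c m0) - l) \<le> ?F u" for m
    proof -
      obtain n where n: "n \<ge> m" "c n = c m0"
        using inf by (metis (mono_tags, lifting) infinite_nat_iff_unbounded_le mem_Collect_eq)
      have "credit g l m (c m0) \<le> credit g l n (c m0)"
        using credit_mono[OF G _ n(1)] c(1)[of m0] succs_nodes by blast
      then show ?thesis using c(2)[of n] n(2) by simp
    qed
    from *[OF c(1) this] c(1) True show ?thesis by auto
  next
    case False
    have "credit g l m v - (weight g u v - l) \<le> ?F u" if "v \<in> succs g u" for v m
      using credit_col(1)[OF G _ False that, of l m] le[of "Suc m"] u by fastforce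
    then show ?thesis using * False by auto
  qed
qed

lemma min_potential_unbounded:
  fixes l :: real
  assumes G: "mean_payoff_game g"
  defines "U \<equiv> {u \<in> nodes g. \<not> bdd_above (range (\<lambda>m. credit g l m u))}"
  shows "\<exists>p d. min_potential g l d U p"
proof -
  define C where "C = Max (insert 0 ((\<lambda>u. SUP m. credit g l m u) ` (nodes g - U)))"
  have C: "credit g l m u \<le> C" if "u \<in> nodes g - U" for m u
  proof -
    have "credit g l m u \<le> (SUP m. credit g l m u)"
      using that by (auto simp: U_def intro: cSUP_upper)
    also have "\<dots> \<le> C" unfolding C_def using that by (intro Max_ge) auto
    finally show ?thesis .
  qed
  have C0: "0 \<le> C" unfolding C_def by (intro Max_ge) auto
  define D where "D = Max (insert 0 ((\<lambda>(u, v). \<bar>weight g u v - l\<bar>) ` (nodes g \<times> nodes g)))"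
  have D: "\<bar>weight g u v - l\<bar> \<le> D" if "u \<in> nodes g" "v \<in> nodes g" for u v
    unfolding D_def using that by (intro Max_ge) auto
  have D0: "0 \<le> D" unfolding D_def by (intro Max_ge) auto
  have large: "\<exists>m. \<forall>u\<in>U. K u < credit g l m u" for K
  proof -
    have "\<exists>m. K u < credit g l m u" if "u \<in> U" for u
    proof (rule ccontr)
      assume "\<nexists>m. K u < credit g l m u"
      then have "bdd_above (range (\<lambda>m. credit g l m u))"
        by (intro bdd_aboveI2[of _ _ "K u"]) (auto simp: not_less)
      then show False using that by (simp add: U_def)
    qed
    then obtain c where c: "\<And>u. u \<in> U \<Longrightarrow> K u < credit g l (c u) u" by metis
    have fU: "finite U" unfolding U_def by auto
    have "K u < credit g l (Max (insert 0 (c ` U))) u" if "u \<in> U" for u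
      using c[OF that] credit_mono[OF G, of u "c u" "Max (insert 0 (c ` U))" l] fU that
      by (force simp: U_def)
    then show ?thesis by blast
  qed
  \<comment> \<open>A credit above \<open>C + D\<close> cannot stem from a move out of
    \<open>U\<close>: the credits there are at most \<open>C\<close>, and an arc changes them by at
    most \<open>D\<close>. Nor can it be the result of truncation at zero.\<close>
  obtain m0 where m0: "\<And>u. u \<in> U \<Longrightarrow> C + D < credit g l m0 u" using large[of "\<lambda>_. C + D"] by blast
  define f where "f t = credit g l (m0 + t)" for t
  have f: "C + D < f t u" if "u \<in> U" for t u
    using m0[OF that] credit_mono[OF G, of u m0 "m0 + t" l] that by (force simp: U_def f_def)
  have f_row: "v \<in> U \<and> f (Suc t) u \<le> f t v - (weight g u v - l)"
    if "u \<in> U" "is_row u" "v \<in> succs g u" for u v t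
  proof -
    have u: "u \<in> nodes g" "v \<in> nodes g" using that succs_nodes[of g u] by (auto simp: U_def)
    have "f (Suc t) u \<le> max 0 (f t v - (weight g u v - l))" for t
      using credit_row(1)[OF G u(1) that(2,3)] by (simp add: f_def)
    then have *: "f (Suc t) u \<le> f t v - (weight g u v - l)" for t
      using f[OF that(1), of "Suc t"] C0 D0 by (smt (verit))
    have "v \<in> U"
    proof (rule ccontr)
      assume "v \<notin> U"
      then have "f t v \<le> C" for t using C[of v] u by (simp add: f_def)
      then show False using *[of 0] f[OF that(1), of "Suc 0"] D[OF u] by (smt (verit))
    qed
    then show ?thesis using * by blast
  qed
  have f_col: "\<exists>v\<in>succs g u. v \<in> U \<and> f (Suc t) u \<le> f t v - (weight g u v - l)"
    if that1: "u \<in> U" and that2: "\<not> is_row u" for u t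
  proof -
    have u: "u \<in> nodes g" using that1 by (auto simp: U_def)
    obtain v where v: "v \<in> succs g u" "f (Suc t) u = max 0 (f t v - (weight g u v - l))"
      using credit_col(2)[OF G u that2, of l "m0 + t"] by (auto simp: f_def)
    have *: "f (Suc t) u \<le> f t v - (weight g u v - l)"
      using f[OF that1, of "Suc t"] v C0 D0 by (smt (verit))
    have vn: "v \<in> nodes g" using v succs_nodes[of g u] by auto
    have "v \<in> U"
    proof (rule ccontr)
      assume "v \<notin> U"
      then have "f t v \<le> C" using C[of v] vn by (simp add: f_def)
      then show False using * f[OF that1, of "Suc t"] D[OF u vn] by (smt (verit))
    qed
    then show ?thesis using v * by blast
  qed
  have "\<exists>m. \<forall>u\<in>U. f 0 u + 1 < f m u"
  proof -
    obtain m where m: "\<And>u. u \<in> U \<Longrightarrow> f 0 u + 1 < credit g l m u" using large[of "\<lambda>u. f 0 u + 1"] by blast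
    have "f 0 u + 1 < f m u" if "u \<in> U" for u
      using m[OF that] credit_mono[OF G, of u m "m0 + m" l] that by (force simp: U_def f_def)
    then show ?thesis by blast
  qed
  then obtain \<tau> where \<tau>: "\<And>u. u \<in> U \<Longrightarrow> f 0 u + 1 < f \<tau> u" by blast
  show ?thesis
  proof (cases "U = {}")
    case True
    then show ?thesis by (auto simp: min_potential_def intro!: exI[of _ "1::real"])
  next
    case False
    then have \<tau>0: "0 < \<tau>" using \<tau> by (force intro: gr0I)
    \<comment> \<open>The linear term falls by 1 over the window, less than the increase of the
      credits, so the maximum over the window is not attained at time 0. The time of the maximum can
      thus be stepped back by one along a move, which gains \<open>1 / \<tau>\<close>.\<close>
    define q where "q u t = f t u - real t / real \<tau>" for u t
    define p where "p u = Max (q u ` {0..\<tau>})" for u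
    have q_le: "q u t \<le> p u" if "t \<le> \<tau>" for u t
      unfolding p_def using that by (intro Max_ge) auto
    have p_eq: "\<exists>t. t < \<tau> \<and> p u = q u (Suc t)" if "u \<in> U" for u
    proof -
      have "p u \<in> q u ` {0..\<tau>}" unfolding p_def by (intro Max_in) auto
      then obtain t where t: "t \<le> \<tau>" "p u = q u t" by auto
      have "q u 0 < q u \<tau>" using \<tau>[OF that] \<tau>0 by (simp add: q_def)
      then have "t \<noteq> 0" using q_le[of \<tau> u] t(2) by (intro notI) simp
      then show ?thesis using t by (intro exI[of _ "t - 1"]) auto
    qed
    have step: "p u \<le> p v - (weight g u v - l) - 1 / real \<tau>"
      if "p u = q u (Suc t)" "t < \<tau>" "f (Suc t) u \<le> f t v - (weight g u v - l)" for u v t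
      using that q_le[of t v] by (simp add: q_def add_divide_distrib)
    have "min_potential g l (1 / real \<tau>) U p"
      unfolding min_potential_def
    proof (intro conjI ballI)
      show "U \<subseteq> nodes g" by (auto simp: U_def)
      show "0 < 1 / real \<tau>" using \<tau>0 by simp
      fix u assume u: "u \<in> U"
      obtain t where t: "t < \<tau>" "p u = q u (Suc t)" using p_eq[OF u] by blast
      show "if is_row u then \<forall>v\<in>succs g u. v \<in> U \<and> p u \<le> p v - (weight g u v - l) - 1 / real \<tau>
        else \<exists>v\<in>succs g u. v \<in> U \<and> p u \<le> p v - (weight g u v - l) - 1 / real \<tau>"
      proof (cases "is_row u")
        case True
        then show ?thesis using f_row[OF u True] step[OF t(2,1)] by simp
      next
        case False
        then show ?thesis using f_col[OF u False, of t] step[OF t(2,1)] by auto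
      qed
    qed
    then show ?thesis by blast
  qed
qed

text \<open>The duality theorem: the two alternatives are bounded and unbounded credits at
  \<open>s\<close>.\<close>

lemma potential_dichotomy:
  assumes "mean_payoff_game g" "s \<in> nodes g"
  shows "(\<exists>Y y. s \<in> Y \<and> max_potential g l Y y) \<or> (\<exists>d U p. s \<in> U \<and> min_potential g l d U p)"
proof (cases "bdd_above (range (\<lambda>m. credit g l m s))")
  case True
  then have "s \<in> {u \<in> nodes g. bdd_above (range (\<lambda>m. credit g l m u))}" using assms(2) by simp
  then show ?thesis using max_potential_bounded[OF assms(1)] by (intro disjI1 exI conjI)
next
  case False
  then have "s \<in> {u \<in> nodes g. \<not> bdd_above (range (\<lambda>m. credit g l m u))}" using assms(2) by simp
  moreover obtain p d where
    "min_potential g l d {u \<in> nodes g. \<not> bdd_above (range (\<lambda>m. credit g l m u))} p"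
    using min_potential_unbounded[OF assms(1)] by metis
  ultimately show ?thesis by (intro disjI2 exI conjI)
qed

section \<open>From potentials to strategies, and the existence of the value\<close>

lemma history_ne: "history \<sigma> \<tau> s k \<noteq> []"
  by (cases k) (auto simp: Let_def)

lemma last_history_Suc:
  "last (history \<sigma> \<tau> s (Suc k)) =
     (if is_row (last (history \<sigma> \<tau> s k)) then \<sigma> (history \<sigma> \<tau> s k) else \<tau> (history \<sigma> \<tau> s k))"
  by (cases "last (history \<sigma> \<tau> s k)") (auto simp: Let_def)

lemma max_strategies_succs:
  assumes "\<sigma> \<in> max_strategies g" "h \<noteq> []" "last h \<in> nodes g" "is_row (last h)"
  shows "\<sigma> h \<in> succs g (last h)"
proof -
  obtain i where i: "last h = Row i" using assms(4) by (cases "last h") auto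
  obtain h' where h: "h = h' @ [Row i]" using assms(2) i by (cases h rule: rev_cases) auto
  have "i < num_rows g" using assms(3) i by (auto simp: nodes_def)
  then show ?thesis using assms(1) by (simp add: h max_strategies_def succs_def)
qed

lemma min_strategies_succs:
  assumes "\<tau> \<in> min_strategies g" "h \<noteq> []" "last h \<in> nodes g" "\<not> is_row (last h)"
  shows "\<tau> h \<in> succs g (last h)"
proof -
  obtain i where i: "last h = Col i" using assms(4) by (cases "last h") auto
  obtain h' where h: "h = h' @ [Col i]" using assms(2) i by (cases h rule: rev_cases) auto
  have "i < num_cols g" using assms(3) i by (auto simp: nodes_def)
  then show ?thesis using assms(1) by (simp add: h min_strategies_def succs_def)
qed

text \<open>Telescoping along a run that never leaves \<open>Y\<close>. The factor \<open>c\<close>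
  is 1 for Max and -1 for Min, so that both players share the argument.\<close>

lemma payment_sum_ge:
  assumes "s \<in> Y" "\<And>k. last (history \<sigma> \<tau> s k) \<in> Y \<Longrightarrow>
      last (history \<sigma> \<tau> s (Suc k)) \<in> Y \<and>
      c * weight g (last (history \<sigma> \<tau> s k)) (last (history \<sigma> \<tau> s (Suc k)))
        \<ge> m + y (last (history \<sigma> \<tau> s k)) - y (last (history \<sigma> \<tau> s (Suc k)))"
  shows "last (history \<sigma> \<tau> s N) \<in> Y \<and> c * real_of_int (\<Sum>k<N. payment g \<sigma> \<tau> s k) \<ge>
     m * N + y s - y (last (history \<sigma> \<tau> s N))"
proof (induction N)
  case 0
  then show ?case using assms(1) by simp
next
  case (Suc N)
  have "c * real_of_int (payment g \<sigma> \<tau> s N) \<ge>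
      m + y (last (history \<sigma> \<tau> s N)) - y (last (history \<sigma> \<tau> s (Suc N)))"
    using assms(2)[of N] Suc.IH by (simp add: payment_def weight_def)
  then show ?case using Suc.IH assms(2)[of N] by (simp add: algebra_simps del: history.simps)
qed

lemma lower_value_ge:
  assumes G: "mean_payoff_game g" and pot: "max_potential g l Y y" and s: "s \<in> Y"
  shows "ereal l \<le> lower_value g s"
proof -
  \<comment> \<open>A strategy has to be legal at every row node, also outside \<open>Y\<close>;
    only inside \<open>Y\<close> does it follow the potential. The choice looks at the last node
    alone, so the strategy is positional.\<close>
  define ok where "ok h v \<longleftrightarrow> v \<in> succs g (last h) \<and>
    (last h \<in> Y \<longrightarrow> v \<in> Y \<and> y (last h) \<le> weight g (last h) v - l + y v)" for h v
  define \<sigma> where "\<sigma> h = (SOME v. ok h v)" for h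
  have ok: "ok h (\<sigma> h)" if "last h \<in> nodes g" "is_row (last h)" for h
  proof -
    have "\<exists>v. ok h v"
      using pot that succs_ne[OF G that(1)] unfolding ok_def max_potential_def by (cases "last h \<in> Y") force+
    then show ?thesis unfolding \<sigma>_def by (rule someI_ex)
  qed
  have \<sigma>: "\<sigma> \<in> max_strategies g"
    unfolding max_strategies_def
  proof (intro CollectI allI impI)
    fix h i assume "i < num_rows g"
    then show "arc_weight g (Row i) (\<sigma> (h @ [Row i])) \<noteq> None"
      using ok[of "h @ [Row i]"] by (simp add: ok_def succs_def nodes_def)
  qed
  have fin: "finite Y" using pot finite_subset[OF _ finite_nodes] by (auto simp: max_potential_def)
  \<comment> \<open>Bounds the two end terms of the telescoping sum uniformly in the length of the
    run; divided by this length it vanishes in the limit.\<close>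
  define D where "D = y s - Max (y ` Y)"
  have "ereal l \<le> liminf (\<lambda>N. ereal (mean_payment g \<sigma> \<tau> s N))" if \<tau>: "\<tau> \<in> min_strategies g" for \<tau>
  proof -
    have "last (history \<sigma> \<tau> s N) \<in> Y \<and> 1 * real_of_int (\<Sum>k<N. payment g \<sigma> \<tau> s k) \<ge>
       l * N + y s - y (last (history \<sigma> \<tau> s N))" for N
    proof (rule payment_sum_ge[where y = y])
      fix k assume k: "last (history \<sigma> \<tau> s k) \<in> Y"
      let ?h = "history \<sigma> \<tau> s k"
      have n: "last ?h \<in> nodes g" using k pot by (auto simp: max_potential_def)
      show "last (history \<sigma> \<tau> s (Suc k)) \<in> Y \<and> l + y (last ?h) - y (last (history \<sigma> \<tau> s (Suc k)))
          \<le> 1 * weight g (last ?h) (last (history \<sigma> \<tau> s (Suc k)))"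
      proof (cases "is_row (last ?h)")
        case True
        then show ?thesis using ok[OF n] k by (auto simp: ok_def last_history_Suc simp del: history.simps)
      next
        case False
        then have "\<tau> ?h \<in> succs g (last ?h)" using min_strategies_succs[OF \<tau> history_ne n] by blast
        then show ?thesis using False pot k
          by (fastforce simp: max_potential_def last_history_Suc simp del: history.simps)
      qed
    qed (rule s)
    then have sum: "real_of_int (\<Sum>k<N. payment g \<sigma> \<tau> s k) \<ge> l * N + D" for N
      using fin Max_ge[of "y ` Y"] by (smt (verit) D_def finite_imageI imageI)
    have "\<forall>\<^sub>F N in sequentially. ereal (l + D / real N) \<le> ereal (mean_payment g \<sigma> \<tau> s N)"
    proof (rule eventually_sequentiallyI[of 1])
      fix N :: nat assume "1 \<le> N"
      then have "l + D / real N = (l * real N + D) / real N" by (simp add: add_divide_distrib)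
      then show "ereal (l + D / real N) \<le> ereal (mean_payment g \<sigma> \<tau> s N)"
        using divide_right_mono[OF sum[of N], of "real N"]
        by (simp add: mean_payment_def del: add_divide_distrib)
    qed
    then have "liminf (\<lambda>N. ereal (l + D / real N)) \<le> liminf (\<lambda>N. ereal (mean_payment g \<sigma> \<tau> s N))"
      by (rule Liminf_mono)
    moreover have "(\<lambda>N. l + D / real N) \<longlonglongrightarrow> l + 0"
      by (intro tendsto_add tendsto_const lim_const_over_n)
    then have "(\<lambda>N. ereal (l + D / real N)) \<longlonglongrightarrow> ereal l" by simp
    then have "liminf (\<lambda>N. ereal (l + D / real N)) = ereal l"
      by (intro lim_imp_Liminf) auto
    ultimately show ?thesis by simp
  qed
  then show ?thesis unfolding lower_value_def by (intro SUP_upper2[OF \<sigma>] INF_greatest)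
qed

text \<open>Mirror image of \<open>lower_value_ge\<close>, in which the gain \<open>d\<close> of
  each move appears in the mean.\<close>

lemma upper_value_le:
  assumes G: "mean_payoff_game g" and pot: "min_potential g l d U p" and s: "s \<in> U"
  shows "upper_value g s \<le> ereal (l - d)"
proof -
  define ok where "ok h v \<longleftrightarrow> v \<in> succs g (last h) \<and>
    (last h \<in> U \<longrightarrow> v \<in> U \<and> p (last h) \<le> p v - (weight g (last h) v - l) - d)" for h v
  define \<tau> where "\<tau> h = (SOME v. ok h v)" for h
  have ok: "ok h (\<tau> h)" if "last h \<in> nodes g" "\<not> is_row (last h)" for h
  proof -
    have "\<exists>v. ok h v"
      using pot that succs_ne[OF G that(1)] unfolding ok_def min_potential_def by (cases "last h \<in> U") force+
    then show ?thesis unfolding \<tau>_def by (rule someI_ex)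
  qed
  have \<tau>: "\<tau> \<in> min_strategies g"
    unfolding min_strategies_def
  proof (intro CollectI allI impI)
    fix h i assume "i < num_cols g"
    then show "arc_weight g (Col i) (\<tau> (h @ [Col i])) \<noteq> None"
      using ok[of "h @ [Col i]"] by (simp add: ok_def succs_def nodes_def)
  qed
  have fin: "finite U" using pot finite_subset[OF _ finite_nodes] by (auto simp: min_potential_def)
  define D where "D = p s - Max (p ` U)"
  have "limsup (\<lambda>N. ereal (mean_payment g \<sigma> \<tau> s N)) \<le> ereal (l - d)" if \<sigma>: "\<sigma> \<in> max_strategies g" for \<sigma>
  proof -
    have "last (history \<sigma> \<tau> s N) \<in> U \<and> -1 * real_of_int (\<Sum>k<N. payment g \<sigma> \<tau> s k) \<ge>
       (d - l) * N + p s - p (last (history \<sigma> \<tau> s N))" for N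
    proof (rule payment_sum_ge[where y = p])
      fix k assume k: "last (history \<sigma> \<tau> s k) \<in> U"
      let ?h = "history \<sigma> \<tau> s k"
      have n: "last ?h \<in> nodes g" using k pot by (auto simp: min_potential_def)
      show "last (history \<sigma> \<tau> s (Suc k)) \<in> U \<and> d - l + p (last ?h) - p (last (history \<sigma> \<tau> s (Suc k)))
          \<le> -1 * weight g (last ?h) (last (history \<sigma> \<tau> s (Suc k)))"
      proof (cases "is_row (last ?h)")
        case False
        then show ?thesis using ok[OF n] k by (auto simp: ok_def last_history_Suc simp del: history.simps)
      next
        case True
        then have "\<sigma> ?h \<in> succs g (last ?h)" using max_strategies_succs[OF \<sigma> history_ne n] by blast
        then show ?thesis using True pot k
          by (fastforce simp: min_potential_def last_history_Suc simp del: history.simps)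
      qed
    qed (rule s)
    then have sum: "- real_of_int (\<Sum>k<N. payment g \<sigma> \<tau> s k) \<ge> (d - l) * N + D" for N
      using fin Max_ge[of "p ` U"] by (smt (verit) D_def finite_imageI imageI)
    have "\<forall>\<^sub>F N in sequentially. ereal (mean_payment g \<sigma> \<tau> s N) \<le> ereal ((l - d) - D / real N)"
    proof (rule eventually_sequentiallyI[of 1])
      fix N :: nat assume "1 \<le> N"
      then have "(l - d) - D / real N = - (((d - l) * real N + D) / real N)"
        by (simp add: field_simps)
      then show "ereal (mean_payment g \<sigma> \<tau> s N) \<le> ereal ((l - d) - D / real N)"
        using divide_right_mono[OF sum[of N], of "real N"]
        by (simp add: mean_payment_def del: add_divide_distrib)
    qed
    then have "limsup (\<lambda>N. ereal (mean_payment g \<sigma> \<tau> s N)) \<le> limsup (\<lambda>N. ereal ((l - d) - D / real N))"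
      by (rule Limsup_mono)
    moreover have "(\<lambda>N. (l - d) - D / real N) \<longlonglongrightarrow> (l - d) - 0"
      by (intro tendsto_diff tendsto_const lim_const_over_n)
    then have "(\<lambda>N. ereal ((l - d) - D / real N)) \<longlonglongrightarrow> ereal (l - d)" by simp
    then have "limsup (\<lambda>N. ereal ((l - d) - D / real N)) = ereal (l - d)"
      by (intro lim_imp_Limsup) auto
    ultimately show ?thesis by simp
  qed
  then show ?thesis unfolding upper_value_def by (intro INF_lower2[OF \<tau>] SUP_least)
qed

lemma lower_le_upper: "lower_value g s \<le> upper_value g s"
  unfolding lower_value_def upper_value_def
proof (intro SUP_least INF_greatest)
  fix \<sigma> \<tau> assume "\<sigma> \<in> max_strategies g" "\<tau> \<in> min_strategies g"
  then show "(INF \<tau>\<in>min_strategies g. liminf (\<lambda>N. ereal (mean_payment g \<sigma> \<tau> s N)))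
      \<le> (SUP \<sigma>\<in>max_strategies g. limsup (\<lambda>N. ereal (mean_payment g \<sigma> \<tau> s N)))"
    by (intro INF_lower2[of \<tau>] SUP_upper2[of \<sigma>] Liminf_le_Limsup) auto
qed

text \<open>By the dichotomy at level \<open>l\<close>, no real \<open>l\<close> lies strictly
  between the lower and the upper value. Constant potentials at the levels \<open>- W\<close> and
  \<open>W + 1\<close> show that both values are finite.\<close>

theorem mean_payoff_value_exists:
  assumes G: "mean_payoff_game g" and s: "s \<in> nodes g"
  shows "\<exists>v. has_value g s v"
proof -
  have dich: "ereal l \<le> lower_value g s \<or> upper_value g s \<le> ereal l" for l
  proof -
    have "upper_value g s \<le> ereal l" if "s \<in> U" "min_potential g l d U p" for d U p
    proof -
      have "ereal (l - d) \<le> ereal l" using that(2) by (simp add: min_potential_def)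
      then show ?thesis using upper_value_le[OF G that(2,1)] order_trans by blast
    qed
    then show ?thesis using potential_dichotomy[OF G s, of l] lower_value_ge[OF G] by blast
  qed
  have eq: "lower_value g s = upper_value g s"
  proof (rule ccontr)
    assume "lower_value g s \<noteq> upper_value g s"
    then have "lower_value g s < upper_value g s" using lower_le_upper[of g s] by simp
    then obtain l where "lower_value g s < ereal l" "ereal l < upper_value g s"
      using ereal_dense2 by blast
    then show False using dich[of l] by (meson leD)
  qed
  define W where "W = Max (insert 0 ((\<lambda>(u, v). \<bar>weight g u v\<bar>) ` (nodes g \<times> nodes g)))"
  have W: "\<bar>weight g u v\<bar> \<le> W" if "u \<in> nodes g" "v \<in> nodes g" for u v
    unfolding W_def using that by (intro Max_ge) auto
  have W': "\<bar>weight g u v\<bar> \<le> W" "v \<in> nodes g" if "u \<in> nodes g" "v \<in> succs g u" for u v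
    using W that succs_nodes by blast+
  have "max_potential g (- W) (nodes g) (\<lambda>_. 0)"
    unfolding max_potential_def
  proof (intro conjI ballI)
    fix u assume u: "u \<in> nodes g"
    have "v \<in> nodes g \<and> 0 \<le> weight g u v - - W + 0" if "v \<in> succs g u" for v
      using W'[OF u that] by auto
    then show "if is_row u then \<exists>v\<in>succs g u. v \<in> nodes g \<and> 0 \<le> weight g u v - - W + 0
      else \<forall>v\<in>succs g u. v \<in> nodes g \<and> 0 \<le> weight g u v - - W + 0"
      using succs_ne[OF G u] by auto
  qed simp
  from lower_value_ge[OF G this s] have 1: "ereal (- W) \<le> lower_value g s" by simp
  have "min_potential g (W + 1) 1 (nodes g) (\<lambda>_. 0)"
    unfolding min_potential_def
  proof (intro conjI ballI)
    fix u assume u: "u \<in> nodes g"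
    have "v \<in> nodes g \<and> 0 \<le> 0 - (weight g u v - (W + 1)) - 1" if "v \<in> succs g u" for v
      using W'[OF u that] by auto
    then show "if is_row u then \<forall>v\<in>succs g u. v \<in> nodes g \<and> 0 \<le> 0 - (weight g u v - (W + 1)) - 1
      else \<exists>v\<in>succs g u. v \<in> nodes g \<and> 0 \<le> 0 - (weight g u v - (W + 1)) - 1"
      using succs_ne[OF G u] by auto
  qed simp_all
  from upper_value_le[OF G this s] have 2: "upper_value g s \<le> ereal W" by simp
  have "\<bar>lower_value g s\<bar> \<noteq> \<infinity>" using 1 2 eq by auto
  then obtain v where "lower_value g s = ereal v" by auto
  then show ?thesis using eq by (auto simp: has_value_def)
qed

text \<open>From here on games enter only through strict potentials; strategies and limits do not
  appear again.\<close>

theorem winning_iff_no_min_potential: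
  assumes G: "mean_payoff_game g" and s: "s \<in> nodes g"
  shows "winning g s \<longleftrightarrow> \<not> (\<exists>d U p. s \<in> U \<and> min_potential g 0 d U p)"
proof -
  obtain v where v: "has_value g s v" using mean_payoff_value_exists[OF assms] by blast
  then have w: "winning g s \<longleftrightarrow> 0 \<le> v" by (auto simp: winning_def has_value_def)
  show ?thesis
  proof
    assume "winning g s"
    show "\<not> (\<exists>d U p. s \<in> U \<and> min_potential g 0 d U p)"
    proof
      assume "\<exists>d U p. s \<in> U \<and> min_potential g 0 d U p"
      then obtain d U p where "s \<in> U" and pot: "min_potential g 0 d U p" by blast
      then have "ereal v \<le> ereal (0 - d)" using upper_value_le[OF G] v by (metis has_value_def)
      then show False using pot w \<open>winning g s\<close> by (simp add: min_potential_def)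
    qed
  next
    assume "\<not> (\<exists>d U p. s \<in> U \<and> min_potential g 0 d U p)"
    then obtain Y y where "s \<in> Y" "max_potential g 0 Y y" using potential_dichotomy[OF assms, of 0] by blast
    then have "ereal 0 \<le> ereal v" using lower_value_ge[OF G] v by (metis has_value_def)
    then show "winning g s" using w by simp
  qed
qed

section \<open>Encodings\<close>

subsection \<open>Binary numbers\<close>

lemma binary_0 [simp]: "binary 0 = []"
  by (simp add: binary.simps)

lemma binary_double: "0 < n \<Longrightarrow> binary (2 * n) = Dig0 # binary n"
  by (subst binary.simps) auto

lemma binary_double_Suc: "binary (Suc (2 * n)) = Dig1 # binary n"
  by (subst binary.simps) auto

lemma binary_eq_Nil [simp]: "binary n = [] \<longleftrightarrow> n = 0"
  by (subst binary.simps) auto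

lemma binary_scale: "0 < n \<Longrightarrow> binary (2 ^ k * n) = replicate k Dig0 @ binary n"
proof (induction k)
  case (Suc k)
  have "binary (2 ^ Suc k * n) = binary (2 * (2 ^ k * n))" by (simp add: mult.assoc)
  then show ?case using Suc by (simp add: binary_double)
qed simp

lemma binary_scale_ones: "binary (2 ^ k * n + (2 ^ k - 1)) = replicate k Dig1 @ binary n"
proof (induction k)
  case (Suc k)
  have "1 \<le> q \<Longrightarrow> 2 * p + (2 * q - 1) = Suc (2 * (p + (q - 1)))" for p q :: nat by arith
  then have "2 ^ Suc k * n + (2 ^ Suc k - 1) = Suc (2 * (2 ^ k * n + (2 ^ k - 1)))"
    unfolding power_Suc mult.assoc by simp
  then show ?case using Suc by (simp only: binary_double_Suc) simp
qed simp

fun pred_word :: "symbol list \<Rightarrow> symbol list" where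
  "pred_word (Dig0 # u) = Dig1 # pred_word u"
| "pred_word (Dig1 # u) = (if u = [] then [] else Dig0 # u)"
| "pred_word u = u"

lemma pred_word_binary: "0 < n \<Longrightarrow> pred_word (binary n) = binary (n - 1)"
proof (induction n rule: less_induct)
  case (less n)
  show ?case
  proof (cases "even n")
    case True
    then obtain m where m: "n = 2 * m" "0 < m" using less.prems by auto
    then have "n - 1 = Suc (2 * (m - 1))" by simp
    then show ?thesis using less.IH[of m] m by (simp add: binary_double binary_double_Suc)
  next
    case False
    then obtain m where "n = Suc (2 * m)" by (auto elim: oddE)
    then show ?thesis by (simp add: binary_double binary_double_Suc)
  qed
qed

definition digits :: "symbol set" where
  "digits = {Dig0, Dig1}"

text \<open>The most significant digit comes last and must be one; this is the condition that
  \<open>scan_digits\<close> can test while reading.\<close>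

lemma range_binary: "u \<in> range binary \<longleftrightarrow> set u \<subseteq> digits \<and> (u \<noteq> [] \<longrightarrow> last u = Dig1)"
proof
  have "set (binary n) \<subseteq> digits \<and> (binary n \<noteq> [] \<longrightarrow> last (binary n) = Dig1)" for n
  proof (induction n rule: less_induct)
    case (less n)
    show ?case
    proof (cases "n = 0")
      case False
      then have "binary n = (if odd n then Dig1 else Dig0) # binary (n div 2)"
        by (subst binary.simps) simp
      moreover have "odd n" if "n div 2 = 0" using that False by presburger
      ultimately show ?thesis using less[of "n div 2"] False by (auto simp: digits_def)
    qed simp
  qed
  then show "u \<in> range binary \<Longrightarrow> set u \<subseteq> digits \<and> (u \<noteq> [] \<longrightarrow> last u = Dig1)" by blast
next
  assume "set u \<subseteq> digits \<and> (u \<noteq> [] \<longrightarrow> last u = Dig1)"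
  then show "u \<in> range binary"
  proof (induction u)
    case Nil
    show ?case by (rule image_eqI[of _ _ 0]) auto
  next
    case (Cons c u)
    then have "u \<in> range binary" by (cases u) auto
    then obtain n where n: "u = binary n" by auto
    show ?case
    proof (cases "c = Dig1")
      case True
      then show ?thesis using n binary_double_Suc[of n] by (metis rangeI)
    next
      case False
      then have "c = Dig0" "u \<noteq> []" using Cons by (auto simp: digits_def)
      then show ?thesis using n binary_double[of n] by (metis binary_eq_Nil neq0_conv rangeI)
    qed
  qed
qed

lemma binary_inj: "binary m = binary n \<Longrightarrow> m = n"
proof (induction m arbitrary: n rule: less_induct)
  case (less m)
  show ?case
  proof (cases "m = 0 \<or> n = 0")
    case True
    then show ?thesis using less.prems binary_eq_Nil by metis
  next
    case False
    have b: "binary k = (if odd k then Dig1 else Dig0) # binary (k div 2)" if "k \<noteq> 0" for k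
      using that by (subst binary.simps) simp
    have "binary (m div 2) = binary (n div 2)" "odd m = odd n"
      using less.prems b[of m] b[of n] False by (auto split: if_splits)
    then have "m div 2 = n div 2" "odd m = odd n" using less.IH[of "m div 2"] False by auto
    then show ?thesis by presburger
  qed
qed

lemma encode_int_cases:
  "encode_int z = (if z < 0 then NegSign # binary (nat (- z)) @ [EndNum] else binary (nat z) @ [EndNum])"
  by (simp add: encode_int_def)

lemma digits_binary: "set (binary n) \<subseteq> digits"
  using range_binary by blast

subsection \<open>Unique readability\<close>

text \<open>Injectivity and prefix-freeness in a single notion. The remainders let it pass through
  concatenations.\<close>

definition uniquely_readable :: "'b set \<Rightarrow> ('b \<Rightarrow> symbol list) \<Rightarrow> bool" where
  "uniquely_readable X e \<longleftrightarrow>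
     (\<forall>x\<in>X. \<forall>y\<in>X. \<forall>r r'. e x @ r = e y @ r' \<longrightarrow> x = y \<and> r = r')"

definition prefix_free :: "symbol list set \<Rightarrow> bool" where
  "prefix_free A \<longleftrightarrow> (\<forall>u\<in>A. \<forall>v\<in>A. \<forall>r r'. u @ r = v @ r' \<longrightarrow> u = v)"

lemma uniquely_readableD:
  "uniquely_readable X e \<Longrightarrow> e x @ r = e y @ r' \<Longrightarrow> x \<in> X \<Longrightarrow> y \<in> X \<Longrightarrow> x = y \<and> r = r'"
  unfolding uniquely_readable_def by blast

lemma prefix_free_image: "uniquely_readable X e \<Longrightarrow> prefix_free (e ` X)"
  unfolding prefix_free_def uniquely_readable_def by blast

lemma uniquely_readable_subset: "uniquely_readable X e \<Longrightarrow> Y \<subseteq> X \<Longrightarrow> uniquely_readable Y e"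
  unfolding uniquely_readable_def by blast

lemma terminated_unique:
  "u @ c # r = v @ c # r' \<Longrightarrow> c \<notin> set u \<Longrightarrow> c \<notin> set v \<Longrightarrow> u = v \<and> r = r'"
  by (induction u arbitrary: v) (auto simp: Cons_eq_append_conv)

lemma EndNum_binary: "EndNum \<notin> set (binary n)" "NegSign \<notin> set (binary n)"
  using digits_binary[of n] by (auto simp: digits_def)

lemma readable_int: "uniquely_readable UNIV encode_int"
  unfolding uniquely_readable_def
proof (intro ballI allI impI)
  fix x y r r' assume *: "encode_int x @ r = encode_int y @ r'"
  have e: "encode_int z = ((if z < 0 then [NegSign] else []) @ binary (nat \<bar>z\<bar>)) @ [EndNum]" for z
    by (simp add: encode_int_def)
  have eq: "(if x < 0 then [NegSign] else []) @ binary (nat \<bar>x\<bar>) =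
      (if y < 0 then [NegSign] else []) @ binary (nat \<bar>y\<bar>) \<and> r = r'"
    by (rule terminated_unique[of _ EndNum]) (use * EndNum_binary in \<open>auto simp: encode_int_def\<close>)
  have "binary m \<noteq> NegSign # u" for m u
    using EndNum_binary(2)[of m] by (metis list.set_intros(1))
  note nb = this
  have "(x < 0) = (y < 0) \<and> binary (nat \<bar>x\<bar>) = binary (nat \<bar>y\<bar>) \<and> r = r'"
    using eq by (cases "x < 0"; cases "y < 0") (simp_all add: nb nb[symmetric])
  then show "x = y \<and> r = r'" using binary_inj[of "nat \<bar>x\<bar>" "nat \<bar>y\<bar>"] by auto
qed

text \<open>Instances contain only integers and flags; with this type the programs and the
  combinatorics are kept apart from \<open>ereal\<close>.\<close>

type_synonym coef = "(int \<times> bool) option"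

text \<open>Coefficients with integer modulus; the flag marks the elements of the copy of the reals.\<close>

fun coeff :: "coef \<Rightarrow> mixed" where
  "coeff None = Plain (-\<infinity>)"
| "coeff (Some (z, False)) = Plain (ereal (of_int z))"
| "coeff (Some (z, True)) = Minus (of_int z)"

fun encode_coef :: "coef \<Rightarrow> symbol list" where
  "encode_coef None = [Bot]"
| "encode_coef (Some (z, False)) = encode_int z"
| "encode_coef (Some (z, True)) = MinusMark # encode_int z"

lemma encode_coeff_coeff [simp]: "encode_coeff (coeff c) = encode_coef c"
  by (cases c rule: coeff.cases) auto

lemma hd_encode_int: "\<exists>c u. encode_int z = c # u \<and> c \<in> {Dig0, Dig1, NegSign, EndNum}"
proof (cases "z < 0 \<or> z = 0")
  case False
  then have "binary (nat z) \<noteq> []" by simp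
  then obtain c u where "binary (nat z) = c # u" by (cases "binary (nat z)") auto
  then show ?thesis using digits_binary[of "nat z"] False by (auto simp: encode_int_cases digits_def)
qed (auto simp: encode_int_cases)

lemma hd_encode_coef: "\<exists>c' u. encode_coef c = c' # u \<and> c' \<notin> {OpenList, CloseList}"
proof (cases c rule: coeff.cases)
  case (2 z)
  then show ?thesis using hd_encode_int[of z] by auto
qed auto

lemma hd_encode_arc: "\<exists>c' u. encode_arc c = c' # u \<and> c' \<notin> {OpenList, CloseList}"
proof (cases c)
  case (Some z)
  then show ?thesis using hd_encode_int[of z] by auto
qed simp

lemma readable_coef: "uniquely_readable UNIV encode_coef"
  unfolding uniquely_readable_def
proof (intro ballI allI impI)
  fix x y r r' assume *: "encode_coef x @ r = encode_coef y @ r'"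
  have n: "encode_int z @ r \<noteq> Bot # r'" "encode_int z @ r \<noteq> MinusMark # r'" for z r r'
    using hd_encode_int[of z] by auto
  show "x = y \<and> r = r'"
    using *
    by (cases x rule: coeff.cases; cases y rule: coeff.cases)
      (auto simp: n n[symmetric] dest: uniquely_readableD[OF readable_int])
qed

lemma readable_arc: "uniquely_readable UNIV encode_arc"
  unfolding uniquely_readable_def
proof (intro ballI allI impI)
  fix x y r r' assume *: "encode_arc x @ r = encode_arc y @ r'"
  have n: "encode_int z @ r \<noteq> Bot # r'" for z r r'
    using hd_encode_int[of z] by auto
  show "x = y \<and> r = r'"
    using *
    by (cases x rule: encode_arc.cases; cases y rule: encode_arc.cases)
      (auto simp: n n[symmetric] dest: uniquely_readableD[OF readable_int])
qed

text \<open>The list needs no length prefix because the first symbol of an item already differs from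
  the closing bracket.\<close>

lemma readable_list:
  assumes "uniquely_readable X e" "\<And>x. x \<in> X \<Longrightarrow> \<exists>c u. e x = c # u \<and> c \<noteq> CloseList"
  shows "uniquely_readable {xs. set xs \<subseteq> X} (encode_list e)"
proof -
  have "xs = ys \<and> r = r'"
    if "concat (map e xs) @ CloseList # r = concat (map e ys) @ CloseList # r'"
      "set xs \<subseteq> X" "set ys \<subseteq> X" for xs ys r r'
    using that
  proof (induction xs arbitrary: ys)
    case Nil
    show ?case
    proof (cases ys)
      case (Cons y ys')
      then obtain c u where "e y = c # u" "c \<noteq> CloseList" using assms(2)[of y] Nil by auto
      then show ?thesis using Nil Cons by simp
    qed (use Nil in simp)
  next
    case (Cons x xs)
    obtain c u where x: "e x = c # u" "c \<noteq> CloseList" using assms(2)[of x] Cons.prems by auto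
    then obtain y ys' where ys: "ys = y # ys'" using Cons.prems(1) by (cases ys) auto
    have "e x @ concat (map e xs) @ CloseList # r = e y @ concat (map e ys') @ CloseList # r'"
      using Cons.prems(1) ys by simp
    from uniquely_readableD[OF assms(1) this]
    have "x = y \<and> concat (map e xs) @ CloseList # r = concat (map e ys') @ CloseList # r'"
      using Cons.prems ys by simp
    then show ?case using Cons ys by simp
  qed
  then show ?thesis by (auto simp: uniquely_readable_def encode_list_def)
qed

lemma readable_list_UNIV:
  assumes "uniquely_readable UNIV e" "\<forall>x. \<exists>c u. e x = c # u \<and> c \<noteq> CloseList"
  shows "uniquely_readable UNIV (encode_list e)"
  using readable_list[of UNIV e] assms by simp

lemma readable_pair:
  assumes "uniquely_readable X e" "uniquely_readable Y e'"
  shows "uniquely_readable (X \<times> Y) (\<lambda>(x, y). e x @ e' y)"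
  unfolding uniquely_readable_def[of "X \<times> Y"]
proof (intro ballI allI impI)
  fix p q r r'
  assume pq: "p \<in> X \<times> Y" "q \<in> X \<times> Y"
    and 0: "(\<lambda>(x, y). e x @ e' y) p @ r = (\<lambda>(x, y). e x @ e' y) q @ r'"
  obtain x y x' y' where p: "p = (x, y)" "q = (x', y')" by fastforce
  then have X: "x \<in> X" "x' \<in> X" and Y: "y \<in> Y" "y' \<in> Y"
    and eq: "e x @ e' y @ r = e x' @ e' y' @ r'" using pq 0 by auto
  from uniquely_readableD[OF assms(1) eq X] have "x = x'" and eq': "e' y @ r = e' y' @ r'" by auto
  with uniquely_readableD[OF assms(2) eq' Y] show "p = q \<and> r = r'" using p by blast
qed

lemma readable_size: "uniquely_readable UNIV encode_size"
  unfolding uniquely_readable_def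
proof (intro ballI allI impI)
  fix x y r r' assume "encode_size x @ r = encode_size y @ r'"
  then have "replicate x Dig1 = replicate y Dig1 \<and> r = r'"
    by (intro terminated_unique[of _ EndNum]) (auto simp: encode_size_def)
  then show "x = y \<and> r = r'" by (metis length_replicate)
qed

lemma readable_node: "uniquely_readable UNIV encode_node"
  unfolding uniquely_readable_def
proof (intro ballI allI impI)
  fix x y r r' assume "encode_node x @ r = encode_node y @ r'"
  then show "x = y \<and> r = r'"
    by (cases x; cases y) (auto dest: uniquely_readableD[OF readable_size])
qed

definition encode_ineq :: "coef list \<times> coef list \<Rightarrow> symbol list" where
  "encode_ineq = (\<lambda>(A, B). encode_list encode_coef A @ encode_list encode_coef B)"

definition inequality_of :: "coef list \<times> coef list \<Rightarrow> inequality" where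
  "inequality_of = (\<lambda>(A, B). (map coeff A, map coeff B))"

lemma encode_inequality_of [simp]: "encode_inequality (inequality_of q) = encode_ineq q"
  by (cases q) (simp add: inequality_of_def encode_ineq_def encode_inequality_def encode_list_def comp_def)

lemma readable_coef_list: "uniquely_readable UNIV (encode_list encode_coef)"
proof -
  have "\<forall>x. \<exists>c u. encode_coef x = c # u \<and> c \<noteq> CloseList" using hd_encode_coef by fastforce
  from readable_list_UNIV[OF readable_coef this] show ?thesis .
qed

lemma readable_ineq: "uniquely_readable UNIV encode_ineq"
  using readable_pair[OF readable_coef_list readable_coef_list] by (simp add: encode_ineq_def)

lemma hd_encode_list: "encode_list e xs = OpenList # concat (map e xs) @ [CloseList]"
  by (simp add: encode_list_def)

lemma readable_ineq_list: "uniquely_readable UNIV (encode_list encode_ineq)"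
proof -
  have "\<forall>q. \<exists>c u. encode_ineq q = c # u \<and> c \<noteq> CloseList"
    by (simp add: encode_ineq_def encode_list_def split: prod.splits)
  from readable_list_UNIV[OF readable_ineq this] show ?thesis .
qed

lemma readable_arc_lists: "uniquely_readable UNIV (encode_list (encode_list encode_arc))"
proof -
  have 1: "uniquely_readable UNIV (encode_list encode_arc)"
  proof -
    have "\<forall>x. \<exists>c u. encode_arc x = c # u \<and> c \<noteq> CloseList" using hd_encode_arc by fastforce
    from readable_list_UNIV[OF readable_arc this] show ?thesis .
  qed
  have "\<forall>q. \<exists>c u. encode_list encode_arc q = c # u \<and> c \<noteq> CloseList"
    by (simp add: encode_list_def)
  from readable_list_UNIV[OF 1 this] show ?thesis .
qed

lemma encode_game_inj:
  assumes "encode_game g @ encode_node s = encode_game g' @ encode_node s'"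
  shows "g = g' \<and> s = s'"
proof -
  let ?e = "encode_list (encode_list encode_arc)"
  have 0: "?e (row_arcs g) @ ?e (col_arcs g) @ encode_node s =
      ?e (row_arcs g') @ ?e (col_arcs g') @ encode_node s'"
    using assms by (simp add: encode_game_def)
  from uniquely_readableD[OF readable_arc_lists 0] have "row_arcs g = row_arcs g'"
    and 1: "?e (col_arcs g) @ encode_node s = ?e (col_arcs g') @ encode_node s'" by auto
  moreover from uniquely_readableD[OF readable_arc_lists 1] have "col_arcs g = col_arcs g'"
    and 2: "encode_node s = encode_node s'" by auto
  ultimately have "g = g'" by simp
  moreover from uniquely_readableD[OF readable_node, of s "[]" s' "[]"] 2 have "s = s'" by simp
  ultimately show ?thesis by simp
qed

subsection \<open>Admissible inequalities\<close>

fun is_plain :: "coef \<Rightarrow> bool" where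
  "is_plain (Some (z, True)) = False"
| "is_plain _ = True"

definition proper :: "nat \<Rightarrow> coef list \<times> coef list \<Rightarrow> bool" where
  "proper n q \<longleftrightarrow> length (fst q) = n + 1 \<and> length (snd q) = n + 1 \<and> (\<forall>c\<in>set (fst q). is_plain c)"

lemma admissible_inequality_of: "proper n q \<Longrightarrow> admissible n (inequality_of q)"
proof -
  assume "proper n q"
  moreover have "is_plain c \<Longrightarrow> coeff c \<in> Rmax" for c
    by (cases c rule: coeff.cases) (auto simp: Rmax_def)
  moreover have "Plain \<infinity> \<noteq> coeff c" for c by (cases c rule: coeff.cases) auto
  moreover have "coeff c \<noteq> Plain (-\<infinity>) \<Longrightarrow> modulus (coeff c) \<in> ereal ` \<int>" for c
    by (cases c rule: coeff.cases) auto
  ultimately show "admissible n (inequality_of q)"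
    by (auto simp: admissible_def mixed_inequality_def no_top_rhs_def integer_moduli_def
        proper_def inequality_of_def split: prod.splits)
qed

text \<open>Together with \<open>admissible_inequality_of\<close> this identifies the admissible
  inequalities with the images of the \<open>proper\<close> ones, so the decision problems can be
  restated over \<open>coef\<close>.\<close>

lemma admissible_cases:
  assumes "admissible n q"
  obtains q' where "q = inequality_of q'" "proper n q'"
proof -
  have *: "\<exists>c'. c = coeff c' \<and> (c \<in> Rmax \<longrightarrow> is_plain c')"
    if c: "c \<noteq> Plain \<infinity>" "c \<noteq> Plain (-\<infinity>) \<Longrightarrow> modulus c \<in> ereal ` \<int>" for c
  proof (cases c)
    case (Plain e)
    show ?thesis
    proof (cases "e = -\<infinity>")
      case True
      then show ?thesis using Plain by (intro exI[of _ None]) auto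
    next
      case False
      then obtain z where "e = ereal (of_int z)" using c Plain by (auto elim: Ints_cases)
      then show ?thesis using Plain by (intro exI[of _ "Some (z, False)"]) auto
    qed
  next
    case (Minus r)
    then obtain z where "r = of_int z" using c Minus by (auto elim: Ints_cases)
    then show ?thesis using Minus by (intro exI[of _ "Some (z, True)"]) (auto simp: Rmax_def)
  qed
  have "\<forall>c\<in>set (fst q) \<union> set (snd q). \<exists>c'. c = coeff c' \<and> (c \<in> Rmax \<longrightarrow> is_plain c')"
    using assms by (intro ballI *)
      (auto simp: admissible_def integer_moduli_def no_top_rhs_def mixed_inequality_def Rmax_def)
  then obtain f where f: "\<And>c. c \<in> set (fst q) \<union> set (snd q) \<Longrightarrow> c = coeff (f c) \<and> (c \<in> Rmax \<longrightarrow> is_plain (f c))"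
    by metis
  show ?thesis
  proof (rule that[of "(map f (fst q), map f (snd q))"])
    show "q = inequality_of (map f (fst q), map f (snd q))"
      using f by (cases q) (auto simp: inequality_of_def comp_def intro!: map_idI[symmetric])
    show "proper n (map f (fst q), map f (snd q))"
      using f assms by (auto simp: proper_def admissible_def mixed_inequality_def)
  qed
qed

lemma admissible_system:
  "(\<forall>p\<in>set S. admissible n p) \<longleftrightarrow> (\<exists>S'. S = map inequality_of S' \<and> (\<forall>p\<in>set S'. proper n p))"
proof
  assume *: "\<forall>p\<in>set S. admissible n p"
  then have "\<forall>p\<in>set S. \<exists>p'. p = inequality_of p' \<and> proper n p'" by (metis admissible_cases)
  then obtain f where "\<And>p. p \<in> set S \<Longrightarrow> p = inequality_of (f p) \<and> proper n (f p)" by metis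
  then show "\<exists>S'. S = map inequality_of S' \<and> (\<forall>p\<in>set S'. proper n p)"
    by (intro exI[of _ "map f S"]) (auto simp: comp_def intro!: map_idI[symmetric])
next
  assume "\<exists>S'. S = map inequality_of S' \<and> (\<forall>p\<in>set S'. proper n p)"
  then show "\<forall>p\<in>set S. admissible n p" using admissible_inequality_of by fastforce
qed

lemma encode_system_of: "encode_system n (map inequality_of S) = encode_size n @ encode_list encode_ineq S"
  by (simp add: encode_system_def encode_list_def comp_def)

text \<open>Membership of a word in the language asks for some instance with this encoding; unique
  readability makes that instance the given one.\<close>

lemma EMPTINESS_iff:
  assumes "\<forall>p\<in>set S. proper n p"
  shows "encode_size n @ encode_list encode_ineq S \<in> EMPTINESS \<longleftrightarrow> polyhedron n (map inequality_of S) = {}"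
proof
  assume "encode_size n @ encode_list encode_ineq S \<in> EMPTINESS"
  then obtain n' S' where *: "encode_size n @ encode_list encode_ineq S = encode_system n' (map inequality_of S')"
    "polyhedron n' (map inequality_of S') = {}"
    unfolding EMPTINESS_def admissible_system by blast
  have "n = n' \<and> encode_list encode_ineq S = encode_list encode_ineq S'"
    using uniquely_readableD[OF readable_size *(1)[unfolded encode_system_of]] by simp
  then have "n = n'" "S = S'"
    using uniquely_readableD[OF readable_ineq_list, of S "[]" S' "[]"] by auto
  then show "polyhedron n (map inequality_of S) = {}" using * by simp
next
  assume "polyhedron n (map inequality_of S) = {}"
  then show "encode_size n @ encode_list encode_ineq S \<in> EMPTINESS"
    using assms encode_system_of[of n S, symmetric] unfolding EMPTINESS_def admissible_system by blast
qed

lemma IMPLICATION_iff: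
  assumes "\<forall>p\<in>set S. proper n p" "proper n q"
  shows "encode_size n @ encode_list encode_ineq S @ encode_ineq q \<in> IMPLICATION \<longleftrightarrow>
    implied_by n (map inequality_of S) (inequality_of q)"
proof
  assume "encode_size n @ encode_list encode_ineq S @ encode_ineq q \<in> IMPLICATION"
  then obtain n' S' q0 where *: "encode_size n @ encode_list encode_ineq S @ encode_ineq q =
      encode_system n' (map inequality_of S') @ encode_inequality q0"
    "implied_by n' (map inequality_of S') q0" "admissible n' q0"
    unfolding IMPLICATION_def admissible_system by blast
  obtain q' where q': "q0 = inequality_of q'" using admissible_cases[OF *(3)] by blast
  have 1: "n = n' \<and> encode_list encode_ineq S @ encode_ineq q = encode_list encode_ineq S' @ encode_ineq q'"
    using uniquely_readableD[OF readable_size, of n _ n'] *(1) q' by (simp add: encode_system_of)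
  then have 2: "S = S' \<and> encode_ineq q = encode_ineq q'"
    using uniquely_readableD[OF readable_ineq_list, of S _ S'] by auto
  then have "q = q'" using uniquely_readableD[OF readable_ineq, of q "[]" q' "[]"] by auto
  then show "implied_by n (map inequality_of S) (inequality_of q)" using * 1 2 q' by simp
next
  assume "implied_by n (map inequality_of S) (inequality_of q)"
  then show "encode_size n @ encode_list encode_ineq S @ encode_ineq q \<in> IMPLICATION"
    unfolding IMPLICATION_def admissible_system
    using assms admissible_inequality_of[OF assms(2)]
    by (intro CollectI exI[of _ n] exI[of _ "map inequality_of S"] exI[of _ "inequality_of q"])
      (auto simp: encode_system_of)
qed

lemma MEAN_PAYOFF_iff:
  assumes "mean_payoff_game g" "s \<in> nodes g"
  shows "encode_game g @ encode_node s \<in> MEAN_PAYOFF \<longleftrightarrow> winning g s"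
  using assms encode_game_inj unfolding MEAN_PAYOFF_def by blast

text \<open>The empty word, which is the output of an aborted run, is a no-instance of each of the
  three problems.\<close>

lemma Nil_not_instance: "[] \<notin> IMPLICATION" "[] \<notin> EMPTINESS" "[] \<notin> MEAN_PAYOFF"
  by (auto simp: IMPLICATION_def EMPTINESS_def MEAN_PAYOFF_def encode_system_def encode_size_def
      encode_game_def encode_list_def)

section \<open>From emptiness to implication\<close>

abbreviation put :: "nat \<Rightarrow> 'a \<Rightarrow> 'a com" where
  "put j c \<equiv> Push j (\<lambda>_. c)"

text \<open>The inequality between the unit and the zero of the semiring, which fails at every
  point.\<close>

definition never :: "nat \<Rightarrow> coef list \<times> coef list" where
  "never n = (Some (0, False) # replicate n None, None # replicate n None)"

text \<open>The input is not parsed: \<open>never\<close> is appended to any word, in the dimension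
  given by its leading unary block. That non-instances stay non-instances is the content of
  \<open>encode_ineq_suffix\<close>.\<close>

definition append_never :: "symbol com" where
  "append_never =
     Loop (\<lambda>t. t 0 = Some Dig1) (put 3 Dig1 ;; put 8 Dig1 ;; Pop 0) ;; transfer 0 8 ;;
     put 8 OpenList ;; put 8 EndNum ;; fill 3 4 8 Bot ;; put 8 CloseList ;;
     put 8 OpenList ;; put 8 Bot ;; fill 3 4 8 Bot ;; put 8 CloseList ;;
     clear 3 ;; transfer 8 0"

lemma takeWhile_eq_replicate: "takeWhile (\<lambda>x. x = c) w = replicate (length (takeWhile (\<lambda>x. x = c) w)) c"
  by (induction w) auto

lemma sem_append_never:
  fixes w :: "symbol list"
  defines "n \<equiv> length (takeWhile (\<lambda>c. c = Dig1) w)"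
  assumes B: "3 * length w + 10 \<le> B"
  shows "sem B append_never (input w) = Done (input (w @ encode_ineq (never n)))"
proof -
  let ?d = "dropWhile (\<lambda>c. c = Dig1) w"
  have n: "n \<le> length w" unfolding n_def by (rule length_takeWhile_le)
  have w: "w = replicate n Dig1 @ ?d"
    unfolding n_def takeWhile_eq_replicate[symmetric] by simp
  have len: "length w = n + length ?d" using arg_cong[OF w, of length] by simp
  have fold: "fold (\<lambda>x s. s(3 := Dig1 # s 3, 8 := Dig1 # s 8)) (replicate k ()) s =
      s(3 := replicate k Dig1 @ s 3, 8 := replicate k Dig1 @ s 8)" for k and s :: "symbol stacks"
    by (induction k arbitrary: s) (auto simp: fun_eq_iff replicate_app_Cons)
  have cc: "concat (map (\<lambda>_. [Dig1]) (replicate k ())) = replicate k Dig1" for k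
    by (induction k) auto
  have "sem B (Loop (\<lambda>t. t 0 = Some Dig1) (put 3 Dig1 ;; put 8 Dig1 ;; Pop 0)) (input w) =
      Done ((fold (\<lambda>x s. s(3 := Dig1 # s 3, 8 := Dig1 # s 8)) (replicate n ()) (input w))(0 := ?d))"
    unfolding sem.simps
  proof (rule iterate_items[where P = "\<lambda>_. True" and e = "\<lambda>_. [Dig1]"])
    show "\<not> tops (s(0 := ?d)) 0 = Some Dig1" for s
      by (auto split: list.splits dest: hd_dropWhile[of "\<lambda>c. c = Dig1" w, simplified])
        (metis (full_types) hd_dropWhile list.sel(1) list.simps(3))
    show "input w 0 = concat (map (\<lambda>_. [Dig1]) (replicate n ())) @ ?d"
      using w by (simp add: cc input_def)
  qed (use B n in \<open>auto simp: fun_eq_iff\<close>)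
  also have "(fold (\<lambda>x s. s(3 := Dig1 # s 3, 8 := Dig1 # s 8)) (replicate n ()) (input w))(0 := ?d) =
      (input ?d)(3 := replicate n Dig1, 8 := replicate n Dig1)"
    unfolding fold by (simp add: input_def fun_eq_iff)
  finally have 1: "sem B (Loop (\<lambda>t. t 0 = Some Dig1) (put 3 Dig1 ;; put 8 Dig1 ;; Pop 0)) (input w) = Done \<dots>" .
  have cm: "concat (map encode_coef (replicate n None)) = replicate n Bot"
    by (induction n) auto
  have "rev ?d @ replicate n Dig1 = rev (replicate n Dig1 @ ?d)" by simp
  also have "\<dots> = rev w" using w by simp
  finally have rw: "rev ?d @ replicate n Dig1 @ r = rev w @ r" for r by (metis append.assoc)
  show ?thesis unfolding append_never_def sem.simps(6) 1 and_then.simps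
    using B n len
    by (simp add: sem_transfer sem_fill sem_clear input_def never_def encode_ineq_def encode_list_def
        cm encode_int_def rw w[symmetric] fun_eq_iff)
qed

lemma OpenList_not_in: "OpenList \<notin> set (concat (map encode_coef A))"
proof -
  have "OpenList \<notin> set (encode_int z)" for z
    using digits_binary[of "nat \<bar>z\<bar>"] by (auto simp: encode_int_def digits_def)
  then have "OpenList \<notin> set (encode_coef c)" for c by (cases c rule: coeff.cases) auto
  then show ?thesis by auto
qed

text \<open>Read from the right: an encoded inequality contains \<open>OpenList\<close> exactly
  twice, so it can also be split off uniquely as a suffix.\<close>

lemma encode_ineq_suffix:
  assumes "u @ encode_ineq p = v @ encode_ineq q"
  shows "u = v \<and> p = q"
proof -
  obtain A B A' B' where pq: "p = (A, B)" "q = (A', B')" by (cases p; cases q) auto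
  define m where "m A = rev (concat (map encode_coef A))" for A
  have m: "OpenList \<notin> set (m A)" for A using OpenList_not_in[of A] by (simp add: m_def)
  have "rev (u @ encode_ineq p) = rev (v @ encode_ineq q)" using assms by simp
  then have 1: "m B @ OpenList # CloseList # m A @ OpenList # rev u =
      m B' @ OpenList # CloseList # m A' @ OpenList # rev v"
    by (simp add: pq encode_ineq_def encode_list_def m_def)
  from terminated_unique[OF 1 m m] have "m A @ OpenList # rev u = m A' @ OpenList # rev v" by simp
  from terminated_unique[OF this m m] have "u = v" by simp
  moreover from this assms have "encode_ineq p @ [] = encode_ineq q @ []" by simp
  from uniquely_readableD[OF readable_ineq this] have "p = q" by simp
  ultimately show ?thesis by simp
qed

lemma coeff_None: "coeff None = 0"
  by (simp add: zero_mixed_def)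

lemma never_not_satisfied:
  assumes "x \<in> points n"
  shows "\<not> satisfies x (inequality_of (never n))"
proof -
  have n: "length x = n" using assms by (simp add: points_def)
  have 1: "affine_form (coeff (Some (0, False)) # replicate n 0) x = 1"
    "affine_form (0 # replicate n 0) x = 0"
    using n by (simp_all add: affine_form_def one_mixed_def sum.neutral)
  have "\<not> (1::mixed) \<le> 0" by (simp add: one_mixed_def zero_mixed_def)
  then show ?thesis using 1
    by (simp add: satisfies_def inequality_of_def never_def coeff_None del: coeff.simps)
qed

theorem emptiness_reducible_to_implication: "stack_reducible EMPTINESS IMPLICATION"
proof -
  define n where "n w = length (takeWhile (\<lambda>c. c = Dig1) w)" for w
  have n: "n (encode_size m @ r) = m" for m r
    by (simp add: n_def encode_size_def takeWhile_append)
  have pn: "proper m (never m)" for m by (auto simp: proper_def never_def)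
  have vac: "implied_by m (map inequality_of S) (inequality_of (never m)) \<longleftrightarrow>
      polyhedron m (map inequality_of S) = {}" for m S
    using never_not_satisfied[of _ m] by (auto simp: implied_by_def polyhedron_def)
  have iff: "w \<in> EMPTINESS \<longleftrightarrow> w @ encode_ineq (never (n w)) \<in> IMPLICATION" for w
  proof
    assume "w \<in> EMPTINESS"
    then obtain m S where w: "w = encode_size m @ encode_list encode_ineq S" and S: "\<forall>p\<in>set S. proper m p"
      unfolding EMPTINESS_def admissible_system by (auto simp: encode_system_of)
    then show "w @ encode_ineq (never (n w)) \<in> IMPLICATION"
      using \<open>w \<in> EMPTINESS\<close> IMPLICATION_iff[OF S pn] EMPTINESS_iff[OF S] vac by (simp add: n)
  next
    assume "w @ encode_ineq (never (n w)) \<in> IMPLICATION"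
    then obtain m S q where eq: "w @ encode_ineq (never (n w)) = encode_system m S @ encode_inequality q"
      and S: "\<forall>p\<in>set S. admissible m p" and q: "admissible m q" and imp: "implied_by m S q"
      unfolding IMPLICATION_def by blast
    obtain q' where q': "q = inequality_of q'" using admissible_cases[OF q] by blast
    obtain S' where S': "S = map inequality_of S'" "\<forall>p\<in>set S'. proper m p"
      using S unfolding admissible_system by blast
    have w: "w = encode_size m @ encode_list encode_ineq S'" and "never (n w) = q'"
      using encode_ineq_suffix[of w "never (n w)" "encode_size m @ encode_list encode_ineq S'" q'] eq q' S'
      unfolding encode_system_of by (metis encode_inequality_of encode_system_of)+
    then have "never m = q'" by (simp add: n)
    then show "w \<in> EMPTINESS" using EMPTINESS_iff[OF S'(2)] imp vac[of m S'] w S' q' by simp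
  qed
  have "registers_below 10 append_never" by (simp add: append_never_def)
  moreover have "sem (poly [:10, 3:] (length w)) append_never (input w) =
      Done (input (w @ encode_ineq (never (n w))))" for w
    unfolding n_def by (rule sem_append_never) simp
  ultimately show ?thesis unfolding stack_reducible_def
    using iff by (intro exI[of _ append_never] exI[of _ 10] exI[of _ "[:10, 3:]"]) auto
qed

section \<open>Recognizing well-formed instances\<close>

abbreviation ones :: "nat \<Rightarrow> symbol list" where
  "ones k \<equiv> replicate k Dig1"

text \<open>A recognizer moves a word of its language from the input to register 9, or aborts. The
  languages may depend on two numbers kept in unary in registers 2 and 3.\<close>

definition advance :: "symbol list \<Rightarrow> symbol stacks \<Rightarrow> symbol stacks" where
  "advance u s = s(0 := drop (length u) (s 0), 9 := rev u @ s 9)"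

text \<open>\<open>Z\<close> collects the scratch registers that must be empty on entry. The last
  condition makes \<open>B\<close> large enough for every loop over the input or over one of the two
  counters.\<close>

definition ready :: "nat set \<Rightarrow> nat \<Rightarrow> nat \<Rightarrow> nat \<Rightarrow> symbol stacks \<Rightarrow> bool" where
  "ready Z a b B s \<longleftrightarrow> Z \<subseteq> {4..8} \<and> (\<forall>z\<in>Z. s z = []) \<and> s 1 = [] \<and> s 2 = ones a \<and> s 3 = ones b \<and>
     length (s 0) + a + b < B"

definition recognizes :: "nat set \<Rightarrow> symbol com \<Rightarrow> (nat \<Rightarrow> nat \<Rightarrow> symbol list set) \<Rightarrow> bool" where
  "recognizes Z P A \<longleftrightarrow> (\<forall>a b B s. ready Z a b B s \<longrightarrow>
     (\<exists>u\<in>A a b. \<exists>r. s 0 = u @ r \<and> sem B P s = Done (advance u s)) \<or>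
     (\<forall>u\<in>A a b. \<forall>r. s 0 \<noteq> u @ r) \<and> sem B P s = Aborted)"

definition catenate :: "symbol list set \<Rightarrow> symbol list set \<Rightarrow> symbol list set" (infixr \<open>\<star>\<close> 75) where
  "A \<star> A' = {u @ v | u v. u \<in> A \<and> v \<in> A'}"

lemma catenateI: "u \<in> A \<Longrightarrow> v \<in> A' \<Longrightarrow> u @ v \<in> A \<star> A'"
  by (auto simp: catenate_def)

primrec word_power :: "symbol list set \<Rightarrow> nat \<Rightarrow> symbol list set" where
  "word_power A 0 = {[]}"
| "word_power A (Suc k) = A \<star> word_power A k"

definition word_star :: "symbol list set \<Rightarrow> symbol list set" where
  "word_star A = {concat us | us. set us \<subseteq> A}"

definition shift :: "symbol com" where
  "shift = Push 9 (top_of 0) ;; Pop 0"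

definition expect :: "symbol set \<Rightarrow> symbol com" where
  "expect C = Cond (\<lambda>t. \<exists>c\<in>C. t 0 = Some c) shift Abort"

definition repeat :: "nat \<Rightarrow> nat \<Rightarrow> symbol com \<Rightarrow> symbol com" where
  "repeat i l P = copy i 6 l ;; Loop (\<lambda>t. t l \<noteq> None) (Pop l ;; P)"

definition until_close :: "symbol com \<Rightarrow> symbol com" where
  "until_close P = Loop (\<lambda>t. t 0 \<noteq> Some CloseList) P ;; expect {CloseList}"

section \<open>Combinators for recognizers: single symbols, sequence, choice, counted and terminated
  repetition\<close>

lemma advance_simps:
  "s 0 = u @ r \<Longrightarrow> advance u s 0 = r" "advance u s 9 = rev u @ s 9"
  "i \<noteq> 0 \<Longrightarrow> i \<noteq> 9 \<Longrightarrow> advance u s i = s i"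
  by (auto simp: advance_def)

lemma advance_append: "advance v (advance u s) = advance (u @ v) s"
  by (auto simp: advance_def fun_eq_iff add.commute)

lemma advance_upd: "i \<noteq> 0 \<Longrightarrow> i \<noteq> 9 \<Longrightarrow> advance u (s(i := l)) = (advance u s)(i := l)"
  by (auto simp: advance_def fun_eq_iff)

lemma advance_Nil: "advance [] s = s"
  by (auto simp: advance_def)

lemma sem_shift: "s 0 = c # r \<Longrightarrow> sem B shift s = Done (advance [c] s)"
  by (auto simp: shift_def advance_def tops_def fun_eq_iff)

lemma ready_advance: "ready Z a b B s \<Longrightarrow> s 0 = u @ r \<Longrightarrow> ready Z a b B (advance u s)"
  by (auto simp: ready_def advance_def)

lemma ready_subset: "ready Z a b B s \<Longrightarrow> Z' \<subseteq> Z \<Longrightarrow> ready Z' a b B s"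
  by (auto simp: ready_def)

lemma recognizesI:
  assumes "\<And>a b B s. ready Z a b B s \<Longrightarrow>
     (\<exists>u\<in>A a b. \<exists>r. s 0 = u @ r \<and> sem B P s = Done (advance u s)) \<or>
     (\<forall>u\<in>A a b. \<forall>r. s 0 \<noteq> u @ r) \<and> sem B P s = Aborted"
  shows "recognizes Z P A"
  using assms unfolding recognizes_def by blast

lemma recognizesE:
  assumes "recognizes Z P A" "ready Z a b B s"
  obtains u r where "u \<in> A a b" "s 0 = u @ r" "sem B P s = Done (advance u s)" "ready Z a b B (advance u s)"
  | "\<forall>u\<in>A a b. \<forall>r. s 0 \<noteq> u @ r" "sem B P s = Aborted"
proof -
  from assms(1)[unfolded recognizes_def, rule_format, OF assms(2)] show thesis
  proof (elim disjE bexE exE conjE)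
    fix u r assume *: "u \<in> A a b" "s 0 = u @ r" "sem B P s = Done (advance u s)"
    show thesis by (rule that(1)[OF * ready_advance[OF assms(2) *(2)]])
  next
    assume *: "\<forall>u\<in>A a b. \<forall>r. s 0 \<noteq> u @ r" "sem B P s = Aborted"
    show thesis by (rule that(2)[OF *])
  qed
qed

lemma recognizes_weaken: "recognizes Z P A \<Longrightarrow> Z \<subseteq> Z' \<Longrightarrow> recognizes Z' P A"
  unfolding recognizes_def by (meson ready_subset)

lemma prefix_freeD: "prefix_free A \<Longrightarrow> u @ r = v @ r' \<Longrightarrow> u \<in> A \<Longrightarrow> v \<in> A \<Longrightarrow> u = v"
  unfolding prefix_free_def by blast

lemma recognizes_expect: "recognizes {} (expect C) (\<lambda>_ _. (\<lambda>c. [c]) ` C)"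
proof (rule recognizesI)
  fix a b B s assume r: "ready {} a b B s"
  show "(\<exists>u\<in>(\<lambda>c. [c]) ` C. \<exists>r. s 0 = u @ r \<and> sem B (expect C) s = Done (advance u s)) \<or>
     (\<forall>u\<in>(\<lambda>c. [c]) ` C. \<forall>r. s 0 \<noteq> u @ r) \<and> sem B (expect C) s = Aborted"
  proof (cases "s 0")
    case Nil
    then show ?thesis using r by (auto simp: expect_def tops_def ready_def)
  next
    case (Cons c w)
    then show ?thesis using r sem_shift[of s c w B, OF Cons]
      by (cases "c \<in> C") (auto simp: expect_def tops_def ready_def)
  qed
qed

text \<open>Prefix-freeness of the first language makes the split of the input unique; hence a
  failure of the second part is final, and no backtracking occurs.\<close>

lemma recognizes_seq:
  assumes P: "recognizes Z P A" and Q: "recognizes Z Q A'" and A: "\<And>a b. prefix_free (A a b)"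
  shows "recognizes Z (P ;; Q) (\<lambda>a b. A a b \<star> A' a b)"
proof (rule recognizesI)
  fix a b B s assume r: "ready Z a b B s"
  from P r show "(\<exists>u\<in>A a b \<star> A' a b. \<exists>r. s 0 = u @ r \<and> sem B (P ;; Q) s = Done (advance u s)) \<or>
     (\<forall>u\<in>A a b \<star> A' a b. \<forall>r. s 0 \<noteq> u @ r) \<and> sem B (P ;; Q) s = Aborted"
  proof (cases rule: recognizesE)
    case (1 u r)
    from Q 1(4) show ?thesis
    proof (cases rule: recognizesE)
      case 2: (1 v r')
      then have "s 0 = (u @ v) @ r'" "u @ v \<in> A a b \<star> A' a b"
        using 1 catenateI by (auto simp: advance_simps)
      moreover have "sem B (P ;; Q) s = Done (advance (u @ v) s)"
        using 1 2 by (simp add: advance_append)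
      ultimately show ?thesis by blast
    next
      case 2
      have "s 0 \<noteq> w @ r'" if w0: "w \<in> A a b \<star> A' a b" for w r'
      proof
        assume eq: "s 0 = w @ r'"
        obtain u' v where w: "w = u' @ v" "u' \<in> A a b" "v \<in> A' a b" using w0 by (auto simp: catenate_def)
        have "u @ r = u' @ v @ r'" using eq 1(2) w by simp
        from prefix_freeD[OF A this 1(1) w(2)] this have "r = v @ r'" by simp
        then have "advance u s 0 = v @ r'" using advance_simps(1)[of s u r, OF 1(2)] by simp
        then show False using 2(1) w(3) by blast
      qed
      then show ?thesis using 1 2 by auto
    qed
  next
    case 2
    have "s 0 \<noteq> w @ r'" if "w \<in> A a b \<star> A' a b" for w r'
      using that 2(1) by (auto simp: catenate_def)
    then show ?thesis using 2 by auto
  qed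
qed

text \<open>A single symbol of lookahead separates the two languages, so the branch is chosen before
  anything is consumed.\<close>

lemma recognizes_cond:
  assumes P: "recognizes Z P A" and Q: "recognizes Z Q A'"
    and "\<And>a b u. u \<in> A a b \<Longrightarrow> \<exists>v. u = c # v" "\<And>a b u. u \<in> A' a b \<Longrightarrow> \<exists>d v. u = d # v \<and> d \<noteq> c"
  shows "recognizes Z (Cond (\<lambda>t. t 0 = Some c) P Q) (\<lambda>a b. A a b \<union> A' a b)"
proof (rule recognizesI)
  fix a b B s assume r: "ready Z a b B s"
  let ?goal = "(\<exists>u\<in>A a b \<union> A' a b. \<exists>r. s 0 = u @ r \<and> sem B (Cond (\<lambda>t. t 0 = Some c) P Q) s = Done (advance u s)) \<or>
     (\<forall>u\<in>A a b \<union> A' a b. \<forall>r. s 0 \<noteq> u @ r) \<and> sem B (Cond (\<lambda>t. t 0 = Some c) P Q) s = Aborted"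
  show ?goal
  proof (cases "tops s 0 = Some c")
    case True
    then have "\<forall>u\<in>A' a b. \<forall>r. s 0 \<noteq> u @ r"
      using assms(4)[of _ a b] by (fastforce simp: tops_def)
    with P r True show ?thesis by (cases rule: recognizesE) auto
  next
    case False
    then have "\<forall>u\<in>A a b. \<forall>r. s 0 \<noteq> u @ r"
      using assms(3)[of _ a b] by (fastforce simp: tops_def)
    with Q r False show ?thesis by (cases rule: recognizesE) auto
  qed
qed

text \<open>\<open>l\<close> counts the remaining repetitions while \<open>P\<close> runs, so it
  must differ from the scratch registers of \<open>P\<close>; register 6 serves only during the
  copying of the counter. Two admissible values of \<open>l\<close> allow two nested loops.\<close>

lemma recognizes_repeat:
  assumes P: "recognizes Z P A" and A: "\<And>a b. prefix_free (A a b)"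
    and l: "l \<in> {4, 5}" "l \<notin> Z" "i \<in> {2, 3}"
  shows "recognizes (insert l (insert 6 Z)) (repeat i l P)
    (\<lambda>a b. word_power (A a b) (if i = 2 then a else b))"
proof (rule recognizesI)
  fix a b B s assume r: "ready (insert l (insert 6 Z)) a b B s"
  define G where "G = sem B (Pop l ;; P)"
  let ?b = "\<lambda>s. tops s l \<noteq> None" and ?g = G
  have loop: "(\<exists>u\<in>word_power (A a b) k. \<exists>r. s 0 = u @ r \<and> iterate n ?b ?g s = Done ((advance u s)(l := []))) \<or>
     (\<forall>u\<in>word_power (A a b) k. \<forall>r. s 0 \<noteq> u @ r) \<and> iterate n ?b ?g s = Aborted"
    if "ready Z a b B s" "s l = ones k" "k \<le> n" for s k n
    using that
  proof (induction k arbitrary: s n)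
    case 0
    have "s(l := []) = s" using 0 by (auto simp: fun_eq_iff)
    then show ?case using 0 l by (cases n) (auto simp: tops_def advance_Nil)
  next
    case (Suc k)
    then obtain m where n: "n = Suc m" "k \<le> m" by (cases n) auto
    have b: "?b s" using Suc.prems l by (auto simp: tops_def)
    let ?s = "s(l := ones k)"
    have g: "?g s = sem B P ?s" using Suc.prems by (simp add: G_def)
    have r: "ready Z a b B ?s" using Suc.prems(1) l by (auto simp: ready_def)
    have s0: "?s 0 = s 0" using l by auto
    from P r show ?case
    proof (cases rule: recognizesE)
      case (1 u r)
      have adv: "advance u ?s l = ones k" using l by (auto simp: advance_def)
      from Suc.IH[OF 1(4) adv n(2)] show ?thesis
      proof
        assume "\<exists>v\<in>word_power (A a b) k. \<exists>r. advance u ?s 0 = v @ r \<and>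
          iterate m ?b ?g (advance u ?s) = Done ((advance v (advance u ?s))(l := []))"
        then obtain v r' where v: "v \<in> word_power (A a b) k" "advance u ?s 0 = v @ r'"
          "iterate m ?b ?g (advance u ?s) = Done ((advance v (advance u ?s))(l := []))" by blast
        have "s 0 = (u @ v) @ r'" using v(2) 1(2) s0 advance_simps(1)[of ?s u r, OF 1(2)] by simp
        moreover have "(advance v (advance u ?s))(l := []) = (advance (u @ v) s)(l := [])"
          using l by (auto simp: advance_append advance_upd)
        ultimately have "s 0 = (u @ v) @ r' \<and> iterate n ?b ?g s = Done ((advance (u @ v) s)(l := []))"
          using v(3) b n g 1(3) by simp
        moreover have "u @ v \<in> word_power (A a b) (Suc k)" using catenateI[OF 1(1) v(1)] by simp
        ultimately show ?thesis by blast
      next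
        assume *: "(\<forall>v\<in>word_power (A a b) k. \<forall>r. advance u ?s 0 \<noteq> v @ r) \<and>
          iterate m ?b ?g (advance u ?s) = Aborted"
        have "s 0 \<noteq> w @ r'" if w0: "w \<in> word_power (A a b) (Suc k)" for w r'
        proof
          assume eq: "s 0 = w @ r'"
          obtain u' v where w: "w = u' @ v" "u' \<in> A a b" "v \<in> word_power (A a b) k"
            using w0 by (auto simp: catenate_def)
          have "u @ r = u' @ v @ r'" using eq 1(2) w s0 by simp
          from prefix_freeD[OF A this 1(1) w(2)] this have "r = v @ r'" by simp
          then have "advance u ?s 0 = v @ r'" using advance_simps(1)[of ?s u r, OF 1(2)] by simp
          then show False using * w(3) by blast
        qed
        then show ?thesis using * b n g 1(3) by auto
      qed
    next
      case 2
      then have "s 0 \<noteq> w @ r'" if "w \<in> word_power (A a b) (Suc k)" for w r'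
        using that s0 by (auto simp: catenate_def)
      then show ?thesis using 2 b n g by auto
    qed
  qed
  let ?k = "if i = 2 then a else b"
  have si: "s i = ones ?k" "?k < B" "s l = []" "s 6 = []" using r l by (auto simp: ready_def)
  have c: "sem B (copy i 6 l) s = Done (s(l := ones ?k))"
    using sem_copy[of i l s B 6] si l by auto
  have r': "ready Z a b B (s(l := ones ?k))" using r l by (auto simp: ready_def)
  have "s 0 = (s(l := ones ?k)) 0" "(advance u (s(l := ones ?k)))(l := []) = advance u s" for u
    using l si(3) by (auto simp: advance_def fun_eq_iff)
  then show "(\<exists>u\<in>word_power (A a b) ?k. \<exists>r. s 0 = u @ r \<and> sem B (repeat i l P) s = Done (advance u s)) \<or>
     (\<forall>u\<in>word_power (A a b) ?k. \<forall>r. s 0 \<noteq> u @ r) \<and> sem B (repeat i l P) s = Aborted"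
    using loop[OF r', of ?k B] si(2) c unfolding repeat_def sem.simps(6,8) and_then.simps G_def by auto
qed

text \<open>Items are nonempty, which bounds the rounds by the length of the input, and none of them
  begins with the closing bracket, so the end of the repetition is seen at once.\<close>

lemma recognizes_until_close:
  assumes P: "recognizes Z P A" and A: "\<And>a b. prefix_free (A a b)"
    and hd: "\<And>a b u. u \<in> A a b \<Longrightarrow> \<exists>c v. u = c # v \<and> c \<noteq> CloseList"
  shows "recognizes Z (until_close P) (\<lambda>a b. word_star (A a b) \<star> {[CloseList]})"
proof (rule recognizesI)
  fix a b B s assume r: "ready Z a b B s"
  let ?b = "\<lambda>s. tops s 0 \<noteq> Some CloseList" and ?g = "sem B P"
  have loop: "(\<exists>u\<in>word_star (A a b). \<exists>r. s 0 = u @ CloseList # r \<and> iterate n ?b ?g s = Done (advance u s)) \<or>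
     (\<forall>u\<in>word_star (A a b). \<forall>r. s 0 \<noteq> u @ CloseList # r) \<and> iterate n ?b ?g s = Aborted"
    if "ready Z a b B s" "length (s 0) < n" for s n
    using that
  proof (induction n arbitrary: s)
    case (Suc n)
    show ?case
    proof (cases "?b s")
      case False
      then obtain r where "s 0 = [] @ CloseList # r" by (auto simp: tops_def split: list.splits)
      moreover have "[] \<in> word_star (A a b)" unfolding word_star_def by (intro CollectI exI[of _ "[]"]) auto
      ultimately show ?thesis using False advance_Nil[of s] by force
    next
      case b: True
      have split: "\<exists>u v. w = u @ v \<and> u \<in> A a b \<and> v \<in> word_star (A a b)"
        if w: "w \<in> word_star (A a b)" "s 0 = w @ CloseList # r" for w r
      proof -
        obtain us where us: "w = concat us" "set us \<subseteq> A a b" using w by (auto simp: word_star_def)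
        have "us \<noteq> []" using b w us by (auto simp: tops_def)
        then show ?thesis using us by (cases us) (auto simp: word_star_def)
      qed
      from P Suc.prems(1) show ?thesis
      proof (cases rule: recognizesE)
        case (1 u r)
        have "length (advance u s 0) < n"
          using hd[OF 1(1)] Suc.prems(2) 1(2) by (auto simp: advance_def)
        from Suc.IH[OF 1(4) this] show ?thesis
        proof
          assume "\<exists>v\<in>word_star (A a b). \<exists>r. advance u s 0 = v @ CloseList # r \<and>
            iterate n ?b ?g (advance u s) = Done (advance v (advance u s))"
          then obtain v r' where v: "v \<in> word_star (A a b)" "advance u s 0 = v @ CloseList # r'"
            "iterate n ?b ?g (advance u s) = Done (advance v (advance u s))" by blast
          have "u @ v \<in> word_star (A a b)"
          proof -
            obtain us where "v = concat us" "set us \<subseteq> A a b" using v by (auto simp: word_star_def)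
            then show ?thesis using 1(1) unfolding word_star_def by (intro CollectI exI[of _ "u # us"]) auto
          qed
          moreover have "s 0 = (u @ v) @ CloseList # r'" using v(2) 1(2) advance_simps(1)[of s u r, OF 1(2)] by simp
          moreover have "iterate (Suc n) ?b ?g s = Done (advance (u @ v) s)"
            using v(3) b 1(3) by (simp add: advance_append)
          ultimately show ?thesis by blast
        next
          assume *: "(\<forall>v\<in>word_star (A a b). \<forall>r. advance u s 0 \<noteq> v @ CloseList # r) \<and>
            iterate n ?b ?g (advance u s) = Aborted"
          have "s 0 \<noteq> w @ CloseList # r'" if w0: "w \<in> word_star (A a b)" for w r'
          proof
            assume eq: "s 0 = w @ CloseList # r'"
            obtain u' v where w: "w = u' @ v" "u' \<in> A a b" "v \<in> word_star (A a b)" using split[OF w0 eq] by blast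
            have "u @ r = u' @ v @ CloseList # r'" using eq 1(2) w by simp
            from prefix_freeD[OF A this 1(1) w(2)] this have "r = v @ CloseList # r'" by simp
            then have "advance u s 0 = v @ CloseList # r'" using advance_simps(1)[of s u r, OF 1(2)] by simp
            then show False using * w(3) by blast
          qed
          then show ?thesis using * b 1(3) by auto
        qed
      next
        case 2
        have "s 0 \<noteq> w @ CloseList # r'" if "w \<in> word_star (A a b)" for w r'
          using split[OF that, of r'] 2(1) by fastforce
        then show ?thesis using 2 b by auto
      qed
    qed
  qed simp
  have "length (s 0) < B" using r by (auto simp: ready_def)
  from loop[OF r this]
  show "(\<exists>u\<in>word_star (A a b) \<star> {[CloseList]}. \<exists>r. s 0 = u @ r \<and> sem B (until_close P) s = Done (advance u s)) \<or>
     (\<forall>u\<in>word_star (A a b) \<star> {[CloseList]}. \<forall>r. s 0 \<noteq> u @ r) \<and> sem B (until_close P) s = Aborted"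
  proof
    assume "\<exists>u\<in>word_star (A a b). \<exists>r. s 0 = u @ CloseList # r \<and> iterate B ?b ?g s = Done (advance u s)"
    then obtain u r where u: "u \<in> word_star (A a b)" "s 0 = u @ CloseList # r"
      "iterate B ?b ?g s = Done (advance u s)" by blast
    have adv: "advance u s 0 = CloseList # r" using u(2) by (simp add: advance_def)
    then have "sem B (expect {CloseList}) (advance u s) = Done (advance (u @ [CloseList]) s)"
      using sem_shift[of "advance u s" CloseList r, OF adv] by (simp add: expect_def tops_def advance_append)
    then show ?thesis using u by (auto simp: until_close_def catenate_def)
  next
    assume *: "(\<forall>u\<in>word_star (A a b). \<forall>r. s 0 \<noteq> u @ CloseList # r) \<and> iterate B ?b ?g s = Aborted"
    then show ?thesis by (auto simp: until_close_def catenate_def)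
  qed
qed

subsection \<open>Numbers and coefficients\<close>

abbreviation at_digit :: "(nat \<Rightarrow> symbol option) \<Rightarrow> bool" where
  "at_digit t \<equiv> \<exists>c\<in>digits. t 0 = Some c"

text \<open>Each zero must be followed by another digit; this enforces that a nonempty number ends
  in \<open>Dig1\<close>.\<close>

definition scan_digits :: "symbol com" where
  "scan_digits =
     Loop at_digit (Cond (\<lambda>t. t 0 = Some Dig0) (shift ;; Cond at_digit Skip Abort) shift) ;;
     expect {EndNum}"

text \<open>After the sign at least one digit is required, because zero is encoded without a
  sign.\<close>

definition scan_int :: "symbol com" where
  "scan_int = Cond (\<lambda>t. t 0 = Some NegSign)
     (expect {NegSign} ;; Cond at_digit scan_digits Abort) scan_digits"

lemma recognizes_digits: "recognizes {} scan_digits (\<lambda>_ _. range (\<lambda>n. binary n @ [EndNum]))"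
proof (rule recognizesI)
  fix a b B s assume r: "ready {} a b B s"
  let ?c = "Cond (\<lambda>t. t 0 = Some Dig0) (shift ;; Cond at_digit Skip Abort) shift"
  define G where "G = sem B ?c"
  let ?d = "\<lambda>w. takeWhile (\<lambda>c. c \<in> digits) w"
  have loop: "iterate n (\<lambda>s. at_digit (tops s)) G s =
     (if ?d (s 0) \<noteq> [] \<longrightarrow> last (?d (s 0)) = Dig1 then Done (advance (?d (s 0)) s) else Aborted)"
    if "length (s 0) < n" "s 1 = []" for n s
    using that
  proof (induction n arbitrary: s)
    case (Suc n)
    show ?case
    proof (cases "s 0")
      case Nil
      then show ?thesis by (simp add: tops_def advance_Nil)
    next
      case (Cons c w)
      show ?thesis
      proof (cases "c \<in> digits")
        case False
        then show ?thesis using Cons by (simp add: tops_def advance_Nil)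
      next
        case True
        have sh: "sem B shift s = Done (advance [c] s)" by (rule sem_shift[of s c w, OF Cons])
        have s1: "advance [c] s 0 = w" "advance [c] s 1 = []"
          using Cons Suc.prems by (simp_all add: advance_def)
        have IH: "iterate n (\<lambda>s. at_digit (tops s)) G (advance [c] s) =
          (if ?d w \<noteq> [] \<longrightarrow> last (?d w) = Dig1 then Done (advance (?d w) (advance [c] s)) else Aborted)"
          using Suc.IH[of "advance [c] s"] s1 Cons Suc.prems by simp
        have t1: "at_digit (tops (advance [c] s)) \<longleftrightarrow> ?d w \<noteq> []"
          using s1 by (cases w) (auto simp: tops_def)
        have "G s = (if c = Dig0 \<and> ?d w = [] then Aborted else Done (advance [c] s))"
          using Cons sh t1 s1 by (auto simp: tops_def G_def)
        moreover have "at_digit (tops s)" using Cons True by (auto simp: tops_def)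
        moreover have "c = Dig0 \<or> c = Dig1" using True by (auto simp: digits_def)
        ultimately show ?thesis using IH Cons True by (auto simp: advance_append)
      qed
    qed
  qed simp
  let ?u = "?d (s 0)" and ?r = "dropWhile (\<lambda>c. c \<in> digits) (s 0)"
  have B: "length (s 0) < B" "s 1 = []" using r by (auto simp: ready_def)
  have s0: "s 0 = ?u @ ?r" by simp
  have tw: "?u = binary n" "?r = EndNum # r'" if "s 0 = (binary n @ [EndNum]) @ r'" for n r'
    using that digits_binary[of n]
    by (auto simp: takeWhile_append dropWhile_append digits_def subset_iff takeWhile_eq_all_conv)
  have adv: "advance ?u s 0 = ?r" by (metis advance_simps(1) s0)
  show "(\<exists>u\<in>range (\<lambda>n. binary n @ [EndNum]). \<exists>r. s 0 = u @ r \<and> sem B scan_digits s = Done (advance u s)) \<or>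
     (\<forall>u\<in>range (\<lambda>n. binary n @ [EndNum]). \<forall>r. s 0 \<noteq> u @ r) \<and> sem B scan_digits s = Aborted"
  proof (cases "(?u \<noteq> [] \<longrightarrow> last ?u = Dig1) \<and> (\<exists>r'. ?r = EndNum # r')")
    case True
    then obtain r' where r': "?r = EndNum # r'" by blast
    have "?u \<in> range binary" unfolding range_binary using True set_takeWhileD by fast
    then obtain n where n: "?u = binary n" by auto
    have "sem B (expect {EndNum}) (advance ?u s) = Done (advance (?u @ [EndNum]) s)"
      using sem_shift[of "advance ?u s" EndNum r'] adv r' by (simp add: expect_def tops_def advance_append)
    then have "sem B scan_digits s = Done (advance (?u @ [EndNum]) s)"
      using loop[OF B] True unfolding scan_digits_def sem.simps(6,8) G_def[symmetric] by simp
    moreover have "s 0 = (?u @ [EndNum]) @ r'" using s0 r' by simp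
    ultimately show ?thesis using n by auto
  next
    case False
    have "s 0 \<noteq> (binary n @ [EndNum]) @ r'" for n r'
    proof
      assume "s 0 = (binary n @ [EndNum]) @ r'"
      then show False using tw[of n r'] False range_binary[of "binary n"] by auto
    qed
    moreover have "sem B scan_digits s = Aborted"
    proof (cases "?u \<noteq> [] \<longrightarrow> last ?u = Dig1")
      case True
      define s' where "s' = advance ?u s"
      have "s' 0 = ?r" "s' 1 = []" using adv B(2) by (simp_all add: s'_def advance_def)
      moreover have "\<forall>r'. ?r \<noteq> EndNum # r'" using True False by blast
      ultimately have "tops s' 0 \<noteq> Some EndNum" by (auto simp: tops_def split: list.splits)
      then have "sem B (expect {EndNum}) (advance ?u s) = Aborted"
        using \<open>s' 1 = []\<close> by (simp add: expect_def s'_def)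
      then show ?thesis using loop[OF B] True unfolding scan_digits_def sem.simps(6,8) G_def[symmetric] by simp
    next
      case False
      then show ?thesis using loop[OF B] unfolding scan_digits_def sem.simps(6,8) G_def[symmetric] by simp
    qed
    ultimately show ?thesis by auto
  qed
qed

lemma recognizes_int: "recognizes {} scan_int (\<lambda>_ _. range encode_int)"
proof -
  have "recognizes {} (Cond at_digit scan_digits Abort) (\<lambda>_ _. (\<lambda>n. binary n @ [EndNum]) ` {0<..})"
  proof (rule recognizesI)
    fix a b B s assume r: "ready {} a b B s"
    have hd: "tops s 0 \<in> Some ` digits" if n: "s 0 = (binary n @ [EndNum]) @ r'" "0 < n" for n r'
    proof -
      obtain c v where "binary n = c # v" using n(2) by (cases "binary n") auto
      then show ?thesis using n digits_binary[of n] by (auto simp: tops_def)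
    qed
    have hd0: "\<not> at_digit (tops s)" if "s 0 = (binary 0 @ [EndNum]) @ r'" for r'
      using that by (auto simp: tops_def digits_def)
    show "(\<exists>u\<in>(\<lambda>n. binary n @ [EndNum]) ` {0<..}. \<exists>r. s 0 = u @ r \<and> sem B (Cond at_digit scan_digits Abort) s = Done (advance u s)) \<or>
     (\<forall>u\<in>(\<lambda>n. binary n @ [EndNum]) ` {0<..}. \<forall>r. s 0 \<noteq> u @ r) \<and> sem B (Cond at_digit scan_digits Abort) s = Aborted"
    proof (cases "at_digit (tops s)")
      case True
      from recognizes_digits r show ?thesis
      proof (cases rule: recognizesE)
        case (1 u r)
        then obtain n where "u = binary n @ [EndNum]" by auto
        moreover have "n \<noteq> 0" using hd0[of r] 1(2) True calculation by auto
        ultimately show ?thesis using 1 True by auto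
      qed (use True in auto)
    next
      case False
      then have "\<forall>u\<in>(\<lambda>n. binary n @ [EndNum]) ` {0<..}. \<forall>r. s 0 \<noteq> u @ r" using hd by fastforce
      then show ?thesis using False r by (simp add: ready_def)
    qed
  qed
  from recognizes_seq[OF recognizes_expect[of "{NegSign}"] this]
  have 1: "recognizes {} (expect {NegSign} ;; Cond at_digit scan_digits Abort)
      (\<lambda>_ _. {[NegSign]} \<star> (\<lambda>n. binary n @ [EndNum]) ` {0<..})"
    by (simp add: prefix_free_def)
  have "recognizes {} scan_int (\<lambda>_ _. {[NegSign]} \<star> (\<lambda>n. binary n @ [EndNum]) ` {0<..} \<union>
      range (\<lambda>n. binary n @ [EndNum]))"
    unfolding scan_int_def
  proof (rule recognizes_cond[OF 1 recognizes_digits])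
    fix u assume "u \<in> range (\<lambda>n. binary n @ [EndNum])"
    then obtain n where "u = binary n @ [EndNum]" by auto
    then show "\<exists>d v. u = d # v \<and> d \<noteq> NegSign"
      using EndNum_binary(2)[of n] by (cases "binary n") auto
  qed (auto simp: catenate_def)
  moreover have "{[NegSign]} \<star> (\<lambda>n. binary n @ [EndNum]) ` {0<..} \<union> range (\<lambda>n. binary n @ [EndNum]) = range encode_int"
    (is "?L = _")
  proof
    show "?L \<subseteq> range encode_int"
    proof
      fix u assume "u \<in> ?L"
      then consider n where "0 < n" "u = NegSign # binary n @ [EndNum]" | n where "u = binary n @ [EndNum]"
        by (auto simp: catenate_def)
      then show "u \<in> range encode_int"
      proof cases
        case (1 n)
        then show ?thesis by (intro range_eqI[of _ _ "- int n"]) (simp add: encode_int_cases)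
      next
        case (2 n)
        then show ?thesis by (intro range_eqI[of _ _ "int n"]) (simp add: encode_int_cases)
      qed
    qed
    show "range encode_int \<subseteq> ?L" by (auto simp: encode_int_cases catenate_def)
  qed
  ultimately show ?thesis by simp
qed

definition scan_arc :: "symbol com" where
  "scan_arc = Cond (\<lambda>t. t 0 = Some Bot) (expect {Bot}) scan_int"

definition scan_coef :: "symbol com" where
  "scan_coef = Cond (\<lambda>t. t 0 = Some MinusMark) (expect {MinusMark} ;; scan_int) scan_arc"

lemma range_encode_arc: "range encode_arc = {[Bot]} \<union> range encode_int"
proof
  show "range encode_arc \<subseteq> {[Bot]} \<union> range encode_int"
  proof
    fix u assume "u \<in> range encode_arc"
    then obtain c where "u = encode_arc c" by auto
    then show "u \<in> {[Bot]} \<union> range encode_int" by (cases c) auto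
  qed
  have "encode_int z = encode_arc (Some z)" "[Bot] = encode_arc None" for z by auto
  then show "{[Bot]} \<union> range encode_int \<subseteq> range encode_arc" by (auto simp del: encode_arc.simps)
qed

lemma recognizes_arc: "recognizes {} scan_arc (\<lambda>_ _. range encode_arc)"
proof -
  have "recognizes {} scan_arc (\<lambda>_ _. {[Bot]} \<union> range encode_int)"
    unfolding scan_arc_def
  proof (rule recognizes_cond[OF _ recognizes_int])
    show "recognizes {} (expect {Bot}) (\<lambda>_ _. {[Bot]})" using recognizes_expect[of "{Bot}"] by simp
    show "\<exists>d v. u = d # v \<and> d \<noteq> Bot" if "u \<in> range encode_int" for u
      using that hd_encode_int by force
  qed auto
  then show ?thesis by (simp add: range_encode_arc)
qed

lemma range_encode_coef: "range encode_coef = {[MinusMark]} \<star> range encode_int \<union> range encode_arc"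
  (is "_ = ?R")
proof
  show "range encode_coef \<subseteq> ?R"
  proof
    fix u assume "u \<in> range encode_coef"
    then obtain c where "u = encode_coef c" by auto
    then show "u \<in> ?R" unfolding range_encode_arc
      by (cases c rule: coeff.cases) (auto simp: catenate_def)
  qed
  have "encode_int z = encode_coef (Some (z, False))" "MinusMark # encode_int z = encode_coef (Some (z, True))"
    "[Bot] = encode_coef None" for z by auto
  then show "?R \<subseteq> range encode_coef" unfolding range_encode_arc
    by (auto simp: catenate_def simp del: encode_coef.simps)
qed

text \<open>Plain coefficients and arcs have the same words, so \<open>scan_arc\<close> also
  recognizes the entries of left-hand sides.\<close>

lemma plain_coefs: "encode_coef ` {c. is_plain c} = range encode_arc"
proof
  show "encode_coef ` {c. is_plain c} \<subseteq> range encode_arc"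
  proof
    fix u assume "u \<in> encode_coef ` {c. is_plain c}"
    then obtain c where "u = encode_coef c" "is_plain c" by auto
    then show "u \<in> range encode_arc" unfolding range_encode_arc
      by (cases c rule: coeff.cases) auto
  qed
  have "encode_int z \<in> encode_coef ` {c. is_plain c}" for z
    by (rule image_eqI[of _ _ "Some (z, False)"]) auto
  moreover have "[Bot] \<in> encode_coef ` {c. is_plain c}" by (rule image_eqI[of _ _ None]) auto
  ultimately show "range encode_arc \<subseteq> encode_coef ` {c. is_plain c}" unfolding range_encode_arc by auto
qed

lemma recognizes_coef: "recognizes {} scan_coef (\<lambda>_ _. range encode_coef)"
  unfolding range_encode_coef scan_coef_def
proof (rule recognizes_cond[OF _ recognizes_arc])
  show "recognizes {} (expect {MinusMark} ;; scan_int) (\<lambda>_ _. {[MinusMark]} \<star> range encode_int)"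
    using recognizes_seq[OF recognizes_expect[of "{MinusMark}"] recognizes_int]
    by (simp add: prefix_free_def)
  show "\<exists>d v. u = d # v \<and> d \<noteq> MinusMark" if "u \<in> range encode_arc" for u
    using that hd_encode_int unfolding range_encode_arc by force
qed (auto simp: catenate_def)

section \<open>Mixed systems over the reals\<close>

text \<open>A point is given by its support \<open>D\<close> and its finite coordinates \<open>X\<close>, where coordinate 0 is
  the homogenizing one.\<close>

definition holds :: "(nat \<Rightarrow> real) \<Rightarrow> nat set \<Rightarrow> coef list \<times> coef list \<Rightarrow> bool" where
  "holds X D q \<longleftrightarrow> (\<forall>j a f. j \<in> D \<and> j < length (fst q) \<and> fst q ! j = Some (a, f) \<longrightarrow>
     (\<exists>k b g. k \<in> D \<and> k < length (snd q) \<and> snd q ! k = Some (b, g) \<and>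
       (if g then of_int a + X j < of_int b + X k else of_int a + X j \<le> of_int b + X k)))"

lemma zero_le_mixed [simp]: "(0::mixed) \<le> m"
  by (cases m) (auto simp: zero_mixed_def)

lemma sum_mixed_le: "finite I \<Longrightarrow> (\<Sum>i\<in>I. f i) \<le> (m::mixed) \<longleftrightarrow> (\<forall>i\<in>I. f i \<le> m)"
  by (induction I rule: finite_induct) (auto simp: plus_mixed_def)

text \<open>Sums are maxima; the second disjunct accounts for the empty sum.\<close>

lemma le_sum_mixed: "finite I \<Longrightarrow> m \<le> (\<Sum>i\<in>I. f i) \<longleftrightarrow> (\<exists>i\<in>I. m \<le> f i) \<or> m \<le> (0::mixed)"
proof (induction I rule: finite_induct)
  case (insert i I)
  have "m \<le> a + b \<longleftrightarrow> m \<le> a \<or> m \<le> b" for a b :: mixed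
    by (simp add: plus_mixed_def le_max_iff_disj)
  then show ?case using insert by auto
qed simp

lemma affine_form_hom:
  assumes "length x = n" "length A = n + 1"
  shows "affine_form (map coeff A) x = (\<Sum>j<n + 1. coeff (A ! j) * ((1 # x) ! j))"
proof -
  have "(\<Sum>j<Suc n. coeff (A ! j) * ((1 # x) ! j)) =
      coeff (A ! 0) * 1 + (\<Sum>j<n. coeff (A ! Suc j) * (x ! j))"
    by (subst sum.lessThan_Suc_shift) simp
  then show ?thesis using assms by (simp add: affine_form_def)
qed

definition point :: "nat \<Rightarrow> (nat \<Rightarrow> real) \<Rightarrow> nat set \<Rightarrow> mixed list" where
  "point n X D = map (\<lambda>j. if Suc j \<in> D then Plain (ereal (X (Suc j))) else 0) [0..<n]"

lemma point_in: "point n X D \<in> points n"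
proof -
  have "Plain (ereal r) \<in> Rmax" for r unfolding Rmax_def by (rule imageI) simp
  moreover have "0 \<in> Rmax" unfolding Rmax_def zero_mixed_def by (rule imageI) simp
  ultimately show ?thesis by (simp add: point_def points_def image_subset_iff)
qed

lemma points_point:
  assumes "x \<in> points n"
  obtains X D where "x = point n X D" "0 \<in> D" "X 0 = 0"
proof -
  define X where "X j = (if j = 0 then 0 else real_of_ereal (modulus (x ! (j - 1))))" for j
  define D where "D = insert 0 {Suc j |j. j < n \<and> x ! j \<noteq> 0}"
  have "x = point n X D"
  proof (rule nth_equalityI)
    show "length x = length (point n X D)" using assms by (simp add: points_def point_def)
    fix j assume j: "j < length x"
    then have "x ! j \<in> Rmax" "j < n" using assms by (auto simp: points_def)
    then obtain e where e: "x ! j = Plain e" "e \<noteq> \<infinity>" by (auto simp: Rmax_def)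
    have "point n X D ! j = (if x ! j \<noteq> 0 then Plain (ereal (real_of_ereal e)) else 0)"
      using \<open>j < n\<close> e by (simp add: point_def D_def X_def)
    then show "x ! j = point n X D ! j" using e by (cases e) (simp_all add: zero_mixed_def)
  qed
  then show thesis by (rule that) (simp_all add: D_def X_def)
qed

text \<open>Both sides are maxima, so every finite term on the left must lie below some finite term
  on the right. Left terms are plain, and for a plain element the order of the semiring is strict
  exactly against marked ones.\<close>

lemma satisfies_iff_holds:
  assumes q: "proper n q" and X: "0 \<in> D" "X 0 = 0"
  shows "satisfies (point n X D) (inequality_of q) \<longleftrightarrow> holds X D q"
proof -
  obtain A B where AB: "q = (A, B)" by (cases q)
  have len: "length A = n + 1" "length B = n + 1" "length (point n X D) = n"
    using q AB by (auto simp: proper_def point_def)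
  have x: "(1 # point n X D) ! j = (if j \<in> D then Plain (ereal (X j)) else 0)" if "j < n + 1" for j
    using that X by (cases j) (auto simp: point_def one_mixed_def)
  have tm: "coeff c * (if j \<in> D then Plain (ereal (X j)) else 0) =
      (if j \<in> D then (case c of None \<Rightarrow> 0 | Some (a, f) \<Rightarrow>
         if f then Minus (of_int a + X j) else Plain (ereal (of_int a + X j))) else 0)" for c j
    by (cases c rule: coeff.cases) (auto simp: times_mixed_def zero_mixed_def)
  let ?t = "\<lambda>c j. if j \<in> D then (case c of None \<Rightarrow> 0 | Some (a, f) \<Rightarrow>
         if f then Minus (of_int a + X j) else Plain (ereal (of_int a + X j))) else (0::mixed)"
  have form: "affine_form (map coeff C) (point n X D) = (\<Sum>j<n + 1. ?t (C ! j) j)" if "length C = n + 1" for C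
    unfolding affine_form_hom[OF len(3) that] by (intro sum.cong refl) (simp add: x tm)
  have "satisfies (point n X D) (inequality_of q) \<longleftrightarrow>
      (\<forall>j<n + 1. (\<exists>k<n + 1. ?t (A ! j) j \<le> ?t (B ! k) k) \<or> ?t (A ! j) j \<le> 0)"
    unfolding satisfies_def AB inequality_of_def split fst_conv snd_conv form[OF len(1)] form[OF len(2)]
    unfolding sum_mixed_le[OF finite_lessThan] unfolding le_sum_mixed[OF finite_lessThan]
    by (simp only: Ball_def Bex_def lessThan_iff)
  also have "\<dots> \<longleftrightarrow> holds X D q"
  proof -
    have le: "Plain (ereal r) \<le> ?t c k \<longleftrightarrow> (\<exists>b g. k \<in> D \<and> c = Some (b, g) \<and>
        (if g then r < of_int b + X k else r \<le> of_int b + X k))" for r c k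
      by (cases c rule: coeff.cases) (auto simp: zero_mixed_def)
    have "((\<exists>k<n + 1. ?t (A ! j) j \<le> ?t (B ! k) k) \<or> ?t (A ! j) j \<le> 0) \<longleftrightarrow>
      (\<forall>a f. j \<in> D \<and> A ! j = Some (a, f) \<longrightarrow> (\<exists>k b g. k \<in> D \<and> k < n + 1 \<and> B ! k = Some (b, g) \<and>
       (if g then of_int a + X j < of_int b + X k else of_int a + X j \<le> of_int b + X k)))"
      if "j < n + 1" for j
    proof (cases "j \<in> D \<and> A ! j \<noteq> None")
      case True
      then obtain a f where a: "A ! j = Some (a, f)" "j \<in> D" by auto
      have "A ! j \<in> set A" using that len by auto
      then have "\<not> f" using q a(1) AB by (cases f) (auto simp: proper_def)
      then have t: "?t (A ! j) j = Plain (ereal (of_int a + X j))" using a by simp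
      have "\<not> Plain (ereal r) \<le> 0" for r by (simp add: zero_mixed_def)
      then show ?thesis unfolding t le using a by auto
    qed (auto split: option.splits)
    then show ?thesis using len by (auto simp: holds_def AB)
  qed
  finally show ?thesis .
qed

section \<open>Homogeneity, and emptiness and implication as statements about real solutions\<close>

lemma holds_shift: "holds (\<lambda>j. X j + c) D q = holds X D q"
  unfolding holds_def by simp

text \<open>The homogenizing coordinate is only asked to be finite; \<open>holds_shift\<close>
  allows it to be normalized to 0.\<close>

definition feasible :: "(coef list \<times> coef list) list \<Rightarrow> bool" where
  "feasible S \<longleftrightarrow> (\<exists>X D. 0 \<in> D \<and> (\<forall>q\<in>set S. holds X D q))"

lemma normalize:
  assumes "holds X D q"
  shows "holds (\<lambda>j. X j - X 0) D q"
  using assms holds_shift[of X "- X 0"] by simp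

lemma polyhedron_empty_iff:
  assumes "\<forall>q\<in>set S. proper n q"
  shows "polyhedron n (map inequality_of S) = {} \<longleftrightarrow> \<not> feasible S"
proof
  assume *: "polyhedron n (map inequality_of S) = {}"
  show "\<not> feasible S"
  proof
    assume "feasible S"
    then obtain X D where XD: "0 \<in> D" "\<And>q. q \<in> set S \<Longrightarrow> holds X D q" by (auto simp: feasible_def)
    let ?X = "\<lambda>j. X j - X 0"
    have "point n ?X D \<in> polyhedron n (map inequality_of S)"
      unfolding polyhedron_def using point_in assms satisfies_iff_holds[of n _ D ?X] XD normalize by auto
    then show False using * by blast
  qed
next
  assume *: "\<not> feasible S"
  show "polyhedron n (map inequality_of S) = {}"
  proof (rule ccontr)
    assume "polyhedron n (map inequality_of S) \<noteq> {}"
    then obtain x where x: "x \<in> points n" "\<And>q. q \<in> set S \<Longrightarrow> satisfies x (inequality_of q)"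
      by (auto simp: polyhedron_def)
    obtain X D where "x = point n X D" "0 \<in> D" "X 0 = 0" using points_point[OF x(1)] .
    then have "\<forall>q\<in>set S. holds X D q" using x(2) satisfies_iff_holds[of n _ D X] assms by blast
    then show False using * \<open>0 \<in> D\<close> unfolding feasible_def by blast
  qed
qed

lemma implied_by_iff:
  assumes "\<forall>q\<in>set S. proper n q" "proper n q"
  shows "implied_by n (map inequality_of S) (inequality_of q) \<longleftrightarrow>
    \<not> (\<exists>X D. 0 \<in> D \<and> (\<forall>p\<in>set S. holds X D p) \<and> \<not> holds X D q)"
proof
  assume *: "implied_by n (map inequality_of S) (inequality_of q)"
  show "\<not> (\<exists>X D. 0 \<in> D \<and> (\<forall>p\<in>set S. holds X D p) \<and> \<not> holds X D q)"
  proof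
    assume "\<exists>X D. 0 \<in> D \<and> (\<forall>p\<in>set S. holds X D p) \<and> \<not> holds X D q"
    then obtain X D where XD: "0 \<in> D" "\<And>q. q \<in> set S \<Longrightarrow> holds X D q" "\<not> holds X D q" by auto
    let ?X = "\<lambda>j. X j - X 0"
    have "\<not> holds ?X D q" using holds_shift[of X "- X 0" D q] XD(3) by simp
    then have "\<not> satisfies (point n ?X D) (inequality_of q)"
      using assms XD satisfies_iff_holds[of n _ D ?X] by auto
    moreover have "\<forall>p\<in>set (map inequality_of S). satisfies (point n ?X D) p"
      using assms XD satisfies_iff_holds[of n _ D ?X] normalize by auto
    ultimately show False using * point_in unfolding implied_by_def by blast
  qed
next
  assume *: "\<not> (\<exists>X D. 0 \<in> D \<and> (\<forall>p\<in>set S. holds X D p) \<and> \<not> holds X D q)"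
  show "implied_by n (map inequality_of S) (inequality_of q)"
    unfolding implied_by_def
  proof (intro ballI impI)
    fix x assume x: "x \<in> points n" "\<forall>p\<in>set (map inequality_of S). satisfies x p"
    obtain X D where XD: "x = point n X D" "0 \<in> D" "X 0 = 0" using points_point[OF x(1)] .
    have "\<forall>p\<in>set S. holds X D p" using x(2) XD satisfies_iff_holds[of n _ D X] assms(1) by simp
    then have "holds X D q" using * XD(2) by blast
    then show "satisfies x (inequality_of q)" using XD satisfies_iff_holds assms(2) by blast
  qed
qed

section \<open>The system of a game\<close>

definition unit :: "nat \<Rightarrow> nat \<Rightarrow> coef \<Rightarrow> coef list" where
  "unit n k c = replicate k None @ c # replicate (n - k) None"

fun coordinate :: "game \<Rightarrow> node \<Rightarrow> nat" where
  "coordinate g (Row i) = 1 + i"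
| "coordinate g (Col j) = 1 + num_rows g + j"

text \<open>The inequalities of a potential for Min. A row node gives one inequality per arc,
  because the bound has to hold for every move of Max.\<close>

definition row_system :: "game \<Rightarrow> nat \<Rightarrow> (coef list \<times> coef list) list" where
  "row_system g i = (let n = num_rows g + num_cols g in
     concat (map (\<lambda>k. case row_arcs g ! i ! k of None \<Rightarrow> []
       | Some w \<Rightarrow> [(unit n (1 + i) (Some (w, False)), unit n (1 + num_rows g + k) (Some (0, False)))])
       [0..<num_cols g]))"

text \<open>One inequality per column node: its right-hand side is the maximum over the moves of
  Min, of which one suffices. The marks make it strict.\<close>

definition col_inequality :: "game \<Rightarrow> nat \<Rightarrow> coef list \<times> coef list" where
  "col_inequality g j = (unit (num_rows g + num_cols g) (1 + num_rows g + j) (Some (0, False)),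
     None # map (map_option (\<lambda>c. (- c, True))) (col_arcs g ! j) @ replicate (num_cols g) None)"

text \<open>Puts the start node into the support: its coordinate dominates the homogenizing one,
  which is finite.\<close>

definition start_inequality :: "game \<Rightarrow> node \<Rightarrow> coef list \<times> coef list" where
  "start_inequality g s = (let n = num_rows g + num_cols g in
     (unit n 0 (Some (0, False)), unit n (coordinate g s) (Some (0, False))))"

definition system_of_game :: "game \<Rightarrow> node \<Rightarrow> (coef list \<times> coef list) list" where
  "system_of_game g s = concat (map (row_system g) [0..<num_rows g]) @
     map (col_inequality g) [0..<num_cols g] @ [start_inequality g s]"

lemma length_unit [simp]: "k \<le> n \<Longrightarrow> length (unit n k c) = n + 1"
  by (simp add: unit_def)

lemma nth_unit: "k \<le> n \<Longrightarrow> j \<le> n \<Longrightarrow> unit n k c ! j = (if j = k then c else None)"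
  by (auto simp: unit_def nth_append nth_Cons')

lemma holds_unit:
  assumes "k \<le> n" "fst q = unit n k (Some (a, f))"
  shows "holds X D q \<longleftrightarrow> (k \<in> D \<longrightarrow>
    (\<exists>l b g. l \<in> D \<and> l < length (snd q) \<and> snd q ! l = Some (b, g) \<and>
       (if g then of_int a + X k < of_int b + X l else of_int a + X k \<le> of_int b + X l)))"
proof -
  have N: "j < length (fst q) \<and> fst q ! j = Some (a', f') \<longleftrightarrow> j = k \<and> a' = a \<and> f' = f" for j a' f'
    using assms nth_unit[OF assms(1), of j] by (cases "j \<le> n") auto
  show ?thesis unfolding holds_def N by simp
qed

lemma holds_units:
  assumes "k \<le> n" "l \<le> n"
  shows "holds X D (unit n k (Some (a, False)), unit n l (Some (b, False))) \<longleftrightarrow>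
    (k \<in> D \<longrightarrow> l \<in> D \<and> of_int a + X k \<le> of_int b + X l)"
proof -
  have N: "j < length (unit n l (Some (b, False))) \<and> unit n l (Some (b, False)) ! j = Some (b', g) \<and> R \<longleftrightarrow>
      j = l \<and> b' = b \<and> \<not> g \<and> R" for j b' g R
    using assms nth_unit[OF assms(2), of j] by (cases "j \<le> n") auto
  show ?thesis unfolding holds_unit[OF assms(1), of "(unit n k (Some (a, False)), unit n l (Some (b, False)))"
      a False, simplified fst_conv snd_conv, OF refl] N by auto
qed

lemma unit_plain: "is_plain c \<Longrightarrow> c' \<in> set (unit n k c) \<Longrightarrow> is_plain c'"
  by (auto simp: unit_def split: if_splits)

lemma proper_system_of_game:
  assumes "mean_payoff_game g" "s \<in> nodes g"
  shows "\<forall>q\<in>set (system_of_game g s). proper (num_rows g + num_cols g) q"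
proof -
  have "coordinate g s \<le> num_rows g + num_cols g" using assms(2) by (auto simp: nodes_def)
  moreover have "length (col_arcs g ! j) = num_rows g" if "j < num_cols g" for j
    using assms(1) that by (auto simp: mean_payoff_game_def num_cols_def)
  ultimately show ?thesis
    by (auto simp: system_of_game_def row_system_def col_inequality_def start_inequality_def proper_def
        Let_def dest!: unit_plain[rotated] split: option.splits if_splits)
qed

lemma succs_Row:
  assumes "i < num_rows g"
  shows "v \<in> succs g (Row i) \<longleftrightarrow> (\<exists>k w. v = Col k \<and> k < num_cols g \<and> row_arcs g ! i ! k = Some w)"
  using assms by (cases v) (auto simp: succs_def)

lemma succs_Col:
  assumes "j < num_cols g"
  shows "v \<in> succs g (Col j) \<longleftrightarrow> (\<exists>i w. v = Row i \<and> i < num_rows g \<and> col_arcs g ! j ! i = Some w)"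
  using assms by (cases v) (auto simp: succs_def)

lemma weight_simps:
  "i < num_rows g \<Longrightarrow> j < num_cols g \<Longrightarrow> weight g (Row i) (Col j) = of_int (the (row_arcs g ! i ! j))"
  "i < num_rows g \<Longrightarrow> j < num_cols g \<Longrightarrow> weight g (Col j) (Row i) = of_int (the (col_arcs g ! j ! i))"
  by (auto simp: weight_def)

text \<open>Only the moves of Min are strict in the system; half of the least slack is passed on to the
  moves of Max.\<close>

lemma min_potential_of_slack:
  assumes U: "U \<subseteq> nodes g"
    and row: "\<And>u v. u \<in> U \<Longrightarrow> is_row u \<Longrightarrow> v \<in> succs g u \<Longrightarrow> v \<in> U \<and> p u \<le> p v - weight g u v"
    and col: "\<And>u. u \<in> U \<Longrightarrow> \<not> is_row u \<Longrightarrow> \<exists>v\<in>succs g u. v \<in> U \<and> p u < p v - weight g u v"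
  shows "\<exists>d p'. min_potential g 0 d U p'"
proof -
  obtain c where c: "\<And>u. u \<in> U \<Longrightarrow> \<not> is_row u \<Longrightarrow> c u \<in> succs g u \<and> c u \<in> U \<and> p u < p (c u) - weight g u (c u)"
    using col by metis
  have bip: "is_row v \<longleftrightarrow> \<not> is_row u" if "v \<in> succs g u" for u v
    using that by (cases u; cases v) (auto simp: succs_def)
  \<comment> \<open>The element 1 keeps the minimum meaningful when \<open>U\<close> contains no
    column node.\<close>
  define E where "E = insert 1 ((\<lambda>u. p (c u) - weight g u (c u) - p u) ` {u\<in>U. \<not> is_row u})"
  define d where "d = Min E / 2"
  have fE: "finite E" unfolding E_def using U finite_subset[OF _ finite_nodes] by auto
  have "0 < Min E" using fE c by (subst Min_gr_iff) (auto simp: E_def)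
  then have d: "0 < d" by (simp add: d_def)
  have slack: "p u \<le> p (c u) - weight g u (c u) - 2 * d" if "u \<in> U" "\<not> is_row u" for u
  proof -
    have "Min E \<le> p (c u) - weight g u (c u) - p u" using that fE by (intro Min_le) (auto simp: E_def)
    then show ?thesis by (simp add: d_def)
  qed
  \<comment> \<open>Every arc joins a row and a column. Lowering the rows by \<open>d\<close> thus
    creates slack \<open>d\<close> for the moves of Max and consumes \<open>d\<close> of the slack
    \<open>2 * d\<close> of the moves of Min.\<close>
  define p' where "p' u = (if is_row u then p u - d else p u)" for u
  have "min_potential g 0 d U p'"
    unfolding min_potential_def
  proof (intro conjI ballI)
    fix u assume u: "u \<in> U"
    show "if is_row u then \<forall>v\<in>succs g u. v \<in> U \<and> p' u \<le> p' v - (weight g u v - 0) - d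
      else \<exists>v\<in>succs g u. v \<in> U \<and> p' u \<le> p' v - (weight g u v - 0) - d"
    proof (cases "is_row u")
      case True
      then show ?thesis using row[OF u True] bip by (auto simp: p'_def)
    next
      case False
      have "p' u \<le> p' (c u) - (weight g u (c u) - 0) - d"
        using slack[OF u False] c[OF u False] bip[of "c u" u] False by (simp add: p'_def)
      then show ?thesis using c[OF u False] False by auto
    qed
  qed (use U d in auto)
  then show ?thesis by blast
qed

text \<open>The support of a solution is the node set of the potential, and its finite coordinates
  are the values of the potential.\<close>

lemma system_of_game_feasible:
  assumes g: "mean_payoff_game g" and s: "s \<in> nodes g"
  shows "feasible (system_of_game g s) \<longleftrightarrow> (\<exists>d U p. s \<in> U \<and> min_potential g 0 d U p)"
proof -
  let ?n = "num_rows g + num_cols g"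
  have sc: "coordinate g s \<le> ?n" using s by (auto simp: nodes_def)
  have len: "length (col_arcs g ! j) = num_rows g" if "j < num_cols g" for j
    using g that by (auto simp: mean_payoff_game_def num_cols_def)
  have col: "holds X D (col_inequality g j) \<longleftrightarrow> (1 + num_rows g + j \<in> D \<longrightarrow>
      (\<exists>i c. 1 + i \<in> D \<and> i < num_rows g \<and> col_arcs g ! j ! i = Some c \<and> X (1 + num_rows g + j) < - of_int c + X (1 + i)))"
    if "j < num_cols g" for X D j
  proof -
    let ?B = "None # map (map_option (\<lambda>c. (- c, True))) (col_arcs g ! j) @ replicate (num_cols g) None"
    have N: "l < length ?B \<and> ?B ! l = Some (b, h) \<longleftrightarrow>
        (\<exists>i c. l = 1 + i \<and> i < num_rows g \<and> col_arcs g ! j ! i = Some c \<and> b = - c \<and> h)" for l b h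
      using len[OF that] by (cases l) (auto simp: nth_append)
    have "holds X D (col_inequality g j) \<longleftrightarrow> (1 + num_rows g + j \<in> D \<longrightarrow>
      (\<exists>l b h. l \<in> D \<and> (l < length ?B \<and> ?B ! l = Some (b, h)) \<and>
       (if h then of_int 0 + X (1 + num_rows g + j) < of_int b + X l else of_int 0 + X (1 + num_rows g + j) \<le> of_int b + X l)))"
      unfolding col_inequality_def conj_assoc using that
      by (subst holds_unit[of "1 + num_rows g + j" ?n _ 0 False]) (simp, simp, unfold snd_conv, rule refl)
    moreover have "(\<exists>l b h. l \<in> D \<and> (l < length ?B \<and> ?B ! l = Some (b, h)) \<and>
       (if h then of_int 0 + X (1 + num_rows g + j) < of_int b + X l else of_int 0 + X (1 + num_rows g + j) \<le> of_int b + X l)) \<longleftrightarrow>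
      (\<exists>i c. 1 + i \<in> D \<and> i < num_rows g \<and> col_arcs g ! j ! i = Some c \<and> X (1 + num_rows g + j) < - of_int c + X (1 + i))"
      (is "?P \<longleftrightarrow> ?Q")
    proof
      assume ?P
      then obtain l b h where l: "l \<in> D" "l < length ?B \<and> ?B ! l = Some (b, h)"
        "if h then of_int 0 + X (1 + num_rows g + j) < of_int b + X l else of_int 0 + X (1 + num_rows g + j) \<le> of_int b + X l"
        by blast
      from l(2)[unfolded N] obtain i c where "l = 1 + i" "i < num_rows g" "col_arcs g ! j ! i = Some c" "b = - c" "h" by blast
      then show ?Q using l(1,3) by auto
    next
      assume ?Q
      then obtain i c where i: "1 + i \<in> D" "i < num_rows g" "col_arcs g ! j ! i = Some c"
        "X (1 + num_rows g + j) < - of_int c + X (1 + i)" by blast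
      show ?P unfolding N using i by (intro exI[of _ "1 + i"] exI[of _ "- c"] exI[of _ True]) simp
    qed
    ultimately show ?thesis by blast
  qed
  have sys: "(\<forall>q\<in>set (system_of_game g s). holds X D q) \<longleftrightarrow>
     (\<forall>i k w. i < num_rows g \<and> k < num_cols g \<and> row_arcs g ! i ! k = Some w \<longrightarrow>
        1 + i \<in> D \<longrightarrow> 1 + num_rows g + k \<in> D \<and> of_int w + X (1 + i) \<le> X (1 + num_rows g + k)) \<and>
     (\<forall>j<num_cols g. holds X D (col_inequality g j)) \<and>
     (0 \<in> D \<longrightarrow> coordinate g s \<in> D \<and> X 0 \<le> X (coordinate g s))" for X D
  proof -
    have row: "(\<forall>q\<in>set (row_system g i). holds X D q) \<longleftrightarrow> (\<forall>k w. k < num_cols g \<and> row_arcs g ! i ! k = Some w \<longrightarrow>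
        1 + i \<in> D \<longrightarrow> 1 + num_rows g + k \<in> D \<and> of_int w + X (1 + i) \<le> X (1 + num_rows g + k))"
      if "i < num_rows g" for i
    proof -
      have mem: "q \<in> set (row_system g i) \<longleftrightarrow> (\<exists>k w. k < num_cols g \<and> row_arcs g ! i ! k = Some w \<and>
          q = (unit ?n (1 + i) (Some (w, False)), unit ?n (1 + num_rows g + k) (Some (0, False))))" for q
        by (force simp: row_system_def Let_def split: option.splits)
      have "(\<forall>q\<in>set (row_system g i). holds X D q) \<longleftrightarrow> (\<forall>k w. k < num_cols g \<and> row_arcs g ! i ! k = Some w \<longrightarrow>
          holds X D (unit ?n (1 + i) (Some (w, False)), unit ?n (1 + num_rows g + k) (Some (0, False))))"
        unfolding Ball_def mem by auto
      moreover have "holds X D (unit ?n (1 + i) (Some (w, False)), unit ?n (1 + num_rows g + k) (Some (0, False))) \<longleftrightarrow>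
          (1 + i \<in> D \<longrightarrow> 1 + num_rows g + k \<in> D \<and> of_int w + X (1 + i) \<le> X (1 + num_rows g + k))"
        if "k < num_cols g" for k w
        using holds_units[of "1 + i" ?n "1 + num_rows g + k" X D w 0] that \<open>i < num_rows g\<close> by simp
      ultimately show ?thesis by simp
    qed
    have start: "holds X D (start_inequality g s) \<longleftrightarrow> (0 \<in> D \<longrightarrow> coordinate g s \<in> D \<and> X 0 \<le> X (coordinate g s))"
      using holds_units[OF _ sc, of 0 X D 0 0] by (simp add: start_inequality_def Let_def)
    have "(\<forall>q\<in>set (system_of_game g s). holds X D q) \<longleftrightarrow> (\<forall>i. i < num_rows g \<longrightarrow> (\<forall>q\<in>set (row_system g i). holds X D q)) \<and>
      (\<forall>j<num_cols g. holds X D (col_inequality g j)) \<and> holds X D (start_inequality g s)"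
      by (simp add: system_of_game_def ball_Un) (auto simp: Ball_def)
    also have "(\<forall>i. i < num_rows g \<longrightarrow> (\<forall>q\<in>set (row_system g i). holds X D q)) \<longleftrightarrow>
      (\<forall>i. i < num_rows g \<longrightarrow> (\<forall>k w. k < num_cols g \<and> row_arcs g ! i ! k = Some w \<longrightarrow>
        1 + i \<in> D \<longrightarrow> 1 + num_rows g + k \<in> D \<and> of_int w + X (1 + i) \<le> X (1 + num_rows g + k)))"
      by (intro all_cong1 imp_cong refl row)
    finally show ?thesis unfolding start by blast
  qed
  show ?thesis
  proof
    assume "feasible (system_of_game g s)"
    then obtain X D where 0: "0 \<in> D" and XD: "\<forall>q\<in>set (system_of_game g s). holds X D q"
      by (auto simp: feasible_def)
    define U where "U = {u \<in> nodes g. coordinate g u \<in> D}"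
    define p where "p u = X (coordinate g u)" for u
    have "s \<in> U" using XD 0 s unfolding sys U_def by blast
    moreover have "\<exists>d p'. min_potential g 0 d U p'"
    proof (rule min_potential_of_slack)
      show "U \<subseteq> nodes g" by (auto simp: U_def)
      fix u v assume u: "u \<in> U" "is_row u" "v \<in> succs g u"
      then obtain i where i: "u = Row i" "i < num_rows g" "1 + i \<in> D"
        by (cases u) (auto simp: U_def nodes_def)
      then obtain k w where k: "v = Col k" "k < num_cols g" "row_arcs g ! i ! k = Some w"
        using u(3) succs_Row[of i g v] by auto
      have "1 + num_rows g + k \<in> D \<and> of_int w + X (1 + i) \<le> X (1 + num_rows g + k)"
        using XD i k unfolding sys by blast
      then show "v \<in> U \<and> p u \<le> p v - weight g u v"
        using i k by (auto simp: U_def p_def nodes_def weight_simps)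
    next
      fix u assume u: "u \<in> U" "\<not> is_row u"
      then obtain j where j: "u = Col j" "j < num_cols g" "1 + num_rows g + j \<in> D"
        by (cases u) (auto simp: U_def nodes_def)
      then obtain i c where "1 + i \<in> D" "i < num_rows g" "col_arcs g ! j ! i = Some c"
          "X (1 + num_rows g + j) < - of_int c + X (1 + i)"
        using XD col[of j X D] unfolding sys by blast
      then show "\<exists>v\<in>succs g u. v \<in> U \<and> p u < p v - weight g u v"
        using j by (intro bexI[of _ "Row i"]) (auto simp: U_def p_def nodes_def weight_simps succs_Col)
    qed
    ultimately show "\<exists>d U p. s \<in> U \<and> min_potential g 0 d U p" by blast
  next
    assume "\<exists>d U p. s \<in> U \<and> min_potential g 0 d U p"
    then obtain d U p where sU: "s \<in> U" and pot: "min_potential g 0 d U p" by blast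
    have d: "0 < d" and Un: "U \<subseteq> nodes g" using pot by (auto simp: min_potential_def)
    define nd where "nd m = (if m \<le> num_rows g then Row (m - 1) else Col (m - 1 - num_rows g))" for m
    have nd: "nd (1 + i) = Row i" if "i < num_rows g" for i using that by (simp add: nd_def)
    have nd': "nd (1 + num_rows g + j) = Col j" for j by (simp add: nd_def)
    have nd'': "nd (coordinate g u) = u" if "u \<in> nodes g" for u
      using that nd nd' by (auto simp: nodes_def)
    define D where "D = {m. m = 0 \<or> nd m \<in> U}"
    \<comment> \<open>The homogenizing coordinate copies the value at the start node, so that the
      start inequality becomes an equality.\<close>
    define X where "X m = (if m = 0 then p s else p (nd m))" for m
    have "\<forall>q\<in>set (system_of_game g s). holds X D q"
      unfolding sys
    proof (intro conjI allI impI)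
      fix i k w assume ik: "i < num_rows g \<and> k < num_cols g \<and> row_arcs g ! i ! k = Some w" "1 + i \<in> D"
      then have R: "Row i \<in> U" "Col k \<in> succs g (Row i)" using nd[of i] by (auto simp: D_def succs_Row)
      have *: "Col k \<in> U \<and> p (Row i) \<le> p (Col k) - (weight g (Row i) (Col k) - 0) - d"
        using pot R unfolding min_potential_def by fastforce
      then show "1 + num_rows g + k \<in> D" using nd'[of k] by (simp add: D_def)
      show "of_int w + X (1 + i) \<le> X (1 + num_rows g + k)"
        using * ik d nd[of i] nd'[of k] by (simp add: X_def weight_simps)
    next
      fix j assume j: "j < num_cols g"
      show "holds X D (col_inequality g j)"
        unfolding col[OF j]
      proof
        assume "1 + num_rows g + j \<in> D"
        then have R: "Col j \<in> U" using nd'[of j] by (simp add: D_def)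
        then obtain v where v: "v \<in> succs g (Col j)" "v \<in> U" "p (Col j) \<le> p v - (weight g (Col j) v - 0) - d"
          using pot unfolding min_potential_def by fastforce
        obtain i c where i: "v = Row i" "i < num_rows g" "col_arcs g ! j ! i = Some c"
          using v(1) succs_Col[OF j] by auto
        have "X (1 + num_rows g + j) < - of_int c + X (1 + i)"
          using v(3) d i j nd'[of j] nd[of i] by (simp add: X_def weight_simps)
        moreover have "1 + i \<in> D" using v(2) i nd[of i] by (simp add: D_def)
        ultimately show "\<exists>i c. 1 + i \<in> D \<and> i < num_rows g \<and> col_arcs g ! j ! i = Some c \<and>
          X (1 + num_rows g + j) < - of_int c + X (1 + i)" using i by blast
      qed
    next
      have c0: "coordinate g s \<noteq> 0" by (cases s) auto
      show "coordinate g s \<in> D" using nd''[OF s] sU by (simp add: D_def)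
      show "X 0 \<le> X (coordinate g s)" using nd''[OF s] c0 by (simp add: X_def)
    qed
    moreover have "0 \<in> D" by (simp add: D_def)
    ultimately show "feasible (system_of_game g s)" unfolding feasible_def by blast
  qed
qed

theorem winning_iff_empty:
  assumes "mean_payoff_game g" "s \<in> nodes g"
  shows "winning g s \<longleftrightarrow>
    polyhedron (num_rows g + num_cols g) (map inequality_of (system_of_game g s)) = {}"
  unfolding polyhedron_empty_iff[OF proper_system_of_game[OF assms]] system_of_game_feasible[OF assms]
    winning_iff_no_min_potential[OF assms] ..

section \<open>The game of a homogeneous mixed system\<close>

text \<open>Replaces a real solution by an integral one of the system scaled by \<open>M\<close>: the order of the
  fractional parts fits between consecutive multiples of \<open>M\<close>.\<close>

lemma integral_solution:
  fixes X :: "nat \<Rightarrow> real" and M :: int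
  assumes "finite D" "int (card D) < M"
  shows "\<exists>Y :: nat \<Rightarrow> int. \<forall>j\<in>D. \<forall>k\<in>D. \<forall>a. (of_int a + X j \<le> X k \<longrightarrow> M * a + Y j \<le> Y k) \<and>
    (of_int a + X j < X k \<longrightarrow> M * a + Y j < Y k)"
proof -
  define F where "F j = {x \<in> (\<lambda>l. frac (X l)) ` D. x < frac (X j)}" for j
  \<comment> \<open>The integer part at scale \<open>M\<close>, refined by the rank of the
    fractional part. Ranks are at most \<open>card D\<close>, which is less than \<open>M\<close>,
    so they never carry over into the next multiple of \<open>M\<close>.\<close>
  define Y where "Y j = M * \<lfloor>X j\<rfloor> + int (card (F j))" for j
  have fin: "finite (F j)" for j using assms(1) by (simp add: F_def)
  have cM: "int (card (F j)) < M" for j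
  proof -
    have "card (F j) \<le> card ((\<lambda>l. frac (X l)) ` D)" using assms(1) by (intro card_mono) (auto simp: F_def)
    also have "\<dots> \<le> card D" by (rule card_image_le[OF assms(1)])
    finally show ?thesis using assms(2) by simp
  qed
  have "(of_int a + X j \<le> X k \<longrightarrow> M * a + Y j \<le> Y k) \<and> (of_int a + X j < X k \<longrightarrow> M * a + Y j < Y k)"
    if D: "j \<in> D" "k \<in> D" for j k a
  \<comment> \<open>If the integer parts balance, the comparison is one of fractional parts, and
    ranks reproduce it exactly. Otherwise the integer parts differ by at least 1, and after scaling
    this outweighs every rank.\<close>
  proof (cases "a + \<lfloor>X j\<rfloor> = \<lfloor>X k\<rfloor>")
    case True
    then have Y: "M * a + Y j - Y k = int (card (F j)) - int (card (F k))"
      by (simp add: Y_def flip: True) (simp add: algebra_simps)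
    have fr: "of_int a + X j - X k = frac (X j) - frac (X k)"
      using True[symmetric] by (simp add: frac_def)
    have "card (F j) \<le> card (F k)" if "frac (X j) \<le> frac (X k)"
      using that by (intro card_mono fin) (auto simp: F_def)
    moreover have "card (F j) < card (F k)" if "frac (X j) < frac (X k)"
      using that D by (intro psubset_card_mono fin) (auto simp: F_def)
    ultimately show ?thesis using Y fr by force
  next
    case False
    have "of_int a + X j \<le> X k \<Longrightarrow> a + \<lfloor>X j\<rfloor> \<le> \<lfloor>X k\<rfloor>" by linarith
    then have "M * a + Y j < Y k" if "of_int a + X j \<le> X k"
    proof -
      have "a + \<lfloor>X j\<rfloor> + 1 \<le> \<lfloor>X k\<rfloor>" using that \<open>_ \<Longrightarrow> a + \<lfloor>X j\<rfloor> \<le> \<lfloor>X k\<rfloor>\<close> False by simp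
      moreover have "0 \<le> M" using assms(2) by linarith
      ultimately have "M * (a + \<lfloor>X j\<rfloor> + 1) \<le> M * \<lfloor>X k\<rfloor>" by (rule mult_left_mono)
      then show ?thesis using cM[of j] by (simp add: Y_def algebra_simps)
    qed
    then show ?thesis by force
  qed
  then show ?thesis by blast
qed

text \<open>Fewer than \<open>K\<close> integers leave some residue modulo \<open>K\<close> free; cutting there absorbs a
  slack of 1.\<close>

lemma round_off_slack:
  fixes Y :: "nat \<Rightarrow> int" and K :: int
  assumes "finite D" "int (card D) < K"
  shows "\<exists>f :: nat \<Rightarrow> int. \<forall>j\<in>D. \<forall>k\<in>D. \<forall>w. Y j \<le> Y k + K * w + 1 \<longrightarrow> f j \<le> f k + w"
proof -
  have K: "0 < K" using assms(2) by linarith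
  have "card ((\<lambda>j. Y j mod K) ` D) \<le> card D" by (rule card_image_le[OF assms(1)])
  then have "card ((\<lambda>j. Y j mod K) ` D) < card {0..<K}" using assms(2) by simp
  then have "\<not> {0..<K} \<subseteq> (\<lambda>j. Y j mod K) ` D" using assms(1) by (meson card_mono finite_imageI leD)
  then obtain r where r: "0 \<le> r" "r < K" "\<And>j. j \<in> D \<Longrightarrow> Y j mod K \<noteq> r" by fastforce
  \<comment> \<open>The offset moves the free residue to \<open>K - 1\<close>. Remainders are then
    at most \<open>K - 2\<close>, so adding the slack 1 cannot complete another multiple of
    \<open>K\<close>.\<close>
  define f where "f j = (Y j - r - 1) div K" for j
  define m where "m j = (Y j - r - 1) mod K" for j
  have Y: "Y j = K * f j + m j + r + 1" for j
    using div_mult_mod_eq[of "Y j - r - 1" K] by (simp add: f_def m_def mult.commute)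
  have m: "0 \<le> m j" "m j \<le> K - 1" for j using K by (simp_all add: m_def)
  have m': "m j \<noteq> K - 1" if "j \<in> D" for j
  proof
    assume "m j = K - 1"
    then have "Y j = K * (f j + 1) + r" using Y[of j] by (simp add: algebra_simps)
    then have "Y j mod K = r mod K" by simp
    then show False using r that by simp
  qed
  have "f j \<le> f k + w" if D: "j \<in> D" "k \<in> D" "Y j \<le> Y k + K * w + 1" for j k w
  proof (rule ccontr)
    assume "\<not> f j \<le> f k + w"
    then have "f k + w + 1 \<le> f j" by simp
    then have "K * (f k + w + 1) \<le> K * f j" using K by (intro mult_left_mono) auto
    then show False using D(3) Y[of j] Y[of k] m[of j] m[of k] m'[OF D(2)] by (simp add: algebra_simps)
  qed
  then show ?thesis by blast
qed

definition row_weight :: "nat \<Rightarrow> coef \<Rightarrow> int option" where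
  "row_weight e c = map_option (\<lambda>(a, _). 2 ^ (2 * e) * a) c"

text \<open>Since Min pays the weights, a negative weight relaxes the inequality: the -1 gives every
  inequality one unit of slack at the full scale. A marked coefficient is charged
  \<open>2 ^ e\<close>, which is one unit at the scale at which solutions are integral.\<close>

definition col_weight :: "nat \<Rightarrow> coef \<Rightarrow> int option" where
  "col_weight e c = map_option (\<lambda>(b, f). - (2 ^ (2 * e) * b) - 1 + (if f then 2 ^ e else 0)) c"

text \<open>Rows are the variables and columns the inequalities, so that a solution is a potential for
  Min.\<close>

definition game_of :: "nat \<Rightarrow> nat \<Rightarrow> (coef list \<times> coef list) list \<Rightarrow> game" where
  "game_of e N H = \<lparr>row_arcs = map (\<lambda>k. map (\<lambda>q. row_weight e (fst q ! k)) H) [0..<N],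
     col_arcs = map (\<lambda>q. map (col_weight e) (snd q)) H\<rparr>"

lemma game_of_simps:
  "num_rows (game_of e N H) = N" "num_cols (game_of e N H) = length H"
  "k < N \<Longrightarrow> i < length H \<Longrightarrow> row_arcs (game_of e N H) ! k ! i = row_weight e (fst (H ! i) ! k)"
  "i < length H \<Longrightarrow> k < length (snd (H ! i)) \<Longrightarrow> col_arcs (game_of e N H) ! i ! k = col_weight e (snd (H ! i) ! k)"
  by (auto simp: game_of_def num_rows_def num_cols_def)

lemma mean_payoff_game_of:
  assumes len: "\<And>q. q \<in> set H \<Longrightarrow> length (fst q) = N \<and> length (snd q) = N"
    and rhs: "\<And>q. q \<in> set H \<Longrightarrow> \<exists>c\<in>set (snd q). c \<noteq> None"
    and lhs: "\<And>k. k < N \<Longrightarrow> \<exists>q\<in>set H. fst q ! k \<noteq> None"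
  shows "mean_payoff_game (game_of e N H)"
proof -
  let ?g = "game_of e N H"
  have "\<exists>v\<in>nodes ?g. arc_weight ?g u v \<noteq> None" if "u \<in> nodes ?g" for u
  proof (cases u)
    case (Row k)
    then have k: "k < N" using that by (auto simp: nodes_def game_of_simps)
    then obtain i where i: "i < length H" "fst (H ! i) ! k \<noteq> None" using lhs by (metis in_set_conv_nth)
    then show ?thesis using Row k
      by (intro bexI[of _ "Col i"]) (auto simp: game_of_simps row_weight_def nodes_def)
  next
    case (Col i)
    then have i: "i < length H" using that by (auto simp: nodes_def game_of_simps)
    then obtain k where k: "k < N" "snd (H ! i) ! k \<noteq> None"
      using rhs[of "H ! i"] len[of "H ! i"] by (metis in_set_conv_nth nth_mem)
    then show ?thesis using Col i len[of "H ! i"]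
      by (intro bexI[of _ "Row k"]) (auto simp: game_of_simps col_weight_def nodes_def)
  qed
  moreover have "length r = num_cols ?g" if "r \<in> set (row_arcs ?g)" for r
    using that by (auto simp: game_of_def num_cols_def)
  moreover have "length c = num_rows ?g" if "c \<in> set (col_arcs ?g)" for c
    using that len by (auto simp: game_of_def num_rows_def)
  ultimately show ?thesis by (simp add: mean_payoff_game_def)
qed

text \<open>Row nodes carry the scaled solution and column nodes the values of the right-hand sides.
  A play from a row through a column to a row checks one left term against one right term.\<close>

theorem winning_game_of:
  assumes len: "\<And>q. q \<in> set H \<Longrightarrow> length (fst q) = N \<and> length (snd q) = N"
    and rhs: "\<And>q. q \<in> set H \<Longrightarrow> \<exists>c\<in>set (snd q). c \<noteq> None"
    and lhs: "\<And>k. k < N \<Longrightarrow> \<exists>q\<in>set H. fst q ! k \<noteq> None"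
    and N: "0 < N" "N < 2 ^ e"
  shows "winning (game_of e N H) (Row 0) \<longleftrightarrow> \<not> feasible H"
proof -
  let ?g = "game_of e N H"
  define M :: int where "M = 2 ^ e"
  have M: "0 < M" "int N < M" using N(2) by (auto simp: M_def)
  have MM: "2 ^ (2 * e) = M * M" by (simp add: M_def power_add mult_2)
  have roww: "row_arcs ?g ! k ! i = (case fst (H ! i) ! k of None \<Rightarrow> None | Some (a, f) \<Rightarrow> Some (M * M * a))"
    if "k < N" "i < length H" for k i
    using that by (auto simp: game_of_simps row_weight_def MM split: option.splits)
  have colw: "col_arcs ?g ! i ! k = (case snd (H ! i) ! k of None \<Rightarrow> None
      | Some (b, f) \<Rightarrow> Some (- (M * M * b) - 1 + (if f then M else 0)))"
    if "k < N" "i < length H" for k i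
    using that len[of "H ! i"] by (auto simp: game_of_simps col_weight_def MM split: option.splits)
      (simp_all add: M_def)
  have s: "Row 0 \<in> nodes ?g" using N by (auto simp: nodes_def game_of_simps)
  have holdsE: "\<exists>k b g. k \<in> D \<and> k < N \<and> snd (H ! i) ! k = Some (b, g) \<and>
      (if g then of_int a + X j < of_int b + X k else of_int a + X j \<le> of_int b + X k)"
    if "\<forall>q\<in>set H. holds X D q" "i < length H" "j \<in> D" "j < N" "fst (H ! i) ! j = Some (a, f)" for X D i j a f
  proof -
    have "holds X D (H ! i)" "length (fst (H ! i)) = N" "length (snd (H ! i)) = N" using that len[of "H ! i"] by auto
    then show ?thesis using that(3-5) unfolding holds_def by metis
  qed
  have "feasible H \<longleftrightarrow> (\<exists>d U p. Row 0 \<in> U \<and> min_potential ?g 0 d U p)"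
  proof
    assume "feasible H"
    then obtain X D0 where 0: "0 \<in> D0" and XD0: "\<forall>q\<in>set H. holds X D0 q" by (auto simp: feasible_def)
    \<comment> \<open>Restricting the support to the actual variables makes it finite, with fewer
      than \<open>M\<close> elements.\<close>
    define D where "D = D0 \<inter> {..<N}"
    have D: "finite D" "int (card D) < M"
      using card_mono[of "{..<N}" D] M by (auto simp: D_def)
    obtain Y :: "nat \<Rightarrow> int" where Y: "\<And>j k a. j \<in> D \<Longrightarrow> k \<in> D \<Longrightarrow> of_int a + X j \<le> X k \<Longrightarrow> M * a + Y j \<le> Y k"
      "\<And>j k a. j \<in> D \<Longrightarrow> k \<in> D \<Longrightarrow> of_int a + X j < X k \<Longrightarrow> M * a + Y j < Y k"
      using integral_solution[OF D, of X] by blast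
    \<comment> \<open>The finite right-hand terms of inequality \<open>i\<close> at the full scale,
      the strict ones lowered by one unit of the integral scale.\<close>
    define opt where "opt i = {M * (M * b + Y k - (if f then 1 else 0)) |k b f. k \<in> D \<and> snd (H ! i) ! k = Some (b, f)}" for i
    have fin: "finite (opt i)" for i
    proof -
      have "opt i \<subseteq> (\<lambda>k. case snd (H ! i) ! k of None \<Rightarrow> 0 | Some (b, f) \<Rightarrow> M * (M * b + Y k - (if f then 1 else 0))) ` D"
        unfolding opt_def by force
      then show ?thesis using D(1) finite_surj by blast
    qed
    define U where "U = Row ` D \<union> Col ` {i. i < length H \<and> opt i \<noteq> {}}"
    \<comment> \<open>The unit of slack is split evenly: the summand \<open>1 / 2\<close> gives half
      of it to the move into the column and leaves the other half for the move out of it. Hence the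
      gain \<open>1 / 2\<close> per move.\<close>
    define p :: "node \<Rightarrow> real" where
      "p u = (case u of Row k \<Rightarrow> of_int (M * Y k) | Col i \<Rightarrow> of_int (Max (opt i)) + 1 / 2)" for u
    have "min_potential ?g 0 (1 / 2) U p"
      unfolding min_potential_def
    proof (intro conjI ballI)
      show "U \<subseteq> nodes ?g" by (auto simp: U_def D_def nodes_def game_of_simps)
      fix u assume u: "u \<in> U"
      show "if is_row u then \<forall>v\<in>succs ?g u. v \<in> U \<and> p u \<le> p v - (weight ?g u v - 0) - 1 / 2
        else \<exists>v\<in>succs ?g u. v \<in> U \<and> p u \<le> p v - (weight ?g u v - 0) - 1 / 2"
      proof (cases u)
        case (Row j)
        then have j: "j \<in> D" "j < N" using u by (auto simp: U_def D_def)
        have "v \<in> U \<and> p u \<le> p v - (weight ?g u v - 0) - 1 / 2" if "v \<in> succs ?g u" for v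
        proof -
          obtain i w where i: "v = Col i" "i < length H" "row_arcs ?g ! j ! i = Some w"
            using \<open>v \<in> succs ?g u\<close> succs_Row[of j ?g v] j Row by (auto simp: game_of_simps)
          then obtain a f where a: "fst (H ! i) ! j = Some (a, f)" "w = M * M * a"
            using roww[OF j(2) i(2)] by (auto split: option.splits)
          obtain k b h where k: "k \<in> D" "snd (H ! i) ! k = Some (b, h)"
            "if h then of_int a + X j < of_int b + X k else of_int a + X j \<le> of_int b + X k"
            using holdsE[OF XD0 i(2) _ j(2) a(1)] j(1) by (auto simp: D_def)
          have "M * (a - b) + Y j \<le> Y k - (if h then 1 else 0)"
            using Y[OF j(1) k(1), of "a - b"] k(3) by (auto split: if_splits)
          then have "M * a + Y j \<le> M * b + Y k - (if h then 1 else 0)" by (simp add: algebra_simps)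
          then have "M * (M * a + Y j) \<le> M * (M * b + Y k - (if h then 1 else 0))"
            using M by (intro mult_left_mono) auto
          moreover have in_opt: "M * (M * b + Y k - (if h then 1 else 0)) \<in> opt i" using k unfolding opt_def by blast
          ultimately have "M * (M * a + Y j) \<le> Max (opt i)" using Max_ge[OF fin in_opt] by linarith
          then have "real_of_int (M * (M * a + Y j)) \<le> of_int (Max (opt i))" by (simp only: of_int_le_iff)
          then have "p u \<le> p v - (weight ?g u v - 0) - 1 / 2"
            using i j Row a by (simp add: p_def weight_simps game_of_simps(1,2) algebra_simps)
          moreover have "v \<in> U" using i in_opt by (auto simp: U_def)
          ultimately show ?thesis by blast
        qed
        then show ?thesis using Row by simp
      next
        case (Col i)
        then have i: "i < length H" "opt i \<noteq> {}" using u by (auto simp: U_def)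
        have "Max (opt i) \<in> opt i" using Max_in[OF fin i(2)] .
        then obtain k b f where k: "Max (opt i) = M * (M * b + Y k - (if f then 1 else 0))" "k \<in> D"
          "snd (H ! i) ! k = Some (b, f)" unfolding opt_def by blast
        have kN: "k < N" using k(2) by (simp add: D_def)
        have c: "col_arcs ?g ! i ! k = Some (- (M * M * b) - 1 + (if f then M else 0))"
          using colw[OF kN i(1)] k(3) by simp
        have "Row k \<in> succs ?g u" using c i kN Col succs_Col[of i ?g "Row k"] by (simp add: game_of_simps(1,2))
        moreover have "Row k \<in> U" using k by (simp add: U_def)
        moreover have "p u \<le> p (Row k) - (weight ?g u (Row k) - 0) - 1 / 2"
        proof -
          have "p u = of_int (M * (M * b + Y k - (if f then 1 else 0))) + 1 / 2" using Col k(1) by (simp add: p_def)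
          then show ?thesis using c i kN Col
            by (cases f) (simp_all add: p_def weight_simps game_of_simps(1,2) algebra_simps)
        qed
        ultimately show ?thesis using Col by auto
      qed
    qed simp
    moreover have "Row 0 \<in> U" using 0 N by (auto simp: U_def D_def)
    ultimately show "\<exists>d U p. Row 0 \<in> U \<and> min_potential ?g 0 d U p" by blast
  next
    assume "\<exists>d U p. Row 0 \<in> U \<and> min_potential ?g 0 d U p"
    then obtain d U p where sU: "Row 0 \<in> U" and pot: "min_potential ?g 0 d U p" by blast
    have d: "0 < d" and Un: "U \<subseteq> nodes ?g" using pot by (auto simp: min_potential_def)
    define D where "D = {k. Row k \<in> U}"
    have DN: "D \<subseteq> {..<N}" using Un by (auto simp: D_def nodes_def game_of_simps)
    then have D: "finite D" "int (card D) < M"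
      using card_mono[OF _ DN] M finite_subset by auto
    \<comment> \<open>Rounding is applied to the integer parts of the potential; it divides by one
      factor \<open>M\<close> and absorbs the relaxation.\<close>
    obtain f :: "nat \<Rightarrow> int" where f: "\<And>j k w. j \<in> D \<Longrightarrow> k \<in> D \<Longrightarrow>
        \<lfloor>p (Row j)\<rfloor> \<le> \<lfloor>p (Row k)\<rfloor> + M * w + 1 \<Longrightarrow> f j \<le> f k + w"
      using round_off_slack[OF D, of "\<lambda>k. \<lfloor>p (Row k)\<rfloor>"] by blast
    \<comment> \<open>Division removes the other factor \<open>M\<close>. A strict inequality had an
      integral margin 1 before and keeps the margin \<open>1 / M\<close>.\<close>
    define X where "X k = real_of_int (f k) / of_int M" for k
    have "holds X D q" if qH: "q \<in> set H" for q
      unfolding holds_def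
    proof (intro allI impI)
      fix j a h assume j: "j \<in> D \<and> j < length (fst q) \<and> fst q ! j = Some (a, h)"
      obtain i where i: "i < length H" "q = H ! i" using qH by (metis in_set_conv_nth)
      have jN: "j < N" using j DN by auto
      have c: "row_arcs ?g ! j ! i = Some (M * M * a)" using roww[OF jN i(1)] j i by simp
      have "Col i \<in> succs ?g (Row j)" using c jN i succs_Row[of j ?g "Col i"] by (simp add: game_of_simps(1,2))
      then have 1: "Col i \<in> U" "p (Row j) \<le> p (Col i) - (weight ?g (Row j) (Col i) - 0) - d"
        using pot j unfolding min_potential_def D_def by fastforce+
      obtain v where v: "v \<in> succs ?g (Col i)" "v \<in> U" "p (Col i) \<le> p v - (weight ?g (Col i) v - 0) - d"
        using pot 1(1) unfolding min_potential_def by fastforce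
      obtain k w where k: "v = Row k" "k < N" "col_arcs ?g ! i ! k = Some w"
        using v(1) succs_Col[of i ?g v] i by (auto simp: game_of_simps(1,2))
      obtain b g where b: "snd q ! k = Some (b, g)" "w = - (M * M * b) - 1 + (if g then M else 0)"
        using colw[OF k(2) i(1)] k(3) i(2) by (auto split: option.splits)
      have kD: "k \<in> D" using v(2) k by (simp add: D_def)
      let ?w = "M * (b - a) - (if g then 1 else 0)"
      \<comment> \<open>The two moves through column \<open>i\<close> add up to this bound. Its unit
        is the relaxation of \<open>col_weight\<close>, in the form expected by
        \<open>round_off_slack\<close>.\<close>
      have "p (Row j) \<le> p (Row k) + of_int (M * ?w + 1)"
        using 1(2) v(3) k i jN c b(2) d by (simp add: weight_simps game_of_simps(1,2) algebra_simps split: if_splits)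
      then have "\<lfloor>p (Row j)\<rfloor> \<le> \<lfloor>p (Row k) + of_int (M * ?w + 1)\<rfloor>" by (rule floor_mono)
      then have "\<lfloor>p (Row j)\<rfloor> \<le> \<lfloor>p (Row k)\<rfloor> + M * ?w + 1" 
        using floor_add_int[of "p (Row k)" "M * ?w + 1"] by linarith
      then have "f j \<le> f k + ?w" using f j kD by blast
      then have "real_of_int (f j) \<le> of_int (f k + ?w)" by (simp only: of_int_le_iff)
      then have "X j \<le> of_int (f k + ?w) / of_int M" using M unfolding X_def by (intro divide_right_mono) auto
      also have "\<dots> = X k + of_int (b - a) - (if g then 1 / of_int M else 0)"
        using M by (simp add: X_def field_simps)
      finally have le: "X j \<le> X k + (of_int b - of_int a) - (if g then 1 / of_int M else 0)" by simp
      have pos: "0 < 1 / real_of_int M" using M by simp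
      have "of_int a + X j < of_int b + X k" if g
        using le pos unfolding if_P[OF that] by linarith
      then have "if g then of_int a + X j < of_int b + X k else of_int a + X j \<le> of_int b + X k"
        using le by (auto split: if_splits)
      moreover have "k < length (snd q)" using len[OF qH] k by simp
      ultimately show "\<exists>k b g. k \<in> D \<and> k < length (snd q) \<and> snd q ! k = Some (b, g) \<and>
          (if g then of_int a + X j < of_int b + X k else of_int a + X j \<le> of_int b + X k)"
        using kD b(1) by blast
    qed
    moreover have "0 \<in> D" using sU by (simp add: D_def)
    ultimately show "feasible H" unfolding feasible_def by blast
  qed
  then show ?thesis using winning_iff_no_min_potential[OF mean_payoff_game_of[OF len rhs lhs] s] by blast
qed

section \<open>Refuting an implication\<close>

definition zero_coef :: coef where
  "zero_coef = Some (0, False)"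

definition mark :: "coef \<Rightarrow> coef" where
  "mark = map_option (\<lambda>(a, f). (a, True))"

definition plain_part :: "coef \<Rightarrow> coef" where
  "plain_part c = (if is_plain c then c else None)"

text \<open>The mark is removed because the negation of a strict bound is weak; conversely
  \<open>mark\<close> provides the strict bounds that arise from negating weak ones.\<close>

definition marked_part :: "coef \<Rightarrow> coef" where
  "marked_part c = (if is_plain c then None else map_option (\<lambda>(a, f). (a, False)) c)"

text \<open>The entry in front belongs to the new homogenizing variable, the one at the end to the
  variable that is forced to be infinite.\<close>

definition frame :: "coef \<Rightarrow> coef list \<Rightarrow> coef \<Rightarrow> coef list" where
  "frame c A d = c # A @ [d]"

text \<open>The negation of \<open>A \<le> B\<close> says that the form \<open>A\<close> is finite, exceeds the plain part of \<open>B\<close>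
  strictly, and is at least the modulus of the rest. Finiteness is expressed by a new homogenizing
  variable (the first one) below \<open>A\<close> and below the old one. The last variable is forced to \<open>-\<infinity>\<close>;
  together with the trivial inequality it provides the arcs required in a game.\<close>

definition refutation :: "nat \<Rightarrow> (coef list \<times> coef list) list \<Rightarrow> coef list \<times> coef list \<Rightarrow>
    (coef list \<times> coef list) list" where
  "refutation n S q = map (\<lambda>p. (frame None (fst p) None, frame None (snd p) zero_coef)) S @
     [(frame None (map plain_part (snd q)) None, frame None (map mark (fst q)) zero_coef),
      (frame zero_coef (map marked_part (snd q)) None, frame None (fst q) zero_coef),
      (frame zero_coef (replicate (n + 1) None) None, frame None (zero_coef # replicate n None) zero_coef),
      (frame zero_coef (replicate (n + 1) zero_coef) zero_coef, frame zero_coef (replicate (n + 1) zero_coef) zero_coef),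
      (frame None (replicate (n + 1) None) (Some (1, False)), frame None (replicate (n + 1) None) zero_coef)]"

text \<open>The right-hand form bounds the number \<open>r\<close>, strictly at marked terms.
  Separated from \<open>holds\<close>, it lets the left terms be treated one at a time.\<close>

definition reaches :: "(nat \<Rightarrow> real) \<Rightarrow> nat set \<Rightarrow> coef list \<Rightarrow> real \<Rightarrow> bool" where
  "reaches X D B r \<longleftrightarrow> (\<exists>k b g. k \<in> D \<and> k < length B \<and> B ! k = Some (b, g) \<and>
     (if g then r < of_int b + X k else r \<le> of_int b + X k))"

lemma holds_reaches:
  "holds X D (A, B) \<longleftrightarrow> (\<forall>j a f. j \<in> D \<and> j < length A \<and> A ! j = Some (a, f) \<longrightarrow> reaches X D B (of_int a + X j))"
  by (simp add: holds_def reaches_def)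

lemma nth_frame:
  "j < length (frame c A d) \<and> frame c A d ! j = x \<longleftrightarrow>
     j = 0 \<and> c = x \<or> (\<exists>i<length A. j = Suc i \<and> A ! i = x) \<or> j = Suc (length A) \<and> d = x"
  by (cases j) (auto simp: frame_def nth_append less_Suc_eq)

lemma reaches_frame:
  "reaches X D (frame c B d) r \<longleftrightarrow>
     0 \<in> D \<and> (\<exists>b g. c = Some (b, g) \<and> (if g then r < of_int b + X 0 else r \<le> of_int b + X 0)) \<or>
     reaches (\<lambda>k. X (Suc k)) {k. Suc k \<in> D} B r \<or>
     Suc (length B) \<in> D \<and> (\<exists>b g. d = Some (b, g) \<and>
       (if g then r < of_int b + X (Suc (length B)) else r \<le> of_int b + X (Suc (length B))))"
proof -
  have "reaches X D (frame c B d) r \<longleftrightarrow> (\<exists>k b g. (k < length (frame c B d) \<and> frame c B d ! k = Some (b, g)) \<and>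
     k \<in> D \<and> (if g then r < of_int b + X k else r \<le> of_int b + X k))"
    unfolding reaches_def by blast
  then show ?thesis unfolding nth_frame unfolding reaches_def by blast
qed

lemma holds_frame:
  "holds X D (frame c A d, B) \<longleftrightarrow>
     (0 \<in> D \<longrightarrow> (\<forall>a f. c = Some (a, f) \<longrightarrow> reaches X D B (of_int a + X 0))) \<and>
     (\<forall>j a f. Suc j \<in> D \<and> j < length A \<and> A ! j = Some (a, f) \<longrightarrow> reaches X D B (of_int a + X (Suc j))) \<and>
     (Suc (length A) \<in> D \<longrightarrow> (\<forall>a f. d = Some (a, f) \<longrightarrow> reaches X D B (of_int a + X (Suc (length A)))))"
proof -
  have "holds X D (frame c A d, B) \<longleftrightarrow> (\<forall>j a f. (j < length (frame c A d) \<and> frame c A d ! j = Some (a, f)) \<longrightarrow>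
     j \<in> D \<longrightarrow> reaches X D B (of_int a + X j))"
    unfolding holds_reaches by blast
  then show ?thesis unfolding nth_frame by blast
qed

lemma not_reaches_None [simp]: "\<not> reaches X D (replicate m None) r"
  by (auto simp: reaches_def)

text \<open>Dropping the frame of a solution gives a counterexample to the implication; conversely a
  counterexample only needs a small enough value for the new homogenizing variable.\<close>

lemma refutation_feasible:
  assumes S: "\<forall>p\<in>set S. proper n p" and q: "proper n q"
  shows "feasible (refutation n S q) \<longleftrightarrow>
    (\<exists>X D. 0 \<in> D \<and> (\<forall>p\<in>set S. holds X D p) \<and> \<not> holds X D q)"
proof -
  obtain A B where AB: "q = (A, B)" by (cases q)
  have len: "length A = n + 1" "length B = n + 1" using q AB by (auto simp: proper_def)
  show ?thesis
  proof
    assume "feasible (refutation n S q)"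
    then obtain X D where 0: "0 \<in> D" and H: "\<forall>p\<in>set (refutation n S q). holds X D p"
      by (auto simp: feasible_def)
    let ?X = "\<lambda>k. X (Suc k)" and ?D = "{k. Suc k \<in> D}"
    \<comment> \<open>If the last coordinate \<open>x\<close> were finite, the last inequality would
      read \<open>1 + x \<le> x\<close>.\<close>
    have bot: "Suc (n + 1) \<notin> D"
    proof
      assume *: "Suc (n + 1) \<in> D"
      have "holds X D (frame None (replicate (n + 1) None) (Some (1, False)), frame None (replicate (n + 1) None) zero_coef)"
        using H by (simp add: refutation_def)
      then have "reaches X D (frame None (replicate (n + 1) None) zero_coef) (of_int 1 + X (Suc (n + 1)))"
        using * unfolding holds_frame by (simp add: ex_bool_eq del: replicate_Suc)
      then show False unfolding reaches_frame by (auto simp: zero_coef_def simp del: replicate_Suc split: if_splits)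
    qed
    have fr: "reaches X D (frame None C d) r \<longleftrightarrow> reaches ?X ?D C r" if "length C = n + 1" for C d r
      using bot that by (simp add: reaches_frame)
    have hf: "holds X D (frame None A' None, frame None C d) \<longleftrightarrow> holds ?X ?D (A', C)" if "length C = n + 1" for A' C d
      unfolding holds_frame[of X D None A' None] fr[OF that] holds_reaches[of ?X ?D A' C] by simp
    have "holds ?X ?D p" if "p \<in> set S" for p
    proof -
      have "length (snd p) = n + 1" using S that by (auto simp: proper_def)
      moreover have "holds X D (frame None (fst p) None, frame None (snd p) zero_coef)"
        using H that by (simp add: refutation_def)
      ultimately show ?thesis using hf by fastforce
    qed
    moreover have "0 \<in> ?D"
    proof -
      have "holds X D (frame zero_coef (replicate (n + 1) None) None, frame None (zero_coef # replicate n None) zero_coef)"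
        using H by (simp add: refutation_def)
      then have "reaches X D (frame None (zero_coef # replicate n None) zero_coef) (of_int 0 + X 0)"
        unfolding holds_frame using 0 zero_coef_def by blast
      then have "reaches ?X ?D (zero_coef # replicate n None) (of_int 0 + X 0)"
        using fr by simp
      then obtain k b g where k: "Suc k \<in> D" "k < Suc n" "(zero_coef # replicate n None) ! k = Some (b, g)"
        unfolding reaches_def by force
      then have "k = 0" by (cases k) auto
      then show ?thesis using k by simp
    qed
    moreover have "\<not> holds ?X ?D q"
    proof -
      have q1: "holds ?X ?D (map plain_part B, map mark A)"
        using H AB len hf by (simp add: refutation_def)
      have q2: "holds X D (frame zero_coef (map marked_part B) None, frame None A zero_coef)"
        using H AB by (simp add: refutation_def)
      \<comment> \<open>The finite terms of the left form. The new homogenizing variable is finite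
        and bounded by this form, so \<open>V\<close> is nonempty; its maximum is the value of the
        form and the term that the right-hand side fails to reach.\<close>
      define V where "V = {of_int a + X (Suc j) |j a f. Suc j \<in> D \<and> j < length A \<and> A ! j = Some (a, f)}"
      have "V \<subseteq> (\<lambda>j. case A ! j of None \<Rightarrow> 0 | Some (a, f) \<Rightarrow> of_int a + X (Suc j)) ` {..<length A}"
        unfolding V_def by force
      then have fV: "finite V" using finite_surj[of "{..<length A}"] by blast
      have mid: "reaches ?X ?D A (of_int b + X (Suc k))"
        if "Suc k \<in> D \<and> k < length B \<and> map marked_part B ! k = Some (b, f)" for k b f
        using q2 that unfolding holds_frame fr[OF len(1)] length_map by blast
      have mid': "reaches ?X ?D (map mark A) (of_int b + X (Suc k))"
        if "k \<in> ?D \<and> k < length B \<and> map plain_part B ! k = Some (b, f)" for k b f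
        using q1 that unfolding holds_reaches length_map by blast
      have reV: "\<exists>v\<in>V. r \<le> v" if re: "reaches ?X ?D A r" for r
      proof -
        obtain k b g where k: "Suc k \<in> D" "k < length A" "A ! k = Some (b, g)"
          "if g then r < of_int b + X (Suc k) else r \<le> of_int b + X (Suc k)"
          using re unfolding reaches_def by blast
        then have "of_int b + X (Suc k) \<in> V" unfolding V_def by blast
        moreover have "r \<le> of_int b + X (Suc k)" using k(4) by (auto split: if_splits)
        ultimately show ?thesis by blast
      qed
      have "reaches ?X ?D A (of_int 0 + X 0)"
        using q2 0 fr[OF len(1)] unfolding holds_frame zero_coef_def by blast
      then have "V \<noteq> {}" using reV by blast
      then have "Max V \<in> V" using fV by simp
      then obtain j a f where j: "Max V = of_int a + X (Suc j)" "Suc j \<in> D" "j < length A" "A ! j = Some (a, f)"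
        unfolding V_def by blast
      have "\<not> reaches ?X ?D B (Max V)"
      proof
        assume "reaches ?X ?D B (Max V)"
        then obtain k b g where k: "Suc k \<in> D" "k < length B" "B ! k = Some (b, g)"
          "if g then Max V < of_int b + X (Suc k) else Max V \<le> of_int b + X (Suc k)"
          unfolding reaches_def by blast
        show False
        proof (cases g)
          case True
          then have "map marked_part B ! k = Some (b, False)" using k by (simp add: marked_part_def)
          then have "reaches ?X ?D A (of_int b + X (Suc k))"
            using mid k by blast
          then obtain v where "v \<in> V" "of_int b + X (Suc k) \<le> v" using reV by blast
          then show False using Max_ge[OF fV, of v] k(4) True by simp
        next
          case False
          then have "map plain_part B ! k = Some (b, False)" using k by (simp add: plain_part_def)
          then have "reaches ?X ?D (map mark A) (of_int b + X (Suc k))"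
            using mid' k by blast
          then obtain i c where i: "Suc i \<in> D" "i < length A" "map mark A ! i = Some (c, True)"
            "of_int b + X (Suc k) < of_int c + X (Suc i)"
            unfolding reaches_def by (auto simp: mark_def split: if_splits)
          then have "of_int c + X (Suc i) \<in> V" unfolding V_def by (auto simp: mark_def)
          then show False using Max_ge[OF fV] i(4) k(4) False by force
        qed
      qed
      then show ?thesis using j AB unfolding AB holds_reaches by auto
    qed
    ultimately show "\<exists>X D. 0 \<in> D \<and> (\<forall>p\<in>set S. holds X D p) \<and> \<not> holds X D q"
      by (intro exI[of _ ?X] exI[of _ ?D] conjI ballI)
  next
    assume "\<exists>X D. 0 \<in> D \<and> (\<forall>p\<in>set S. holds X D p) \<and> \<not> holds X D q"
    then obtain X D where 0: "0 \<in> D" and HS: "\<And>p. p \<in> set S \<Longrightarrow> holds X D p" and Hq: "\<not> holds X D q" by blast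
    obtain j a f where j: "j \<in> D" "j < length A" "A ! j = Some (a, f)" "\<not> reaches X D B (of_int a + X j)"
      using Hq unfolding AB holds_reaches by blast
    have "\<not> f" using q AB j nth_mem[of j A] by (cases f) (auto simp: proper_def)
    \<comment> \<open>The violating term \<open>of_int a + X j\<close> is the value to be undercut:
      the new homogenizing variable must lie below it and below the old homogenizing
      variable.\<close>
    define X' where "X' k = (case k of 0 \<Rightarrow> min (X 0) (of_int a + X j) | Suc k \<Rightarrow> X k)" for k
    \<comment> \<open>Cutting off at \<open>n\<close> keeps the last variable of the frame
      infinite.\<close>
    define D' where "D' = insert 0 (Suc ` (D \<inter> {..n}))"
    have X': "(\<lambda>k. X' (Suc k)) = X" "X' 0 = min (X 0) (of_int a + X j)" by (auto simp: X'_def)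
    have D': "{k. Suc k \<in> D'} = D \<inter> {..n}" "0 \<in> D'" "Suc (n + 1) \<notin> D'" by (auto simp: D'_def)
    have rn: "reaches X (D \<inter> {..n}) C r \<longleftrightarrow> reaches X D C r" if "length C = n + 1" for C r
      using that by (auto simp: reaches_def less_Suc_eq_le)
    have fr: "reaches X' D' (frame None C d) r \<longleftrightarrow> reaches X D C r" if "length C = n + 1" for C d r
      using D' that by (simp add: reaches_frame X' rn)
    have lhs: "Suc i \<in> D' \<and> i < length C \<longleftrightarrow> i \<in> D \<and> i < length C" if "length C = n + 1" for i and C :: "coef list"
      using that by (auto simp: D'_def)
    have hf: "holds X' D' (frame None A' None, frame None C d) \<longleftrightarrow> holds X D (A', C)"
      if "length C = n + 1" "length A' = n + 1" for A' C d
      unfolding holds_frame[of X' D' None A' None] fr[OF that(1)] holds_reaches[of X D A' C]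
      using lhs[OF that(2)] by (auto simp: X'_def)
    have reA: "reaches X D A (X' 0)" unfolding reaches_def
      using j \<open>\<not> f\<close> X'(2) by (intro exI[of _ j] exI[of _ a] exI[of _ f]) auto
    have "\<forall>p\<in>set (refutation n S q). holds X' D' p"
    proof -
      have 1: "holds X' D' (frame None (fst p) None, frame None (snd p) zero_coef)" if "p \<in> set S" for p
      proof -
        have "length (snd p) = n + 1" "length (fst p) = n + 1" using S that by (auto simp: proper_def)
        then show ?thesis using hf HS[OF that] by simp
      qed
      have 2: "holds X D (map plain_part B, map mark A)"
        unfolding holds_reaches
      proof (intro allI impI)
        fix k b h assume k: "k \<in> D \<and> k < length (map plain_part B) \<and> map plain_part B ! k = Some (b, h)"
        then have "B ! k = Some (b, False)" "k < length B" "k \<in> D"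
          by (auto simp: plain_part_def split: if_splits)
        then have "of_int b + X k < of_int a + X j" using j(4) unfolding reaches_def by force
        then show "reaches X D (map mark A) (of_int b + X k)"
          unfolding reaches_def using j by (intro exI[of _ j] exI[of _ a] exI[of _ True]) (simp add: mark_def)
      qed
      have 3: "holds X' D' (frame zero_coef (map marked_part B) None, frame None A zero_coef)"
        unfolding holds_frame fr[OF len(1)]
      proof (intro conjI allI impI)
        fix c h assume "zero_coef = Some (c, h)"
        then show "reaches X D A (of_int c + X' 0)" using reA by (simp add: zero_coef_def)
      next
        fix k b h assume k: "Suc k \<in> D' \<and> k < length (map marked_part B) \<and> map marked_part B ! k = Some (b, h)"
        then have "B ! k = Some (b, True)" "k < length B" "k \<in> D"
          using D'(1) by (cases "B ! k" rule: coeff.cases; auto simp: marked_part_def)+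
        then have "of_int b + X k \<le> of_int a + X j" using j(4) unfolding reaches_def by force
        then show "reaches X D A (of_int b + X' (Suc k))"
          unfolding reaches_def using j \<open>\<not> f\<close>
          by (intro exI[of _ j] exI[of _ a] exI[of _ False]) (simp add: X'_def)
      qed simp
      have 4: "holds X' D' (frame zero_coef (replicate (n + 1) None) None, frame None (zero_coef # replicate n None) zero_coef)"
      proof -
        have "reaches X D (zero_coef # replicate n None) (X' 0)"
          unfolding reaches_def using 0 X'(2)
          by (intro exI[of _ 0] exI[of _ 0] exI[of _ False]) (simp add: zero_coef_def)
        then have "reaches X' D' (frame None (zero_coef # replicate n None) zero_coef) (X' 0)" using fr by simp
        then show ?thesis unfolding holds_frame by (auto simp: zero_coef_def simp del: replicate_Suc)
      qed
      have self: "holds X' D' (C, C)" if "\<forall>c\<in>set C. c = zero_coef" for C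
        unfolding holds_reaches
      proof (intro allI impI)
        fix j a f assume *: "j \<in> D' \<and> j < length C \<and> C ! j = Some (a, f)"
        then have "Some (a, f) = zero_coef" using that nth_mem[of j C] by auto
        then show "reaches X' D' C (of_int a + X' j)"
          unfolding reaches_def using * by (intro exI[of _ j] exI[of _ a] exI[of _ f]) (simp add: zero_coef_def)
      qed
      have 5: "holds X' D' (frame zero_coef (replicate (n + 1) zero_coef) zero_coef, frame zero_coef (replicate (n + 1) zero_coef) zero_coef)"
        by (rule self) (auto simp: frame_def)
      have 6: "holds X' D' (frame None (replicate (n + 1) None) (Some (1, False)), frame None (replicate (n + 1) None) zero_coef)"
        unfolding holds_frame using D'(3) by (auto simp del: replicate_Suc)
      show ?thesis using 1 2 3 4 5 6 hf len AB by (simp add: refutation_def)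
    qed
    then show "feasible (refutation n S q)" unfolding feasible_def using D'(2) by blast
  qed
qed

text \<open>Homogenizing gives \<open>n + 1\<close> coordinates and the frame two more, hence
  \<open>n + 3\<close> rows. The exponent \<open>n + 2\<close> is one more than the unary number
  \<open>n + 1\<close> that the program keeps, and \<open>n + 3 < 2 ^ (n + 2)\<close>.\<close>

theorem implied_iff_winning:
  assumes S: "\<forall>p\<in>set S. proper n p" and q: "proper n q"
  shows "mean_payoff_game (game_of (n + 2) (n + 3) (refutation n S q))"
    and "winning (game_of (n + 2) (n + 3) (refutation n S q)) (Row 0) \<longleftrightarrow>
      implied_by n (map inequality_of S) (inequality_of q)"
proof -
  let ?H = "refutation n S q"
  have len: "length (fst p) = n + 3 \<and> length (snd p) = n + 3" if "p \<in> set ?H" for p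
    using that S q by (auto simp: refutation_def frame_def proper_def)
  have rhs: "\<exists>c\<in>set (snd p). c \<noteq> None" if "p \<in> set ?H" for p
    using that by (auto simp: refutation_def frame_def zero_coef_def)
  have lhs: "\<exists>p\<in>set ?H. fst p ! k \<noteq> None" if "k < n + 3" for k
  proof -
    let ?p = "(frame zero_coef (replicate (n + 1) zero_coef) zero_coef, frame zero_coef (replicate (n + 1) zero_coef) zero_coef)"
    have "frame zero_coef (replicate (n + 1) zero_coef) zero_coef = replicate (n + 3) zero_coef"
      by (simp add: frame_def replicate_append_same[symmetric] eval_nat_numeral)
    then show ?thesis using that by (intro bexI[of _ ?p]) (auto simp: refutation_def zero_coef_def simp del: replicate_Suc)
  qed
  have pow: "n + 3 < 2 ^ (n + 2)" by (induction n) auto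
  show "mean_payoff_game (game_of (n + 2) (n + 3) ?H)"
    by (rule mean_payoff_game_of[OF len rhs lhs])
  show "winning (game_of (n + 2) (n + 3) ?H) (Row 0) \<longleftrightarrow> implied_by n (map inequality_of S) (inequality_of q)"
    using winning_game_of[OF len rhs lhs _ pow] refutation_feasible[OF S q] implied_by_iff[OF S q] by simp
qed

section \<open>From implication to games\<close>

subsection \<open>Checking the instance\<close>

lemma word_power_image: "word_power (e ` X) k = {concat (map e xs) |xs. length xs = k \<and> set xs \<subseteq> X}"
proof (induction k)
  case (Suc k)
  show ?case
  proof
    show "word_power (e ` X) (Suc k) \<subseteq> {concat (map e xs) |xs. length xs = Suc k \<and> set xs \<subseteq> X}"
    proof
      fix w assume "w \<in> word_power (e ` X) (Suc k)"
      then obtain x xs where "w = e x @ concat (map e xs)" "x \<in> X" "length xs = k" "set xs \<subseteq> X"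
        by (auto simp: catenate_def Suc)
      then show "w \<in> {concat (map e xs) |xs. length xs = Suc k \<and> set xs \<subseteq> X}"
        by (intro CollectI exI[of _ "x # xs"]) auto
    qed
    show "{concat (map e xs) |xs. length xs = Suc k \<and> set xs \<subseteq> X} \<subseteq> word_power (e ` X) (Suc k)"
    proof
      fix w assume "w \<in> {concat (map e xs) |xs. length xs = Suc k \<and> set xs \<subseteq> X}"
      then obtain x xs where "w = e x @ concat (map e xs)" "x \<in> X" "length xs = k" "set xs \<subseteq> X"
        by (auto simp: length_Suc_conv)
      moreover have "concat (map e xs) \<in> word_power (e ` X) k" unfolding Suc using calculation by blast
      ultimately show "w \<in> word_power (e ` X) (Suc k)" by (auto intro!: catenateI)
    qed
  qed
qed auto

lemma word_star_image: "word_star (e ` X) = {concat (map e xs) |xs. set xs \<subseteq> X}"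
proof
  show "word_star (e ` X) \<subseteq> {concat (map e xs) |xs. set xs \<subseteq> X}"
  proof
    fix w assume "w \<in> word_star (e ` X)"
    then obtain us where us: "w = concat us" "set us \<subseteq> e ` X" by (auto simp: word_star_def)
    have "map e (map (inv_into X e) us) = us"
      using us(2) by (auto simp: f_inv_into_f subset_iff intro!: map_idI)
    moreover have "set (map (inv_into X e) us) \<subseteq> X" using us(2) by (auto intro!: inv_into_into)
    ultimately show "w \<in> {concat (map e xs) |xs. set xs \<subseteq> X}" using us(1) by (metis (mono_tags) mem_Collect_eq)
  qed
  show "{concat (map e xs) |xs. set xs \<subseteq> X} \<subseteq> word_star (e ` X)"
  proof
    fix w assume "w \<in> {concat (map e xs) |xs. set xs \<subseteq> X}"
    then obtain xs where "w = concat (map e xs)" "set xs \<subseteq> X" by auto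
    then show "w \<in> word_star (e ` X)" unfolding word_star_def
      by (intro CollectI exI[of _ "map e xs"]) auto
  qed
qed

lemma prefix_free_word_power: "prefix_free A \<Longrightarrow> prefix_free (word_power A k)"
proof (induction k)
  case (Suc k)
  show ?case unfolding prefix_free_def
  proof (intro ballI allI impI)
    fix u v r r' assume u: "u \<in> word_power A (Suc k)" "v \<in> word_power A (Suc k)" and eq: "u @ r = v @ r'"
    obtain u1 u2 v1 v2 where *: "u = u1 @ u2" "v = v1 @ v2" "u1 \<in> A" "v1 \<in> A"
      "u2 \<in> word_power A k" "v2 \<in> word_power A k" using u by (auto simp: catenate_def)
    have e1: "u1 @ u2 @ r = v1 @ v2 @ r'" using eq * by simp
    from prefix_freeD[OF Suc.prems e1 *(3,4)] have "u1 = v1" .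
    with e1 have "u2 @ r = v2 @ r'" by simp
    from prefix_freeD[OF Suc.IH[OF Suc.prems] this *(5,6)] \<open>u1 = v1\<close> show "u = v" using * by simp
  qed
qed (simp add: prefix_free_def)

lemma prefix_free_singleton [simp]: "prefix_free {u}"
  by (simp add: prefix_free_def)

definition shaped :: "nat \<Rightarrow> (coef list \<times> coef list) set" where
  "shaped a = {q. length (fst q) = a \<and> length (snd q) = a \<and> (\<forall>c\<in>set (fst q). is_plain c)}"

definition scan_ineq :: "symbol com" where
  "scan_ineq = expect {OpenList} ;; repeat 2 5 scan_arc ;; expect {CloseList} ;;
     expect {OpenList} ;; repeat 2 5 scan_coef ;; expect {CloseList}"

lemma recognizes_ineq: "recognizes {5, 6} scan_ineq (\<lambda>a b. encode_ineq ` shaped a)"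
proof -
  let ?A = "word_power (range encode_arc)" and ?C = "word_power (range encode_coef)"
  have pf: "prefix_free (?A k)" "prefix_free (?C k)" for k
    by (intro prefix_free_word_power prefix_free_image readable_arc readable_coef)+
  have ex: "recognizes {5, 6} (expect {c}) (\<lambda>_ _. {[c]})" for c
    using recognizes_weaken[OF recognizes_expect[of "{c}"], of "{5, 6}"] by simp
  have rA: "recognizes {5, 6} (repeat 2 5 scan_arc) (\<lambda>a b. ?A a)"
    using recognizes_repeat[OF recognizes_arc, of 5 2] prefix_free_image[OF readable_arc] by simp
  have rC: "recognizes {5, 6} (repeat 2 5 scan_coef) (\<lambda>a b. ?C a)"
    using recognizes_repeat[OF recognizes_coef, of 5 2] prefix_free_image[OF readable_coef] by simp
  have "recognizes {5, 6} scan_ineq (\<lambda>a b. {[OpenList]} \<star> ?A a \<star> {[CloseList]} \<star> {[OpenList]} \<star> ?C a \<star> {[CloseList]})"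
    unfolding scan_ineq_def by (intro recognizes_seq ex rA rC pf prefix_free_singleton)
  moreover have "{[OpenList]} \<star> ?A a \<star> {[CloseList]} \<star> {[OpenList]} \<star> ?C a \<star> {[CloseList]} = encode_ineq ` shaped a"
    (is "?L = ?R") for a
  proof
    show "?L \<subseteq> ?R"
    proof
      fix w assume "w \<in> ?L"
      then obtain x y where w: "w = OpenList # x @ CloseList # OpenList # y @ [CloseList]" "x \<in> ?A a" "y \<in> ?C a"
        by (auto simp: catenate_def)
      obtain A where A: "x = concat (map encode_coef A)" "length A = a" "\<forall>c\<in>set A. is_plain c"
        using w(2) unfolding plain_coefs[symmetric] word_power_image by auto
      obtain C where C: "y = concat (map encode_coef C)" "length C = a"
        using w(3) unfolding word_power_image by auto
      show "w \<in> ?R" by (rule image_eqI[of _ _ "(A, C)"])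
        (use w A C in \<open>auto simp: encode_ineq_def encode_list_def shaped_def\<close>)
    qed
    show "?R \<subseteq> ?L"
    proof
      fix w assume "w \<in> ?R"
      then obtain A C where w: "w = [OpenList] @ concat (map encode_coef A) @ [CloseList] @ [OpenList] @
          concat (map encode_coef C) @ [CloseList]" "(A, C) \<in> shaped a"
        by (auto simp: encode_ineq_def encode_list_def)
      have "concat (map encode_coef A) \<in> ?A a" "concat (map encode_coef C) \<in> ?C a"
        using w(2) unfolding plain_coefs[symmetric] word_power_image by (auto simp: shaped_def)
      then show "w \<in> ?L" unfolding w(1) by (intro catenateI) auto
    qed
  qed
  ultimately show ?thesis by simp
qed

definition scan_implication :: "symbol com" where
  "scan_implication = (expect {OpenList} ;; until_close scan_ineq) ;; scan_ineq"

lemma recognizes_implication: "recognizes {5, 6} scan_implication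
    (\<lambda>a b. {encode_list encode_ineq S @ encode_ineq q |S q. set S \<subseteq> shaped a \<and> q \<in> shaped a})"
proof -
  have pf: "prefix_free (encode_ineq ` shaped a)" for a
    by (intro prefix_free_image uniquely_readable_subset[OF readable_ineq]) simp
  have pl: "prefix_free (encode_list encode_ineq ` {S. set S \<subseteq> shaped a})" for a
    by (intro prefix_free_image uniquely_readable_subset[OF readable_ineq_list]) simp
  have ex: "recognizes {5, 6} (expect {c}) (\<lambda>_ _. {[c]})" for c
    using recognizes_weaken[OF recognizes_expect[of "{c}"], of "{5, 6}"] by simp
  have "recognizes {5, 6} (expect {OpenList} ;; until_close scan_ineq)
      (\<lambda>a b. {[OpenList]} \<star> word_star (encode_ineq ` shaped a) \<star> {[CloseList]})"
    by (intro recognizes_seq ex recognizes_until_close recognizes_ineq pf prefix_free_singleton)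
      (auto simp: encode_ineq_def encode_list_def)
  moreover have "{[OpenList]} \<star> word_star (encode_ineq ` shaped a) \<star> {[CloseList]} =
      encode_list encode_ineq ` {S. set S \<subseteq> shaped a}" for a
    unfolding word_star_image by (force simp: catenate_def encode_list_def)
  ultimately have "recognizes {5, 6} (expect {OpenList} ;; until_close scan_ineq)
      (\<lambda>a b. encode_list encode_ineq ` {S. set S \<subseteq> shaped a})" by simp
  from recognizes_seq[OF this recognizes_ineq pl] show ?thesis
    unfolding scan_implication_def[symmetric] by (rule back_subst[of "recognizes _ _"])
      (force simp: catenate_def fun_eq_iff)
qed

text \<open>The additional mark in register 2 accounts for the constant term: coefficient lists have
  \<open>n + 1\<close> entries.\<close>

definition read_size :: "symbol com" where
  "read_size = Loop (\<lambda>t. t 0 = Some Dig1) (put 2 Dig1 ;; shift) ;; put 2 Dig1 ;; expect {EndNum}"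

lemma sem_read_size:
  assumes "length w < B"
  shows "(\<exists>n r. w = encode_size n @ r \<and>
      sem B read_size (input w) = Done ((advance (encode_size n) (input w))(2 := ones (n + 1)))) \<or>
    (\<forall>n r. w \<noteq> encode_size n @ r) \<and> sem B read_size (input w) = Aborted"
proof -
  define n where "n = length (takeWhile (\<lambda>c. c = Dig1) w)"
  let ?d = "dropWhile (\<lambda>c. c = Dig1) w"
  have n: "n \<le> length w" unfolding n_def by (rule length_takeWhile_le)
  have w: "w = ones n @ ?d" unfolding n_def takeWhile_eq_replicate[symmetric] by simp
  have dw: "drop n w = ?d" using arg_cong[OF w, of "drop n"] by simp
  have fold: "fold (\<lambda>x s. s(2 := Dig1 # s 2, 9 := Dig1 # s 9)) (replicate k ()) s =
      s(2 := ones k @ s 2, 9 := ones k @ s 9)" for k and s :: "symbol stacks"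
    by (induction k arbitrary: s) (auto simp: fun_eq_iff replicate_app_Cons)
  have cc: "concat (map (\<lambda>_. [Dig1]) (replicate k ())) = ones k" for k by (induction k) auto
  have "sem B (Loop (\<lambda>t. t 0 = Some Dig1) (put 2 Dig1 ;; shift)) (input w) =
      Done ((fold (\<lambda>x s. s(2 := Dig1 # s 2, 9 := Dig1 # s 9)) (replicate n ()) (input w))(0 := ?d))"
    unfolding sem.simps
  proof (rule iterate_items[where P = "\<lambda>_. True" and e = "\<lambda>_. [Dig1]"])
    show "\<not> tops (s(0 := ?d)) 0 = Some Dig1" for s
      by (auto split: list.splits) (metis (full_types) hd_dropWhile list.sel(1) list.simps(3))
    show "input w 0 = concat (map (\<lambda>_. [Dig1]) (replicate n ())) @ ?d"
      using w by (simp add: cc input_def)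
  qed (use assms n in \<open>auto simp: shift_def fun_eq_iff\<close>)
  also have "(fold (\<lambda>x s. s(2 := Dig1 # s 2, 9 := Dig1 # s 9)) (replicate n ()) (input w))(0 := ?d) =
      (advance (ones n) (input w))(2 := ones n)"
    unfolding fold by (simp add: input_def advance_def fun_eq_iff dw)
  finally have 1: "sem B (Loop (\<lambda>t. t 0 = Some Dig1) (put 2 Dig1 ;; shift)) (input w) =
    Done ((advance (ones n) (input w))(2 := ones n))" .
  let ?s = "(advance (ones n) (input w))(2 := ones (n + 1))"
  have s0: "?s 0 = ?d" "?s 1 = []" by (simp_all add: advance_def input_def dw)
  have r: "sem B read_size (input w) = sem B (expect {EndNum}) ?s"
    unfolding read_size_def sem.simps(6) 1 by simp
  show ?thesis
  proof (cases "\<exists>r. ?d = EndNum # r")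
    case True
    then obtain r where d: "?d = EndNum # r" by blast
    have "sem B read_size (input w) = Done (advance [EndNum] ?s)"
      using sem_shift[of ?s EndNum r B] s0 d by (simp add: \<open>sem B read_size _ = _\<close> expect_def tops_def)
    also have "advance [EndNum] ?s = (advance (encode_size n) (input w))(2 := ones (n + 1))"
      by (simp add: advance_upd advance_append encode_size_def)
    finally have "sem B read_size (input w) = Done ((advance (encode_size n) (input w))(2 := ones (n + 1)))" .
    moreover have "w = encode_size n @ r" using w d by (simp add: encode_size_def)
    ultimately show ?thesis by blast
  next
    case False
    have "w \<noteq> encode_size m @ r" for m r
    proof
      assume "w = encode_size m @ r"
      then have "?d = EndNum # r" by (simp add: encode_size_def dropWhile_append)
      then show False using False by blast
    qed
    moreover have "tops ?s 0 \<noteq> Some EndNum" using False s0 by (auto simp: tops_def split: list.splits)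
    then have "sem B read_size (input w) = Aborted" using r s0 by (simp add: expect_def)
    ultimately show ?thesis by blast
  qed
qed

definition at_end :: "symbol com" where
  "at_end = Cond (\<lambda>t. t 0 = None) Skip Abort"

text \<open>The recognizers leave the word reversed in register 9; the last transfer restores it for
  the translation.\<close>

definition check_implication :: "symbol com" where
  "check_implication = read_size ;; scan_implication ;; at_end ;; transfer 9 0"

lemma shaped_proper: "shaped (n + 1) = {q. proper n q}"
  by (auto simp: shaped_def proper_def)

lemma sem_check_implication:
  assumes B: "3 * length w + 10 \<le> B"
  shows "(\<exists>n S q. w = encode_size n @ encode_list encode_ineq S @ encode_ineq q \<and>
      (\<forall>p\<in>set S. proper n p) \<and> proper n q \<and>
      sem B check_implication (input w) = Done ((input w)(2 := ones (n + 1)))) \<or>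
    (\<forall>n S q. (\<forall>p\<in>set S. proper n p) \<and> proper n q \<longrightarrow>
      w \<noteq> encode_size n @ encode_list encode_ineq S @ encode_ineq q) \<and>
    sem B check_implication (input w) = Aborted"
proof -
  have "length w < B" using B by simp
  from sem_read_size[OF this] show ?thesis
  proof
    assume "(\<forall>n r. w \<noteq> encode_size n @ r) \<and> sem B read_size (input w) = Aborted"
    then show ?thesis by (auto simp: check_implication_def)
  next
    assume "\<exists>n r. w = encode_size n @ r \<and>
      sem B read_size (input w) = Done ((advance (encode_size n) (input w))(2 := ones (n + 1)))"
    then obtain n r where w: "w = encode_size n @ r" and
      1: "sem B read_size (input w) = Done ((advance (encode_size n) (input w))(2 := ones (n + 1)))" by blast
    let ?s = "(advance (encode_size n) (input w))(2 := ones (n + 1))"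
    have s0: "?s 0 = r" "?s 1 = []" using w by (simp_all add: advance_def input_def)
    have uniq: "n' = n \<and> r' = r" if "w = encode_size n' @ r'" for n' r'
      using uniquely_readableD[OF readable_size, of n' r' n r] w that by simp
    have rdy: "ready {5, 6} (n + 1) 0 B ?s"
      using B w by (auto simp: ready_def advance_def input_def encode_size_def)
    from recognizes_implication rdy show ?thesis
    proof (cases rule: recognizesE)
      case (1 u r')
      then obtain S q where u: "u = encode_list encode_ineq S @ encode_ineq q"
        "\<forall>p\<in>set S. proper n p" "proper n q" unfolding shaped_proper by auto
      let ?s' = "advance u ?s"
      have r: "r = u @ r'" using 1(2) s0 by simp
      have s': "?s' 0 = r'" "?s' 1 = []" "?s' 9 = rev (encode_size n @ u)"
        using r w by (simp_all add: advance_def input_def)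
      have run: "sem B check_implication (input w) = and_then (sem B at_end ?s') (sem B (transfer 9 0))"
        unfolding check_implication_def sem.simps(6) \<open>sem B read_size _ = _\<close> using 1(3) by simp
      show ?thesis
      proof (cases r')
        case Nil
        have "sem B check_implication (input w) = sem B (transfer 9 0) ?s'"
          using run s' Nil by (simp add: at_end_def tops_def)
        also have "\<dots> = Done (?s'(0 := rev (?s' 9) @ ?s' 0, 9 := []))"
          using s' B w r by (intro sem_transfer) auto
        also have "?s'(0 := rev (?s' 9) @ ?s' 0, 9 := []) = (input w)(2 := ones (n + 1))"
        proof
          fix i
          have W: "encode_size n @ u = w" using w r Nil by simp
          have "?s' 0 = []" "?s' 9 = rev w" using s'(1,3) Nil W by simp_all
          moreover have "i \<noteq> 0 \<Longrightarrow> i \<noteq> 9 \<Longrightarrow> ?s' i = ((input w)(2 := ones (n + 1))) i"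
            by (simp add: advance_def)
          ultimately show "(?s'(0 := rev (?s' 9) @ ?s' 0, 9 := [])) i = ((input w)(2 := ones (n + 1))) i"
            by (cases "i = 0"; cases "i = 9") (simp_all add: input_def)
        qed
        finally have "sem B check_implication (input w) = Done ((input w)(2 := ones (n + 1)))" .
        moreover have "w = encode_size n @ encode_list encode_ineq S @ encode_ineq q" using w r u Nil by simp
        ultimately show ?thesis using u by blast
      next
        case (Cons c r'')
        have "w \<noteq> encode_size n' @ encode_list encode_ineq S' @ encode_ineq q'" for n' S' q'
        proof
          assume "w = encode_size n' @ encode_list encode_ineq S' @ encode_ineq q'"
          then have "encode_list encode_ineq S' @ encode_ineq q' @ [] = encode_list encode_ineq S @ encode_ineq q @ r'"
            using uniq[of n' "encode_list encode_ineq S' @ encode_ineq q'"] r u by simp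
          from uniquely_readableD[OF readable_ineq_list this]
          have "encode_ineq q' @ [] = encode_ineq q @ r'" by simp
          from uniquely_readableD[OF readable_ineq this] show False using Cons by simp
        qed
        moreover have "sem B check_implication (input w) = Aborted"
          using run s' Cons by (simp add: at_end_def tops_def)
        ultimately show ?thesis by blast
      qed
    next
      case 2
      have "w \<noteq> encode_size n' @ encode_list encode_ineq S' @ encode_ineq q'"
        if "\<forall>p\<in>set S'. proper n' p" "proper n' q'" for n' S' q'
      proof
        assume w': "w = encode_size n' @ encode_list encode_ineq S' @ encode_ineq q'"
        from uniq[OF this] have "n' = n" and rq: "r = (encode_list encode_ineq S' @ encode_ineq q') @ []" by auto
        have "encode_list encode_ineq S' @ encode_ineq q' \<in>
          {encode_list encode_ineq S @ encode_ineq q |S q. set S \<subseteq> shaped (n + 1) \<and> q \<in> shaped (n + 1)}"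
          using that \<open>n' = n\<close> unfolding shaped_proper by (intro CollectI exI[of _ S'] exI[of _ q']) auto
        from 2(1)[rule_format, OF this, of "[]"] show False using rq s0(1) by simp
      qed
      moreover have "sem B check_implication (input w) = Aborted"
        unfolding check_implication_def sem.simps(6) \<open>sem B read_size _ = _\<close> using 2 by simp
      ultimately show ?thesis by blast
    qed
  qed
qed

subsection \<open>Weights of the game\<close>

lemma encode_int_nonpos: "encode_int (- int m) = (if m = 0 then [EndNum] else NegSign # binary m @ [EndNum])"
  by (simp add: encode_int_cases)

lemma encode_int_nat: "encode_int (int m) = binary m @ [EndNum]"
  by (simp add: encode_int_cases)

lemma row_weight_nat:
  "row_weight e (Some (int m, f)) = Some (int (2 ^ (2 * e) * m))"
  "row_weight e (Some (- int m, f)) = Some (- int (2 ^ (2 * e) * m))"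
  by (simp_all add: row_weight_def)

text \<open>Weights as signed natural numbers in the shapes \<open>2 ^ i * m\<close>,
  \<open>2 ^ i * m + (2 ^ i - 1)\<close> and \<open>Suc (2 * m)\<close>, whose binary words are
  known explicitly.\<close>

lemma col_weight_nat:
  "col_weight (Suc k) (Some (int m, False)) = Some (- int (Suc (2 * (2 ^ Suc (2 * k) * m))))"
  "col_weight (Suc k) (Some (- int (Suc m), False)) =
     Some (int (2 ^ (2 * Suc k) * m + (2 ^ (2 * Suc k) - 1)))"
  "col_weight (Suc k) (Some (0, True)) = Some (int (2 ^ Suc k * 0 + (2 ^ Suc k - 1)))"
  "col_weight (Suc k) (Some (- int m, True)) = Some (int (2 ^ Suc k * (2 ^ Suc k * m) + (2 ^ Suc k - 1)))"
  "col_weight (Suc k) (Some (int (Suc m), True)) =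
     Some (- int (Suc (2 * (2 ^ k * (2 ^ Suc k * m + (2 ^ Suc k - 1))))))"
proof -
  have p: "int (2 ^ i - 1) = 2 ^ i - 1" for i by (simp add: of_nat_diff)
  show "col_weight (Suc k) (Some (int m, False)) = Some (- int (Suc (2 * (2 ^ Suc (2 * k) * m))))"
    by (simp add: col_weight_def algebra_simps)
  show "col_weight (Suc k) (Some (- int (Suc m), False)) =
     Some (int (2 ^ (2 * Suc k) * m + (2 ^ (2 * Suc k) - 1)))"
    unfolding col_weight_def of_nat_add p by (simp add: algebra_simps)
  show "col_weight (Suc k) (Some (0, True)) = Some (int (2 ^ Suc k * 0 + (2 ^ Suc k - 1)))"
    unfolding col_weight_def of_nat_add p by (simp add: algebra_simps)
  have sq: "(2::int) ^ (2 * Suc k) = 2 ^ Suc k * 2 ^ Suc k" by (simp add: power_add[symmetric])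
  show "col_weight (Suc k) (Some (- int m, True)) = Some (int (2 ^ Suc k * (2 ^ Suc k * m) + (2 ^ Suc k - 1)))"
    unfolding col_weight_def sq of_nat_add p by (simp add: algebra_simps)
  show "col_weight (Suc k) (Some (int (Suc m), True)) =
     Some (- int (Suc (2 * (2 ^ k * (2 ^ Suc k * m + (2 ^ Suc k - 1))))))"
    unfolding col_weight_def sq of_nat_Suc of_nat_mult of_nat_add p by (simp add: algebra_simps)
qed

subsection \<open>Emitting the two weight matrices\<close>

text \<open>Register 2 holds \<open>k\<close> in unary. The rows of the first matrix are still to be transposed; the
  two outputs are collected, in reverse, in registers 3 and 4.\<close>

definition emits :: "nat \<Rightarrow> symbol com \<Rightarrow> symbol list \<Rightarrow> symbol list \<Rightarrow> symbol list \<Rightarrow> bool" where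
  "emits k P u v v' \<longleftrightarrow> (\<forall>B s r. s 0 = u @ r \<and> s 2 = ones k \<and> s 6 = [] \<and> k + length (s 0) < B \<longrightarrow>
     sem B P s = Done ((advance u s)(3 := rev v @ s 3, 4 := rev v' @ s 4)))"

lemma emits_seq:
  assumes "emits k P u v v'" "emits k Q u2 v2 v2'"
  shows "emits k (P ;; Q) (u @ u2) (v @ v2) (v' @ v2')"
  unfolding emits_def
proof (intro allI impI)
  fix B r and s :: "symbol stacks"
  assume s: "s 0 = (u @ u2) @ r \<and> s 2 = ones k \<and> s 6 = [] \<and> k + length (s 0) < B"
  let ?s = "(advance u s)(3 := rev v @ s 3, 4 := rev v' @ s 4)"
  have "s 0 = u @ (u2 @ r) \<and> s 2 = ones k \<and> s 6 = [] \<and> k + length (s 0) < B" using s unfolding append_assoc .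
  then have 1: "sem B P s = Done ?s" using assms(1) unfolding emits_def by blast
  have "?s 0 = u2 @ r \<and> ?s 2 = ones k \<and> ?s 6 = [] \<and> k + length (?s 0) < B"
    using s by (auto simp: advance_def)
  then have "sem B Q ?s = Done ((advance u2 ?s)(3 := rev v2 @ ?s 3, 4 := rev v2' @ ?s 4))"
    using assms(2) unfolding emits_def by blast
  moreover have "(advance u2 ?s)(3 := rev v2 @ ?s 3, 4 := rev v2' @ ?s 4) =
      (advance (u @ u2) s)(3 := rev (v @ v2) @ s 3, 4 := rev (v' @ v2') @ s 4)"
    by (auto simp: advance_def fun_eq_iff add.commute)
  ultimately show "sem B (P ;; Q) s = Done ((advance (u @ u2) s)(3 := rev (v @ v2) @ s 3, 4 := rev (v' @ v2') @ s 4))"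
    using 1 by simp
qed

lemma emits_eq: "emits k P u v v' \<Longrightarrow> u = u1 \<Longrightarrow> v = v1 \<Longrightarrow> v' = v1' \<Longrightarrow> emits k P u1 v1 v1'"
  by simp

primrec puts :: "nat \<Rightarrow> 'a list \<Rightarrow> 'a com" where
  "puts j [] = Skip"
| "puts j (c # u) = put j c ;; puts j u"

lemma sem_puts: "sem B (puts j u) s = Done (s(j := rev u @ s j))"
  by (induction u arbitrary: s) auto

text \<open>Emitted words are then handled as a whole by \<open>sem_puts\<close> instead of being
  unfolded symbol by symbol.\<close>

declare puts.simps [simp del]

lemma emits_puts:
  "emits k (puts 3 v) [] v []" "emits k (puts 4 v) [] [] v"
  by (auto simp: emits_def sem_puts advance_Nil)

lemma emits_fill:
  "emits k (fill 2 6 3 c) [] (replicate k c) []" "emits k (fill 2 6 4 c) [] [] (replicate k c)"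
  by (auto simp: emits_def sem_fill advance_Nil)

lemma emits_shift: "emits k shift [c] [] []"
  by (auto simp: emits_def sem_shift) (auto simp: advance_def fun_eq_iff)

lemma emits_cond_True:
  "emits k P u v v' \<Longrightarrow> u = c # u' \<Longrightarrow> emits k (Cond (\<lambda>t. t 0 = Some c) P Q) u v v'"
  by (auto simp: emits_def tops_def)

lemma emits_cond_iff:
  "emits k (Cond (\<lambda>t. t 0 = Some c) P Q) (d # u) v v' \<longleftrightarrow>
     (if d = c then emits k P (d # u) v v' else emits k Q (d # u) v v')"
  by (auto simp: emits_def tops_def)

lemma emits_cond_False:
  "emits k Q u v v' \<Longrightarrow> u = d # u' \<Longrightarrow> d \<noteq> c \<Longrightarrow> emits k (Cond (\<lambda>t. t 0 = Some c) P Q) u v v'"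
  by (auto simp: emits_def tops_def)

lemma emits_loop:
  assumes "\<And>x. x \<in> set xs \<Longrightarrow> emits k P (e x) (h x) (h' x)"
    and hd: "\<And>x. x \<in> set xs \<Longrightarrow> \<exists>d u. e x = d # u \<and> d \<noteq> c"
  shows "emits k (Loop (\<lambda>t. t 0 \<noteq> Some c) P ;; shift)
    (concat (map e xs) @ [c]) (concat (map h xs)) (concat (map h' xs))"
  unfolding emits_def
proof (intro allI impI)
  fix B r and s :: "symbol stacks"
  assume s: "s 0 = (concat (map e xs) @ [c]) @ r \<and> s 2 = ones k \<and> s 6 = [] \<and> k + length (s 0) < B"
  have "iterate n (\<lambda>s. tops s 0 \<noteq> Some c) (sem B P) s =
      Done ((advance (concat (map e xs)) s)(3 := rev (concat (map h xs)) @ s 3, 4 := rev (concat (map h' xs)) @ s 4))"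
    if "s 0 = concat (map e xs) @ c # r" "s 2 = ones k" "s 6 = []" "k + length (s 0) < B" "length xs \<le> n" for n s
    using that assms
  proof (induction xs arbitrary: s n)
    case Nil
    then show ?case by (cases n) (auto simp: tops_def advance_Nil)
  next
    case (Cons x xs)
    then obtain m where n: "n = Suc m" "length xs \<le> m" by (cases n) auto
    let ?s = "(advance (e x) s)(3 := rev (h x) @ s 3, 4 := rev (h' x) @ s 4)"
    obtain d u where "e x = d # u" "d \<noteq> c" using Cons.prems(7)[of x] by auto
    then have t: "tops s 0 \<noteq> Some c" using Cons.prems(1) by (auto simp: tops_def)
    have "emits k P (e x) (h x) (h' x)" using Cons.prems(6) by simp
    then have 1: "sem B P s = Done ?s"
      using Cons.prems(1-4) unfolding emits_def by simp
    have "iterate m (\<lambda>s. tops s 0 \<noteq> Some c) (sem B P) ?s =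
      Done ((advance (concat (map e xs)) ?s)(3 := rev (concat (map h xs)) @ ?s 3, 4 := rev (concat (map h' xs)) @ ?s 4))"
      by (rule Cons.IH) (use Cons.prems n in \<open>auto simp: advance_def\<close>)
    moreover have eq: "(advance (concat (map e xs)) ?s)(3 := rev (concat (map h xs)) @ ?s 3, 4 := rev (concat (map h' xs)) @ ?s 4) =
      (advance (concat (map e (x # xs))) s)(3 := rev (concat (map h (x # xs))) @ s 3, 4 := rev (concat (map h' (x # xs))) @ s 4)"
      by (auto simp: advance_def fun_eq_iff add.commute)
    ultimately have 2: "iterate m (\<lambda>s. tops s 0 \<noteq> Some c) (sem B P) ?s = Done ((advance (concat (map e (x # xs))) s)
        (3 := rev (concat (map h (x # xs))) @ s 3, 4 := rev (concat (map h' (x # xs))) @ s 4))"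
      by (simp only: eq)
    show ?case unfolding n(1) by (simp only: iterate.simps if_True t 1 and_then.simps 2 simp_thms)
  qed
  moreover have "length xs \<le> B"
  proof -
    have "length xs \<le> length (concat (map e xs))" using hd by (induction xs) fastforce+
    then show ?thesis using s by auto
  qed
  ultimately have 1: "sem B (Loop (\<lambda>t. t 0 \<noteq> Some c) P) s =
    Done ((advance (concat (map e xs)) s)(3 := rev (concat (map h xs)) @ s 3, 4 := rev (concat (map h' xs)) @ s 4))"
    (is "_ = Done ?s") using s by auto
  have "?s 0 = c # r" using s by (simp add: advance_def)
  then have "sem B shift ?s = Done (advance [c] ?s)" by (rule sem_shift[of ?s c r])
  moreover have "advance [c] ?s = (advance (concat (map e xs) @ [c]) s)
      (3 := rev (concat (map h xs)) @ s 3, 4 := rev (concat (map h' xs)) @ s 4)"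
    by (auto simp: advance_def fun_eq_iff add.commute)
  ultimately show "sem B (Loop (\<lambda>t. t 0 \<noteq> Some c) P ;; shift) s = Done ((advance (concat (map e xs) @ [c]) s)
      (3 := rev (concat (map h xs)) @ s 3, 4 := rev (concat (map h' xs)) @ s 4))"
    using 1 by (simp del: sem.simps(8))
qed

section \<open>Programs for copying, decrementing and scaling binary numbers\<close>

definition copy_number :: "nat \<Rightarrow> symbol com" where
  "copy_number j = (Loop (\<lambda>t. t 0 \<noteq> Some EndNum) (Push j (top_of 0) ;; shift) ;; shift) ;; puts j [EndNum]"

definition skip_number :: "symbol com" where
  "skip_number = Loop (\<lambda>t. t 0 \<noteq> Some EndNum) shift ;; shift"

text \<open>The borrow as a program: low zeros become ones up to the first \<open>Dig1\<close>,
  which becomes a zero unless it is the top digit.\<close>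

definition pred_number :: "symbol com" where
  "pred_number = (Loop (\<lambda>t. t 0 \<noteq> Some Dig1) (puts 4 [Dig1] ;; shift) ;; shift) ;;
     Cond (\<lambda>t. t 0 = Some EndNum) Skip (puts 4 [Dig0]) ;; copy_number 4"

lemma emits_push_shift:
  "emits k (Push 3 (top_of 0) ;; shift) [c] [c] []" "emits k (Push 4 (top_of 0) ;; shift) [c] [] [c]"
  by (auto simp: emits_def advance_def shift_def tops_def fun_eq_iff)

lemma concat_singles: "concat (map (\<lambda>x. [x]) xs) = xs" "concat (map (\<lambda>x. []) xs) = []"
  by (induction xs) auto

lemma emits_copy_number:
  assumes "EndNum \<notin> set u"
  shows "emits k (copy_number 3) (u @ [EndNum]) (u @ [EndNum]) []"
    and "emits k (copy_number 4) (u @ [EndNum]) [] (u @ [EndNum])"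
proof -
  have h: "\<exists>d v. [x] = d # v \<and> d \<noteq> EndNum" if "x \<in> set u" for x using that assms by auto
  show "emits k (copy_number 3) (u @ [EndNum]) (u @ [EndNum]) []"
    using emits_seq[OF emits_loop[where e = "\<lambda>x. [x]" and h = "\<lambda>x. [x]" and h' = "\<lambda>x. []" and xs = u,
        OF emits_push_shift(1) h] emits_puts(1)[of k "[EndNum]"]]
    by (simp add: copy_number_def concat_singles)
  show "emits k (copy_number 4) (u @ [EndNum]) [] (u @ [EndNum])"
    using emits_seq[OF emits_loop[where e = "\<lambda>x. [x]" and h = "\<lambda>x. []" and h' = "\<lambda>x. [x]" and xs = u,
        OF emits_push_shift(2) h] emits_puts(2)[of k "[EndNum]"]]
    by (simp add: copy_number_def concat_singles)
qed

lemma emits_skip_number: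
  assumes "EndNum \<notin> set u"
  shows "emits k skip_number (u @ [EndNum]) [] []"
proof -
  have h: "\<exists>d v. [x] = d # v \<and> d \<noteq> EndNum" if "x \<in> set u" for x using that assms by auto
  show ?thesis
    using emits_loop[where e = "\<lambda>x. [x]" and h = "\<lambda>x. []" and h' = "\<lambda>x. []" and xs = u, OF emits_shift h]
    by (simp add: skip_number_def concat_singles)
qed

lemma emits_pred_number:
  assumes "0 < m"
  shows "emits k pred_number (binary m @ [EndNum]) [] (binary (m - 1) @ [EndNum])"
proof -
  have split: "\<exists>i v. u = replicate i Dig0 @ Dig1 # v \<and>
      pred_word u = replicate i Dig1 @ (if v = [] then [] else Dig0 # v)"
    if "set u \<subseteq> digits" "u \<noteq> []" "last u = Dig1" for u
    using that
  proof (induction u)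
    case (Cons c u)
    show ?case
    proof (cases "c = Dig1")
      case True
      then show ?thesis by (intro exI[of _ 0]) auto
    next
      case False
      then have c: "c = Dig0" "u \<noteq> []" using Cons.prems by (auto simp: digits_def)
      then obtain i v where "u = replicate i Dig0 @ Dig1 # v"
        "pred_word u = replicate i Dig1 @ (if v = [] then [] else Dig0 # v)"
        using Cons by auto
      then show ?thesis using c by (intro exI[of _ "Suc i"] exI[of _ v]) auto
    qed
  qed simp
  have bm: "set (binary m) \<subseteq> digits" "binary m \<noteq> []" "last (binary m) = Dig1"
    using range_binary[of "binary m"] assms by auto
  then obtain i v where iv: "binary m = replicate i Dig0 @ Dig1 # v"
    "pred_word (binary m) = replicate i Dig1 @ (if v = [] then [] else Dig0 # v)" using split by blast
  have v: "EndNum \<notin> set v" using bm(1) iv(1) by (auto simp: digits_def)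
  have c: "concat (map (\<lambda>x. [Dig0]) (replicate i ())) = replicate i Dig0"
    "concat (map (\<lambda>x. [Dig1]) (replicate i ())) = replicate i Dig1"
    "concat (map (\<lambda>x. []) (replicate i ())) = []" for i by (induction i) auto
  have 1: "emits k (Loop (\<lambda>t. t 0 \<noteq> Some Dig1) (puts 4 [Dig1] ;; shift) ;; shift)
      (replicate i Dig0 @ [Dig1]) [] (replicate i Dig1)"
    using emits_loop[where e = "\<lambda>x. [Dig0]" and h = "\<lambda>x. []" and h' = "\<lambda>x. [Dig1]" and c = Dig1
        and xs = "replicate i ()" and P = "puts 4 [Dig1] ;; shift" and k = k]
      emits_seq[OF emits_puts(2)[of k "[Dig1]"] emits_shift[of k Dig0]] by (simp add: c)
  have 2: "emits k (Cond (\<lambda>t. t 0 = Some EndNum) Skip (puts 4 [Dig0]) ;; copy_number 4)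
      (v @ [EndNum]) [] ((if v = [] then [] else Dig0 # v) @ [EndNum])"
  proof (cases v)
    case Nil
    have "sem B (Cond (\<lambda>t. t 0 = Some EndNum) Skip (puts 4 [Dig0]) ;; copy_number 4) s = sem B (copy_number 4) s"
      if "s 0 = EndNum # r" for B s r using that by (simp add: tops_def)
    then show ?thesis using emits_copy_number(2)[of "[]" k] Nil by (simp add: emits_def)
  next
    case (Cons d v')
    then have "d \<noteq> EndNum" using v by auto
    then have "sem B (Cond (\<lambda>t. t 0 = Some EndNum) Skip (puts 4 [Dig0]) ;; copy_number 4) s =
        sem B (puts 4 [Dig0] ;; copy_number 4) s"
      if "s 0 = (v @ [EndNum]) @ r" for B s r using that Cons by (simp add: tops_def)
    then show ?thesis using emits_seq[OF emits_puts(2)[of k "[Dig0]"] emits_copy_number(2)[OF v, of k]] Cons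
      by (simp add: emits_def del: sem.simps)
  qed
  have eq: "binary (m - 1) = replicate i Dig1 @ (if v = [] then [] else Dig0 # v)"
    using pred_word_binary[OF assms] iv(2) by simp
  show ?thesis
    using emits_seq[OF 1 2] unfolding pred_number_def iv(1) eq by simp
qed

text \<open>The binary word of \<open>2 ^ Suc k - 1\<close> without end marker, to be used as a
  block of low digits.\<close>

definition ones_out :: "symbol com" where
  "ones_out = puts 4 [Dig1] ;; fill 2 6 4 Dig1"

text \<open>Scaling by \<open>2 ^ (2 * Suc k)\<close> inserts zeros behind the sign. Zero,
  recognizable by an immediate \<open>EndNum\<close>, has no digits and must be copied as it
  is.\<close>

definition scale_number :: "symbol com" where
  "scale_number =
     (let z = puts 3 [Dig0] ;; fill 2 6 3 Dig0 ;; puts 3 [Dig0] ;; fill 2 6 3 Dig0 ;; copy_number 3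
      in Cond (\<lambda>t. t 0 = Some NegSign) (shift ;; puts 3 [NegSign] ;; z)
           (Cond (\<lambda>t. t 0 = Some EndNum) (copy_number 3) z))"

text \<open>Write \<open>K = Suc k\<close>. For negative \<open>b\<close> the weight is
  \<open>4 ^ K * (\<bar>b\<bar> - 1) + (4 ^ K - 1)\<close>: \<open>2 * K\<close> ones before the
  predecessor. For positive \<open>b\<close> it is minus \<open>4 ^ K * b + 1\<close>: a one and
  \<open>2 * K - 1\<close> zeros before the digits.\<close>

definition plain_number :: "symbol com" where
  "plain_number = Cond (\<lambda>t. t 0 = Some NegSign) (shift ;; ones_out ;; ones_out ;; pred_number)
     (Cond (\<lambda>t. t 0 = Some EndNum) (shift ;; puts 4 [NegSign, Dig1, EndNum])
       (puts 4 [NegSign, Dig1] ;; fill 2 6 4 Dig0 ;; puts 4 [Dig0] ;; fill 2 6 4 Dig0 ;; copy_number 4))"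

text \<open>Write \<open>K = Suc k\<close>. For negative \<open>b\<close> the weight is
  \<open>4 ^ K * \<bar>b\<bar> + (2 ^ K - 1)\<close>: \<open>K\<close> ones and \<open>K\<close>
  zeros before the digits. For positive \<open>b\<close> it is minus
  \<open>1 + 2 ^ K * (2 ^ K * b - 1)\<close>: a one, \<open>K - 1\<close> zeros and \<open>K\<close>
  ones before the predecessor.\<close>

definition marked_number :: "symbol com" where
  "marked_number = Cond (\<lambda>t. t 0 = Some NegSign)
       (shift ;; ones_out ;; puts 4 [Dig0] ;; fill 2 6 4 Dig0 ;; copy_number 4)
     (Cond (\<lambda>t. t 0 = Some EndNum) (shift ;; ones_out ;; puts 4 [EndNum])
       (puts 4 [NegSign, Dig1] ;; fill 2 6 4 Dig0 ;; ones_out ;; pred_number))"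

lemma int_cases_sign:
  obtains (zero) "z = 0" | (pos) m where "z = int (Suc m)" | (neg) m where "z = - int (Suc m)"
  by (cases z rule: int_cases) (metis int_cases not0_implies_Suc of_nat_0)+

lemma binary_Cons: "0 < m \<Longrightarrow> \<exists>d u. binary m = d # u \<and> d \<in> digits"
  using digits_binary[of m] by (cases "binary m") auto

lemma emits_ones_out: "emits k ones_out [] [] (replicate (Suc k) Dig1)"
  using emits_seq[OF emits_puts(2)[of k "[Dig1]"] emits_fill(2)[of k Dig1]] by (simp add: ones_out_def)

lemmas emits_intros = emits_seq emits_puts emits_fill emits_ones_out emits_copy_number[OF EndNum_binary(1)]
  emits_skip_number[OF EndNum_binary(1)]

lemma emits_scale_number:
  "emits k scale_number (encode_int z) (encode_arc (row_weight (Suc k) (Some (z, f)))) []"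
proof -
  let ?Z = "[Dig0] @ replicate k Dig0 @ [Dig0] @ replicate k Dig0"
  have Z: "?Z = replicate (2 * Suc k) Dig0"
    by (simp add: mult_2 replicate_add[symmetric]) (simp add: replicate_app_Cons[symmetric] replicate_add)
  show ?thesis
  proof (cases z rule: int_cases_sign)
    case zero
    have "emits k (copy_number 3) [EndNum] [EndNum] []" using emits_copy_number(1)[of "[]" k] by simp
    then show ?thesis unfolding scale_number_def Let_def using zero
      by (simp add: emits_cond_iff encode_int_cases row_weight_def)
  next
    case (pos m)
    obtain d u where d: "binary (Suc m) = d # u" "d \<in> digits" using binary_Cons by blast
    have e: "encode_arc (row_weight (Suc k) (Some (z, f))) = replicate (2 * Suc k) Dig0 @ binary (Suc m) @ [EndNum]"
      unfolding pos row_weight_nat encode_arc.simps encode_int_nat binary_scale[OF zero_less_Suc] by simp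
    have "emits k (puts 3 [Dig0] ;; fill 2 6 3 Dig0 ;; puts 3 [Dig0] ;; fill 2 6 3 Dig0 ;; copy_number 3)
      ([] @ [] @ [] @ [] @ binary (Suc m) @ [EndNum])
      ([Dig0] @ replicate k Dig0 @ [Dig0] @ replicate k Dig0 @ binary (Suc m) @ [EndNum]) ([] @ [] @ [] @ [] @ [])"
      by (intro emits_intros)
    moreover have "encode_int z = binary (Suc m) @ [EndNum]" unfolding pos by (rule encode_int_nat)
    ultimately show ?thesis unfolding scale_number_def Let_def e Z[symmetric] using d
      by (intro emits_cond_False) (auto simp: digits_def)
  next
    case (neg m)
    have e: "encode_arc (row_weight (Suc k) (Some (z, f))) = NegSign # replicate (2 * Suc k) Dig0 @ binary (Suc m) @ [EndNum]"
      unfolding neg row_weight_nat encode_arc.simps encode_int_nonpos binary_scale[OF zero_less_Suc] by simp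
    have "emits k (shift ;; puts 3 [NegSign] ;; puts 3 [Dig0] ;; fill 2 6 3 Dig0 ;; puts 3 [Dig0] ;; fill 2 6 3 Dig0 ;; copy_number 3)
      ([NegSign] @ [] @ [] @ [] @ [] @ [] @ binary (Suc m) @ [EndNum])
      ([] @ [NegSign] @ [Dig0] @ replicate k Dig0 @ [Dig0] @ replicate k Dig0 @ binary (Suc m) @ [EndNum])
      ([] @ [] @ [] @ [] @ [] @ [] @ [])"
      by (intro emits_intros emits_shift)
    moreover have "encode_int z = NegSign # binary (Suc m) @ [EndNum]" unfolding neg encode_int_nonpos by simp
    ultimately show ?thesis unfolding scale_number_def Let_def e Z[symmetric]
      by (intro emits_cond_True) auto
  qed
qed

lemma emits_plain_number:
  "emits k plain_number (encode_int z) [] (encode_arc (col_weight (Suc k) (Some (z, False))))"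
proof (cases z rule: int_cases_sign)
  case zero
  have e: "encode_arc (col_weight (Suc k) (Some (z, False))) = [NegSign, Dig1, EndNum]"
    using binary_double_Suc[of 0] by (simp add: zero col_weight_def encode_int_cases)
  have "emits k (shift ;; puts 4 [NegSign, Dig1, EndNum]) ([EndNum] @ []) ([] @ []) ([] @ [NegSign, Dig1, EndNum])"
    by (intro emits_intros emits_shift)
  then show ?thesis unfolding plain_number_def e using zero
    by (simp add: emits_cond_iff encode_int_cases)
next
  case (pos m)
  obtain d u where d: "binary (Suc m) = d # u" "d \<in> digits" using binary_Cons by blast
  have R: "replicate (Suc (2 * k)) Dig0 = replicate k Dig0 @ [Dig0] @ replicate k Dig0"
    by (simp add: mult_2 replicate_add replicate_app_Cons)
  have e: "encode_arc (col_weight (Suc k) (Some (z, False))) =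
      NegSign # Dig1 # replicate (Suc (2 * k)) Dig0 @ binary (Suc m) @ [EndNum]"
    unfolding pos col_weight_nat encode_arc.simps encode_int_nonpos
      binary_double_Suc binary_scale[OF zero_less_Suc] by simp
  have "emits k (puts 4 [NegSign, Dig1] ;; fill 2 6 4 Dig0 ;; puts 4 [Dig0] ;; fill 2 6 4 Dig0 ;; copy_number 4)
    ([] @ [] @ [] @ [] @ binary (Suc m) @ [EndNum]) ([] @ [] @ [] @ [] @ [])
    ([NegSign, Dig1] @ replicate k Dig0 @ [Dig0] @ replicate k Dig0 @ binary (Suc m) @ [EndNum])"
    by (intro emits_intros)
  moreover have "encode_int z = binary (Suc m) @ [EndNum]" unfolding pos by (rule encode_int_nat)
  ultimately show ?thesis unfolding plain_number_def e R using d
    by (intro emits_cond_False) (auto simp: digits_def)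
next
  case (neg m)
  have R: "replicate (2 * Suc k) Dig1 = replicate (Suc k) Dig1 @ replicate (Suc k) Dig1"
    by (simp only: mult_2 replicate_add)
  have e: "encode_arc (col_weight (Suc k) (Some (z, False))) =
      replicate (Suc k) Dig1 @ replicate (Suc k) Dig1 @ binary m @ [EndNum]"
    unfolding neg col_weight_nat encode_arc.simps encode_int_nat binary_scale_ones R by simp
  have "emits k (shift ;; ones_out ;; ones_out ;; pred_number)
    ([NegSign] @ [] @ [] @ binary (Suc m) @ [EndNum]) ([] @ [] @ [] @ [])
    ([] @ replicate (Suc k) Dig1 @ replicate (Suc k) Dig1 @ binary (Suc m - 1) @ [EndNum])"
    by (intro emits_intros emits_shift emits_pred_number) simp
  moreover have "encode_int z = NegSign # binary (Suc m) @ [EndNum]" unfolding neg encode_int_nonpos by simp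
  ultimately show ?thesis unfolding plain_number_def e
    by (intro emits_cond_True) (auto simp del: replicate_Suc)
qed

lemma emits_marked_number:
  "emits k marked_number (encode_int z) [] (encode_arc (col_weight (Suc k) (Some (z, True))))"
proof (cases z rule: int_cases_sign)
  case zero
  have e: "encode_arc (col_weight (Suc k) (Some (z, True))) = replicate (Suc k) Dig1 @ [EndNum]"
    unfolding zero col_weight_nat encode_arc.simps encode_int_nat binary_scale_ones by simp
  have "emits k (shift ;; ones_out ;; puts 4 [EndNum]) ([EndNum] @ [] @ []) ([] @ [] @ [])
    ([] @ replicate (Suc k) Dig1 @ [EndNum])"
    by (intro emits_intros emits_shift)
  then show ?thesis unfolding marked_number_def e using zero
    by (simp add: emits_cond_iff encode_int_cases del: replicate_Suc)
next
  case (pos m)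
  obtain d u where d: "binary (Suc m) = d # u" "d \<in> digits" using binary_Cons by blast
  have "(1::nat) < 2 ^ Suc k" by (rule one_less_power) simp_all
  then have p: "0 < 2 ^ Suc k * m + (2 ^ Suc k - 1)" by simp
  have e: "encode_arc (col_weight (Suc k) (Some (z, True))) =
      NegSign # Dig1 # replicate k Dig0 @ replicate (Suc k) Dig1 @ binary m @ [EndNum]"
    unfolding pos col_weight_nat encode_arc.simps encode_int_nonpos
      binary_double_Suc binary_scale[OF p] binary_scale_ones by simp
  have "emits k (puts 4 [NegSign, Dig1] ;; fill 2 6 4 Dig0 ;; ones_out ;; pred_number)
    ([] @ [] @ [] @ binary (Suc m) @ [EndNum]) ([] @ [] @ [] @ [])
    ([NegSign, Dig1] @ replicate k Dig0 @ replicate (Suc k) Dig1 @ binary (Suc m - 1) @ [EndNum])"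
    by (intro emits_intros emits_pred_number) simp
  moreover have "encode_int z = binary (Suc m) @ [EndNum]" unfolding pos by (rule encode_int_nat)
  ultimately show ?thesis unfolding marked_number_def e using d
    by (intro emits_cond_False) (auto simp: digits_def simp del: replicate_Suc)
next
  case (neg m)
  have e: "encode_arc (col_weight (Suc k) (Some (z, True))) =
      replicate (Suc k) Dig1 @ [Dig0] @ replicate k Dig0 @ binary (Suc m) @ [EndNum]"
    unfolding neg col_weight_nat encode_arc.simps encode_int_nat binary_scale_ones binary_scale[OF zero_less_Suc] by simp
  have "emits k (shift ;; ones_out ;; puts 4 [Dig0] ;; fill 2 6 4 Dig0 ;; copy_number 4)
    ([NegSign] @ [] @ [] @ [] @ binary (Suc m) @ [EndNum]) ([] @ [] @ [] @ [] @ [])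
    ([] @ replicate (Suc k) Dig1 @ [Dig0] @ replicate k Dig0 @ binary (Suc m) @ [EndNum])"
    by (intro emits_intros emits_shift)
  moreover have "encode_int z = NegSign # binary (Suc m) @ [EndNum]" unfolding neg encode_int_nonpos by simp
  ultimately show ?thesis unfolding marked_number_def e
    by (intro emits_cond_True) (auto simp del: replicate_Suc)
qed

definition row_coef :: "symbol com" where
  "row_coef = Cond (\<lambda>t. t 0 = Some Bot) (shift ;; puts 3 [Bot]) scale_number"

definition col_coef :: "symbol com" where
  "col_coef = Cond (\<lambda>t. t 0 = Some Bot) (shift ;; puts 4 [Bot])
     (Cond (\<lambda>t. t 0 = Some MinusMark) (shift ;; marked_number) plain_number)"

definition mark_coef :: "symbol com" where
  "mark_coef = Cond (\<lambda>t. t 0 = Some Bot) (shift ;; puts 4 [Bot]) marked_number"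

definition plain_part_coef :: "symbol com" where
  "plain_part_coef = Cond (\<lambda>t. t 0 = Some MinusMark) (shift ;; skip_number ;; puts 3 [Bot]) row_coef"

definition marked_part_coef :: "symbol com" where
  "marked_part_coef = Cond (\<lambda>t. t 0 = Some MinusMark) (shift ;; scale_number)
     (Cond (\<lambda>t. t 0 = Some Bot) (shift ;; puts 3 [Bot]) (skip_number ;; puts 3 [Bot]))"

lemma emits_cond_int:
  "emits k Q (encode_int z) v v' \<Longrightarrow> c \<in> {Bot, MinusMark} \<Longrightarrow>
     emits k (Cond (\<lambda>t. t 0 = Some c) P Q) (encode_int z) v v'"
  using hd_encode_int[of z] by (auto intro: emits_cond_False)

lemma emits_bot: "emits k (shift ;; puts 3 [Bot]) [c] [Bot] []" "emits k (shift ;; puts 4 [Bot]) [c] [] [Bot]"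
  using emits_seq[OF emits_shift[of k c] emits_puts(1)[of k "[Bot]"]]
    emits_seq[OF emits_shift[of k c] emits_puts(2)[of k "[Bot]"]] by simp_all

lemma emits_skip_int: "emits k skip_number (encode_int z) [] []"
proof -
  have "emits k skip_number (((if z < 0 then [NegSign] else []) @ binary (nat \<bar>z\<bar>)) @ [EndNum]) [] []"
    by (rule emits_skip_number) (auto simp: EndNum_binary)
  then show ?thesis by (simp add: encode_int_def)
qed

lemma emits_coefs:
  "is_plain c \<Longrightarrow> emits k row_coef (encode_coef c) (encode_arc (row_weight (Suc k) c)) []"
  "emits k col_coef (encode_coef c) [] (encode_arc (col_weight (Suc k) c))"
  "is_plain c \<Longrightarrow> emits k mark_coef (encode_coef c) [] (encode_arc (col_weight (Suc k) (mark c)))"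
  "emits k plain_part_coef (encode_coef c) (encode_arc (row_weight (Suc k) (plain_part c))) []"
  "emits k marked_part_coef (encode_coef c) (encode_arc (row_weight (Suc k) (marked_part c))) []"
proof -
  have N: "encode_arc (row_weight (Suc k) None) = [Bot]" "encode_arc (col_weight (Suc k) None) = [Bot]"
    by (simp_all add: row_weight_def col_weight_def)
  have R: "emits k row_coef (encode_int z) (encode_arc (row_weight (Suc k) (Some (z, f)))) []" for z f
    unfolding row_coef_def by (rule emits_cond_int[OF emits_scale_number]) simp
  have RB: "emits k row_coef [Bot] [Bot] []"
    unfolding row_coef_def by (rule emits_cond_True[OF emits_bot(1)]) simp
  show "emits k row_coef (encode_coef c) (encode_arc (row_weight (Suc k) c)) []" if "is_plain c"
    using that R RB by (cases c rule: coeff.cases) (auto simp: N)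
  show "emits k col_coef (encode_coef c) [] (encode_arc (col_weight (Suc k) c))"
  proof (cases c rule: coeff.cases)
    case 1
    then show ?thesis unfolding col_coef_def by (simp add: N emits_cond_iff emits_bot)
  next
    case (2 z)
    then show ?thesis unfolding col_coef_def by (auto intro!: emits_cond_int emits_plain_number)
  next
    case (3 z)
    have "emits k (shift ;; marked_number) (MinusMark # encode_int z) [] (encode_arc (col_weight (Suc k) c))"
      using emits_seq[OF emits_shift emits_marked_number[of k z], of MinusMark] 3 by simp
    then show ?thesis unfolding col_coef_def using 3 by (simp add: emits_cond_iff)
  qed
  show "emits k mark_coef (encode_coef c) [] (encode_arc (col_weight (Suc k) (mark c)))" if "is_plain c"
  proof (cases c rule: coeff.cases)
    case 1
    then show ?thesis unfolding mark_coef_def by (simp add: N mark_def emits_cond_iff emits_bot)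
  next
    case (2 z)
    then show ?thesis unfolding mark_coef_def
      by (auto simp: mark_def intro!: emits_cond_int emits_marked_number)
  qed (use that in simp)
  show "emits k plain_part_coef (encode_coef c) (encode_arc (row_weight (Suc k) (plain_part c))) []"
  proof (cases c rule: coeff.cases)
    case 1
    then show ?thesis unfolding plain_part_coef_def using RB
      by (simp add: N plain_part_def emits_cond_iff)
  next
    case (2 z)
    then show ?thesis unfolding plain_part_coef_def
      by (auto simp: plain_part_def intro!: emits_cond_int R)
  next
    case (3 z)
    have "emits k (shift ;; skip_number ;; puts 3 [Bot]) ([MinusMark] @ encode_int z @ []) ([] @ [] @ [Bot]) ([] @ [] @ [])"
      by (intro emits_seq emits_shift emits_skip_int emits_puts)
    then show ?thesis unfolding plain_part_coef_def using 3
      by (simp add: N plain_part_def emits_cond_iff)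
  qed
  show "emits k marked_part_coef (encode_coef c) (encode_arc (row_weight (Suc k) (marked_part c))) []"
  proof (cases c rule: coeff.cases)
    case 1
    then show ?thesis unfolding marked_part_coef_def
      by (simp add: N marked_part_def emits_cond_iff emits_bot)
  next
    case (2 z)
    have "emits k (skip_number ;; puts 3 [Bot]) (encode_int z @ []) ([] @ [Bot]) ([] @ [])"
      by (intro emits_seq emits_skip_int emits_puts)
    then show ?thesis unfolding marked_part_coef_def using 2
      by (auto simp: N marked_part_def intro!: emits_cond_int)
  next
    case (3 z)
    have "emits k (shift ;; scale_number) ([MinusMark] @ encode_int z) ([] @ encode_arc (row_weight (Suc k) (Some (z, False)))) ([] @ [])"
      by (intro emits_seq emits_shift emits_scale_number)
    then show ?thesis unfolding marked_part_coef_def using 3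
      by (simp add: marked_part_def emits_cond_iff)
  qed
qed

text \<open>Only the first stage is bounded in terms of the input. The later ones are asked to
  succeed for any bound above the current register lengths, and \<open>sem_growth\<close> turns
  these lengths into polynomials.\<close>

lemma stack_reducible_stages:
  assumes reg: "registers_below k c1" "registers_below k c2" "registers_below k c3" "1 < k"
    and run: "\<And>w. (\<exists>s1 s2 w'. sem (3 * length w + 20) c1 (input w) = Done s1 \<and>
        (\<forall>B. (\<forall>i. length (s1 i) + 20 \<le> B) \<longrightarrow> sem B c2 s1 = Done s2) \<and>
        (\<forall>B. (\<forall>i. length (s2 i) + 20 \<le> B) \<longrightarrow> sem B c3 s2 = Done (input w')) \<and> (w \<in> L \<longleftrightarrow> w' \<in> L')) \<or>
      sem (3 * length w + 20) c1 (input w) = Aborted \<and> w \<notin> L"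
  shows "stack_reducible L L'"
proof -
  define p1 :: "nat poly" where "p1 = [:20, 3:]"
  define p2 where "p2 = [:20, 1:] + p1 + pcompose (cost c1) p1"
  define p3 where "p3 = p2 + [:20, 1:] + pcompose (cost c1) p1 + pcompose (cost c2) p2"
  have "(\<exists>w'. sem (poly p3 (length w)) (c1 ;; c2 ;; c3) (input w) = Done (input w') \<and> (w \<in> L \<longleftrightarrow> w' \<in> L')) \<or>
        sem (poly p3 (length w)) (c1 ;; c2 ;; c3) (input w) = Aborted \<and> w \<notin> L" for w
  proof -
    let ?B1 = "3 * length w + 20"
    have e1: "poly p1 (length w) = ?B1" by (simp add: p1_def)
    have le: "?B1 \<le> poly p2 (length w)" "poly p2 (length w) \<le> poly p3 (length w)"
      by (simp_all add: p2_def p3_def e1)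
    have le13: "?B1 \<le> poly p3 (length w)" using le by linarith
    have li: "length (input w i) \<le> length w" for i by (simp add: input_def)
    from run[of w] show ?thesis
    proof
      assume "sem ?B1 c1 (input w) = Aborted \<and> w \<notin> L"
      then show ?thesis using sem_mono[of ?B1 c1 "input w"] le13 by simp
    next
      assume "\<exists>s1 s2 w'. sem ?B1 c1 (input w) = Done s1 \<and>
        (\<forall>B. (\<forall>i. length (s1 i) + 20 \<le> B) \<longrightarrow> sem B c2 s1 = Done s2) \<and>
        (\<forall>B. (\<forall>i. length (s2 i) + 20 \<le> B) \<longrightarrow> sem B c3 s2 = Done (input w')) \<and> (w \<in> L \<longleftrightarrow> w' \<in> L')"
      then obtain s1 s2 w' where 1: "sem ?B1 c1 (input w) = Done s1"
        and 2: "\<And>B. (\<And>i. length (s1 i) + 20 \<le> B) \<Longrightarrow> sem B c2 s1 = Done s2"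
        and 3: "\<And>B. (\<And>i. length (s2 i) + 20 \<le> B) \<Longrightarrow> sem B c3 s2 = Done (input w')"
        and iff: "w \<in> L \<longleftrightarrow> w' \<in> L'" by blast
      have l1: "length (s1 i) \<le> length w + poly (cost c1) ?B1" for i
        using sem_growth[OF 1, of i] li[of i] by linarith
      have b2: "length (s1 i) + 20 \<le> poly p2 (length w)" for i
        using l1[of i] by (simp add: p2_def poly_pcompose e1)
      have s2: "sem (poly p2 (length w)) c2 s1 = Done s2" by (rule 2[OF b2])
      have b3: "length (s2 i) + 20 \<le> poly p3 (length w)" for i
        using sem_growth[OF s2, of i] l1[of i] by (simp add: p3_def poly_pcompose e1)
      have s3: "sem (poly p3 (length w)) c3 s2 = Done (input w')" by (rule 3[OF b3])
      have "sem (poly p3 (length w)) c1 (input w) = Done s1" using sem_mono[of ?B1 c1 "input w"] 1 le13 by simp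
      moreover have "sem (poly p3 (length w)) c2 s1 = Done s2" using sem_mono[of "poly p2 (length w)" c2 s1 "poly p3 (length w)"] s2 le(2) by simp
      ultimately show ?thesis using s3 iff by auto
    qed
  qed
  then show ?thesis unfolding stack_reducible_def using reg
    by (intro exI[of _ "c1 ;; c2 ;; c3"] exI[of _ k] exI[of _ p3]) auto
qed

subsection \<open>Emitting the refutation\<close>

definition minus_one :: "symbol list" where
  "minus_one = [NegSign, Dig1, EndNum]"

lemma constant_words:
  "encode_arc (row_weight e None) = [Bot]" "encode_arc (col_weight e None) = [Bot]"
  "encode_arc (row_weight e zero_coef) = [EndNum]" "encode_arc (col_weight e zero_coef) = minus_one"
  using binary_double_Suc[of 0]
  by (simp_all add: row_weight_def col_weight_def zero_coef_def encode_int_cases minus_one_def)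

lemma encode_ineq_eq: "encode_ineq q = encode_list encode_coef (fst q) @ encode_list encode_coef (snd q)"
  by (cases q) (simp add: encode_ineq_def)

definition row_word :: "nat \<Rightarrow> coef list \<Rightarrow> symbol list" where
  "row_word e A = encode_list encode_arc (map (row_weight e) A)"

definition col_word :: "nat \<Rightarrow> coef list \<Rightarrow> symbol list" where
  "col_word e A = encode_list encode_arc (map (col_weight e) A)"

definition frame_rows :: "symbol list \<Rightarrow> symbol com \<Rightarrow> symbol list \<Rightarrow> symbol com" where
  "frame_rows c P d = shift ;; puts 3 (OpenList # c) ;; (Loop (\<lambda>t. t 0 \<noteq> Some CloseList) P ;; shift) ;;
     puts 3 (d @ [CloseList])"

definition frame_cols :: "symbol list \<Rightarrow> symbol com \<Rightarrow> symbol list \<Rightarrow> symbol com" where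
  "frame_cols c P d = shift ;; puts 4 (OpenList # c) ;; (Loop (\<lambda>t. t 0 \<noteq> Some CloseList) P ;; shift) ;;
     puts 4 (d @ [CloseList])"

lemma hd_coef': "\<exists>d u. encode_coef x = d # u \<and> d \<noteq> CloseList"
  using hd_encode_coef[of x] by auto

lemma emits_frame_rows:
  assumes "\<And>x. x \<in> set A \<Longrightarrow> emits k P (encode_coef x) (encode_arc (row_weight e (g x))) []"
    and "c' = encode_arc (row_weight e c)" "d' = encode_arc (row_weight e d)"
  shows "emits k (frame_rows c' P d') (encode_list encode_coef A) (row_word e (frame c (map g A) d)) []"
proof -
  have "emits k (frame_rows c' P d') ([OpenList] @ [] @ (concat (map encode_coef A) @ [CloseList]) @ [])
      ([] @ (OpenList # c') @ concat (map (\<lambda>x. encode_arc (row_weight e (g x))) A) @ (d' @ [CloseList]))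
      ([] @ [] @ concat (map (\<lambda>_. []) A) @ [])"
    unfolding frame_rows_def by (intro emits_seq emits_shift emits_puts emits_loop assms(1) hd_coef')
  then show ?thesis
    by (rule emits_eq) (simp_all add: encode_list_def row_word_def frame_def assms(2,3) comp_def concat_singles)
qed

lemma emits_frame_cols:
  assumes "\<And>x. x \<in> set A \<Longrightarrow> emits k P (encode_coef x) [] (encode_arc (col_weight e (g x)))"
    and "c' = encode_arc (col_weight e c)" "d' = encode_arc (col_weight e d)"
  shows "emits k (frame_cols c' P d') (encode_list encode_coef A) [] (col_word e (frame c (map g A) d))"
proof -
  have "emits k (frame_cols c' P d') ([OpenList] @ [] @ (concat (map encode_coef A) @ [CloseList]) @ [])
      ([] @ [] @ concat (map (\<lambda>_. []) A) @ [])
      ([] @ (OpenList # c') @ concat (map (\<lambda>x. encode_arc (col_weight e (g x))) A) @ (d' @ [CloseList]))"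
    unfolding frame_cols_def by (intro emits_seq emits_shift emits_puts emits_loop assms(1) hd_coef')
  then show ?thesis
    by (rule emits_eq) (simp_all add: encode_list_def col_word_def frame_def assms(2,3) comp_def concat_singles)
qed

definition emit_system :: "symbol com" where
  "emit_system = shift ;; (Loop (\<lambda>t. t 0 \<noteq> Some CloseList)
     (frame_rows [Bot] row_coef [Bot] ;; frame_cols [Bot] col_coef minus_one) ;; shift)"

text \<open>Negation exchanges the sides: the left form of the conclusion, which is read first,
  feeds the column matrix, and the right form feeds the row matrix.\<close>

definition emit_strict :: "symbol com" where
  "emit_strict = frame_cols [Bot] mark_coef minus_one ;; frame_rows [Bot] plain_part_coef [Bot]"

definition emit_weak :: "symbol com" where
  "emit_weak = frame_cols [Bot] col_coef minus_one ;; frame_rows [EndNum] marked_part_coef [Bot]"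

text \<open>The left-hand sides arrive inequality by inequality, so this is the transpose of the
  matrix \<open>row_arcs\<close> of the game.\<close>

definition rows_out :: "nat \<Rightarrow> (coef list \<times> coef list) list \<Rightarrow> symbol list" where
  "rows_out e H = concat (map (\<lambda>q. row_word e (fst q)) H)"

definition cols_out :: "nat \<Rightarrow> (coef list \<times> coef list) list \<Rightarrow> symbol list" where
  "cols_out e H = concat (map (\<lambda>q. col_word e (snd q)) H)"

lemma emits_system:
  assumes "\<forall>p\<in>set S. proper n p"
  defines "H \<equiv> map (\<lambda>p. (frame None (fst p) None, frame None (snd p) zero_coef)) S"
  shows "emits k emit_system (encode_list encode_ineq S) (rows_out (Suc k) H) (cols_out (Suc k) H)"
proof -
  have "emits k (frame_rows [Bot] row_coef [Bot] ;; frame_cols [Bot] col_coef minus_one) (encode_ineq p)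
      (row_word (Suc k) (frame None (fst p) None)) (col_word (Suc k) (frame None (snd p) zero_coef))"
    if "p \<in> set S" for p
  proof -
    have "emits k row_coef (encode_coef x) (encode_arc (row_weight (Suc k) x)) []" if "x \<in> set (fst p)" for x
      using emits_coefs(1) that assms(1) \<open>p \<in> set S\<close> by (auto simp: proper_def)
    then have 1: "emits k (frame_rows [Bot] row_coef [Bot]) (encode_list encode_coef (fst p))
        (row_word (Suc k) (frame None (map (\<lambda>x. x) (fst p)) None)) []"
      by (rule emits_frame_rows) (simp_all add: constant_words)
    have 2: "emits k (frame_cols [Bot] col_coef minus_one) (encode_list encode_coef (snd p))
        [] (col_word (Suc k) (frame None (map (\<lambda>x. x) (snd p)) zero_coef))"
      by (rule emits_frame_cols[OF emits_coefs(2)]) (simp_all add: constant_words)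
    show ?thesis using emits_seq[OF 1 2] by (simp add: encode_ineq_eq)
  qed
  then have "emits k (Loop (\<lambda>t. t 0 \<noteq> Some CloseList)
     (frame_rows [Bot] row_coef [Bot] ;; frame_cols [Bot] col_coef minus_one) ;; shift)
     (concat (map encode_ineq S) @ [CloseList])
     (concat (map (\<lambda>p. row_word (Suc k) (frame None (fst p) None)) S))
     (concat (map (\<lambda>p. col_word (Suc k) (frame None (snd p) zero_coef)) S))"
    by (rule emits_loop) (auto simp: encode_ineq_def encode_list_def)
  from emits_seq[OF emits_shift[of k OpenList] this] show ?thesis
    unfolding emit_system_def by (rule emits_eq) (simp_all add: encode_list_def rows_out_def cols_out_def H_def comp_def)
qed

lemma emits_strict_weak:
  assumes "proper n q"
  shows "emits k emit_strict (encode_ineq q)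
      (row_word (Suc k) (frame None (map plain_part (snd q)) None)) (col_word (Suc k) (frame None (map mark (fst q)) zero_coef))"
    and "emits k emit_weak (encode_ineq q)
      (row_word (Suc k) (frame zero_coef (map marked_part (snd q)) None)) (col_word (Suc k) (frame None (fst q) zero_coef))"
proof -
  have "emits k mark_coef (encode_coef x) [] (encode_arc (col_weight (Suc k) (mark x)))" if "x \<in> set (fst q)" for x
    using emits_coefs(3) that assms by (auto simp: proper_def)
  then have 1: "emits k (frame_cols [Bot] mark_coef minus_one) (encode_list encode_coef (fst q))
      [] (col_word (Suc k) (frame None (map mark (fst q)) zero_coef))"
    by (rule emits_frame_cols) (simp_all add: constant_words)
  have 2: "emits k (frame_rows [Bot] plain_part_coef [Bot]) (encode_list encode_coef (snd q))
      (row_word (Suc k) (frame None (map plain_part (snd q)) None)) []"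
    by (rule emits_frame_rows[OF emits_coefs(4)]) (simp_all add: constant_words)
  show "emits k emit_strict (encode_ineq q)
      (row_word (Suc k) (frame None (map plain_part (snd q)) None)) (col_word (Suc k) (frame None (map mark (fst q)) zero_coef))"
    using emits_seq[OF 1 2] by (simp add: emit_strict_def encode_ineq_eq)
  have 3: "emits k (frame_cols [Bot] col_coef minus_one) (encode_list encode_coef (fst q))
      [] (col_word (Suc k) (frame None (map (\<lambda>x. x) (fst q)) zero_coef))"
    by (rule emits_frame_cols[OF emits_coefs(2)]) (simp_all add: constant_words)
  have 4: "emits k (frame_rows [EndNum] marked_part_coef [Bot]) (encode_list encode_coef (snd q))
      (row_word (Suc k) (frame zero_coef (map marked_part (snd q)) None)) []"
    by (rule emits_frame_rows[OF emits_coefs(5)]) (simp_all add: constant_words)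
  show "emits k emit_weak (encode_ineq q)
      (row_word (Suc k) (frame zero_coef (map marked_part (snd q)) None)) (col_word (Suc k) (frame None (fst q) zero_coef))"
    using emits_seq[OF 3 4] by (simp add: emit_weak_def encode_ineq_eq)
qed

definition fill_minus_one :: "symbol com" where
  "fill_minus_one = transfer 2 6 ;;
     Loop (\<lambda>t. t 6 \<noteq> None) (Push 2 (top_of 6) ;; puts 4 minus_one ;; Pop 6)"

lemma emits_fill_minus_one: "emits k fill_minus_one [] [] (concat (replicate k minus_one))"
  unfolding emits_def
proof (intro allI impI)
  fix B r and s :: "symbol stacks"
  assume s: "s 0 = [] @ r \<and> s 2 = ones k \<and> s 6 = [] \<and> k + length (s 0) < B"
  let ?s = "s(6 := ones k, 2 := [])"
  have fold: "fold (\<lambda>x s. s(2 := x # s 2, 4 := rev minus_one @ s 4)) (replicate m c) s =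
      s(2 := replicate m c @ s 2, 4 := rev (concat (replicate m minus_one)) @ s 4)"
    for m c and s :: "symbol stacks"
  proof (induction m arbitrary: s)
    case (Suc m)
    show ?case unfolding replicate_Suc fold_simps Suc by (simp add: fun_eq_iff replicate_app_Cons)
  qed simp
  have "sem B (Loop (\<lambda>t. t 6 \<noteq> None) (Push 2 (top_of 6) ;; puts 4 minus_one ;; Pop 6)) ?s =
      Done ((fold (\<lambda>x s. s(2 := x # s 2, 4 := rev minus_one @ s 4)) (ones k) ?s)(6 := []))"
    by (rule sem_each[where P = "\<lambda>_. True"]) (use s in \<open>auto simp: sem_puts fun_eq_iff\<close>)
  moreover have "(fold (\<lambda>x s. s(2 := x # s 2, 4 := rev minus_one @ s 4)) (ones k) ?s)(6 := []) =
      (advance [] s)(3 := rev [] @ s 3, 4 := rev (concat (replicate k minus_one)) @ s 4)"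
    unfolding fold using s by (auto simp: fun_eq_iff advance_Nil)
  moreover have "sem B (transfer 2 6) s = Done ?s" using s by (auto simp: sem_transfer)
  ultimately show "sem B fill_minus_one s =
      Done ((advance [] s)(3 := rev [] @ s 3, 4 := rev (concat (replicate k minus_one)) @ s 4))"
    unfolding fill_minus_one_def by (simp only: sem.simps(6) and_then.simps)
qed

lemma emits_fill_pred: "emits (Suc n) (fill 2 6 4 c ;; Pop 4) [] [] (replicate n c)"
  by (auto simp: emits_def sem_fill advance_Nil)

text \<open>The last three inequalities of \<open>refutation\<close>, which depend on
  \<open>n\<close> alone. Register 2 holds \<open>n + 1\<close>, so a row of \<open>n\<close>
  entries is filled and then shortened by one; the zeros in front of \<open>Dig1\<close> scale the
  coefficient 1.\<close>

definition emit_constants :: "symbol com" where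
  "emit_constants =
     puts 3 [OpenList, EndNum] ;; fill 2 6 3 Bot ;; puts 3 [Bot, CloseList] ;;
     puts 4 ([OpenList, Bot] @ minus_one) ;; (fill 2 6 4 Bot ;; Pop 4) ;; puts 4 (minus_one @ [CloseList]) ;;
     puts 3 [OpenList, EndNum] ;; fill 2 6 3 EndNum ;; puts 3 [EndNum, CloseList] ;;
     puts 4 (OpenList # minus_one) ;; fill_minus_one ;; puts 4 (minus_one @ [CloseList]) ;;
     puts 3 [OpenList, Bot] ;; fill 2 6 3 Bot ;;
     puts 3 [Dig0] ;; fill 2 6 3 Dig0 ;; puts 3 [Dig0] ;; fill 2 6 3 Dig0 ;; puts 3 [Dig1, EndNum, CloseList] ;;
     puts 4 [OpenList, Bot] ;; fill 2 6 4 Bot ;; puts 4 (minus_one @ [CloseList])"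

lemma emits_constants:
  fixes n :: nat
  defines "H \<equiv> [(frame zero_coef (replicate (n + 1) None) None, frame None (zero_coef # replicate n None) zero_coef),
      (frame zero_coef (replicate (n + 1) zero_coef) zero_coef, frame zero_coef (replicate (n + 1) zero_coef) zero_coef),
      (frame None (replicate (n + 1) None) (Some (1, False)), frame None (replicate (n + 1) None) zero_coef)]"
  shows "emits (n + 1) emit_constants [] (rows_out (n + 2) H) (cols_out (n + 2) H)"
proof -
  let ?k = "n + 1"
  have one: "encode_arc (row_weight (Suc ?k) (Some (1, False))) =
      [Dig0] @ replicate ?k Dig0 @ [Dig0] @ replicate ?k Dig0 @ [Dig1, EndNum]"
  proof -
    have "row_weight (Suc ?k) (Some (int 1, False)) = Some (int (2 ^ (2 * Suc ?k) * 1))" by (rule row_weight_nat)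
    then have "encode_arc (row_weight (Suc ?k) (Some (1, False))) = replicate (2 * Suc ?k) Dig0 @ binary 1 @ [EndNum]"
      using encode_int_nat[of "2 ^ (2 * Suc ?k) * 1"] binary_scale[of 1 "2 * Suc ?k"] by simp
    moreover have "binary 1 = [Dig1]" using binary_double_Suc[of 0] by simp
    moreover have "replicate (2 * Suc ?k) Dig0 = [Dig0] @ replicate ?k Dig0 @ [Dig0] @ replicate ?k Dig0"
      by (simp add: mult_2 replicate_add replicate_app_Cons)
    ultimately show ?thesis by simp
  qed
  have rep: "concat (map encode_arc (replicate m x)) = concat (replicate m (encode_arc x))" for m x
    by (induction m) auto
  have repb: "concat (replicate m [c]) = replicate m c" for m and c :: symbol by (induction m) auto
  have "emits ?k emit_constants
     ([] @ [] @ [] @ [] @ [] @ [] @ [] @ [] @ [] @ [] @ [] @ [] @ [] @ [] @ [] @ [] @ [] @ [] @ [] @ [] @ [] @ [])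
     ([OpenList, EndNum] @ replicate ?k Bot @ [Bot, CloseList] @ [] @ [] @ [] @
      [OpenList, EndNum] @ replicate ?k EndNum @ [EndNum, CloseList] @ [] @ [] @ [] @
      [OpenList, Bot] @ replicate ?k Bot @ [Dig0] @ replicate ?k Dig0 @ [Dig0] @ replicate ?k Dig0 @ [Dig1, EndNum, CloseList] @
      [] @ [] @ [])
     ([] @ [] @ [] @ ([OpenList, Bot] @ minus_one) @ replicate n Bot @ (minus_one @ [CloseList]) @
      [] @ [] @ [] @ (OpenList # minus_one) @ concat (replicate ?k minus_one) @ (minus_one @ [CloseList]) @
      [] @ [] @ [] @ [] @ [] @ [] @ [] @ [OpenList, Bot] @ replicate ?k Bot @ (minus_one @ [CloseList]))"
    unfolding emit_constants_def
    using emits_fill_pred[of n Bot] by (intro emits_seq emits_puts emits_fill emits_fill_minus_one) simp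
  then show ?thesis
    by (rule emits_eq)
      (simp_all add: H_def rows_out_def cols_out_def row_word_def col_word_def encode_list_def frame_def
        constant_words one[simplified] map_replicate rep repb del: replicate_Suc, simp_all)
qed

definition move_until :: "nat \<Rightarrow> nat \<Rightarrow> symbol \<Rightarrow> symbol com" where
  "move_until i j c = Loop (\<lambda>t. t i \<noteq> Some c) (Push j (top_of i) ;; Pop i) ;; Push j (top_of i) ;; Pop i"

lemma sem_move_until:
  assumes "s i = u @ c # r" "c \<notin> set u" "length u \<le> B" "i \<noteq> j" "i \<noteq> 1" "j \<noteq> 1"
  shows "sem B (move_until i j c) s = Done (s(i := r, j := c # rev u @ s j))"
proof -
  have "iterate B (\<lambda>s. tops s i \<noteq> Some c) (sem B (Push j (top_of i) ;; Pop i)) s =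
      Done ((fold (\<lambda>x s. s(j := x # s j)) u s)(i := c # r))"
    by (rule iterate_items[where P = "\<lambda>_. True" and e = "\<lambda>x. [x]"])
      (use assms in \<open>auto simp: concat_singles fun_eq_iff\<close>)
  then have "sem B (Loop (\<lambda>t. t i \<noteq> Some c) (Push j (top_of i) ;; Pop i)) s =
      Done (s(j := rev u @ s j, i := c # r))" by (simp add: fold_push)
  then show ?thesis unfolding move_until_def using assms
    by (simp only: sem.simps(6) and_then.simps) (auto simp: fun_eq_iff)
qed

text \<open>The conclusion contributes two inequalities and is therefore read twice. Moving back to
  the second \<open>OpenList\<close> from the right returns exactly its encoding to the
  input.\<close>

definition emit_refutation :: "symbol com" where
  "emit_refutation = (skip_number ;; emit_system ;; emit_strict) ;;
     move_until 9 0 OpenList ;; move_until 9 0 OpenList ;; (emit_weak ;; emit_constants)"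

lemma sem_emit_refutation:
  assumes S: "\<forall>p\<in>set S. proper n p" and q: "proper n q"
    and w: "w = encode_size n @ encode_list encode_ineq S @ encode_ineq q" and B: "3 * length w + 20 \<le> B"
  shows "sem B emit_refutation ((input w)(2 := ones (n + 1))) =
    Done ((\<lambda>_. [])(2 := ones (n + 1), 9 := rev w, 3 := rev (rows_out (n + 2) (refutation n S q)),
      4 := rev (cols_out (n + 2) (refutation n S q))))"
proof -
  let ?k = "n + 1"
  let ?H1 = "map (\<lambda>p. (frame None (fst p) None, frame None (snd p) zero_coef)) S @
    [(frame None (map plain_part (snd q)) None, frame None (map mark (fst q)) zero_coef)]"
  let ?H2 = "(frame zero_coef (map marked_part (snd q)) None, frame None (fst q) zero_coef) #
     [(frame zero_coef (replicate (n + 1) None) None, frame None (zero_coef # replicate n None) zero_coef),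
      (frame zero_coef (replicate (n + 1) zero_coef) zero_coef, frame zero_coef (replicate (n + 1) zero_coef) zero_coef),
      (frame None (replicate (n + 1) None) (Some (1, False)), frame None (replicate (n + 1) None) zero_coef)]"
  have H: "refutation n S q = ?H1 @ ?H2" by (simp add: refutation_def)
  have "emits ?k skip_number (ones n @ [EndNum]) [] []" by (rule emits_skip_number) simp
  from emits_seq[OF this emits_seq[OF emits_system[OF S] emits_strict_weak(1)[OF q]]]
  have E1: "emits ?k (skip_number ;; emit_system ;; emit_strict) w (rows_out (n + 2) ?H1) (cols_out (n + 2) ?H1)"
    by (rule emits_eq) (simp_all add: w encode_size_def rows_out_def cols_out_def)
  have E2: "emits ?k (emit_weak ;; emit_constants) (encode_ineq q) (rows_out (n + 2) ?H2) (cols_out (n + 2) ?H2)"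
    using emits_seq[OF emits_strict_weak(2)[OF q, of ?k] emits_constants[of n]]
    by (rule emits_eq) (simp_all add: rows_out_def cols_out_def)
  let ?s0 = "(input w)(2 := ones ?k)"
  let ?s1 = "(\<lambda>_. [])(2 := ones ?k, 9 := rev w, 3 := rev (rows_out (n + 2) ?H1), 4 := rev (cols_out (n + 2) ?H1)) :: symbol stacks"
  have nw: "?k < length w" using w by (simp add: encode_size_def encode_list_def)
  have "sem B (skip_number ;; emit_system ;; emit_strict) ?s0 = Done ((advance w ?s0)
      (3 := rev (rows_out (n + 2) ?H1) @ ?s0 3, 4 := rev (cols_out (n + 2) ?H1) @ ?s0 4))"
    using E1[unfolded emits_def, rule_format, of ?s0 "[]" B] nw B by (simp add: input_def)
  moreover have "(advance w ?s0)(3 := rev (rows_out (n + 2) ?H1) @ ?s0 3, 4 := rev (cols_out (n + 2) ?H1) @ ?s0 4) = ?s1"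
    by (auto simp: fun_eq_iff advance_def input_def)
  ultimately have 1: "sem B (skip_number ;; emit_system ;; emit_strict) ?s0 = Done ?s1" by (simp only:)
  obtain A C where AC: "q = (A, C)" by (cases q)
  let ?a = "concat (map encode_coef A) @ [CloseList]" and ?c = "concat (map encode_coef C) @ [CloseList]"
  let ?pre = "encode_size n @ encode_list encode_ineq S"
  have eq: "encode_ineq q = OpenList # ?a @ OpenList # ?c" by (simp add: AC encode_ineq_def encode_list_def)
  have r9: "?s1 9 = rev ?c @ OpenList # (rev ?a @ OpenList # rev ?pre)" by (simp add: w eq)
  have lw: "length ?a \<le> B" "length ?c \<le> B" using w eq B by simp_all
  let ?s2 = "?s1(9 := rev ?a @ OpenList # rev ?pre, 0 := OpenList # rev (rev ?c) @ ?s1 0)"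
  have 2: "sem B (move_until 9 0 OpenList) ?s1 = Done ?s2"
    by (rule sem_move_until[of ?s1 9 "rev ?c" OpenList "rev ?a @ OpenList # rev ?pre", OF r9])
      (use lw OpenList_not_in[of C] in auto)
  let ?s3 = "?s2(9 := rev ?pre, 0 := OpenList # rev (rev ?a) @ ?s2 0)"
  have 3: "sem B (move_until 9 0 OpenList) ?s2 = Done ?s3"
    by (rule sem_move_until[of ?s2 9 "rev ?a" OpenList "rev ?pre"])
      (use lw OpenList_not_in[of A] in auto)
  have s30: "?s3 0 = encode_ineq q" by (simp add: eq)
  have "sem B (emit_weak ;; emit_constants) ?s3 = Done ((advance (encode_ineq q) ?s3)
      (3 := rev (rows_out (n + 2) ?H2) @ ?s3 3, 4 := rev (cols_out (n + 2) ?H2) @ ?s3 4))"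
    by (rule E2[unfolded emits_def, rule_format, of ?s3 "[]" B]) (use nw B w s30 in simp)
  moreover have "(advance (encode_ineq q) ?s3)
      (3 := rev (rows_out (n + 2) ?H2) @ ?s3 3, 4 := rev (cols_out (n + 2) ?H2) @ ?s3 4) =
    (\<lambda>_. [])(2 := ones (n + 1), 9 := rev w, 3 := rev (rows_out (n + 2) (refutation n S q)),
      4 := rev (cols_out (n + 2) (refutation n S q)))" (is "?l = ?r")
  proof
    fix i
    have "?l 9 = ?r 9" by (simp add: advance_def w)
    moreover have "?l 0 = ?r 0" using s30 by (simp add: advance_def eq)
    moreover have "?l 3 = ?r 3" "?l 4 = ?r 4" by (simp_all add: H rows_out_def cols_out_def)
    moreover have "i \<notin> {0, 3, 4, 9} \<Longrightarrow> ?l i = ?r i" by (simp add: advance_def)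
    ultimately show "?l i = ?r i" by (cases "i \<in> {0, 3, 4, 9}") blast+
  qed
  ultimately have 4: "sem B (emit_weak ;; emit_constants) ?s3 = Done ((\<lambda>_. [])(2 := ones (n + 1), 9 := rev w,
    3 := rev (rows_out (n + 2) (refutation n S q)), 4 := rev (cols_out (n + 2) (refutation n S q))))" by (simp only:)
  show ?thesis unfolding emit_refutation_def
    by (simp only: sem.simps(6)[of B "skip_number ;; emit_system ;; emit_strict"]
        sem.simps(6)[of B "move_until 9 0 OpenList"] 1 2 3 4 and_then.simps)
qed

subsection \<open>Transposing the first matrix\<close>

definition lists_word :: "int option list list \<Rightarrow> symbol list" where
  "lists_word Ls = concat (map (encode_list encode_arc) Ls)"

definition move_entry :: "symbol com" where
  "move_entry = Cond (\<lambda>t. t 5 = Some Bot) (Push 8 (top_of 5) ;; Pop 5) (move_until 5 8 EndNum)"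

definition head_of_list :: "symbol com" where
  "head_of_list = (Push 6 (top_of 5) ;; Pop 5) ;; move_entry ;; move_until 5 6 CloseList"

definition column :: "symbol com" where
  "column = Loop (\<lambda>t. t 5 \<noteq> None) head_of_list ;; transfer 6 5"

text \<open>Each round peels the head off every list and puts the shortened lists back, so one list
  of the transpose is produced per mark in register 2.\<close>

definition transpose_rows :: "symbol com" where
  "transpose_rows = Loop (\<lambda>t. t 2 \<noteq> None) (Pop 2 ;; put 8 OpenList ;; column ;; put 8 CloseList)"

lemma CloseList_arc: "CloseList \<notin> set (encode_arc a)"
proof (cases a)
  case (Some z)
  then show ?thesis using digits_binary[of "nat \<bar>z\<bar>"] by (auto simp: encode_int_def digits_def)
qed simp

lemma sem_move_entry:
  assumes s: "s 5 = encode_arc a @ r" and B: "length (encode_arc a) \<le> B"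
  shows "sem B move_entry s = Done (s(5 := r, 8 := rev (encode_arc a) @ s 8))"
proof (cases a)
  case None
  then show ?thesis using s by (auto simp: move_entry_def tops_def fun_eq_iff)
next
  case (Some z)
  let ?u = "(if z < 0 then [NegSign] else []) @ binary (nat \<bar>z\<bar>)"
  have u: "s 5 = ?u @ EndNum # r" "EndNum \<notin> set ?u" "length ?u \<le> B"
    using s B Some EndNum_binary by (auto simp: encode_int_def)
  have "tops s 5 \<noteq> Some Bot"
    using s Some hd_encode_int[of z] by (auto simp: tops_def)
  then have "sem B move_entry s = sem B (move_until 5 8 EndNum) s" by (simp add: move_entry_def)
  then show ?thesis using sem_move_until[of s 5 ?u EndNum r B 8, OF u] Some by (simp add: encode_int_def)
qed

lemma sem_head_of_list:
  assumes s: "s 5 = encode_list encode_arc (a # es) @ r" and B: "length (encode_list encode_arc (a # es)) \<le> B"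
  shows "sem B head_of_list s = Done (s(5 := r, 8 := rev (encode_arc a) @ s 8,
    6 := rev (encode_list encode_arc es) @ s 6))"
proof -
  let ?v = "concat (map encode_arc es)"
  let ?s1 = "s(6 := OpenList # s 6, 5 := encode_arc a @ ?v @ CloseList # r)"
  let ?s2 = "?s1(5 := ?v @ CloseList # r, 8 := rev (encode_arc a) @ ?s1 8)"
  have 1: "sem B (Push 6 (top_of 5) ;; Pop 5) s = Done ?s1"
    using s by (auto simp: tops_def encode_list_def fun_eq_iff)
  have 2: "sem B move_entry ?s1 = Done ?s2"
    by (rule sem_move_entry) (use B in \<open>auto simp: encode_list_def\<close>)
  have 3: "sem B (move_until 5 6 CloseList) ?s2 = Done (?s2(5 := r, 6 := CloseList # rev ?v @ ?s2 6))"
    by (rule sem_move_until) (use B CloseList_arc in \<open>auto simp: encode_list_def\<close>)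
  have "sem B head_of_list s = Done (?s2(5 := r, 6 := CloseList # rev ?v @ ?s2 6))"
    unfolding head_of_list_def
    by (simp only: sem.simps(6)[of B "Push 6 (top_of 5) ;; Pop 5"] sem.simps(6)[of B move_entry] 1 2 3 and_then.simps)
  moreover have "?s2(5 := r, 6 := CloseList # rev ?v @ ?s2 6) = s(5 := r, 8 := rev (encode_arc a) @ s 8,
    6 := rev (encode_list encode_arc es) @ s 6)" by (auto simp: fun_eq_iff encode_list_def)
  ultimately show ?thesis by (simp only:)
qed

lemma length_lists_word:
  "length Ls \<le> length (lists_word Ls)" "length (lists_word (map tl Ls)) \<le> length (lists_word Ls)"
  "L \<in> set Ls \<Longrightarrow> length (encode_list encode_arc L) \<le> length (lists_word Ls)"
proof -
  show "length Ls \<le> length (lists_word Ls)"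
    by (induction Ls) (auto simp: lists_word_def encode_list_def)
  have t: "length (encode_list encode_arc (tl L)) \<le> length (encode_list encode_arc L)" for L
    by (cases L) (auto simp: encode_list_def)
  show "length (lists_word (map tl Ls)) \<le> length (lists_word Ls)"
  proof (induction Ls)
    case (Cons L Ls)
    then show ?case using t[of L] by (simp add: lists_word_def)
  qed (simp add: lists_word_def)
  show "L \<in> set Ls \<Longrightarrow> length (encode_list encode_arc L) \<le> length (lists_word Ls)"
    by (induction Ls) (auto simp: lists_word_def)
qed

lemma sem_column:
  assumes s: "s 5 = lists_word Ls" "s 6 = []" and ne: "\<forall>L\<in>set Ls. L \<noteq> []" and B: "length (lists_word Ls) \<le> B"
  shows "sem B column s = Done (s(5 := lists_word (map tl Ls),
    8 := rev (concat (map (\<lambda>L. encode_arc (hd L)) Ls)) @ s 8))"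
proof -
  let ?f = "\<lambda>L s. s(8 := rev (encode_arc (hd L)) @ s 8, 6 := rev (encode_list encode_arc (tl L)) @ s 6)"
  have fold: "fold ?f Ls s = s(8 := rev (concat (map (\<lambda>L. encode_arc (hd L)) Ls)) @ s 8,
      6 := rev (lists_word (map tl Ls)) @ s 6)" for Ls and s :: "symbol stacks"
  proof (induction Ls arbitrary: s)
    case (Cons L Ls)
    show ?case unfolding fold_simps Cons by (simp add: fun_eq_iff lists_word_def)
  qed (simp add: fun_eq_iff lists_word_def)
  have lo: "sem B (Loop (\<lambda>t. t 5 \<noteq> None) head_of_list) s = Done ((fold ?f Ls s)(5 := []))"
    unfolding sem.simps(8)
  proof (rule iterate_items[where P = "\<lambda>_. True" and e = "encode_list encode_arc"])
    fix L r and s :: "symbol stacks" assume L: "L \<in> set Ls"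
    have "L \<noteq> []" using ne L by blast
    then obtain a es where aes: "L = a # es" by (meson neq_Nil_conv)
    show "sem B head_of_list (s(5 := encode_list encode_arc L @ r)) = Done ((?f L s)(5 := r))"
      by (subst sem_head_of_list[of _ a es r])
        (use L aes B length_lists_word(3)[OF L] in \<open>auto simp: fun_eq_iff\<close>)
  next
    fix L r and s :: "symbol stacks"
    show "tops (s(5 := encode_list encode_arc L @ r)) 5 \<noteq> None" by (simp add: encode_list_def)
  qed (use s B length_lists_word(1)[of Ls] in \<open>auto simp: lists_word_def\<close>)
  let ?s1 = "(fold ?f Ls s)(5 := [])"
  have "?s1 6 = rev (lists_word (map tl Ls))" "?s1 5 = []" unfolding fold using s by simp_all
  then have "sem B (transfer 6 5) ?s1 = Done (?s1(5 := lists_word (map tl Ls), 6 := []))"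
    using sem_transfer[of 6 5 ?s1 B] B length_lists_word(2)[of Ls] by simp
  moreover have "?s1(5 := lists_word (map tl Ls), 6 := []) = s(5 := lists_word (map tl Ls),
    8 := rev (concat (map (\<lambda>L. encode_arc (hd L)) Ls)) @ s 8)"
    unfolding fold using s by (auto simp: fun_eq_iff)
  ultimately have tr: "sem B (transfer 6 5) ?s1 = Done (s(5 := lists_word (map tl Ls),
    8 := rev (concat (map (\<lambda>L. encode_arc (hd L)) Ls)) @ s 8))" by (simp only:)
  show ?thesis unfolding column_def by (simp only: sem.simps(6) lo tr and_then.simps)
qed

lemma sem_transpose_rows:
  assumes "s 5 = lists_word Ls" "s 6 = []" "s 2 = ones N" "\<forall>L\<in>set Ls. length L = N"
    and "length (lists_word Ls) \<le> B" "N \<le> B"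
  shows "sem B transpose_rows s = Done (s(2 := [], 5 := lists_word (map (\<lambda>_. []) Ls),
    8 := rev (concat (map (\<lambda>k. encode_list encode_arc (map (\<lambda>L. L ! k) Ls)) [0..<N])) @ s 8))"
proof -
  let ?P = "Pop 2 ;; put 8 OpenList ;; column ;; put 8 CloseList"
  have "iterate m (\<lambda>s. tops s 2 \<noteq> None) (sem B ?P) s = Done (s(2 := [], 5 := lists_word (map (\<lambda>_. []) Ls),
    8 := rev (concat (map (\<lambda>k. encode_list encode_arc (map (\<lambda>L. L ! k) Ls)) [0..<N])) @ s 8))"
    if "s 5 = lists_word Ls" "s 6 = []" "s 2 = ones N" "\<forall>L\<in>set Ls. length L = N"
      "length (lists_word Ls) \<le> B" "N \<le> m" for s N Ls m
    using that
  proof (induction N arbitrary: s Ls m)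
    case 0
    then have "Ls = map (\<lambda>_. []) Ls" by (auto intro!: map_idI[symmetric])
    then have "s(2 := [], 5 := lists_word (map (\<lambda>_. []) Ls), 8 := rev (concat (map (\<lambda>k. encode_list encode_arc
        (map (\<lambda>L. L ! k) Ls)) [0..<0])) @ s 8) = s" using 0 by (auto simp: fun_eq_iff)
    moreover have "iterate m (\<lambda>s. tops s 2 \<noteq> None) (sem B ?P) s = Done s"
      using 0 by (cases m) (simp_all add: tops_def)
    ultimately show ?case by (simp only:)
  next
    case (Suc N)
    obtain m' where m: "m = Suc m'" "N \<le> m'" using Suc.prems by (cases m) auto
    let ?s1 = "s(2 := ones N, 8 := OpenList # s 8)"
    let ?c = "concat (map (\<lambda>L. encode_arc (hd L)) Ls)"
    let ?s2 = "?s1(5 := lists_word (map tl Ls), 8 := rev ?c @ ?s1 8)"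
    let ?s3 = "s(2 := ones N, 5 := lists_word (map tl Ls), 8 := CloseList # rev ?c @ OpenList # s 8)"
    have ne: "\<forall>L\<in>set Ls. L \<noteq> []" using Suc.prems by auto
    have c: "sem B column ?s1 = Done ?s2"
      by (rule sem_column) (use Suc.prems ne in auto)
    have "sem B ?P s = and_then (sem B column ?s1) (sem B (put 8 CloseList))"
      using Suc.prems by (simp del: fun_upd_apply) (simp add: fun_upd_def)
    also have "\<dots> = Done ?s3" unfolding c by (auto simp: fun_eq_iff)
    finally have 1: "sem B ?P s = Done ?s3" .
    have t: "tops s 2 \<noteq> None" using Suc.prems by (simp add: tops_def)
    have IH: "iterate m' (\<lambda>s. tops s 2 \<noteq> None) (sem B ?P) ?s3 = Done (?s3(2 := [],
        5 := lists_word (map (\<lambda>_. []) (map tl Ls)),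
        8 := rev (concat (map (\<lambda>k. encode_list encode_arc (map (\<lambda>L. L ! k) (map tl Ls))) [0..<N])) @ ?s3 8))"
      by (rule Suc.IH) (use Suc.prems m length_lists_word(2)[of Ls] in auto)
    have up: "[0..<Suc N] = 0 # map Suc [0..<N]" by (simp add: map_Suc_upt upt_conv_Cons)
    have hd0: "map (\<lambda>L. L ! 0) Ls = map hd Ls" using ne by (auto simp: hd_conv_nth)
    have tlk: "map (\<lambda>L. L ! Suc k) Ls = map (\<lambda>L. L ! k) (map tl Ls)" if "k < N" for k
      using Suc.prems(4) that by (auto simp: nth_tl)
    have e: "concat (map (\<lambda>k. encode_list encode_arc (map (\<lambda>L. L ! k) Ls)) [0..<Suc N]) =
      encode_list encode_arc (map hd Ls) @ concat (map (\<lambda>k. encode_list encode_arc (map (\<lambda>L. L ! k) (map tl Ls))) [0..<N])"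
    proof -
      have "map (\<lambda>k. encode_list encode_arc (map (\<lambda>L. L ! Suc k) Ls)) [0..<N] =
          map (\<lambda>k. encode_list encode_arc (map (\<lambda>L. L ! k) (map tl Ls))) [0..<N]"
        by (rule map_cong[OF refl]) (simp only: set_upt atLeastLessThan_iff tlk)
      then show ?thesis unfolding up by (simp only: list.map(2) map_map comp_def concat.simps hd0)
    qed
    have "?s3(2 := [], 5 := lists_word (map (\<lambda>_. []) (map tl Ls)),
        8 := rev (concat (map (\<lambda>k. encode_list encode_arc (map (\<lambda>L. L ! k) (map tl Ls))) [0..<N])) @ ?s3 8) =
      s(2 := [], 5 := lists_word (map (\<lambda>_. []) Ls),
        8 := rev (concat (map (\<lambda>k. encode_list encode_arc (map (\<lambda>L. L ! k) Ls)) [0..<Suc N])) @ s 8)"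
      unfolding e by (auto simp: fun_eq_iff encode_list_def comp_def)
    then show ?case unfolding m(1) using IH by (simp only: iterate.simps if_True t 1 and_then.simps simp_thms)
  qed
  from this[OF assms] show ?thesis unfolding transpose_rows_def sem.simps(8) .
qed

text \<open>Two more marks raise the counter from \<open>n + 1\<close> to the number
  \<open>n + 3\<close> of rows. The final \<open>Dig0\<close> and \<open>EndNum\<close> encode the
  start node \<open>Row 0\<close>.\<close>

definition assemble_game :: "symbol com" where
  "assemble_game = transfer 3 5 ;; puts 2 [Dig1, Dig1] ;; put 8 OpenList ;; transpose_rows ;;
     puts 8 [CloseList, OpenList] ;; transfer 4 6 ;; transfer 6 8 ;; puts 8 [CloseList, Dig0, EndNum] ;;
     clear 5 ;; clear 9"

lemma registers_below_puts [simp]: "registers_below k (puts j u) \<longleftrightarrow> u = [] \<or> j < k \<and> j \<noteq> 1"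
  by (induction u) (auto simp: puts.simps)

theorem implication_reducible_to_mean_payoff: "stack_reducible IMPLICATION MEAN_PAYOFF"
proof (rule stack_reducible_stages)
  show "registers_below 10 (check_implication ;; emit_refutation)"
    by (simp add: check_implication_def read_size_def scan_implication_def scan_ineq_def at_end_def
        expect_def shift_def repeat_def until_close_def scan_arc_def scan_coef_def scan_int_def scan_digits_def
        emit_refutation_def emit_system_def emit_strict_def emit_weak_def emit_constants_def frame_rows_def
        frame_cols_def skip_number_def move_until_def fill_minus_one_def row_coef_def col_coef_def mark_coef_def
        plain_part_coef_def marked_part_coef_def scale_number_def plain_number_def marked_number_def Let_def
        ones_out_def pred_number_def copy_number_def)
  show "registers_below 10 assemble_game"
    by (simp add: assemble_game_def transpose_rows_def column_def head_of_list_def move_entry_def move_until_def)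
  show "registers_below 10 (transfer 8 0)" by simp
  fix w :: "symbol list"
  let ?B1 = "3 * length w + 20"
  let ?goal = "(\<exists>s1 s2 w'. sem ?B1 (check_implication ;; emit_refutation) (input w) = Done s1 \<and>
        (\<forall>B. (\<forall>i. length (s1 i) + 20 \<le> B) \<longrightarrow> sem B assemble_game s1 = Done s2) \<and>
        (\<forall>B. (\<forall>i. length (s2 i) + 20 \<le> B) \<longrightarrow> sem B (transfer 8 0) s2 = Done (input w')) \<and>
        (w \<in> IMPLICATION \<longleftrightarrow> w' \<in> MEAN_PAYOFF)) \<or>
      sem ?B1 (check_implication ;; emit_refutation) (input w) = Aborted \<and> w \<notin> IMPLICATION"
  have "3 * length w + 10 \<le> ?B1" by simp
  from sem_check_implication[OF this] show ?goal
  proof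
    assume "(\<forall>n S q. (\<forall>p\<in>set S. proper n p) \<and> proper n q \<longrightarrow>
      w \<noteq> encode_size n @ encode_list encode_ineq S @ encode_ineq q) \<and>
      sem ?B1 check_implication (input w) = Aborted"
    moreover have "w \<in> IMPLICATION \<Longrightarrow> \<exists>n S q. (\<forall>p\<in>set S. proper n p) \<and> proper n q \<and>
      w = encode_size n @ encode_list encode_ineq S @ encode_ineq q"
    proof -
      assume "w \<in> IMPLICATION"
      then obtain n S q where "w = encode_system n S @ encode_inequality q" "\<forall>p\<in>set S. admissible n p" "admissible n q"
        unfolding IMPLICATION_def by blast
      moreover from this obtain S' q' where "S = map inequality_of S'" "\<forall>p\<in>set S'. proper n p"
        "q = inequality_of q'" "proper n q'" unfolding admissible_system by (metis admissible_cases)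
      ultimately show ?thesis by (intro exI[of _ n] exI[of _ S'] exI[of _ q']) (simp add: encode_system_of)
    qed
    ultimately show ?goal by auto
  next
    assume "\<exists>n S q. w = encode_size n @ encode_list encode_ineq S @ encode_ineq q \<and>
      (\<forall>p\<in>set S. proper n p) \<and> proper n q \<and>
      sem ?B1 check_implication (input w) = Done ((input w)(2 := ones (n + 1)))"
    then obtain n S q where w: "w = encode_size n @ encode_list encode_ineq S @ encode_ineq q"
      and S: "\<forall>p\<in>set S. proper n p" and q: "proper n q"
      and chk: "sem ?B1 check_implication (input w) = Done ((input w)(2 := ones (n + 1)))" by blast
    let ?H = "refutation n S q" and ?e = "n + 2" and ?N = "n + 3"
    let ?g = "game_of ?e ?N ?H"
    let ?Ls = "map (\<lambda>q. map (row_weight ?e) (fst q)) ?H"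
    let ?s1 = "(\<lambda>_. [])(2 := ones (n + 1), 9 := rev w, 3 := rev (rows_out ?e ?H), 4 := rev (cols_out ?e ?H)) :: symbol stacks"
    let ?w' = "encode_game ?g @ encode_node (Row 0)"
    let ?s2 = "(\<lambda>_. [])(8 := rev ?w') :: symbol stacks"
    have ro: "rows_out ?e ?H = lists_word ?Ls"
      by (simp add: rows_out_def lists_word_def row_word_def comp_def)
    have lenH: "length (fst p) = ?N" if "p \<in> set ?H" for p
      using that S q by (auto simp: refutation_def frame_def proper_def)
    have lenL: "\<forall>L\<in>set ?Ls. length L = ?N" using lenH by auto
    let ?T = "concat (map (\<lambda>k. encode_list encode_arc (map (\<lambda>L. L ! k) ?Ls)) [0..<?N])"
    have w': "?w' = OpenList # ?T @ [CloseList, OpenList] @ cols_out ?e ?H @ [CloseList, Dig0, EndNum]"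
    proof -
      have "map (\<lambda>L. L ! k) ?Ls = map (\<lambda>q. row_weight ?e (fst q ! k)) ?H" if "k < ?N" for k
        using lenH that by auto
      then have "map (\<lambda>k. encode_list encode_arc (map (\<lambda>L. L ! k) ?Ls)) [0..<?N] =
          map (\<lambda>k. encode_list encode_arc (map (\<lambda>q. row_weight ?e (fst q ! k)) ?H)) [0..<?N]"
        by (intro map_cong[OF refl]) (simp only: set_upt atLeastLessThan_iff)
      then have T: "?T = concat (map (encode_list encode_arc) (row_arcs ?g))"
        by (simp only:) (simp add: game_of_def comp_def)
      have C: "cols_out ?e ?H = concat (map (encode_list encode_arc) (col_arcs ?g))"
        by (simp add: game_of_def cols_out_def col_word_def comp_def)
      show ?thesis unfolding T C
        by (simp add: encode_game_def encode_list_def[of "encode_list encode_arc"] encode_size_def)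
    qed
    have e1: "sem ?B1 (check_implication ;; emit_refutation) (input w) = Done ?s1"
      using sem_emit_refutation[OF S q w, of ?B1] by (simp only: sem.simps(6) chk and_then.simps order_refl)
    have e2: "sem B assemble_game ?s1 = Done ?s2" if B: "\<forall>i. length (?s1 i) + 20 \<le> B" for B
    proof -
      have b2: "n + 21 \<le> B" using B[rule_format, of 2] by simp
      have "length (rows_out ?e ?H) \<le> B" using B[rule_format, of 3] by simp
      then have b3: "length (lists_word ?Ls) \<le> B" by (simp only: ro)
      have b4: "length (cols_out ?e ?H) \<le> B" using B[rule_format, of 4] by simp
      have b9: "length w \<le> B" using B[rule_format, of 9] by simp
      let ?t1 = "?s1(5 := lists_word ?Ls, 3 := [])"
      have 1: "sem B (transfer 3 5) ?s1 = Done ?t1"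
        unfolding ro by (subst sem_transfer) (use b3 in simp_all)
      let ?t2 = "?t1(2 := ones ?N, 8 := [OpenList])"
      have 2: "sem B (puts 2 [Dig1, Dig1]) ?t1 = Done (?t1(2 := ones ?N))"
        by (simp add: sem_puts eval_nat_numeral)
      have 3: "sem B (put 8 OpenList) (?t1(2 := ones ?N)) = Done ?t2" by simp
      let ?t3 = "?t2(2 := [], 5 := lists_word (map (\<lambda>_. []) ?Ls), 8 := rev ?T @ ?t2 8)"
      have 4: "sem B transpose_rows ?t2 = Done ?t3"
        by (rule sem_transpose_rows) (use b2 b3 lenL in simp_all)
      let ?t4 = "?t3(8 := rev [CloseList, OpenList] @ ?t3 8)"
      have 5: "sem B (puts 8 [CloseList, OpenList]) ?t3 = Done ?t4" by (rule sem_puts)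
      let ?t5 = "?t4(6 := rev (?t4 4) @ ?t4 6, 4 := [])"
      have 6: "sem B (transfer 4 6) ?t4 = Done ?t5" by (rule sem_transfer) (use b4 in simp_all)
      let ?t6 = "?t5(8 := rev (?t5 6) @ ?t5 8, 6 := [])"
      have 7: "sem B (transfer 6 8) ?t5 = Done ?t6" by (rule sem_transfer) (use b4 in simp_all)
      let ?t7 = "?t6(8 := rev [CloseList, Dig0, EndNum] @ ?t6 8)"
      have 8: "sem B (puts 8 [CloseList, Dig0, EndNum]) ?t6 = Done ?t7" by (rule sem_puts)
      have "length (lists_word (map (\<lambda>_. []) ?Ls)) \<le> B"
      proof -
        have "length (lists_word (map (\<lambda>_. []) Ls)) \<le> length (lists_word Ls)" for Ls
          by (induction Ls) (auto simp: lists_word_def encode_list_def)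
        then show ?thesis using b3 by (rule order_trans)
      qed
      then have 9: "sem B (clear 5) ?t7 = Done (?t7(5 := []))" by (intro sem_clear) simp_all
      have 10: "sem B (clear 9) (?t7(5 := [])) = Done (?t7(5 := [], 9 := []))"
        by (rule sem_clear) (use b9 in simp_all)
      have "sem B assemble_game ?s1 = Done (?t7(5 := [], 9 := []))"
        unfolding assemble_game_def by (simp only: sem.simps(6) 1 2 3 4 5 6 7 8 9 10 and_then.simps)
      moreover have "?t7(5 := [], 9 := []) = ?s2"
      proof
        fix i
        have "(?t7(5 := [], 9 := [])) 8 = ?s2 8" unfolding w' by simp
        moreover have "i \<noteq> 8 \<Longrightarrow> (?t7(5 := [], 9 := [])) i = ?s2 i" by simp
        ultimately show "(?t7(5 := [], 9 := [])) i = ?s2 i" by (cases "i = 8") blast+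
      qed
      ultimately show ?thesis by (simp only:)
    qed
    have e3: "sem B (transfer 8 0) ?s2 = Done (input ?w')" if B: "\<forall>i. length (?s2 i) + 20 \<le> B" for B
    proof -
      have "length (?s2 8) \<le> B" using B[rule_format, of 8] by linarith
      then have "sem B (transfer 8 0) ?s2 = Done (?s2(0 := rev (?s2 8) @ ?s2 0, 8 := []))"
        by (intro sem_transfer) simp_all
      moreover have "?s2(0 := rev (?s2 8) @ ?s2 0, 8 := []) = input ?w'"
      proof
        fix i show "(?s2(0 := rev (?s2 8) @ ?s2 0, 8 := [])) i = input ?w' i"
          unfolding input_def by (cases "i = 0") simp_all
      qed
      ultimately show ?thesis by (simp only:)
    qed
    have "Row 0 \<in> nodes ?g" by (simp add: nodes_def game_of_simps)
    from MEAN_PAYOFF_iff[OF implied_iff_winning(1)[OF S q] this]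
    have "w \<in> IMPLICATION \<longleftrightarrow> ?w' \<in> MEAN_PAYOFF"
      unfolding w IMPLICATION_iff[OF S q] implied_iff_winning(2)[OF S q] by (rule sym)
    then show ?goal using e1 e2 e3 by blast
  qed
qed simp

subsection \<open>Recognizing mean payoff games\<close>

text \<open>In a word that lists adjacency matrices, \<open>live\<close> forbids the lists without any entry other
  than \<open>Bot\<close>; its first argument tells whether only \<open>Bot\<close> has occurred since the last \<open>OpenList\<close>.\<close>

fun live :: "bool \<Rightarrow> symbol list \<Rightarrow> bool" where
  "live f [] = True"
| "live f (c # w) = (\<not> (c = CloseList \<and> f) \<and> live (c = OpenList \<or> f \<and> c = Bot) w)"

fun open_flag :: "bool \<Rightarrow> symbol list \<Rightarrow> bool" where
  "open_flag f [] = f"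
| "open_flag f (c # w) = open_flag (c = OpenList \<or> f \<and> c = Bot) w"

text \<open>Every row, every column and each of the two matrices closes once; with the number of
  columns known, this count yields the number of rows.\<close>

definition closes :: "symbol list \<Rightarrow> nat" where
  "closes w = length (filter (\<lambda>c. c = CloseList) w)"

text \<open>Each encoded entry contains exactly one of \<open>EndNum\<close> and \<open>Bot\<close>,
  so this is the length of the first list, which is the number of columns.\<close>

definition first_entries :: "symbol list \<Rightarrow> nat" where
  "first_entries w = length (filter (\<lambda>c. c \<in> {EndNum, Bot}) (takeWhile (\<lambda>c. c \<noteq> CloseList) w))"

lemma set_encode_int: "set (encode_int z) \<inter> {OpenList, CloseList, Bot} = {}"
  using digits_binary[of "nat \<bar>z\<bar>"] by (auto simp: encode_int_def digits_def)

lemma set_encode_arc: "OpenList \<notin> set (encode_arc x)" "CloseList \<notin> set (encode_arc x)"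
  using set_encode_int by (cases x; force)+

lemma live_word:
  "set u \<inter> {OpenList, CloseList, Bot} = {} \<Longrightarrow> u \<noteq> [] \<Longrightarrow> live f (u @ r) = live False r"
proof (induction u arbitrary: f)
  case (Cons c u)
  then show ?case by (cases u) auto
qed simp

lemma live_arc: "live f (encode_arc x @ r) = live (f \<and> x = None) r"
proof (cases x)
  case (Some z)
  have "encode_int z \<noteq> []" by (simp add: encode_int_def)
  from live_word[OF set_encode_int this] show ?thesis using Some by simp
qed simp

lemma live_arcs: "live f (concat (map encode_arc xs) @ r) = live (f \<and> (\<forall>x\<in>set xs. x = None)) r"
  by (induction xs arbitrary: f) (simp_all add: live_arc conj_assoc)

lemma live_list: "live f (encode_list encode_arc xs @ r) \<longleftrightarrow> (\<exists>x\<in>set xs. x \<noteq> None) \<and> live False r"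
  by (simp add: encode_list_def live_arcs)

lemma live_lists:
  "live False (concat (map (encode_list encode_arc) R) @ r) \<longleftrightarrow> (\<forall>xs\<in>set R. \<exists>x\<in>set xs. x \<noteq> None) \<and> live False r"
  by (induction R) (auto simp: live_list)

lemma live_matrix: "live False (encode_list (encode_list encode_arc) R @ r) \<longleftrightarrow>
    R \<noteq> [] \<and> (\<forall>xs\<in>set R. \<exists>x\<in>set xs. x \<noteq> None) \<and> live False r"
proof (cases R)
  case (Cons xs R')
  then show ?thesis using live_lists[of R' "CloseList # r"]
    by (simp add: encode_list_def[of "encode_list encode_arc"] live_list)
qed (simp add: encode_list_def)

lemma live_no_close: "CloseList \<notin> set u \<Longrightarrow> live f u"
  by (induction u arbitrary: f) auto

lemma live_game: "live False (encode_game g @ encode_node s) \<longleftrightarrow> row_arcs g \<noteq> [] \<and> col_arcs g \<noteq> [] \<and>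
    (\<forall>xs\<in>set (row_arcs g) \<union> set (col_arcs g). \<exists>x\<in>set xs. x \<noteq> None)"
proof -
  have "live False (encode_node s)" by (rule live_no_close) (cases s; auto simp: encode_size_def)
  then show ?thesis by (auto simp: encode_game_def live_matrix)
qed

lemma closes_append: "closes (u @ v) = closes u + closes v"
  by (simp add: closes_def)

lemma closes_list: "closes (encode_list encode_arc xs) = 1"
proof -
  have "filter (\<lambda>c. c = CloseList) (concat (map encode_arc xs)) = []"
    using set_encode_arc(2) by (auto simp: filter_empty_conv)
  then show ?thesis by (simp add: closes_def encode_list_def)
qed

lemma closes_matrix: "closes (encode_list (encode_list encode_arc) R) = length R + 1"
proof -
  have "closes (concat (map (encode_list encode_arc) R)) = length R"
    by (induction R) (simp_all add: closes_append closes_list, simp add: closes_def)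
  then show ?thesis by (simp add: encode_list_def[of "encode_list encode_arc"] closes_def)
qed

lemma closes_game: "closes (encode_game g @ encode_node s) = num_rows g + num_cols g + 2"
proof -
  have "closes (encode_node s) = 0" by (cases s) (auto simp: closes_def encode_size_def filter_empty_conv)
  then show ?thesis by (simp add: encode_game_def closes_append closes_matrix num_rows_def num_cols_def)
qed

lemma first_entries_game:
  assumes "row_arcs g = xs # R"
  shows "first_entries (encode_game g @ r) = length xs"
proof -
  have "length (filter (\<lambda>c. c \<in> {EndNum, Bot}) (encode_arc x)) = 1" for x
  proof (cases x)
    case (Some z)
    have "filter (\<lambda>c. c \<in> {EndNum, Bot}) (binary m) = []" for m
      using digits_binary[of m] by (auto simp: filter_empty_conv digits_def)
    then show ?thesis using Some by (simp add: encode_int_def)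
  qed simp
  then have "length (filter (\<lambda>c. c \<in> {EndNum, Bot}) (concat (map encode_arc xs))) = length xs"
    by (induction xs) simp_all
  moreover have "takeWhile (\<lambda>c. c \<noteq> CloseList) (encode_game g @ r) = OpenList # OpenList # concat (map encode_arc xs)"
  proof -
    have "\<forall>c\<in>set (concat (map encode_arc xs)). c \<noteq> CloseList" using set_encode_arc(2) by auto
    then have "takeWhile (\<lambda>c. c \<noteq> CloseList) (concat (map encode_arc xs) @ CloseList # r') = concat (map encode_arc xs)" for r'
      by (subst takeWhile_append2) auto
    then show ?thesis using assms by (simp add: encode_game_def encode_list_def)
  qed
  ultimately show ?thesis by (simp add: first_entries_def)
qed

definition survey :: "symbol list \<Rightarrow> symbol list \<Rightarrow> nat \<Rightarrow> nat \<Rightarrow> bool \<Rightarrow> symbol stacks" where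
  "survey w q m n f = (\<lambda>_. [])(0 := w, 9 := q, 2 := ones m, 3 := ones n, 5 := if f then [Bot] else [])"

text \<open>Register 2 is empty as long as no list has been closed, which tells whether an entry
  belongs to the first row. Register 5 holds the flag of \<open>live\<close>.\<close>

definition survey_symbol :: "symbol com" where
  "survey_symbol =
     Cond (\<lambda>t. t 0 = Some CloseList) (Cond (\<lambda>t. t 5 \<noteq> None) Abort (put 2 Dig1))
       (Cond (\<lambda>t. (t 0 = Some EndNum \<or> t 0 = Some Bot) \<and> t 2 = None) (put 3 Dig1) Skip) ;;
     Cond (\<lambda>t. t 0 = Some OpenList) (Cond (\<lambda>t. t 5 = None) (put 5 Bot) Skip)
       (Cond (\<lambda>t. t 0 = Some Bot) Skip (Pop 5)) ;;
     shift"

lemma sem_survey_symbol: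
  "sem B survey_symbol (survey (c # w) q m n f) = (if c = CloseList \<and> f then Aborted else
     Done (survey w (c # q) (if c = CloseList then Suc m else m)
       (if (c = EndNum \<or> c = Bot) \<and> m = 0 then Suc n else n) (c = OpenList \<or> f \<and> c = Bot)))"
  by (cases f; cases m; cases c) (simp_all add: survey_symbol_def survey_def shift_def tops_def fun_eq_iff)

lemma sem_survey:
  assumes "length w \<le> k"
  shows "iterate k (\<lambda>s. tops s 0 \<noteq> None) (sem B survey_symbol) (survey w q m n f) =
    (if live f w then Done (survey [] (rev w @ q) (m + closes w) (if m = 0 then n + first_entries w else n) (open_flag f w))
     else Aborted)"
  using assms
proof (induction w arbitrary: k q m n f)
  case Nil
  have "tops (survey [] q m n f) 0 = None" by (simp add: survey_def tops_def)
  then show ?case by (cases k) (simp_all add: closes_def first_entries_def)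
next
  case (Cons c w)
  then obtain k' where k: "k = Suc k'" "length w \<le> k'" by (cases k) auto
  have t: "tops (survey (c # w) q m n f) 0 \<noteq> None" by (simp add: survey_def tops_def)
  show ?case unfolding k(1) iterate.simps using t Cons.IH[OF k(2)]
    by (cases "c = CloseList"; cases "c = EndNum \<or> c = Bot") (auto simp: sem_survey_symbol closes_def first_entries_def)
qed

text \<open>The encoding of a game does not state its dimensions, so they are counted before the
  syntax is checked. The two final pops discount the brackets of the matrices. For a malformed word
  the counts are arbitrary, and the later checks reject it.\<close>

definition read_dimensions :: "symbol com" where
  "read_dimensions = Loop (\<lambda>t. t 0 \<noteq> None) survey_symbol ;; clear 5 ;; transfer 9 0 ;; copy 3 6 5 ;;
     Loop (\<lambda>t. t 5 \<noteq> None) (Pop 5 ;; Pop 2) ;; Pop 2 ;; Pop 2"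

lemma sem_read_dimensions:
  assumes B: "length w < B"
  shows "sem B read_dimensions (input w) = (if live False w
    then Done (survey w [] (closes w - first_entries w - 2) (first_entries w) False) else Aborted)"
proof -
  let ?n = "first_entries w" and ?m = "closes w"
  have i: "input w = survey w [] 0 0 False" by (auto simp: input_def survey_def fun_eq_iff)
  have 1: "sem B (Loop (\<lambda>t. t 0 \<noteq> None) survey_symbol) (input w) = (if live False w
      then Done (survey [] (rev w) ?m ?n (open_flag False w)) else Aborted)"
    using sem_survey[of w B B "[]" 0 0 False] B by (simp add: i)
  have n: "?n \<le> length w" unfolding first_entries_def
    by (rule order_trans[OF length_filter_le length_takeWhile_le])
  show ?thesis
  proof (cases "live False w")
    case True
    let ?f = "open_flag False w"
    have "sem B (clear 5) (survey [] (rev w) ?m ?n ?f) = Done ((survey [] (rev w) ?m ?n ?f)(5 := []))"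
      using B by (intro sem_clear) (auto simp: survey_def)
    moreover have "(survey [] (rev w) ?m ?n ?f)(5 := []) = survey [] (rev w) ?m ?n False"
      by (auto simp: survey_def fun_eq_iff)
    ultimately have 2: "sem B (clear 5) (survey [] (rev w) ?m ?n ?f) = Done (survey [] (rev w) ?m ?n False)" by (simp only:)
    let ?s = "survey [] (rev w) ?m ?n False"
    have "sem B (transfer 9 0) ?s = Done (?s(0 := rev (?s 9) @ ?s 0, 9 := []))"
      using B by (intro sem_transfer) (auto simp: survey_def)
    moreover have "?s(0 := rev (?s 9) @ ?s 0, 9 := []) = survey w [] ?m ?n False"
      by (auto simp: survey_def fun_eq_iff)
    ultimately have 3: "sem B (transfer 9 0) ?s = Done (survey w [] ?m ?n False)" by (simp only:)
    let ?t = "survey w [] ?m ?n False"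
    have "sem B (copy 3 6 5) ?t = Done (?t(5 := ?t 3 @ ?t 5))"
      using B n by (intro sem_copy) (auto simp: survey_def)
    moreover have "?t(5 := ?t 3 @ ?t 5) = ?t(5 := ones ?n)" by (auto simp: survey_def fun_eq_iff)
    ultimately have 4: "sem B (copy 3 6 5) ?t = Done (?t(5 := ones ?n))" by (simp only:)
    have fold: "fold (\<lambda>x s. s(2 := tl (s 2))) xs s = s(2 := drop (length xs) (s 2))" for xs :: "symbol list" and s :: "symbol stacks"
      by (induction xs arbitrary: s) (auto simp: drop_Suc)
    have "sem B (Loop (\<lambda>t. t 5 \<noteq> None) (Pop 5 ;; Pop 2)) (?t(5 := ones ?n)) =
        Done ((fold (\<lambda>x s. s(2 := tl (s 2))) (ones ?n) (?t(5 := ones ?n)))(5 := []))"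
      by (rule sem_each[where P = "\<lambda>_. True"]) (use B n in \<open>auto simp: fun_eq_iff\<close>)
    moreover have "(fold (\<lambda>x s. s(2 := tl (s 2))) (ones ?n) (?t(5 := ones ?n)))(5 := []) = survey w [] (?m - ?n) ?n False"
      unfolding fold by (auto simp: survey_def fun_eq_iff)
    ultimately have 5: "sem B (Loop (\<lambda>t. t 5 \<noteq> None) (Pop 5 ;; Pop 2)) (?t(5 := ones ?n)) =
        Done (survey w [] (?m - ?n) ?n False)" by (simp only:)
    have 6: "sem B (Pop 2) (survey w [] k ?n False) = Done (survey w [] (k - 1) ?n False)" for k
      by (cases k) (auto simp: survey_def fun_eq_iff)
    have e: "?m - ?n - 1 - 1 = ?m - ?n - 2" by simp
    have "sem B read_dimensions (input w) = Done (survey w [] (?m - ?n - 1 - 1) ?n False)"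
      unfolding read_dimensions_def using True
      by (simp only: sem.simps(6) 1 if_True and_then.simps 2 3 4 5 6)
    then show ?thesis unfolding e using True by (simp only: if_True)
  next
    case False
    then show ?thesis unfolding read_dimensions_def by (simp only: sem.simps(6) 1 if_False and_then.simps)
  qed
qed

section \<open>Recognizing matrices of given size, and the start node\<close>

definition scan_list :: "nat \<Rightarrow> nat \<Rightarrow> symbol com \<Rightarrow> symbol com" where
  "scan_list i l P = expect {OpenList} ;; repeat i l P ;; expect {CloseList}"

lemma recognizes_list:
  assumes P: "recognizes Z P (\<lambda>a b. e ` X a b)" and A: "\<And>a b. prefix_free (e ` X a b)"
    and l: "l \<in> {4, 5}" "l \<notin> Z" "i \<in> {2, 3}"
  shows "recognizes (insert l (insert 6 Z)) (scan_list i l P)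
    (\<lambda>a b. encode_list e ` {xs. length xs = (if i = 2 then a else b) \<and> set xs \<subseteq> X a b})"
proof -
  let ?Z = "insert l (insert 6 Z)"
  have ex: "recognizes ?Z (expect {c}) (\<lambda>_ _. {[c]})" for c
    using recognizes_weaken[OF recognizes_expect[of "{c}"], of ?Z] by simp
  have "recognizes ?Z (scan_list i l P)
      (\<lambda>a b. {[OpenList]} \<star> word_power (e ` X a b) (if i = 2 then a else b) \<star> {[CloseList]})"
    unfolding scan_list_def
    by (intro recognizes_seq ex recognizes_repeat[OF P A l] prefix_free_word_power A prefix_free_singleton)
  moreover have "{[OpenList]} \<star> word_power (e ` X a b) n \<star> {[CloseList]} =
      encode_list e ` {xs. length xs = n \<and> set xs \<subseteq> X a b}" for a b n
    unfolding word_power_image by (force simp: catenate_def encode_list_def)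
  ultimately show ?thesis by simp
qed

definition scan_game :: "symbol com" where
  "scan_game = scan_list 2 4 (scan_list 3 5 scan_arc) ;; scan_list 3 4 (scan_list 2 5 scan_arc)"

lemma recognizes_game: "recognizes {4, 5, 6} scan_game
    (\<lambda>a b. {encode_list (encode_list encode_arc) R @ encode_list (encode_list encode_arc) C | R C.
      length R = a \<and> (\<forall>xs\<in>set R. length xs = b) \<and> length C = b \<and> (\<forall>xs\<in>set C. length xs = a)})"
proof -
  have rl: "uniquely_readable UNIV (encode_list encode_arc)"
  proof -
    have "\<forall>x. \<exists>c u. encode_arc x = c # u \<and> c \<noteq> CloseList" using hd_encode_arc by fastforce
    from readable_list_UNIV[OF readable_arc this] show ?thesis .
  qed
  have pf: "prefix_free (encode_list encode_arc ` Y)" for Y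
    by (intro prefix_free_image uniquely_readable_subset[OF rl]) simp
  have pa: "prefix_free (range encode_arc)" by (rule prefix_free_image[OF readable_arc])
  have pl: "prefix_free (encode_list (encode_list encode_arc) ` Y)" for Y
    by (intro prefix_free_image uniquely_readable_subset[OF readable_arc_lists]) simp
  have inner: "recognizes {5, 6} (scan_list i 5 scan_arc)
      (\<lambda>a b. encode_list encode_arc ` {xs. length xs = (if i = 2 then a else b)})" if "i \<in> {2, 3}" for i
    using recognizes_list[of "{}" scan_arc encode_arc "\<lambda>_ _. UNIV" 5 i] recognizes_arc pa that by simp
  have outer: "recognizes {4, 5, 6} (scan_list j 4 (scan_list i 5 scan_arc))
      (\<lambda>a b. encode_list (encode_list encode_arc) ` {R. length R = (if j = 2 then a else b) \<and>
         set R \<subseteq> {xs. length xs = (if i = 2 then a else b)}})" if "i \<in> {2, 3}" "j \<in> {2, 3}" for i j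
    using recognizes_list[OF inner[OF that(1)] pf, of 4 j] that(2) by (simp add: insert_commute)
  have "recognizes {4, 5, 6} scan_game (\<lambda>a b.
      encode_list (encode_list encode_arc) ` {R. length R = (if (2::nat) = 2 then a else b) \<and>
         set R \<subseteq> {xs. length xs = (if (3::nat) = 2 then a else b)}} \<star>
      encode_list (encode_list encode_arc) ` {R. length R = (if (3::nat) = 2 then a else b) \<and>
         set R \<subseteq> {xs. length xs = (if (2::nat) = 2 then a else b)}})"
    unfolding scan_game_def by (intro recognizes_seq outer pl) simp_all
  then show ?thesis
    by (rule back_subst[of "recognizes _ _"]) (auto simp: catenate_def fun_eq_iff subset_iff image_def, blast+)
qed

text \<open>Register 5 holds the number of nodes of the relevant kind. Each digit of the index
  removes one mark, and a mark must remain at the end, which expresses that the index is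
  smaller.\<close>

definition scan_index :: "symbol com" where
  "scan_index = Loop (\<lambda>t. t 0 = Some Dig1) (Cond (\<lambda>t. t 5 = None) Abort (Pop 5 ;; shift)) ;;
     Cond (\<lambda>t. t 0 = Some EndNum \<and> t 5 \<noteq> None) shift Abort ;; clear 5 ;; at_end"

lemma sem_scan_index:
  assumes "s 0 = r" "s 1 = []" "s 5 = ones m" "length r + m \<le> B"
  shows "sem B scan_index s = (if \<exists>k<m. r = encode_size k
    then Done (s(0 := [], 9 := rev r @ s 9, 5 := [])) else Aborted)"
proof -
  let ?b = "\<lambda>s. tops s 0 = Some Dig1"
  let ?g = "sem B (Cond (\<lambda>t. t 5 = None) Abort (Pop 5 ;; shift))"
  let ?fin = "Cond (\<lambda>t. t 0 = Some EndNum \<and> t 5 \<noteq> None) shift Abort ;; clear 5 ;; at_end"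
  have "and_then (iterate n ?b ?g s) (sem B ?fin) = (if \<exists>k<m. r = encode_size k
    then Done (s(0 := [], 9 := rev r @ s 9, 5 := [])) else Aborted)"
    if "length r \<le> n" "s 0 = r" "s 1 = []" "s 5 = ones m" "length r + m \<le> B" for n s m
    using that
  proof (induction r arbitrary: n s m)
    case Nil
    have "tops s 0 = None" using Nil by (simp add: tops_def)
    then show ?case using Nil by (cases n) (simp_all add: encode_size_def)
  next
    case (Cons c r)
    show ?case
    proof (cases "c = Dig1")
      case True
      obtain n' where n: "n = Suc n'" "length r \<le> n'" using Cons.prems(1) by (cases n) auto
      have t: "tops s 0 = Some Dig1" using Cons.prems True by (simp add: tops_def)
      show ?thesis
      proof (cases m)
        case 0
        then have "?g s = Aborted" using Cons.prems by (simp add: tops_def)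
        then show ?thesis using t 0 n by simp
      next
        case (Suc m')
        let ?s = "advance [Dig1] (s(5 := ones m'))"
        have "(s(5 := ones m')) 0 = Dig1 # r" using Cons.prems True by simp
        from sem_shift[of "s(5 := ones m')" Dig1 r, OF this]
        have g: "?g s = Done ?s" using Cons.prems Suc by (simp add: tops_def)
        have s: "?s 0 = r" "?s 1 = []" "?s 5 = ones m'" using Cons.prems True by (simp_all add: advance_def)
        have IH: "and_then (iterate n' ?b ?g ?s) (sem B ?fin) = (if \<exists>k<m'. r = encode_size k
            then Done (?s(0 := [], 9 := rev r @ ?s 9, 5 := [])) else Aborted)"
          by (rule Cons.IH) (use n s Cons.prems Suc in auto)
        have st: "?s(0 := [], 9 := rev r @ ?s 9, 5 := []) = s(0 := [], 9 := rev (c # r) @ s 9, 5 := [])"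
          using True by (auto simp: advance_def fun_eq_iff)
        have ex: "(\<exists>k<m. c # r = encode_size k) \<longleftrightarrow> (\<exists>k<m'. r = encode_size k)"
        proof
          assume "\<exists>k<m. c # r = encode_size k"
          then obtain k where k: "k < m" "c # r = encode_size k" by blast
          then obtain k' where "k = Suc k'" using True by (cases k) (auto simp: encode_size_def)
          then show "\<exists>k<m'. r = encode_size k" using k Suc by (intro exI[of _ k']) (simp add: encode_size_def)
        next
          assume "\<exists>k<m'. r = encode_size k"
          then obtain k where "k < m'" "r = encode_size k" by blast
          then show "\<exists>k<m. c # r = encode_size k" using True Suc by (intro exI[of _ "Suc k"]) (simp add: encode_size_def)
        qed
        show ?thesis unfolding n(1) iterate.simps if_P[OF t] g and_then.simps IH st ex ..
      qed
    next
      case False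
      have t: "tops s 0 = Some c" using Cons.prems by (simp add: tops_def)
      have it: "iterate n ?b ?g s = Done s" using t False by (cases n) simp_all
      have ex: "(\<exists>k<m. c # r = encode_size k) \<longleftrightarrow> c = EndNum \<and> r = [] \<and> 0 < m"
      proof
        assume "\<exists>k<m. c # r = encode_size k"
        then obtain k where k: "k < m" "c # r = encode_size k" by blast
        then show "c = EndNum \<and> r = [] \<and> 0 < m" using False by (cases k) (auto simp: encode_size_def)
      next
        assume "c = EndNum \<and> r = [] \<and> 0 < m"
        then show "\<exists>k<m. c # r = encode_size k" by (intro exI[of _ 0]) (simp add: encode_size_def)
      qed
      show ?thesis
      proof (cases "c = EndNum \<and> 0 < m")
        case True
        have t5: "tops s 5 \<noteq> None" using Cons.prems True by (cases m) (auto simp: tops_def)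
        have s0: "s 0 = EndNum # r" using Cons.prems True by simp
        let ?s = "advance [EndNum] s"
        have s: "?s 0 = r" "?s 1 = []" "length (?s 5) \<le> B" using s0 Cons.prems by (simp_all add: advance_def)
        have cl: "sem B (clear 5) ?s = Done (?s(5 := []))" by (rule sem_clear) (use s in simp_all)
        have "sem B ?fin s = sem B at_end (?s(5 := []))"
          using t t5 True sem_shift[of s EndNum r B, OF s0] cl by simp
        also have "\<dots> = (if r = [] then Done (?s(5 := [])) else Aborted)"
          using s by (simp add: at_end_def tops_def split: list.splits)
        finally have f: "sem B ?fin s = (if r = [] then Done (?s(5 := [])) else Aborted)" .
        have "?s(5 := []) = s(0 := [], 9 := rev (c # r) @ s 9, 5 := [])" if "r = []"
          using True s0 that by (auto simp: advance_def fun_eq_iff)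
        then show ?thesis unfolding it and_then.simps f ex using True
          by (cases "r = []") (simp_all only: simp_thms if_True if_False)
      next
        case F: False
        have "sem B ?fin s = Aborted" using F t Cons.prems by (auto simp: tops_def)
        then show ?thesis unfolding it and_then.simps ex using F by auto
      qed
    qed
  qed
  from this[of B s m] assms show ?thesis unfolding scan_index_def by simp
qed

definition scan_node :: "symbol com" where
  "scan_node = Cond (\<lambda>t. t 0 = Some Dig0) (shift ;; copy 2 6 5 ;; scan_index)
     (Cond (\<lambda>t. t 0 = Some Dig1) (shift ;; copy 3 6 5 ;; scan_index) Abort)"

lemma sem_scan_node:
  assumes s: "s 0 = r" "s 1 = []" "s 2 = ones a" "s 3 = ones b" "s 5 = []" "s 6 = []" and B: "length r + a + b \<le> B"
  shows "sem B scan_node s = (if \<exists>v\<in>Row ` {..<a} \<union> Col ` {..<b}. r = encode_node v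
    then Done (s(0 := [], 9 := rev r @ s 9)) else Aborted)"
proof (cases r)
  case Nil
  moreover have "[] \<noteq> encode_node v" for v by (cases v) auto
  ultimately show ?thesis using s by (auto simp: scan_node_def tops_def)
next
  case (Cons c r')
  have sh: "sem B shift s = Done (advance [c] s)" by (rule sem_shift[of s c r']) (simp add: s Cons)
  have main: "sem B (shift ;; copy i 6 5 ;; scan_index) s = (if \<exists>k<m. r' = encode_size k
      then Done (s(0 := [], 9 := rev r @ s 9)) else Aborted)" if i: "i = 2 \<or> i = 3" "s i = ones m" "m \<le> a + b" for i m
  proof -
    let ?s = "advance [c] s"
    have ai: "?s i = ones m" "?s 5 = []" "?s 6 = []" "?s 0 = r'" "?s 1 = []"
      using i s Cons by (auto simp: advance_def)
    have "sem B (copy i 6 5) ?s = Done (?s(5 := ?s i @ ?s 5))" by (rule sem_copy) (use ai i B Cons in auto)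
    then have 1: "sem B (copy i 6 5) ?s = Done (?s(5 := ones m))" using ai by (simp only: append_Nil2)
    have 2: "sem B scan_index (?s(5 := ones m)) = (if \<exists>k<m. r' = encode_size k
      then Done ((?s(5 := ones m))(0 := [], 9 := rev r' @ (?s(5 := ones m)) 9, 5 := [])) else Aborted)"
      by (rule sem_scan_index) (use ai B Cons i in auto)
    have 3: "(?s(5 := ones m))(0 := [], 9 := rev r' @ (?s(5 := ones m)) 9, 5 := []) = s(0 := [], 9 := rev r @ s 9)"
      using s Cons by (auto simp: advance_def fun_eq_iff)
    show ?thesis by (simp only: sem.simps(6) sh and_then.simps 1 2 3)
  qed
  have t: "tops s 0 = Some c" using s Cons by (simp add: tops_def)
  have ex: "(\<exists>v\<in>Row ` {..<a} \<union> Col ` {..<b}. r = encode_node v) \<longleftrightarrow>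
      c = Dig0 \<and> (\<exists>k<a. r' = encode_size k) \<or> c = Dig1 \<and> (\<exists>k<b. r' = encode_size k)"
    unfolding Cons bex_Un by auto
  show ?thesis unfolding ex scan_node_def sem.simps(7) t
    using main[of 2 a] main[of 3 b] s by (cases c) simp_all
qed

definition check_game :: "symbol com" where
  "check_game = read_dimensions ;; scan_game ;; scan_node ;; transfer 9 0"

text \<open>For matrices of matching sizes the existence of outgoing arcs is a condition on each
  list by itself, which \<open>live\<close> tests in one pass.\<close>

lemma mean_payoff_game_iff:
  assumes "\<forall>xs\<in>set (row_arcs g). length xs = num_cols g" "\<forall>xs\<in>set (col_arcs g). length xs = num_rows g"
  shows "mean_payoff_game g \<longleftrightarrow> (\<forall>xs\<in>set (row_arcs g) \<union> set (col_arcs g). \<exists>x\<in>set xs. x \<noteq> None)"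
proof -
  have r: "(\<exists>v\<in>nodes g. arc_weight g (Row i) v \<noteq> None) \<longleftrightarrow> (\<exists>x\<in>set (row_arcs g ! i). x \<noteq> None)" if "i < num_rows g" for i
  proof
    have len: "length (row_arcs g ! i) = num_cols g" using assms(1) that by (simp add: num_rows_def)
    show "\<exists>x\<in>set (row_arcs g ! i). x \<noteq> None" if ex: "\<exists>v\<in>nodes g. arc_weight g (Row i) v \<noteq> None"
    proof -
      obtain v where v: "v \<in> nodes g" "arc_weight g (Row i) v \<noteq> None" using ex by blast
      then obtain j where "v = Col j" "j < num_cols g" by (auto simp: nodes_def)
      then have "row_arcs g ! i ! j \<noteq> None" using v(2) by (simp split: if_splits)
      then show ?thesis using len \<open>j < num_cols g\<close> nth_mem[of j "row_arcs g ! i"] by metis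
    qed
    assume "\<exists>x\<in>set (row_arcs g ! i). x \<noteq> None"
    then obtain j where "j < num_cols g" "row_arcs g ! i ! j \<noteq> None" using len by (metis in_set_conv_nth)
    then show "\<exists>v\<in>nodes g. arc_weight g (Row i) v \<noteq> None"
      using \<open>i < num_rows g\<close> by (intro bexI[of _ "Col j"]) (auto simp: nodes_def)
  qed
  have c: "(\<exists>v\<in>nodes g. arc_weight g (Col j) v \<noteq> None) \<longleftrightarrow> (\<exists>x\<in>set (col_arcs g ! j). x \<noteq> None)" if "j < num_cols g" for j
  proof
    have len: "length (col_arcs g ! j) = num_rows g" using assms(2) that by (simp add: num_cols_def)
    show "\<exists>x\<in>set (col_arcs g ! j). x \<noteq> None" if ex: "\<exists>v\<in>nodes g. arc_weight g (Col j) v \<noteq> None"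
    proof -
      obtain v where v: "v \<in> nodes g" "arc_weight g (Col j) v \<noteq> None" using ex by blast
      then obtain i where "v = Row i" "i < num_rows g" by (auto simp: nodes_def)
      then have "col_arcs g ! j ! i \<noteq> None" using v(2) by (simp split: if_splits)
      then show ?thesis using len \<open>i < num_rows g\<close> nth_mem[of i "col_arcs g ! j"] by metis
    qed
    assume "\<exists>x\<in>set (col_arcs g ! j). x \<noteq> None"
    then obtain i where "i < num_rows g" "col_arcs g ! j ! i \<noteq> None" using len by (metis in_set_conv_nth)
    then show "\<exists>v\<in>nodes g. arc_weight g (Col j) v \<noteq> None"
      using \<open>j < num_cols g\<close> by (intro bexI[of _ "Row i"]) (auto simp: nodes_def)
  qed
  have all: "(\<forall>u\<in>nodes g. Q u) \<longleftrightarrow> (\<forall>i<num_rows g. Q (Row i)) \<and> (\<forall>j<num_cols g. Q (Col j))" for Q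
    by (auto simp: nodes_def)
  have "(\<forall>u\<in>nodes g. \<exists>v\<in>nodes g. arc_weight g u v \<noteq> None) \<longleftrightarrow>
      (\<forall>i<num_rows g. \<exists>v\<in>nodes g. arc_weight g (Row i) v \<noteq> None) \<and>
      (\<forall>j<num_cols g. \<exists>v\<in>nodes g. arc_weight g (Col j) v \<noteq> None)"
    by (rule all)
  also have "\<dots> \<longleftrightarrow> (\<forall>xs\<in>set (row_arcs g) \<union> set (col_arcs g). \<exists>x\<in>set xs. x \<noteq> None)"
    using r c unfolding ball_Un num_rows_def num_cols_def by (simp add: all_set_conv_all_nth)
  finally show ?thesis using assms by (simp add: mean_payoff_game_def)
qed

lemma sem_check_game:
  assumes B: "3 * length w + 20 \<le> B"
  shows "(\<exists>g s. w = encode_game g @ encode_node s \<and> mean_payoff_game g \<and> s \<in> nodes g \<and>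
      sem B check_game (input w) = Done (survey w [] (num_rows g) (num_cols g) False)) \<or>
    (\<forall>g s. mean_payoff_game g \<and> s \<in> nodes g \<longrightarrow> w \<noteq> encode_game g @ encode_node s) \<and>
    sem B check_game (input w) = Aborted"
proof -
  define b where "b = first_entries w"
  define a where "a = closes w - b - 2"
  let ?M = "encode_list (encode_list encode_arc)"
  have lens: "a \<le> length w" "b \<le> length w"
    unfolding a_def b_def closes_def first_entries_def
    using length_filter_le[of "\<lambda>c. c = CloseList" w]
      order_trans[OF length_filter_le length_takeWhile_le, of "\<lambda>c. c \<in> {EndNum, Bot}" "\<lambda>c. c \<noteq> CloseList" w]
    by linarith+
  have valid: "live False w \<and> num_rows g = a \<and> num_cols g = b \<and> (\<forall>xs\<in>set (row_arcs g). length xs = b) \<and>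
      (\<forall>xs\<in>set (col_arcs g). length xs = a) \<and> w = ?M (row_arcs g) @ ?M (col_arcs g) @ encode_node s"
    if g: "mean_payoff_game g" "s \<in> nodes g" "w = encode_game g @ encode_node s" for g s
  proof -
    have sh: "\<forall>xs\<in>set (row_arcs g). length xs = num_cols g" "\<forall>xs\<in>set (col_arcs g). length xs = num_rows g"
      using g(1) by (auto simp: mean_payoff_game_def)
    have ne: "\<forall>xs\<in>set (row_arcs g) \<union> set (col_arcs g). \<exists>x\<in>set xs. x \<noteq> None"
      using mean_payoff_game_iff[OF sh] g(1) by simp
    have "row_arcs g \<noteq> [] \<or> col_arcs g \<noteq> []" using g(2) by (auto simp: nodes_def num_rows_def num_cols_def)
    moreover have "col_arcs g \<noteq> []" if "xs \<in> set (row_arcs g)" for xs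
      using ne sh(1) that by (force simp: num_cols_def)
    moreover have "row_arcs g \<noteq> []" if "xs \<in> set (col_arcs g)" for xs
      using ne sh(2) that by (force simp: num_rows_def)
    \<comment> \<open>A node exists, and it has a successor of the other kind; so neither matrix is
      empty, and there is a first row whose entries can be counted.\<close>
    ultimately have nil: "row_arcs g \<noteq> []" "col_arcs g \<noteq> []" by (metis list.set_intros(1) neq_Nil_conv)+
    then obtain xs R where R: "row_arcs g = xs # R" by (cases "row_arcs g") auto
    have b: "num_cols g = b" using first_entries_game[OF R] sh(1) R g(3) by (simp add: b_def)
    have "closes w = num_rows g + num_cols g + 2" using closes_game[of g s] g(3) by simp
    then have "num_rows g = a" using b by (simp add: a_def)
    moreover have "live False w" using live_game[of g s] g(3) nil ne by simp
    ultimately show ?thesis using sh b g(3) by (simp add: encode_game_def)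
  qed
  have rd: "sem B read_dimensions (input w) = (if live False w then Done (survey w [] a b False) else Aborted)"
    using sem_read_dimensions[of w B] B by (simp add: a_def b_def)
  show ?thesis
  proof (cases "live False w")
    case False
    then show ?thesis using valid rd by (auto simp: check_game_def)
  next
    case True
    let ?s = "survey w [] a b False"
    have s0: "?s 0 = w" "?s 9 = []" "?s 1 = []" "?s 2 = ones a" "?s 3 = ones b" "?s 5 = []" "?s 6 = []" by (simp_all add: survey_def)
    have rdy: "ready {4, 5, 6} a b B ?s" using B lens by (auto simp: ready_def survey_def)
    have run: "sem B check_game (input w) = and_then (and_then (sem B scan_game ?s) (sem B scan_node)) (sem B (transfer 9 0))"
      unfolding check_game_def sem.simps(6) rd if_P[OF True] by (cases "sem B scan_game ?s") simp_all
    from recognizes_game rdy show ?thesis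
    proof (cases rule: recognizesE)
      case (1 u r)
      then obtain R C where u: "u = ?M R @ ?M C" and sh: "length R = a" "\<forall>xs\<in>set R. length xs = b"
        "length C = b" "\<forall>xs\<in>set C. length xs = a" by blast
      have w: "w = u @ r" using 1(2) s0 by simp
      let ?t = "advance u ?s"
      have t: "?t 0 = r" "?t 9 = rev u" "\<And>i. i \<noteq> 0 \<Longrightarrow> i \<noteq> 9 \<Longrightarrow> ?t i = ?s i"
        using w s0 by (simp_all add: advance_def)
      have B': "length r + a + b \<le> B" using B lens w by simp
      have nd: "sem B scan_node ?t = (if \<exists>v\<in>Row ` {..<a} \<union> Col ` {..<b}. r = encode_node v
          then Done (?t(0 := [], 9 := rev r @ ?t 9)) else Aborted)"
        by (rule sem_scan_node) (use t s0 B' in simp_all)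
      define g where "g = \<lparr>row_arcs = R, col_arcs = C\<rparr>"
      have g: "num_rows g = a" "num_cols g = b" "row_arcs g = R" "col_arcs g = C"
        using sh by (simp_all add: g_def num_rows_def num_cols_def)
      show ?thesis
      proof (cases "\<exists>v\<in>Row ` {..<a} \<union> Col ` {..<b}. r = encode_node v")
        case ex: True
        then obtain v where v: "v \<in> nodes g" "r = encode_node v" using g by (auto simp: nodes_def)
        have wg: "w = encode_game g @ encode_node v" using w u v g by (simp add: encode_game_def)
        have "mean_payoff_game g"
          using mean_payoff_game_iff[of g] sh g live_game[of g v] True wg by simp
        let ?t' = "?t(0 := [], 9 := rev r @ ?t 9)"
        have "sem B (transfer 9 0) ?t' = Done (?t'(0 := rev (?t' 9) @ ?t' 0, 9 := []))"
          by (rule sem_transfer) (use t(2) w B in simp_all)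
        moreover have "?t'(0 := rev (?t' 9) @ ?t' 0, 9 := []) = ?s"
        proof
          fix i show "(?t'(0 := rev (?t' 9) @ ?t' 0, 9 := [])) i = ?s i"
            using t w s0 by (cases "i = 0"; cases "i = 9") simp_all
        qed
        ultimately have "sem B (transfer 9 0) ?t' = Done ?s" by (simp only:)
        then have "sem B check_game (input w) = Done ?s"
          unfolding run 1(3) and_then.simps nd if_P[OF ex] .
        then show ?thesis using wg v \<open>mean_payoff_game g\<close> g by blast
      next
        case ex: False
        have "w \<noteq> encode_game g' @ encode_node v" if g': "mean_payoff_game g'" "v \<in> nodes g'" for g' v
        proof
          assume e: "w = encode_game g' @ encode_node v"
          from valid[OF g' e] have d: "num_rows g' = a" "num_cols g' = b"
            and "?M (row_arcs g') @ (?M (col_arcs g') @ encode_node v) = ?M R @ (?M C @ r)" using w u by auto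
          from uniquely_readableD[OF readable_arc_lists this(3)]
          have "?M (col_arcs g') @ encode_node v = ?M C @ r" by simp
          from uniquely_readableD[OF readable_arc_lists this] have "r = encode_node v" by simp
          then show False using ex g'(2) d by (auto simp: nodes_def)
        qed
        moreover have "sem B check_game (input w) = Aborted"
          unfolding run 1(3) and_then.simps nd if_not_P[OF ex] ..
        ultimately show ?thesis by blast
      qed
    next
      case 2
      have "w \<noteq> encode_game g' @ encode_node v" if g': "mean_payoff_game g'" "v \<in> nodes g'" for g' v
      proof
        assume e: "w = encode_game g' @ encode_node v"
        from valid[OF g' e] have d: "length (row_arcs g') = a" "length (col_arcs g') = b"
            "\<forall>xs\<in>set (row_arcs g'). length xs = b" "\<forall>xs\<in>set (col_arcs g'). length xs = a"
          and w: "w = (?M (row_arcs g') @ ?M (col_arcs g')) @ encode_node v"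
          by (simp_all add: num_rows_def num_cols_def)
        then have "?M (row_arcs g') @ ?M (col_arcs g') \<in> {?M R @ ?M C | R C. length R = a \<and> (\<forall>xs\<in>set R. length xs = b) \<and>
            length C = b \<and> (\<forall>xs\<in>set C. length xs = a)}" by blast
        from 2(1)[rule_format, OF this, of "encode_node v"] show False using w s0(1) by simp
      qed
      moreover have "sem B check_game (input w) = Aborted" unfolding run 2(2) by simp
      ultimately show ?thesis by blast
    qed
  qed
qed

section \<open>From mean payoff games to systems of mixed inequalities\<close>

subsection \<open>A calculus for translating programs\<close>

text \<open>Registers 2 to 7 are unary counters, the input is consumed from register 0, and the output is
  collected, in reverse, in register 8.\<close>

definition conf :: "(nat \<Rightarrow> nat) \<Rightarrow> symbol list \<Rightarrow> symbol list \<Rightarrow> symbol stacks" where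
  "conf c r q = (\<lambda>i. if i = 0 then r else if i = 8 then q else if i \<in> {2..7} then ones (c i) else [])"

text \<open>The rest \<open>r\<close> of the input and the earlier output \<open>q\<close> are
  arbitrary, which makes the notion compositional; a single \<open>N\<close> serves a whole
  program.\<close>

definition translates :: "nat \<Rightarrow> (nat \<Rightarrow> nat) \<Rightarrow> symbol com \<Rightarrow> symbol list \<Rightarrow> symbol list \<Rightarrow> (nat \<Rightarrow> nat) \<Rightarrow> bool" where
  "translates N c P u v c' \<longleftrightarrow>
     (\<forall>B\<ge>N. \<forall>r q. sem B P (conf c (u @ r) q) = Done (conf c' r (rev v @ q)))"

text \<open>The argument only records which symbol is expected on the input.\<close>

definition pop_input :: "symbol \<Rightarrow> symbol com" where
  "pop_input x = Pop 0"

text \<open>\<open>a\<close> and \<open>b\<close> are the dimensions. Unprimed counters are the row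
  and column indices reached, primed ones the numbers still to come; the two together pad a unit
  vector on both sides of its entry.\<close>

definition counters :: "nat \<Rightarrow> nat \<Rightarrow> nat \<Rightarrow> nat \<Rightarrow> nat \<Rightarrow> nat \<Rightarrow> nat \<Rightarrow> nat" where
  "counters a b i i' k k' = (\<lambda>_. 0)(2 := a, 3 := b, 4 := i, 5 := i', 6 := k, 7 := k')"

lemma translates_eq:
  "translates N c P u v c' \<Longrightarrow> u = u1 \<Longrightarrow> v = v1 \<Longrightarrow> c' = c1 \<Longrightarrow> translates N c P u1 v1 c1"
  by simp

lemma translates_seq:
  "translates N c P u v c' \<Longrightarrow> translates N c' Q u2 v2 c'' \<Longrightarrow> translates N c (P ;; Q) (u @ u2) (v @ v2) c''"
  by (simp add: translates_def)

lemma translates_pop_input: "translates N c (pop_input x) [x] [] c"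
  by (auto simp: translates_def pop_input_def conf_def fun_eq_iff)

lemma translates_puts: "translates N c (puts 8 v) [] v c"
  by (auto simp: translates_def sem_puts conf_def fun_eq_iff)

lemma translates_fill:
  assumes "j \<in> {2..7}" "c j \<le> N"
  shows "translates N c (fill j 9 8 x) [] (replicate (c j) x) c"
  unfolding translates_def
proof (intro allI impI)
  fix B r q assume "N \<le> B"
  then have "sem B (fill j 9 8 x) (conf c ([] @ r) q) = Done ((conf c ([] @ r) q)
      (8 := replicate (length (conf c ([] @ r) q j)) x @ conf c ([] @ r) q 8))"
    using assms by (intro sem_fill) (auto simp: conf_def)
  also have "(conf c ([] @ r) q)(8 := replicate (length (conf c ([] @ r) q j)) x @ conf c ([] @ r) q 8) =
      conf c r (rev (replicate (c j) x) @ q)"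
    using assms by (auto simp: conf_def fun_eq_iff)
  finally show "sem B (fill j 9 8 x) (conf c ([] @ r) q) = Done (conf c r (rev (replicate (c j) x) @ q))" .
qed

lemma translates_copy:
  assumes "j \<in> {2..7}" "k \<in> {2..7}" "j \<noteq> k" "c j \<le> N"
  shows "translates N c (fill j 9 k Dig1) [] [] (c(k := c j + c k))"
  unfolding translates_def
proof (intro allI impI)
  fix B r q assume "N \<le> B"
  then have "sem B (fill j 9 k Dig1) (conf c ([] @ r) q) = Done ((conf c ([] @ r) q)
      (k := replicate (length (conf c ([] @ r) q j)) Dig1 @ conf c ([] @ r) q k))"
    using assms by (intro sem_fill) (auto simp: conf_def)
  also have "(conf c ([] @ r) q)(k := replicate (length (conf c ([] @ r) q j)) Dig1 @ conf c ([] @ r) q k) =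
      conf (c(k := c j + c k)) r (rev [] @ q)"
    using assms by (auto simp: conf_def fun_eq_iff replicate_add)
  finally show "sem B (fill j 9 k Dig1) (conf c ([] @ r) q) = Done (conf (c(k := c j + c k)) r (rev [] @ q))" .
qed

lemma translates_inc: "k \<in> {2..7} \<Longrightarrow> translates N c (put k Dig1) [] [] (c(k := Suc (c k)))"
  by (auto simp: translates_def conf_def fun_eq_iff)

lemma translates_dec: "k \<in> {2..7} \<Longrightarrow> translates N c (Pop k) [] [] (c(k := c k - 1))"
  by (cases "c k") (auto simp: translates_def conf_def fun_eq_iff)

lemma translates_clear:
  assumes "k \<in> {2..7}" "c k \<le> N"
  shows "translates N c (clear k) [] [] (c(k := 0))"
  unfolding translates_def
proof (intro allI impI)
  fix B r q assume "N \<le> B"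
  then have "sem B (clear k) (conf c ([] @ r) q) = Done ((conf c ([] @ r) q)(k := []))"
    using assms by (intro sem_clear) (auto simp: conf_def)
  also have "(conf c ([] @ r) q)(k := []) = conf (c(k := 0)) r (rev [] @ q)"
    using assms by (auto simp: conf_def fun_eq_iff)
  finally show "sem B (clear k) (conf c ([] @ r) q) = Done (conf (c(k := 0)) r (rev [] @ q))" .
qed

lemma tops_conf:
  "k \<in> {2..7} \<Longrightarrow> tops (conf c r q) k = (if c k = 0 then None else Some Dig1)"
  "tops (conf c (x # r) q) 0 = Some x"
  by (cases "c k") (auto simp: tops_def conf_def)

lemma translates_cond_iff:
  "translates N c (Cond (\<lambda>t. t 0 = Some x) P Q) (d # u) v c' \<longleftrightarrow>
     (if d = x then translates N c P (d # u) v c' else translates N c Q (d # u) v c')"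
  by (simp add: translates_def tops_conf)

lemma translates_cond:
  "translates N c P (x # u) v c' \<Longrightarrow> translates N c (Cond (\<lambda>t. t 0 = Some x) P Q) (x # u) v c'"
  "translates N c Q (d # u) v c' \<Longrightarrow> d \<noteq> x \<Longrightarrow> translates N c (Cond (\<lambda>t. t 0 = Some x) P Q) (d # u) v c'"
  by (simp_all add: translates_cond_iff)

lemma translates_int:
  assumes "length (encode_int z) \<le> N"
  shows "translates N c (move_until 0 8 EndNum) (encode_int z) (encode_int z) c"
proof -
  define u where "u = butlast (encode_int z)"
  have u: "encode_int z = u @ [EndNum]" "EndNum \<notin> set u"
    using EndNum_binary(1)[of "nat \<bar>z\<bar>"] by (auto simp: u_def encode_int_def butlast_append)
  have "sem B (move_until 0 8 EndNum) (conf c (encode_int z @ r) q) = Done (conf c r (rev (encode_int z) @ q))"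
    if "N \<le> B" for B r q
  proof -
    have "sem B (move_until 0 8 EndNum) (conf c (encode_int z @ r) q) =
        Done ((conf c (encode_int z @ r) q)(0 := r, 8 := EndNum # rev u @ conf c (encode_int z @ r) q 8))"
      by (rule sem_move_until[of "conf c (encode_int z @ r) q" 0 u EndNum r])
        (use u assms that in \<open>simp_all add: conf_def\<close>)
    also have "(conf c (encode_int z @ r) q)(0 := r, 8 := EndNum # rev u @ conf c (encode_int z @ r) q 8) =
        conf c r (rev (encode_int z) @ q)" using u(1) by (auto simp: conf_def fun_eq_iff)
    finally show ?thesis .
  qed
  then show ?thesis by (simp add: translates_def)
qed

text \<open>The family \<open>C\<close> gives the counters at the start of each round and takes the
  place of a loop invariant. The continuation \<open>Q\<close> is included because the test for
  leaving the loop may inspect its input.\<close>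

lemma translates_loop:
  assumes P: "\<And>i. i < m \<Longrightarrow> translates N (C i) P (e i) (h i) (C (Suc i))"
    and b: "\<And>i r q. i < m \<Longrightarrow> b (tops (conf (C i) (e i @ r) q))" "\<And>r q. \<not> b (tops (conf (C m) (u' @ r) q))"
    and Q: "translates N (C m) Q u' v' c'" and m: "m \<le> N"
  shows "translates N (C 0) (Loop b P ;; Q) (concat (map e [0..<m]) @ u') (concat (map h [0..<m]) @ v') c'"
  unfolding translates_def
proof (intro allI impI)
  fix B r q assume B: "N \<le> B"
  have "iterate n (\<lambda>s. b (tops s)) (sem B P) (conf (C i) (concat (map e [i..<m]) @ u' @ r) q) =
      Done (conf (C m) (u' @ r) (rev (concat (map h [i..<m])) @ q))" if "i + d = m" "d \<le> n" for i d n q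
    using that
  proof (induction d arbitrary: i n q)
    case 0
    then have "i = m" by simp
    then show ?case using b(2) by (cases n) simp_all
  next
    case (Suc d)
    then obtain n' where n: "n = Suc n'" "d \<le> n'" by (cases n) auto
    have i: "i < m" "[i..<m] = i # [Suc i..<m]" using Suc.prems by (auto simp: upt_conv_Cons)
    have 1: "sem B P (conf (C i) (e i @ (concat (map e [Suc i..<m]) @ u' @ r)) q) =
        Done (conf (C (Suc i)) (concat (map e [Suc i..<m]) @ u' @ r) (rev (h i) @ q))"
      using P[OF i(1)] B unfolding translates_def by blast
    have IH: "iterate n' (\<lambda>s. b (tops s)) (sem B P) (conf (C (Suc i)) (concat (map e [Suc i..<m]) @ u' @ r) (rev (h i) @ q)) =
        Done (conf (C m) (u' @ r) (rev (concat (map h [Suc i..<m])) @ rev (h i) @ q))"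
      by (rule Suc.IH) (use Suc.prems n in auto)
    show ?case unfolding n(1) i(2)
      using IH by (simp add: b(1)[OF i(1)] 1)
  qed
  from this[of 0 m B q] m B
  have "sem B (Loop b P) (conf (C 0) (concat (map e [0..<m]) @ u' @ r) q) =
      Done (conf (C m) (u' @ r) (rev (concat (map h [0..<m])) @ q))" by simp
  moreover have "sem B Q (conf (C m) (u' @ r) q') = Done (conf c' r (rev v' @ q'))" for q'
    using Q B unfolding translates_def by blast
  ultimately show "sem B (Loop b P ;; Q) (conf (C 0) ((concat (map e [0..<m]) @ u') @ r) q) =
      Done (conf c' r (rev (concat (map h [0..<m]) @ v') @ q))"
    by (simp del: sem.simps(8))
qed

lemma counters_apply:
  "counters a b i i' k k' 2 = a" "counters a b i i' k k' 3 = b" "counters a b i i' k k' 4 = i"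
  "counters a b i i' k k' 5 = i'" "counters a b i i' k k' 6 = k" "counters a b i i' k k' 7 = k'"
  by (simp_all add: counters_def)

lemma counters_upd:
  "(counters a b i i' k k')(4 := x) = counters a b x i' k k'"
  "(counters a b i i' k k')(5 := x) = counters a b i x k k'"
  "(counters a b i i' k k')(6 := x) = counters a b i i' x k'"
  "(counters a b i i' k k')(7 := x) = counters a b i i' k x"
  by (auto simp: counters_def fun_eq_iff)

text \<open>Every counter operation in terms of \<open>counters\<close>, so that programs can be
  verified by repeated application of rules.\<close>

lemma translates_counters:
  assumes "a \<le> N" "b \<le> N"
  shows "translates N (counters a b i i' k k') (fill 2 9 8 x) [] (replicate a x) (counters a b i i' k k')"
    "translates N (counters a b i i' k k') (fill 3 9 8 x) [] (replicate b x) (counters a b i i' k k')"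
    "i \<le> N \<Longrightarrow> translates N (counters a b i i' k k') (fill 4 9 8 x) [] (replicate i x) (counters a b i i' k k')"
    "i' \<le> N \<Longrightarrow> translates N (counters a b i i' k k') (fill 5 9 8 x) [] (replicate i' x) (counters a b i i' k k')"
    "k \<le> N \<Longrightarrow> translates N (counters a b i i' k k') (fill 6 9 8 x) [] (replicate k x) (counters a b i i' k k')"
    "k' \<le> N \<Longrightarrow> translates N (counters a b i i' k k') (fill 7 9 8 x) [] (replicate k' x) (counters a b i i' k k')"
    "translates N (counters a b 0 i' k k') (fill 2 9 4 Dig1) [] [] (counters a b a i' k k')"
    "translates N (counters a b i 0 k k') (fill 2 9 5 Dig1) [] [] (counters a b i a k k')"
    "translates N (counters a b i i' 0 k') (fill 3 9 6 Dig1) [] [] (counters a b i i' b k')"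
    "translates N (counters a b i i' k 0) (fill 3 9 7 Dig1) [] [] (counters a b i i' k b)"
    "translates N (counters a b i i' k k') (put 4 Dig1) [] [] (counters a b (Suc i) i' k k')"
    "translates N (counters a b i i' k k') (put 6 Dig1) [] [] (counters a b i i' (Suc k) k')"
    "translates N (counters a b i i' k k') (Pop 4) [] [] (counters a b (i - 1) i' k k')"
    "translates N (counters a b i i' k k') (Pop 5) [] [] (counters a b i (i' - 1) k k')"
    "translates N (counters a b i i' k k') (Pop 6) [] [] (counters a b i i' (k - 1) k')"
    "translates N (counters a b i i' k k') (Pop 7) [] [] (counters a b i i' k (k' - 1))"
    "i \<le> N \<Longrightarrow> translates N (counters a b i i' k k') (clear 4) [] [] (counters a b 0 i' k k')"
    "k \<le> N \<Longrightarrow> translates N (counters a b i i' k k') (clear 6) [] [] (counters a b i i' 0 k')"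
  using assms translates_fill[of 2 "counters a b i i' k k'" N x] translates_fill[of 3 "counters a b i i' k k'" N x]
    translates_fill[of 4 "counters a b i i' k k'" N x] translates_fill[of 5 "counters a b i i' k k'" N x]
    translates_fill[of 6 "counters a b i i' k k'" N x] translates_fill[of 7 "counters a b i i' k k'" N x]
    translates_copy[of 2 4 "counters a b 0 i' k k'" N] translates_copy[of 2 5 "counters a b i 0 k k'" N]
    translates_copy[of 3 6 "counters a b i i' 0 k'" N] translates_copy[of 3 7 "counters a b i i' k 0" N]
    translates_inc[of 4 N "counters a b i i' k k'"] translates_inc[of 6 N "counters a b i i' k k'"]
    translates_dec[of 4 N "counters a b i i' k k'"] translates_dec[of 5 N "counters a b i i' k k'"]
    translates_dec[of 6 N "counters a b i i' k k'"] translates_dec[of 7 N "counters a b i i' k k'"]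
    translates_clear[of 4 "counters a b i i' k k'" N] translates_clear[of 6 "counters a b i i' k k'" N]
  by (simp_all add: counters_apply counters_upd)

text \<open>Placed before the general decrement in \<open>translates_rules\<close>, these two keep
  subtraction out of the counters.\<close>

lemma translates_dec_Suc:
  "translates N (counters a b i (Suc i') k k') (Pop 5) [] [] (counters a b i i' k k')"
  "translates N (counters a b i i' k (Suc k')) (Pop 7) [] [] (counters a b i i' k k')"
  using translates_dec[of 5 N "counters a b i (Suc i') k k'"] translates_dec[of 7 N "counters a b i i' k (Suc k')"]
  by (simp_all add: counters_apply counters_upd)

lemmas translates_rules =
  translates_seq translates_puts translates_pop_input translates_dec_Suc translates_counters

subsection \<open>The inequalities of the system\<close>

lemma encode_unit:
  "encode_list encode_coef (unit n k c) =
     OpenList # replicate k Bot @ encode_coef c @ replicate (n - k) Bot @ [CloseList]"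
proof -
  have "concat (map encode_coef (replicate m None)) = replicate m Bot" for m by (induction m) auto
  then show ?thesis by (simp add: unit_def encode_list_def)
qed

text \<open>Writes the two unit vectors of an arc inequality, padded from the counters; a missing
  arc produces no inequality.\<close>

definition emit_arc :: "symbol com" where
  "emit_arc = Cond (\<lambda>t. t 0 = Some Bot) (pop_input Bot)
     (puts 8 [OpenList, Bot] ;; fill 4 9 8 Bot ;; move_until 0 8 EndNum ;; fill 5 9 8 Bot ;; fill 3 9 8 Bot ;;
      puts 8 [CloseList, OpenList, Bot] ;; fill 2 9 8 Bot ;; fill 6 9 8 Bot ;; puts 8 [EndNum] ;;
      fill 7 9 8 Bot ;; puts 8 [CloseList])"

definition arc_inequalities :: "nat \<Rightarrow> nat \<Rightarrow> nat \<Rightarrow> nat \<Rightarrow> int option \<Rightarrow> (coef list \<times> coef list) list" where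
  "arc_inequalities a b i k x = (case x of None \<Rightarrow> []
     | Some w \<Rightarrow> [(unit (a + b) (1 + i) (Some (w, False)), unit (a + b) (1 + a + k) (Some (0, False)))])"

lemma translates_arc:
  assumes "i + Suc i' = a" "k + Suc k' = b" "a \<le> N" "b \<le> N" "length (encode_arc x) \<le> N"
  shows "translates N (counters a b i i' k k') emit_arc (encode_arc x)
    (concat (map encode_ineq (arc_inequalities a b i k x))) (counters a b i i' k k')"
proof (cases x)
  case None
  then show ?thesis
    by (simp add: emit_arc_def translates_cond_iff translates_pop_input arc_inequalities_def)
next
  case (Some z)
  obtain d u where z: "encode_int z = d # u" "d \<noteq> Bot" using hd_encode_int[of z] by auto
  have len: "length (encode_int z) \<le> N" using assms Some by simp
  have d: "a + b - Suc i = i' + b" "a + b - Suc (a + k) = k'" using assms by auto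
  show ?thesis unfolding Some emit_arc_def encode_arc.simps
    unfolding z(1) translates_cond_iff if_not_P[OF z(2)]
    unfolding z(1)[symmetric]
    by (rule translates_eq, (rule translates_rules translates_int[OF len] |
        (use assms in \<open>simp add: arc_inequalities_def encode_ineq_def encode_unit d replicate_add encode_int_cases; fail\<close>) |
        (use assms in linarith))+)
qed

definition emit_row :: "symbol com" where
  "emit_row = Pop 5 ;; pop_input OpenList ;; fill 3 9 7 Dig1 ;;
     Loop (\<lambda>t. t 7 \<noteq> None) (Pop 7 ;; emit_arc ;; put 6 Dig1) ;;
     pop_input CloseList ;; clear 6 ;; put 4 Dig1"

lemma map_nth_upt: "length xs = b \<Longrightarrow> map (\<lambda>k. f (xs ! k)) [0..<b] = map f xs"
  by (rule nth_equalityI) auto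

lemma translates_row:
  assumes "i + Suc i' = a" "length xs = b" "a \<le> N" "b \<le> N" "\<forall>x\<in>set xs. length (encode_arc x) \<le> N"
  shows "translates N (counters a b i (Suc i') 0 0) emit_row (encode_list encode_arc xs)
    (concat (map (\<lambda>k. concat (map encode_ineq (arc_inequalities a b i k (xs ! k)))) [0..<b]))
    (counters a b (Suc i) i' 0 0)"
proof -
  let ?h = "\<lambda>k. concat (map encode_ineq (arc_inequalities a b i k (xs ! k)))"
  have step: "translates N (counters a b i i' k (b - k)) (Pop 7 ;; emit_arc ;; put 6 Dig1) (encode_arc (xs ! k)) (?h k)
      (counters a b i i' (Suc k) (b - Suc k))" if "k < b" for k
    by (rule translates_eq, (rule translates_rules translates_arc[of i i' a k "b - k - 1" b N "xs ! k"] |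
        (use assms that in \<open>simp; fail\<close>) | (use assms that in linarith))+)
  have "translates N (counters a b i i' b 0) (pop_input CloseList ;; clear 6 ;; put 4 Dig1) [CloseList] []
      (counters a b (Suc i) i' 0 0)"
    by (rule translates_eq, (rule translates_rules | (use assms in \<open>simp; fail\<close>))+)
  then have "translates N (counters a b i i' 0 (b - 0)) (Loop (\<lambda>t. t 7 \<noteq> None) (Pop 7 ;; emit_arc ;; put 6 Dig1) ;;
      pop_input CloseList ;; clear 6 ;; put 4 Dig1)
      (concat (map (\<lambda>k. encode_arc (xs ! k)) [0..<b]) @ [CloseList]) (concat (map ?h [0..<b]) @ [])
      (counters a b (Suc i) i' 0 0)"
    by (intro translates_loop[where C = "\<lambda>k. counters a b i i' k (b - k)"] step)
      (use assms in \<open>simp_all add: tops_conf counters_apply\<close>)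
  note loop = this[unfolded diff_zero]
  show ?thesis unfolding emit_row_def
    by (rule translates_eq, (rule loop translates_rules |
      (use assms in \<open>simp add: encode_list_def map_nth_upt; fail\<close>))+)
qed

text \<open>Negation toggles the sign, except that zero must not receive one. The mark makes the
  inequality of the column strict.\<close>

definition emit_negated :: "symbol com" where
  "emit_negated = Cond (\<lambda>t. t 0 = Some Bot) (pop_input Bot ;; puts 8 [Bot])
     (Cond (\<lambda>t. t 0 = Some NegSign) (pop_input NegSign ;; puts 8 [MinusMark] ;; move_until 0 8 EndNum)
       (Cond (\<lambda>t. t 0 = Some EndNum) (puts 8 [MinusMark] ;; move_until 0 8 EndNum)
         (puts 8 [MinusMark, NegSign] ;; move_until 0 8 EndNum)))"

lemma translates_negated:
  assumes "length (encode_arc x) \<le> N"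
  shows "translates N c emit_negated (encode_arc x) (encode_coef (map_option (\<lambda>z. (- z, True)) x)) c"
proof (cases x)
  case None
  then show ?thesis using translates_seq[OF translates_pop_input[of N c Bot] translates_puts[of N c "[Bot]"]]
    by (simp add: emit_negated_def translates_cond_iff)
next
  case (Some z)
  have mv: "translates N c (puts 8 w ;; move_until 0 8 EndNum) (encode_int y) (w @ encode_int y) c"
    if "length (encode_int y) \<le> N" for w y
    using translates_seq[OF translates_puts translates_int[OF that]] by simp
  consider "z < 0" | "z = 0" | "z > 0" by linarith
  then show ?thesis
  proof cases
    case 1
    then have e: "encode_int z = NegSign # encode_int (- z)" by (simp add: encode_int_def)
    have "length (encode_int (- z)) \<le> N" using assms Some e by simp
    from translates_seq[OF translates_pop_input[of N c NegSign] mv[OF this, of "[MinusMark]"]]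
    show ?thesis using Some by (simp add: emit_negated_def e translates_cond_iff)
  next
    case 2
    have e: "encode_int 0 = [EndNum]" by (simp add: encode_int_def)
    show ?thesis using mv[of 0 "[MinusMark]"] assms Some 2 by (simp add: emit_negated_def e translates_cond_iff)
  next
    case 3
    then have e: "encode_int (- z) = NegSign # encode_int z" by (simp add: encode_int_def)
    obtain d u where z: "encode_int z = d # u" "d \<notin> {Bot, NegSign, EndNum}"
    proof -
      obtain d u where du: "binary (nat z) = d # u" using 3 by (cases "binary (nat z)") auto
      then have "encode_int z = d # u @ [EndNum]" using 3 by (simp add: encode_int_def)
      moreover have "d \<in> digits" using digits_binary[of "nat z"] du by simp
      ultimately show thesis using that by (auto simp: digits_def)
    qed
    show ?thesis using mv[of z "[MinusMark, NegSign]"] assms z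
      by (simp add: Some emit_negated_def e translates_cond_iff)
  qed
qed

definition column_inequality :: "nat \<Rightarrow> nat \<Rightarrow> nat \<Rightarrow> int option list \<Rightarrow> coef list \<times> coef list" where
  "column_inequality a b j xs = (unit (a + b) (1 + a + j) (Some (0, False)),
     None # map (map_option (\<lambda>c. (- c, True))) xs @ replicate b None)"

definition emit_col :: "symbol com" where
  "emit_col = Pop 7 ;; pop_input OpenList ;; puts 8 [OpenList, Bot] ;; fill 2 9 8 Bot ;; fill 6 9 8 Bot ;;
     puts 8 [EndNum] ;; fill 7 9 8 Bot ;; puts 8 [CloseList, OpenList, Bot] ;; fill 2 9 5 Dig1 ;;
     Loop (\<lambda>t. t 5 \<noteq> None) (Pop 5 ;; emit_negated) ;;
     pop_input CloseList ;; fill 3 9 8 Bot ;; puts 8 [CloseList] ;; put 6 Dig1"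

lemma translates_col:
  assumes "j + Suc j' = b" "length xs = a" "a \<le> N" "b \<le> N" "\<forall>x\<in>set xs. length (encode_arc x) \<le> N"
  shows "translates N (counters a b 0 0 j (Suc j')) emit_col (encode_list encode_arc xs)
    (encode_ineq (column_inequality a b j xs)) (counters a b 0 0 (Suc j) j')"
proof -
  let ?h = "\<lambda>i. encode_coef (map_option (\<lambda>z. (- z, True)) (xs ! i))"
  have step: "translates N (counters a b 0 (a - i) j j') (Pop 5 ;; emit_negated) (encode_arc (xs ! i)) (?h i)
      (counters a b 0 (a - Suc i) j j')" if "i < a" for i
    by (rule translates_eq, (rule translates_rules translates_negated[of "xs ! i"] |
        (use assms that in \<open>simp; fail\<close>) | (use assms that in linarith))+)
  have "translates N (counters a b 0 0 j j') (pop_input CloseList ;; fill 3 9 8 Bot ;; puts 8 [CloseList] ;; put 6 Dig1)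
      [CloseList] (replicate b Bot @ [CloseList]) (counters a b 0 0 (Suc j) j')"
    by (rule translates_eq, (rule translates_rules | (use assms in \<open>simp; fail\<close>))+)
  then have "translates N (counters a b 0 (a - 0) j j') (Loop (\<lambda>t. t 5 \<noteq> None) (Pop 5 ;; emit_negated) ;;
      pop_input CloseList ;; fill 3 9 8 Bot ;; puts 8 [CloseList] ;; put 6 Dig1)
      (concat (map (\<lambda>i. encode_arc (xs ! i)) [0..<a]) @ [CloseList])
      (concat (map ?h [0..<a]) @ (replicate b Bot @ [CloseList])) (counters a b 0 0 (Suc j) j')"
    by (intro translates_loop[where C = "\<lambda>i. counters a b 0 (a - i) j j'"] step)
      (use assms in \<open>simp_all add: tops_conf counters_apply\<close>)
  note loop = this[unfolded diff_zero]
  have rep: "concat (map encode_coef (replicate m None)) = replicate m Bot" for m by (induction m) auto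
  have d: "a + b - Suc (a + j) = j'" using assms by simp
  have n: "encode_coef (Some (0, False)) = [EndNum]" by (simp add: encode_int_def)
  have v: "encode_ineq (column_inequality a b j xs) = OpenList # Bot # replicate a Bot @ replicate j Bot @ EndNum #
      replicate j' Bot @ CloseList # OpenList # Bot # concat (map ?h [0..<a]) @ replicate b Bot @ [CloseList]"
  proof -
    have "map ?h [0..<a] = map (\<lambda>x. encode_coef (map_option (\<lambda>z. (- z, True)) x)) xs"
      using assms(2) by (rule map_nth_upt)
    then show ?thesis
      by (simp add: column_inequality_def encode_ineq_def encode_unit n d replicate_add del: encode_coef.simps)
        (simp add: encode_list_def rep comp_def)
  qed
  show ?thesis unfolding emit_col_def v
    by (rule translates_eq, (rule loop translates_rules |
      (use assms in \<open>simp add: encode_list_def map_nth_upt; fail\<close>))+)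
qed

text \<open>Each digit of the unary index becomes one entry of padding and takes one mark from the
  counter, so what is left of the counter is the padding behind the entry.\<close>

definition emit_start :: "symbol com" where
  "emit_start = puts 8 [OpenList, EndNum] ;; fill 2 9 8 Bot ;; fill 3 9 8 Bot ;; puts 8 [CloseList, OpenList, Bot] ;;
     Cond (\<lambda>t. t 0 = Some Dig0)
       (pop_input Dig0 ;; fill 2 9 4 Dig1 ;;
        Loop (\<lambda>t. t 0 = Some Dig1) (pop_input Dig1 ;; Pop 4 ;; puts 8 [Bot]) ;;
        pop_input EndNum ;; Pop 4 ;; puts 8 [EndNum] ;; fill 4 9 8 Bot ;; fill 3 9 8 Bot ;; puts 8 [CloseList, CloseList])
       (pop_input Dig1 ;; fill 2 9 8 Bot ;; fill 3 9 6 Dig1 ;;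
        Loop (\<lambda>t. t 0 = Some Dig1) (pop_input Dig1 ;; Pop 6 ;; puts 8 [Bot]) ;;
        pop_input EndNum ;; Pop 6 ;; puts 8 [EndNum] ;; fill 6 9 8 Bot ;; puts 8 [CloseList, CloseList])"

lemma concat_map_const: "concat (map (\<lambda>_. [c]) [0..<n]) = replicate n c"
  by (induction n) (simp_all add: replicate_app_Cons[of _ _ "[]", simplified])

text \<open>The final counters depend on the kind and index of the node and are cleared afterwards,
  hence the existential.\<close>

lemma translates_start:
  assumes "a = num_rows g" "b = num_cols g" "s \<in> nodes g" "a \<le> N" "b \<le> N"
  shows "\<exists>c. translates N (counters a b 0 0 0 0) emit_start (encode_node s) (encode_ineq (start_inequality g s) @ [CloseList]) c"
proof -
  have n: "encode_coef (Some (0, False)) = [EndNum]" by (simp add: encode_int_def)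
  have v: "encode_ineq (start_inequality g s) = OpenList # EndNum # replicate a Bot @ replicate b Bot @ CloseList #
      OpenList # replicate (coordinate g s) Bot @ EndNum # replicate (a + b - coordinate g s) Bot @ [CloseList]"
    using assms by (simp add: start_inequality_def Let_def encode_ineq_def encode_unit n replicate_add del: encode_coef.simps)
  show ?thesis
  proof (cases s)
    case (Row i)
    then have i: "i < a" using assms by (auto simp: nodes_def)
    have step: "translates N (counters a b (a - l) 0 0 0) (pop_input Dig1 ;; Pop 4 ;; puts 8 [Bot]) [Dig1] [Bot]
        (counters a b (a - Suc l) 0 0 0)" if "l < i" for l
      by (rule translates_eq, (rule translates_rules | (use assms in \<open>simp; fail\<close>))+)
    have "translates N (counters a b (a - i) 0 0 0) (pop_input EndNum ;; Pop 4 ;; puts 8 [EndNum] ;; fill 4 9 8 Bot ;;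
        fill 3 9 8 Bot ;; puts 8 [CloseList, CloseList]) [EndNum]
        (EndNum # replicate (a - i - 1) Bot @ replicate b Bot @ [CloseList, CloseList]) (counters a b (a - i - 1) 0 0 0)"
      by (rule translates_eq, (rule translates_rules | (use assms in \<open>simp; fail\<close>))+)
    then have "translates N (counters a b (a - 0) 0 0 0)
        (Loop (\<lambda>t. t 0 = Some Dig1) (pop_input Dig1 ;; Pop 4 ;; puts 8 [Bot]) ;;
          pop_input EndNum ;; Pop 4 ;; puts 8 [EndNum] ;; fill 4 9 8 Bot ;; fill 3 9 8 Bot ;; puts 8 [CloseList, CloseList])
        (concat (map (\<lambda>_. [Dig1]) [0..<i]) @ [EndNum])
        (concat (map (\<lambda>_. [Bot]) [0..<i]) @ (EndNum # replicate (a - i - 1) Bot @ replicate b Bot @ [CloseList, CloseList]))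
        (counters a b (a - i - 1) 0 0 0)"
      by (intro translates_loop[where C = "\<lambda>l. counters a b (a - l) 0 0 0"] step) (use assms i in \<open>simp_all add: tops_conf\<close>)
    note loop = this[unfolded diff_zero concat_map_const]
    have r: "translates N (counters a b 0 0 0 0) (pop_input Dig0 ;; fill 2 9 4 Dig1 ;;
        Loop (\<lambda>t. t 0 = Some Dig1) (pop_input Dig1 ;; Pop 4 ;; puts 8 [Bot]) ;;
        pop_input EndNum ;; Pop 4 ;; puts 8 [EndNum] ;; fill 4 9 8 Bot ;; fill 3 9 8 Bot ;; puts 8 [CloseList, CloseList])
        (Dig0 # encode_size i) (replicate i Bot @ EndNum # replicate (a - i - 1) Bot @ replicate b Bot @ [CloseList, CloseList])
        (counters a b (a - i - 1) 0 0 0)"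
      by (rule translates_eq, (rule loop translates_rules | (use assms in \<open>simp add: encode_size_def; fail\<close>))+)
    have d: "a + b - Suc i = (a - i - 1) + b" using i by simp
    show ?thesis unfolding v unfolding Row encode_node.simps coordinate.simps emit_start_def
      by (rule exI, rule translates_eq, (rule translates_cond(1)[OF r] translates_rules |
        (use assms(4,5) in \<open>simp add: d replicate_add; fail\<close>))+)
  next
    case (Col j)
    then have j: "j < b" using assms by (auto simp: nodes_def)
    have step: "translates N (counters a b 0 0 (b - l) 0) (pop_input Dig1 ;; Pop 6 ;; puts 8 [Bot]) [Dig1] [Bot]
        (counters a b 0 0 (b - Suc l) 0)" if "l < j" for l
      by (rule translates_eq, (rule translates_rules | (use assms in \<open>simp; fail\<close>))+)
    have "translates N (counters a b 0 0 (b - j) 0) (pop_input EndNum ;; Pop 6 ;; puts 8 [EndNum] ;; fill 6 9 8 Bot ;;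
        puts 8 [CloseList, CloseList]) [EndNum]
        (EndNum # replicate (b - j - 1) Bot @ [CloseList, CloseList]) (counters a b 0 0 (b - j - 1) 0)"
      by (rule translates_eq, (rule translates_rules | (use assms in \<open>simp; fail\<close>))+)
    then have "translates N (counters a b 0 0 (b - 0) 0)
        (Loop (\<lambda>t. t 0 = Some Dig1) (pop_input Dig1 ;; Pop 6 ;; puts 8 [Bot]) ;;
          pop_input EndNum ;; Pop 6 ;; puts 8 [EndNum] ;; fill 6 9 8 Bot ;; puts 8 [CloseList, CloseList])
        (concat (map (\<lambda>_. [Dig1]) [0..<j]) @ [EndNum])
        (concat (map (\<lambda>_. [Bot]) [0..<j]) @ (EndNum # replicate (b - j - 1) Bot @ [CloseList, CloseList]))
        (counters a b 0 0 (b - j - 1) 0)"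
      by (intro translates_loop[where C = "\<lambda>l. counters a b 0 0 (b - l) 0"] step) (use assms j in \<open>simp_all add: tops_conf\<close>)
    note loop = this[unfolded diff_zero concat_map_const]
    have r: "translates N (counters a b 0 0 0 0) (pop_input Dig1 ;; fill 2 9 8 Bot ;; fill 3 9 6 Dig1 ;;
        Loop (\<lambda>t. t 0 = Some Dig1) (pop_input Dig1 ;; Pop 6 ;; puts 8 [Bot]) ;;
        pop_input EndNum ;; Pop 6 ;; puts 8 [EndNum] ;; fill 6 9 8 Bot ;; puts 8 [CloseList, CloseList])
        (Dig1 # encode_size j) (replicate a Bot @ replicate j Bot @ EndNum # replicate (b - j - 1) Bot @ [CloseList, CloseList])
        (counters a b 0 0 (b - j - 1) 0)"
      by (rule translates_eq, (rule loop translates_rules | (use assms in \<open>simp add: encode_size_def; fail\<close>))+)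
    have d: "a + b - Suc (a + j) = b - j - 1" using j by simp
    show ?thesis unfolding v unfolding Col encode_node.simps coordinate.simps emit_start_def
      by (rule exI, rule translates_eq, (rule translates_cond(2)[OF r] translates_rules |
        (use assms in \<open>simp add: d replicate_add; fail\<close>))+)
  qed
qed

definition translate_game :: "symbol com" where
  "translate_game = fill 2 9 8 Dig1 ;; fill 3 9 8 Dig1 ;; puts 8 [EndNum, OpenList] ;; pop_input OpenList ;;
     fill 2 9 5 Dig1 ;; Loop (\<lambda>t. t 5 \<noteq> None) emit_row ;; pop_input CloseList ;; pop_input OpenList ;; clear 4 ;;
     fill 3 9 7 Dig1 ;; Loop (\<lambda>t. t 7 \<noteq> None) emit_col ;; pop_input CloseList ;; clear 6 ;; emit_start"

lemma translates_game:
  assumes g: "mean_payoff_game g" and s: "s \<in> nodes g"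
    and N: "length (encode_game g) \<le> N"
  defines "a \<equiv> num_rows g" and "b \<equiv> num_cols g"
  shows "\<exists>c. translates N (counters a b 0 0 0 0) translate_game (encode_game g @ encode_node s)
    (encode_size (a + b) @ encode_list encode_ineq (system_of_game g s)) c"
proof -
  have rows: "length xs = b" if "xs \<in> set (row_arcs g)" for xs using g that by (simp add: mean_payoff_game_def b_def)
  have cols: "length xs = a" if "xs \<in> set (col_arcs g)" for xs using g that by (simp add: mean_payoff_game_def a_def)
  have le: "length (e x) \<le> length (encode_list e xs)" if "x \<in> set xs" for e :: "'x \<Rightarrow> symbol list" and x xs
    using that by (induction xs) (auto simp: encode_list_def)
  have num: "length xs \<le> length (encode_list e xs)" if "\<And>x. e x \<noteq> []" for e :: "'x \<Rightarrow> symbol list" and xs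
  proof (induction xs)
    case (Cons x xs)
    have "0 < length (e x)" using that by simp
    moreover have "length (encode_list e (x # xs)) = length (e x) + length (encode_list e xs)"
      by (simp add: encode_list_def)
    ultimately show ?case using Cons by (simp del: length_greater_0_conv)
  qed simp
  have arcs: "length (encode_arc x) \<le> N" if "x \<in> set xs" "xs \<in> set (row_arcs g) \<union> set (col_arcs g)" for x xs
  proof -
    have "length (encode_arc x) \<le> length (encode_list encode_arc xs)" by (rule le[OF that(1)])
    also have "\<dots> \<le> length (encode_game g)"
      using that(2) le[of xs "row_arcs g" "encode_list encode_arc"] le[of xs "col_arcs g" "encode_list encode_arc"]
      by (auto simp: encode_game_def)
    finally show ?thesis using N by simp
  qed
  have ab: "a \<le> N" "b \<le> N"
    using N num[of "encode_list encode_arc" "row_arcs g"] num[of "encode_list encode_arc" "col_arcs g"]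
    by (simp_all add: encode_game_def a_def b_def num_rows_def num_cols_def hd_encode_list)
  obtain c where st: "translates N (counters a b 0 0 0 0) emit_start (encode_node s)
      (encode_ineq (start_inequality g s) @ [CloseList]) c"
    using translates_start[OF _ _ s ab] a_def b_def by blast
  let ?cv = "\<lambda>j. encode_ineq (column_inequality a b j (col_arcs g ! j))"
  let ?rv = "\<lambda>i. concat (map (\<lambda>k. concat (map encode_ineq (arc_inequalities a b i k (row_arcs g ! i ! k)))) [0..<b])"
  have la: "length (row_arcs g) = a" "length (col_arcs g) = b" by (simp_all add: a_def b_def num_rows_def num_cols_def)
  have cstep: "translates N (counters a b 0 0 j (b - j)) emit_col (encode_list encode_arc (col_arcs g ! j)) (?cv j)
      (counters a b 0 0 (Suc j) (b - Suc j))" if "j < b" for j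
  proof -
    have "col_arcs g ! j \<in> set (col_arcs g)" using that la by simp
    then have "translates N (counters a b 0 0 j (Suc (b - Suc j))) emit_col (encode_list encode_arc (col_arcs g ! j)) (?cv j)
      (counters a b 0 0 (Suc j) (b - Suc j))"
      using that by (intro translates_col cols ab) (auto intro: arcs)
    moreover have "Suc (b - Suc j) = b - j" using that by simp
    ultimately show ?thesis by (simp only:)
  qed
  have rstep: "translates N (counters a b i (a - i) 0 0) emit_row (encode_list encode_arc (row_arcs g ! i)) (?rv i)
      (counters a b (Suc i) (a - Suc i) 0 0)" if "i < a" for i
  proof -
    have "row_arcs g ! i \<in> set (row_arcs g)" using that la by simp
    then have "translates N (counters a b i (Suc (a - Suc i)) 0 0) emit_row (encode_list encode_arc (row_arcs g ! i)) (?rv i)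
      (counters a b (Suc i) (a - Suc i) 0 0)"
      using that by (intro translates_row rows ab) (auto intro: arcs)
    moreover have "Suc (a - Suc i) = a - i" using that by simp
    ultimately show ?thesis by (simp only:)
  qed
  \<comment> \<open>A loop rule includes the continuation of the loop, so the program is verified
    from its last commands backwards.\<close>
  have "translates N (counters a b 0 0 b 0) (pop_input CloseList ;; clear 6 ;; emit_start) (CloseList # encode_node s)
      (encode_ineq (start_inequality g s) @ [CloseList]) c"
    by (rule translates_eq, (rule st translates_rules | (use ab in \<open>simp; fail\<close>))+)
  then have "translates N (counters a b 0 0 0 (b - 0)) (Loop (\<lambda>t. t 7 \<noteq> None) emit_col ;;
      pop_input CloseList ;; clear 6 ;; emit_start)
      (concat (map (\<lambda>j. encode_list encode_arc (col_arcs g ! j)) [0..<b]) @ (CloseList # encode_node s))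
      (concat (map ?cv [0..<b]) @ (encode_ineq (start_inequality g s) @ [CloseList])) c"
    by (intro translates_loop[where C = "\<lambda>j. counters a b 0 0 j (b - j)"] cstep)
      (use ab in \<open>simp_all add: tops_conf counters_apply\<close>)
  note cl = this[unfolded diff_zero map_nth_upt[OF la(2)]]
  have "translates N (counters a b a 0 0 0) (pop_input CloseList ;; pop_input OpenList ;; clear 4 ;;
     fill 3 9 7 Dig1 ;; Loop (\<lambda>t. t 7 \<noteq> None) emit_col ;; pop_input CloseList ;; clear 6 ;; emit_start)
     (CloseList # encode_list (encode_list encode_arc) (col_arcs g) @ encode_node s)
     (concat (map ?cv [0..<b]) @ (encode_ineq (start_inequality g s) @ [CloseList])) c"
    by (rule translates_eq, (rule cl translates_rules | (use ab in \<open>simp add: encode_list_def; fail\<close>))+)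
  then have "translates N (counters a b 0 (a - 0) 0 0) (Loop (\<lambda>t. t 5 \<noteq> None) emit_row ;;
     pop_input CloseList ;; pop_input OpenList ;; clear 4 ;;
     fill 3 9 7 Dig1 ;; Loop (\<lambda>t. t 7 \<noteq> None) emit_col ;; pop_input CloseList ;; clear 6 ;; emit_start)
     (concat (map (\<lambda>i. encode_list encode_arc (row_arcs g ! i)) [0..<a]) @
       (CloseList # encode_list (encode_list encode_arc) (col_arcs g) @ encode_node s))
     (concat (map ?rv [0..<a]) @ (concat (map ?cv [0..<b]) @ (encode_ineq (start_inequality g s) @ [CloseList]))) c"
    by (intro translates_loop[where C = "\<lambda>i. counters a b i (a - i) 0 0"] rstep)
      (use ab in \<open>simp_all add: tops_conf counters_apply\<close>)
  note rl = this[unfolded diff_zero map_nth_upt[OF la(1)]]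
  have rs: "row_system g i = concat (map (\<lambda>k. arc_inequalities a b i k (row_arcs g ! i ! k)) [0..<b])" for i
    by (simp add: row_system_def Let_def arc_inequalities_def a_def b_def)
  have ci: "col_inequality g j = column_inequality a b j (col_arcs g ! j)" for j
    by (simp add: col_inequality_def column_inequality_def a_def b_def)
  have cc: "concat (concat L) = concat (map concat L)" for L :: "symbol list list list"
    by (induction L) simp_all
  have v: "encode_list encode_ineq (system_of_game g s) = OpenList # concat (map ?rv [0..<a]) @
      concat (map ?cv [0..<b]) @ encode_ineq (start_inequality g s) @ [CloseList]"
    unfolding system_of_game_def a_def[symmetric] b_def[symmetric]
    by (simp add: encode_list_def rs ci map_concat cc comp_def)
  show ?thesis unfolding translate_game_def v
    by (rule exI, rule translates_eq, (rule rl translates_rules |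
      (use ab in \<open>simp add: encode_game_def encode_size_def encode_list_def replicate_add; fail\<close>))+)
qed

text \<open>A stack reduction has to end with everything but register 0 empty.\<close>

definition clear_counters :: "symbol com" where
  "clear_counters = clear 2 ;; clear 3 ;; clear 4 ;; clear 5 ;; clear 6 ;; clear 7"

lemma sem_clear_counters:
  assumes "\<forall>i. length (s i) \<le> B"
  shows "sem B clear_counters s = Done (s(2 := [], 3 := [], 4 := [], 5 := [], 6 := [], 7 := []))"
  unfolding clear_counters_def using assms by (simp add: sem_clear)

theorem mean_payoff_reducible_to_emptiness: "stack_reducible MEAN_PAYOFF EMPTINESS"
proof (rule stack_reducible_stages)
  show "registers_below 10 (check_game ;; translate_game)"
    by (simp add: check_game_def read_dimensions_def survey_symbol_def shift_def scan_game_def scan_list_def repeat_def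
        expect_def scan_arc_def scan_int_def scan_digits_def scan_node_def scan_index_def at_end_def
        translate_game_def emit_row_def emit_arc_def emit_col_def emit_negated_def emit_start_def pop_input_def
        move_until_def)
  show "registers_below 10 clear_counters" by (simp add: clear_counters_def)
  show "registers_below 10 (transfer 8 0)" by simp
  fix w :: "symbol list"
  let ?B1 = "3 * length w + 20"
  let ?goal = "(\<exists>s1 s2 w'. sem ?B1 (check_game ;; translate_game) (input w) = Done s1 \<and>
        (\<forall>B. (\<forall>i. length (s1 i) + 20 \<le> B) \<longrightarrow> sem B clear_counters s1 = Done s2) \<and>
        (\<forall>B. (\<forall>i. length (s2 i) + 20 \<le> B) \<longrightarrow> sem B (transfer 8 0) s2 = Done (input w')) \<and>
        (w \<in> MEAN_PAYOFF \<longleftrightarrow> w' \<in> EMPTINESS)) \<or>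
      sem ?B1 (check_game ;; translate_game) (input w) = Aborted \<and> w \<notin> MEAN_PAYOFF"
  from sem_check_game[OF order_refl, of w] show ?goal
  proof
    assume *: "(\<forall>g s. mean_payoff_game g \<and> s \<in> nodes g \<longrightarrow> w \<noteq> encode_game g @ encode_node s) \<and>
      sem ?B1 check_game (input w) = Aborted"
    then have "w \<notin> MEAN_PAYOFF" unfolding MEAN_PAYOFF_def by blast
    then show ?goal using * by simp
  next
    assume "\<exists>g s. w = encode_game g @ encode_node s \<and> mean_payoff_game g \<and> s \<in> nodes g \<and>
      sem ?B1 check_game (input w) = Done (survey w [] (num_rows g) (num_cols g) False)"
    then obtain g s where w: "w = encode_game g @ encode_node s" and g: "mean_payoff_game g" "s \<in> nodes g"
      and chk: "sem ?B1 check_game (input w) = Done (survey w [] (num_rows g) (num_cols g) False)" by blast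
    let ?n = "num_rows g + num_cols g"
    let ?w' = "encode_size ?n @ encode_list encode_ineq (system_of_game g s)"
    have "length (encode_game g) \<le> ?B1" using w by simp
    from translates_game[OF g this] obtain c where
      tr: "translates ?B1 (counters (num_rows g) (num_cols g) 0 0 0 0) translate_game w ?w' c"
      unfolding w[symmetric] by blast
    have sv: "survey w [] (num_rows g) (num_cols g) False = conf (counters (num_rows g) (num_cols g) 0 0 0 0) (w @ []) []"
      by (auto simp: survey_def conf_def counters_def fun_eq_iff)
    let ?s1 = "conf c [] (rev ?w' @ [])"
    have "sem ?B1 translate_game (conf (counters (num_rows g) (num_cols g) 0 0 0 0) (w @ []) []) = Done ?s1"
      using tr unfolding translates_def by blast
    then have 1: "sem ?B1 (check_game ;; translate_game) (input w) = Done ?s1"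
      by (simp only: sem.simps(6) chk and_then.simps sv)
    let ?s2 = "(\<lambda>_. [])(8 := rev ?w') :: symbol stacks"
    have 2: "sem B clear_counters ?s1 = Done ?s2" if B: "\<forall>i. length (?s1 i) + 20 \<le> B" for B
    proof -
      have "\<forall>i. length (?s1 i) \<le> B" using B add_leD1 by blast
      from sem_clear_counters[OF this] have
        "sem B clear_counters ?s1 = Done (?s1(2 := [], 3 := [], 4 := [], 5 := [], 6 := [], 7 := []))" .
      moreover have "?s1(2 := [], 3 := [], 4 := [], 5 := [], 6 := [], 7 := []) = ?s2"
      proof
        fix i :: nat
        have "i = 2 \<or> i = 3 \<or> i = 4 \<or> i = 5 \<or> i = 6 \<or> i = 7 \<or> i \<notin> {2..7}" by auto
        then show "(?s1(2 := [], 3 := [], 4 := [], 5 := [], 6 := [], 7 := [])) i = ?s2 i"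
          by (elim disjE) (auto simp: conf_def)
      qed
      ultimately show ?thesis by (simp only:)
    qed
    have 3: "sem B (transfer 8 0) ?s2 = Done (input ?w')" if B: "\<forall>i. length (?s2 i) + 20 \<le> B" for B
    proof -
      have "length (?s2 8) \<le> B" using B[rule_format, of 8] by linarith
      then have "sem B (transfer 8 0) ?s2 = Done (?s2(0 := rev (?s2 8) @ ?s2 0, 8 := []))"
        by (intro sem_transfer) simp_all
      moreover have "?s2(0 := rev (?s2 8) @ ?s2 0, 8 := []) = input ?w'"
      proof
        fix i show "(?s2(0 := rev (?s2 8) @ ?s2 0, 8 := [])) i = input ?w' i"
          unfolding input_def by (cases "i = 0") simp_all
      qed
      ultimately show ?thesis by (simp only:)
    qed
    have "\<forall>q\<in>set (system_of_game g s). proper ?n q" using proper_system_of_game[OF g] by blast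
    from EMPTINESS_iff[OF this] MEAN_PAYOFF_iff[OF g] winning_iff_empty[OF g]
    have "w \<in> MEAN_PAYOFF \<longleftrightarrow> ?w' \<in> EMPTINESS" unfolding w by simp
    then show ?goal using 1 2 3 by blast
  qed
qed simp

theorem theorem25:
  shows "karp_equivalent IMPLICATION EMPTINESS \<and>
         karp_equivalent EMPTINESS MEAN_PAYOFF \<and>
         karp_equivalent IMPLICATION MEAN_PAYOFF"
  proof -
  have 1: "stack_reducible EMPTINESS IMPLICATION" by (rule emptiness_reducible_to_implication)
  have 2: "stack_reducible IMPLICATION MEAN_PAYOFF" by (rule implication_reducible_to_mean_payoff)
  have 3: "stack_reducible MEAN_PAYOFF EMPTINESS" by (rule mean_payoff_reducible_to_emptiness)
  \<comment> \<open>Of the six Karp reductions, three are edges of the cycle and three are composed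
    of two consecutive edges.\<close>
  note cycle = stack_reducible_trans[OF 1 2] stack_reducible_trans[OF 2 3] stack_reducible_trans[OF 3 1]
  show ?thesis
    using cycle 1 2 3 Nil_not_instance by (simp add: karp_equivalent_def stack_reducible_imp_karp)
qed

end
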